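(* Let $\Omega\subset\mathbb{R}^N$ be a bounded smooth domain, $s\in(0,1)$, $p>1$, $N>sp$, and $p_s^*=\frac{Np}{N-sp}$. Suppose $\lambda_1<a<\lambda^{*}$, $b>0$, $1<q<p$, and assume that one of the following conditions holds: (i) $N>sp^2$ and $1<p\leq \frac{2N}{N+s}$; (ii) $N>sp\big((p-1)^2+p\big)$ and $p>\frac{2N}{N+s}$. Then there exists $\lambda_0>0$ such that for every $\lambda\in(0,\lambda_0)$ the problem $$(-\Delta)^s_p u=-\lambda|u|^{q-2}u+a|u|^{p-2}u+b(u^+)^{p_s^*-1}\ \text{in }\Omega,\qquad u=0\ \text{in }\mathbb{R}^N\setminus\Omega,$$ has at least three nontrivial weak solutions in $X_p^s$.
   Context: $(-\Delta)^s_p u(x)=2\lim_{\epsilon\to0}\int_{\mathbb{R}^N\setminus B(x,\epsilon)}\frac{|u(x)-u(y)|^{p-2}(u(x)-u(y))}{|x-y|^{N+sp}}dy$ is the fractional $p$-Laplacian. $X_p^s=\{u\in W^{s,p}(\mathbb{R}^N): u=0 \text{ a.e. in } \mathbb{R}^N\setminus\Omega\}$ with norm $\|u\|_{X_p^s}=\big(\int_{\mathbb{R}^{2N}}\frac{|u(x)-u(y)|^p}{|x-y|^{N+sp}}dxdy\big)^{1/p}$. For $u,v\in X_p^s$, $A(u)\cdot v=\int_{\mathbb{R}^{2N}}\frac{|u(x)-u(y)|^{p-2}(u(x)-u(y))(v(x)-v(y))}{|x-y|^{N+sp}}dxdy$. A weak solution is $u\in X_p^s$ with $A(u)\cdot v=-\lambda\int_\Omega|u|^{q-2}uv+a\int_\Omega|u|^{p-2}uv+b\int_\Omega(u^+)^{p_s^*-1}v$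 for all $v\in X_p^s$. $u^+=\max\{u,0\}$. $\lambda_1$ is the first eigenvalue of $(-\Delta)^s_p$ on $X_p^s$ (i.e. $\lambda_1=\inf\{\|u\|_{X_p^s}^p: u\in X_p^s,\|u\|_{L^p(\Omega)}=1\}$), with $\varphi_1$ its positive $L^p$-normalized eigenfunction. $W=\{u\in X_p^s: A(\varphi_1)\cdot u=0\}$ and $\lambda^*=\inf\{\|u\|_{X_p^s}^p: u\in W,\ \|u\|_{L^p(\Omega)}^p=1\}$. *)

theory Defs
  imports "HOL-Analysis.Analysis"
begin

abbreviation dimN :: "'n::finite itself \<Rightarrow> real" where
  "dimN T \<equiv> real CARD('n)"

fun ipd :: "'n::finite list \<Rightarrow> (real^'n \<Rightarrow> real) \<Rightarrow> real^'n \<Rightarrow> real" where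
  "ipd [] f = f"
| "ipd (i # is) f = (\<lambda>x. frechet_derivative (ipd is f) (at x) (axis i 1))"

definition smooth_fun :: "(real^'n::finite \<Rightarrow> real) \<Rightarrow> bool" where
  "smooth_fun f \<longleftrightarrow> (\<forall>is x. ipd is f differentiable at x)"

definition smooth_bounded_domain :: "(real^'n::finite) set \<Rightarrow> bool" where
  "smooth_bounded_domain \<Omega> \<longleftrightarrow> bounded \<Omega> \<and> open \<Omega> \<and> connected \<Omega> \<and> \<Omega> \<noteq> {} \<and>
     (\<exists>\<rho>. smooth_fun \<rho> \<and> \<Omega> = {x. \<rho> x < 0} \<and>
          (\<forall>x. \<rho> x = 0 \<longrightarrow> frechet_derivative \<rho> (at x) \<noteq> (\<lambda>h. 0)))"

definition crit_exp :: "'n::finite itself \<Rightarrow> real \<Rightarrow> real \<Rightarrow> real" where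
  "crit_exp T s p = dimN T * p / (dimN T - s * p)"

definition gagliardo :: "real \<Rightarrow> real \<Rightarrow> (real^'n::finite \<Rightarrow> real) \<Rightarrow> ennreal" where
  "gagliardo s p u = (\<integral>\<^sup>+ z. ennreal (case z of (x, y) \<Rightarrow>
      \<bar>u x - u y\<bar> powr p / norm (x - y) powr (dimN TYPE('n) + s * p))
      \<partial>(lebesgue \<Otimes>\<^sub>M lebesgue))"

definition Wsp :: "real \<Rightarrow> real \<Rightarrow> (real^'n::finite \<Rightarrow> real) set" where
  "Wsp s p = {u. u \<in> borel_measurable lebesgue \<and>
      (\<integral>\<^sup>+ x. ennreal (\<bar>u x\<bar> powr p) \<partial>lebesgue) < \<infinity> \<and> gagliardo s p u < \<infinity>}"

definition Xsp :: "(real^'n::finite) set \<Rightarrow> real \<Rightarrow> real \<Rightarrow> (real^'n \<Rightarrow> real) set" where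
  "Xsp \<Omega> s p = {u. u \<in> Wsp s p \<and> (AE x in lebesgue. x \<notin> \<Omega> \<longrightarrow> u x = 0)}"

definition Xnorm_p :: "real \<Rightarrow> real \<Rightarrow> (real^'n::finite \<Rightarrow> real) \<Rightarrow> real" where
  "Xnorm_p s p u = enn2real (gagliardo s p u)"

definition A_op :: "real \<Rightarrow> real \<Rightarrow> (real^'n::finite \<Rightarrow> real) \<Rightarrow> (real^'n \<Rightarrow> real) \<Rightarrow> real" where
  "A_op s p u v = (\<integral> z. (case z of (x, y) \<Rightarrow>
      \<bar>u x - u y\<bar> powr (p - 2) * (u x - u y) * (v x - v y)
        / norm (x - y) powr (dimN TYPE('n) + s * p)) \<partial>(lebesgue \<Otimes>\<^sub>M lebesgue))"

definition Lp_pow_on :: "(real^'n::finite) set \<Rightarrow> real \<Rightarrow> (real^'n \<Rightarrow> real) \<Rightarrow> real" where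
  "Lp_pow_on \<Omega> p u = (LINT x:\<Omega>|lebesgue. \<bar>u x\<bar> powr p)"

definition lambda1 :: "(real^'n::finite) set \<Rightarrow> real \<Rightarrow> real \<Rightarrow> real" where
  "lambda1 \<Omega> s p = Inf {Xnorm_p s p u | u. u \<in> Xsp \<Omega> s p \<and> Lp_pow_on \<Omega> p u = 1}"

definition first_eigenfunction :: "(real^'n::finite) set \<Rightarrow> real \<Rightarrow> real \<Rightarrow> (real^'n \<Rightarrow> real) \<Rightarrow> bool" where
  "first_eigenfunction \<Omega> s p \<phi> \<longleftrightarrow> \<phi> \<in> Xsp \<Omega> s p \<and> Lp_pow_on \<Omega> p \<phi> = 1 \<and>
     (AE x in lebesgue. x \<in> \<Omega> \<longrightarrow> \<phi> x > 0) \<and>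
     (\<forall>v \<in> Xsp \<Omega> s p. A_op s p \<phi> v =
        lambda1 \<Omega> s p * (LINT x:\<Omega>|lebesgue. \<bar>\<phi> x\<bar> powr (p - 2) * \<phi> x * v x))"

definition Wspace :: "(real^'n::finite) set \<Rightarrow> real \<Rightarrow> real \<Rightarrow> (real^'n \<Rightarrow> real) \<Rightarrow> (real^'n \<Rightarrow> real) set" where
  "Wspace \<Omega> s p \<phi> = {u \<in> Xsp \<Omega> s p. A_op s p \<phi> u = 0}"

definition lambda_star :: "(real^'n::finite) set \<Rightarrow> real \<Rightarrow> real \<Rightarrow> (real^'n \<Rightarrow> real) \<Rightarrow> real" where
  "lambda_star \<Omega> s p \<phi> = Inf {Xnorm_p s p u | u. u \<in> Wspace \<Omega> s p \<phi> \<and> Lp_pow_on \<Omega> p u = 1}"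

definition weak_solution :: "(real^'n::finite) set \<Rightarrow> real \<Rightarrow> real \<Rightarrow> real \<Rightarrow> real \<Rightarrow> real \<Rightarrow> real
    \<Rightarrow> (real^'n \<Rightarrow> real) \<Rightarrow> bool" where
  "weak_solution \<Omega> s p q lam a b u \<longleftrightarrow> u \<in> Xsp \<Omega> s p \<and>
     (\<forall>v \<in> Xsp \<Omega> s p. A_op s p u v =
        - lam * (LINT x:\<Omega>|lebesgue. \<bar>u x\<bar> powr (q - 2) * u x * v x)
        + a * (LINT x:\<Omega>|lebesgue. \<bar>u x\<bar> powr (p - 2) * u x * v x)
        + b * (LINT x:\<Omega>|lebesgue. max (u x) 0 powr (crit_exp TYPE('n) s p - 1) * v x))"

end

theory Submission
  imports Defs "HOL-Library.Diagonal_Subsequence"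
begin

text \<open>Two solutions are small. Reflecting a mountain pass critical point of the functional with the
  nonlinearity \<open>a u\<^sup>+ powr (p - 1) - lam u\<^sup>+ powr (q - 1)\<close> gives a nonpositive one, and adding
  the critical term to that nonlinearity gives a nonnegative one; along multiples of the first
  eigenfunction their levels are \<open>O(lam)\<close>. The third comes from linking the sphere in the
  \<open>A(\<phi>1)\<close>-annihilator, where \<open>a < lambda_star\<close> gives a level independent of \<open>lam\<close>,
  with a half plane spanned by a truncated eigenfunction and a Sobolev extremal concentrated in the hole
  of that truncation. \<open>N > s p\<^sup>2\<close> puts the extremals into \<open>L\<^sup>p\<close>, so the term \<open>a |u|\<^sup>p\<close> beats all cut-off
  errors and keeps the minimax level below the threshold of compactness. Cerami sequences are bounded
  because, by Picone's inequality, no nonnegative eigenfunction has an eigenvalue above the first.\<close>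

text \<open>Two classical tools have substitutes here. In place of pointwise decay of the extremals,
  their membership in L^p makes every error of cutting off at radius R of order o(R^(-s p)), while
  the term a |u|^p gains a fixed multiple of R^(-s p). In place of a strong maximum principle, the
  defect in Picone's inequality has bounded integral, but would blow up if a nonnegative
  eigenfunction vanished on part of the domain without vanishing identically. Functions are not
  identified almost everywhere, so deformations do not flow in a Banach space: they move continuous
  families over a compact parameter set by finitely many explicit steps. Cerami's condition fits
  this well: it admits u itself as a test direction, and steps as long as a multiple of 3 + |u| cost
  only an exponential factor over a bounded time. One inequality for homogeneous functions,
  \<open>pw_add_bound\<close>, carries Brezis-Lieb, uniform differentiability and the cut-off
  estimates for all p > 1 at once. The solutions are told apart by sign (the two small ones) and by
  level (the third).\<close>

abbreviation leb :: "'a::euclidean_space measure" where "leb \<equiv> lebesgue"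

abbreviation nnl :: "('a::euclidean_space \<Rightarrow> ennreal) \<Rightarrow> ennreal" (binder "NI " 10) where "nnl f \<equiv> nn_integral lebesgue f"
abbreviation lil :: "('a::euclidean_space \<Rightarrow> real) \<Rightarrow> real" (binder "LI " 10) where "lil f \<equiv> lebesgue_integral lebesgue f"

notation LIMSEQ (infix "--->" 60)

abbreviation Bl :: "('a::euclidean_space \<Rightarrow> 'b::topological_space) set" where "Bl \<equiv> borel_measurable lebesgue"
abbreviation "en \<equiv> ennreal"
abbreviation "ind \<equiv> indicator"
abbreviation evs :: "(nat \<Rightarrow> bool) \<Rightarrow> bool" (binder "EV " 10) where "evs P \<equiv> eventually P sequentially"

section \<open>Homogeneous power functions and their integrals\<close>

text \<open>One family for all nonlinearities of the problem: (\<open>cp\<close>, \<open>cm\<close>)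
  = (1, 1) is |t|^d, (1, -1) the odd power |t|^(d-1) t, (1, 0) the power of the positive part. It is
  homogeneous under positive scaling and closed under differentiation, where \<open>cm\<close>
  changes sign.\<close>

definition pw :: "real => real => real => real => real" where
 "pw d cp cm t = (if 0 <= t then cp*t powr d else cm*(- t) powr d)"

lemma pw_0 [simp]: "pw d cp cm 0 = 0"
 by (simp add: pw_def)

lemma pw_scale:
 assumes "c > 0"
 shows "pw d cp cm (c*t) = c powr d*pw d cp cm t"
proof (cases "0 <= t")
 case True
 then show ?thesis using assms by (simp add: pw_def powr_mult)
next
 case False
 have "(- (c*t)) powr d = c powr d*(- t) powr d" by (metis mult_minus_right powr_mult)
 then show ?thesis using assms False by (simp add: pw_def zero_le_mult_iff)
qed

lemma pw_abs_le: "abs (pw d cp cm t) <= (abs cp + abs cm)*abs t powr d"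
 by (auto simp: pw_def abs_mult algebra_simps)

lemma pw_one_one: "pw d 1 1 t = abs t powr d"
 by (auto simp: pw_def)

lemma pw_odd: "pw (r - 1) 1 (- 1) t = abs t powr (r - 2)*t"
proof (cases "t = 0")
 case False
 have e: "abs t powr (r - 1) = abs t powr (r - 2)*abs t" using powr_add[of "abs t" "r - 2" 1] False by simp
 show ?thesis using e by (auto simp: pw_def)
qed simp

lemma continuous_pw:
 assumes "d > 0"
 shows "continuous_on UNIV (pw d cp cm)"
proof -
 have e: "pw d cp cm = (%t. cp*(max t 0) powr d + cm*(max (- t) 0) powr d)" using assms by (auto simp: pw_def fun_eq_iff max_def)
 show ?thesis unfolding e using assms by (intro continuous_on_add continuous_on_mult continuous_on_const continuous_on_powr'
    continuous_on_max continuous_on_minus continuous_on_id) auto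
qed

lemma measurable_pw [measurable]:
 "pw d cp cm : borel_measurable borel"
proof -
 have e: "pw d cp cm = (%t. if 0 <= t then cp*t powr d else cm*(- t) powr d)" by (auto simp: pw_def fun_eq_iff)
 show ?thesis unfolding e by measurable
qed

text \<open>Only t = 0 needs an argument: there the difference quotient is at most a multiple of
  |h|^(r-1), which vanishes since r > 1.\<close>

lemma has_derivative_pw:
 assumes "r > 1"
 shows "(pw r cp cm has_real_derivative r*pw (r - 1) cp (- cm) t) (at t)"
proof -
 consider "t > 0" | "t < 0" | "t = 0" by linarith
 then show ?thesis
 proof cases
  case 1
  have ev: "\<forall>\<^sub>F x in nhds t. pw r cp cm x = cp*x powr r" using eventually_nhds_in_open[of "{0<..}" t] 1
   by (auto simp: pw_def elim!: eventually_mono)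
  have "((%x. cp*x powr r) has_real_derivative cp*(r*t powr (r - 1))) (at t)" using 1 by (auto intro!: derivative_eq_intros)
  then show ?thesis using 1 by (subst DERIV_cong_ev[OF refl ev refl]) (simp add: pw_def mult_ac)
 next
  case 2
  have ev: "\<forall>\<^sub>F x in nhds t. pw r cp cm x = cm*(- x) powr r" using eventually_nhds_in_open[of "{..<0}" t] 2
   by (auto simp: pw_def elim!: eventually_mono)
  have "((%x. cm*(- x) powr r) has_real_derivative cm*(- r*(- t) powr (r - 1))) (at t)" using 2 by (auto intro!: derivative_eq_intros)
  then show ?thesis using 2 by (subst DERIV_cong_ev[OF refl ev refl]) (simp add: pw_def mult_ac)
 next
  case 3
  have "((%h. (pw r cp cm (0 + h) - pw r cp cm 0)/h) \<longlongrightarrow> 0) (at 0)"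
  proof (rule Lim_null_comparison)
   show "\<forall>\<^sub>F h in at 0. norm ((pw r cp cm (0 + h) - pw r cp cm 0)/h) <= (abs cp + abs cm)*abs h powr (r - 1)"
   proof (rule eventually_at_filter[THEN iffD2], rule always_eventually, intro allI impI)
    fix h :: real assume "h \<noteq> 0"
    have "abs (pw r cp cm h)/abs h <= (abs cp + abs cm)*abs h powr r/abs h" using pw_abs_le[of r cp cm h] by (intro divide_right_mono) auto
    also have "... = (abs cp + abs cm)*abs h powr (r - 1)" using \<open>h \<noteq> 0\<close> by (simp add: powr_diff)
    finally show "norm ((pw r cp cm (0 + h) - pw r cp cm 0)/h) <= (abs cp + abs cm)*abs h powr (r - 1)" by simp
   qed
   have "((%h. abs h powr (r - 1)) \<longlongrightarrow> 0) (at (0::real))" using assms by (auto intro!: tendsto_eq_intros)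
   then show "((%h. (abs cp + abs cm)*abs h powr (r - 1)) \<longlongrightarrow> 0) (at (0::real))" by (rule tendsto_mult_right_zero)
  qed
  then show ?thesis using 3 by (simp add: DERIV_def)
 qed
qed

text \<open>By homogeneity, uniform continuity on a compact interval is all that is needed, so that
 the cases \<open>d < 1\<close> and \<open>d >= 1\<close> do not have to be distinguished.\<close>
lemma pw_add_bound:
 assumes d: "d > 0" and e: "e > 0"
 obtains C where "C > 0" "!!a b. abs (pw d cp cm (a + b) - pw d cp cm a) <= e*abs a powr d + C*abs b powr d"
proof -
 have "uniformly_continuous_on {-2..2} (pw d cp cm)"
  using continuous_pw[OF d] by (intro compact_uniformly_continuous) (auto intro: continuous_on_subset)
 then obtain \<delta>0 where d0: "\<delta>0 > 0"
  "!!x y. x : {-2..2} ==> y : {-2..2} ==> dist y x < \<delta>0 ==> dist (pw d cp cm y) (pw d cp cm x) < e"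
  using e unfolding uniformly_continuous_on_def by blast
 define \<delta> where "\<delta> = min 1 (\<delta>0/2)"
 have dl: "\<delta> > 0" "\<delta> <= 1" "\<delta> < \<delta>0" using d0(1) by (auto simp: \<delta>_def min_def)
 define K where "K = abs cp + abs cm"
 have K0: "K >= 0" by (simp add: K_def)
 define C where "C = K*(1/\<delta> + 1) powr d + K*(1/\<delta>) powr d + 1"
 show ?thesis
 proof (rule that)
  show "C > 0" using K0 by (auto simp: C_def intro!: add_nonneg_pos add_nonneg_nonneg)
  fix a b
  show "abs (pw d cp cm (a + b) - pw d cp cm a) <= e*abs a powr d + C*abs b powr d"
  proof (cases "abs b <= \<delta>*abs a \<and> a \<noteq> 0")
   case True
   define x where "x = a/abs a"
   define y where "y = (a + b)/abs a"
   have a: "abs a > 0" using True by simp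
   have "abs b/abs a <= \<delta>" using True a by (simp add: divide_simps)
   then have yx: "abs (y - x) <= \<delta>" using a by (simp add: x_def y_def diff_divide_distrib[symmetric])
   have x1: "abs x = 1" using a by (simp add: x_def)
   have "dist (pw d cp cm y) (pw d cp cm x) < e" using yx x1 dl by (intro d0(2)) (auto simp: dist_real_def)
   then have "abs (pw d cp cm y - pw d cp cm x) <= e" by (simp add: dist_real_def)
   moreover have "pw d cp cm (a + b) = abs a powr d*pw d cp cm y" using pw_scale[OF a, of d cp cm y] a by (simp add: y_def)
   moreover have "pw d cp cm a = abs a powr d*pw d cp cm x" using pw_scale[OF a, of d cp cm x] a by (simp add: x_def)
   ultimately have "abs (pw d cp cm (a + b) - pw d cp cm a) <= abs a powr d*e" by (simp add: right_diff_distrib[symmetric] abs_mult mult_left_mono)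
   also have "... <= e*abs a powr d + C*abs b powr d" using \<open>C > 0\<close> by (simp add: mult.commute)
   finally show ?thesis .
  next
   case False
   \<comment> \<open>Here |a| is controlled by |b|, so both values are simply bounded by multiples
     of |b|^d. Continuity matters only in the other case, where dividing by |a| moves the base point
     to 1 or -1.\<close>
   then have ab: "abs a <= (1/\<delta>)*abs b" using dl by (auto simp: divide_simps mult.commute)
   have "abs (pw d cp cm (a + b) - pw d cp cm a) <= K*abs (a + b) powr d + K*abs a powr d"
    using pw_abs_le[of d cp cm "a+b"] pw_abs_le[of d cp cm a] unfolding K_def by linarith
   also have "... <= K*((1/\<delta> + 1)*abs b) powr d + K*((1/\<delta>)*abs b) powr d"
    using ab d K0 by (intro add_mono mult_left_mono powr_mono2) (auto simp: algebra_simps)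
   also have "... = (C - 1)*abs b powr d" unfolding C_def powr_mult by (simp add: algebra_simps)
   also have "... <= C*abs b powr d" by (simp add: mult_right_mono)
   finally show ?thesis using e by (simp add: add_increasing)
  qed
 qed
qed

text \<open>The mean value theorem turns the remainder into b times an increment of the derivative,
  which is itself a \<open>pw\<close> of exponent r - 1 > 0, so \<open>pw_add_bound\<close> applies
  to it.\<close>

lemma pw_taylor_bound:
 assumes r: "r > 1" and e: "e > 0"
 obtains C where "C > 0" "!!a b. abs (pw r cp cm (a + b) - pw r cp cm a - r*pw (r - 1) cp (- cm) a*b)
  <= e*(abs a powr (r - 1)*abs b) + C*abs b powr r"
proof -
 have r1: "r - 1 > 0" using r by simp
 obtain C where C: "C > 0" "!!a b. abs (pw (r - 1) cp (- cm) (a + b) - pw (r - 1) cp (- cm) a)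
   <= e/r*abs a powr (r - 1) + C*abs b powr (r - 1)" using pw_add_bound[OF r1, of "e/r" cp "- cm"] e r by auto
 show ?thesis
 proof (rule that)
  show "r*C > 0" using r C by simp
  fix a b
  have "EX c. abs (c - a) <= abs b \<and> pw r cp cm (a + b) - pw r cp cm a = b*(r*pw (r - 1) cp (- cm) c)"
  proof -
   consider "b = 0" | "b > 0" | "b < 0" by linarith
   then show ?thesis
   proof cases
    case 1 then show ?thesis by auto
   next
    case 2
    have "EX z. a < z \<and> z < a + b \<and> pw r cp cm (a + b) - pw r cp cm a = (a + b - a)*(r*pw (r - 1) cp (- cm) z)"
     using 2 has_derivative_pw[OF r] by (intro MVT2) auto
    then obtain z where z: "a < z" "z < a + b" "pw r cp cm (a + b) - pw r cp cm a = (a + b - a)*(r*pw (r - 1) cp (- cm) z)" by blast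
    then show ?thesis using 2 by (intro exI[of _ z]) auto
   next
    case 3
    have "EX z. a + b < z \<and> z < a \<and> pw r cp cm a - pw r cp cm (a + b) = (a - (a + b))*(r*pw (r - 1) cp (- cm) z)"
     using 3 has_derivative_pw[OF r] by (intro MVT2) auto
    then obtain z where z: "a + b < z" "z < a" "pw r cp cm a - pw r cp cm (a + b) = (a - (a + b))*(r*pw (r - 1) cp (- cm) z)" by blast
    then show ?thesis using 3 by (intro exI[of _ z]) (auto simp: algebra_simps)
   qed
  qed
  then obtain c where c: "abs (c - a) <= abs b" "pw r cp cm (a + b) - pw r cp cm a = b*(r*pw (r - 1) cp (- cm) c)" by blast
  have "pw r cp cm (a + b) - pw r cp cm a - r*pw (r - 1) cp (- cm) a*b
   = r*b*(pw (r - 1) cp (- cm) (a + (c - a)) - pw (r - 1) cp (- cm) a)" by (simp add: c(2) algebra_simps)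
  then have "abs (pw r cp cm (a + b) - pw r cp cm a - r*pw (r - 1) cp (- cm) a*b)
   = r*abs b*abs (pw (r - 1) cp (- cm) (a + (c - a)) - pw (r - 1) cp (- cm) a)" using r by (simp add: abs_mult)
  also have "... <= r*abs b*(e/r*abs a powr (r - 1) + C*abs (c - a) powr (r - 1))" using r C(2)[of a "c - a"] by (intro mult_left_mono) auto
  also have "... <= r*abs b*(e/r*abs a powr (r - 1) + C*abs b powr (r - 1))" using r C c(1) by (intro mult_left_mono add_left_mono powr_mono2) auto
  also have "... = e*(abs a powr (r - 1)*abs b) + r*C*(abs b*abs b powr (r - 1))" using r by (simp add: field_simps)
  also have "abs b*abs b powr (r - 1) = abs b powr r" using powr_mult_base[of "abs b" "r - 1"] by simp
  finally show "abs (pw r cp cm (a + b) - pw r cp cm a - r*pw (r - 1) cp (- cm) a*b)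
   <= e*(abs a powr (r - 1)*abs b) + r*C*abs b powr r" .
 qed
qed

lemma powr_convex_comb:
 fixes x y :: real
 assumes "r >= 1" "x >= 0" "y >= 0" "0 <= t" "t <= 1"
 shows "((1 - t)*x + t*y) powr r <= (1 - t)*x powr r + t*y powr r"
proof -
 have le: "c powr r <= c" if "0 <= c" "c <= 1" for c :: real using that assms(1) by (cases "c = 0") (auto intro!: powr_le_one_le)
 consider "x = 0" | "y = 0" | "x > 0" "y > 0" using assms by linarith
 then show ?thesis
 proof cases
  case 1
  then show ?thesis using le[of t] assms by (auto simp: powr_mult intro!: mult_right_mono)
 next
  case 2
  then show ?thesis using le[of "1 - t"] assms by (auto simp: powr_mult intro!: mult_right_mono)
 next
  case 3
  then show ?thesis using convex_onD[OF powr_convex[OF assms(1)], of t x y] assms by auto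
 qed
qed

lemma powr_add_le:
 fixes x y :: real
 assumes "r >= 1" "x >= 0" "y >= 0"
 shows "(x + y) powr r <= 2 powr r*(x powr r + y powr r)"
proof -
 have "(x + y) powr r <= (2*max x y) powr r" using assms by (intro powr_mono2) auto
 also have "... = 2 powr r*max x y powr r" by (simp add: powr_mult)
 also have "... <= 2 powr r*(x powr r + y powr r)" by (intro mult_left_mono) (auto simp: max_def)
 finally show ?thesis .
qed

section \<open>Integrals of powers: Hoelder, Minkowski and elementary inequalities\<close>

definition Lp :: "'a measure => real => ('a => real) => bool" where
 "Lp M r f \<longleftrightarrow> f : borel_measurable M \<and> integrable M (%x. abs (f x) powr r)"

definition Lpi :: "'a measure => real => ('a => real) => real" where
 "Lpi M r f = (\<integral>x. abs (f x) powr r \<partial>M)"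

definition Lpn :: "'a measure => real => ('a => real) => real" where
 "Lpn M r f = Lpi M r f powr (1/r)"

lemma LpD [dest]: "Lp M r f ==> f : borel_measurable M" "Lp M r f ==> integrable M (%x. abs (f x) powr r)"
 by (auto simp: Lp_def)

lemmas Lp_measurable [measurable_dest] = LpD(1)

lemma Lpi_nonneg [simp]: "0 <= Lpi M r f"
 by (simp add: Lpi_def)

lemma Lpn_nonneg [simp]: "0 <= Lpn M r f"
 by (simp add: Lpn_def)

lemma Lpn_powr: "r \<noteq> 0 ==> Lpn M r f powr r = Lpi M r f"
 by (simp add: Lpn_def powr_powr)

lemma Lpi_eq_0: "Lp M r f ==> Lpi M r f = 0 \<longleftrightarrow> (AE x in M. f x = 0)"
 unfolding Lpi_def Lp_def by (subst integral_nonneg_eq_0_iff_AE) auto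

lemma Lpn_eq_0: "Lp M r f ==> Lpn M r f = 0 \<longleftrightarrow> (AE x in M. f x = 0)"
 using Lpi_eq_0 by (auto simp: Lpn_def)

lemma Lp_zero [simp]: "Lp M r (%x. 0)"
 by (simp add: Lp_def)

lemma Lp_bound:
 assumes "Lp M r f" "g : borel_measurable M" "AE x in M. abs (g x) <= C*abs (f x)" "r >= 0"
 shows "Lp M r g" unfolding Lp_def
proof
 show "integrable M (%x. abs (g x) powr r)"
 proof (rule Bochner_Integration.integrable_bound)
  show "integrable M (%x. abs C powr r*abs (f x) powr r)" using assms by auto
  show "(%x. abs (g x) powr r) : borel_measurable M" using assms by measurable
  show "AE x in M. norm (abs (g x) powr r) <= norm (abs C powr r*abs (f x) powr r)" using assms(3)
  proof eventually_elim
   case (elim x)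
   then have "abs (g x) <= abs C*abs (f x)" by (metis abs_ge_self abs_ge_zero mult_right_mono order_trans)
   then have "abs (g x) powr r <= (abs C*abs (f x)) powr r" using assms(4) by (intro powr_mono2) auto
   then show ?case by (simp add: powr_mult abs_mult)
  qed
 qed
qed (use assms in auto)

lemma Lpi_mono:
 assumes "Lp M r f" "g : borel_measurable M" "AE x in M. abs (g x) <= abs (f x)" "r >= 0"
 shows "Lpi M r g <= Lpi M r f"
proof -
 have "Lp M r g" using Lp_bound[OF assms(1,2), of 1] assms by auto
 then show ?thesis unfolding Lpi_def using assms by (intro integral_mono_AE) (auto intro!: powr_mono2)
qed

lemma Lp_cmult [intro]: "Lp M r f ==> r >= 0 ==> Lp M r (%x. c*f x)"
 by (rule Lp_bound[where C = "abs c"]) (auto simp: abs_mult)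

lemma Lpi_cmult: "Lpi M r (%x. c*f x) = abs c powr r*Lpi M r f"
 by (simp add: Lpi_def abs_mult powr_mult)

lemma Lpn_cmult: "r \<noteq> 0 ==> Lpn M r (%x. c*f x) = abs c*Lpn M r f"
 by (simp add: Lpn_def Lpi_cmult powr_mult powr_powr)

lemma Lp_add [intro]:
 assumes "Lp M r f" "Lp M r g" "r >= 1"
 shows "Lp M r (%x. f x + g x)" unfolding Lp_def
proof
 show "integrable M (%x. abs (f x + g x) powr r)"
 proof (rule Bochner_Integration.integrable_bound)
  show "integrable M (%x. 2 powr r*(abs (f x) powr r + abs (g x) powr r))" using assms by (auto intro!: Bochner_Integration.integrable_add)
  show "(%x. abs (f x + g x) powr r) : borel_measurable M" using assms by measurable
  show "AE x in M. norm (abs (f x + g x) powr r) <= norm (2 powr r*(abs (f x) powr r + abs (g x) powr r))"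
  proof (rule AE_I2)
   fix x
   have "abs (f x + g x) powr r <= (abs (f x) + abs (g x)) powr r" using assms by (intro powr_mono2) auto
   also have "... <= 2 powr r*(abs (f x) powr r + abs (g x) powr r)" using assms by (intro powr_add_le) auto
   finally show "norm (abs (f x + g x) powr r) <= norm (2 powr r*(abs (f x) powr r + abs (g x) powr r))" by simp
  qed
 qed
qed (use assms in auto)

lemma Lp_diff [intro]:
 assumes "Lp M r f" "Lp M r g" "r >= 1"
 shows "Lp M r (%x. f x - g x)" using Lp_add[OF assms(1) Lp_cmult[OF assms(2), of "-1"]] assms(3) by simp

lemma Lpi_cong_AE:
 assumes "f : borel_measurable M" "g : borel_measurable M" "AE x in M. f x = g x"
 shows "Lpi M r f = Lpi M r g" unfolding Lpi_def by (rule integral_cong_AE) (use assms in auto)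

lemma Lp_Young_integrable:
 assumes "Lp M r f" "Lp M r g" "r > 1"
 shows "integrable M (%x. abs (f x) powr (r - 1)*abs (g x))"
proof (rule Bochner_Integration.integrable_bound)
 show "integrable M (%x. abs (f x) powr r + abs (g x) powr r)" using assms by auto
 show "(%x. abs (f x) powr (r - 1)*abs (g x)) : borel_measurable M" using assms by measurable
 show "AE x in M. norm (abs (f x) powr (r - 1)*abs (g x)) <= norm (abs (f x) powr r + abs (g x) powr r)"
 proof (rule AE_I2)
  fix x
  have "abs (f x) powr (r - 1)*abs (g x) <= max (abs (f x)) (abs (g x)) powr (r - 1)*max (abs (f x)) (abs (g x))"
   using assms by (intro mult_mono powr_mono2) auto
  also have "... = max (abs (f x)) (abs (g x)) powr r" using powr_mult_base[of "max (abs (f x)) (abs (g x))" "r - 1"] by (simp add: mult.commute)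
  also have "... <= abs (f x) powr r + abs (g x) powr r" by (auto simp: max_def)
  finally show "norm (abs (f x) powr (r - 1)*abs (g x)) <= norm (abs (f x) powr r + abs (g x) powr r)" by simp
 qed
qed

text \<open>Young's inequality for |f|^r/A and |g|^r/B with weights 1 - 1/r and 1/r, then
  integration. The exponents r - 1 and 1 are those of a first variation tested with g, so no
  conjugate exponent has to be named.\<close>

lemma Hoelder:
 assumes f: "Lp M r f" and g: "Lp M r g" and r: "r > 1"
 shows "(\<integral>x. abs (f x) powr (r - 1)*abs (g x) \<partial>M) <= Lpn M r f powr (r - 1)*Lpn M r g"
proof (cases "Lpi M r f = 0 \<or> Lpi M r g = 0")
 case True
 then have "AE x in M. abs (f x) powr (r - 1)*abs (g x) = 0" using Lpi_eq_0[OF f] Lpi_eq_0[OF g] by auto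
 then have "(\<integral>x. abs (f x) powr (r - 1)*abs (g x) \<partial>M) = (\<integral>x. 0 \<partial>M)"
  using f g by (intro integral_cong_AE) (auto simp: Lp_def)
 then show ?thesis by simp
next
 case False
 define A where "A = Lpi M r f"
 define B where "B = Lpi M r g"
 have AB: "A > 0" "B > 0" using False Lpi_nonneg[of M r f] Lpi_nonneg[of M r g] by (auto simp: A_def B_def less_le)
 define c where "c = A powr ((r - 1)/r)*B powr (1/r)"
 have pt: "abs (f x) powr (r - 1)*abs (g x) <= c*((1 - 1/r)/A*abs (f x) powr r + 1/r/B*abs (g x) powr r)" for x
 proof (cases "f x = 0 \<or> g x = 0")
  case True
  then show ?thesis using AB r by (auto simp: c_def)
 next
  case False
  have "(abs (f x) powr r/A) powr (1 - 1/r)*(abs (g x) powr r/B) powr (1/r)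
   <= (1 - 1/r)*(abs (f x) powr r/A) + 1/r*(abs (g x) powr r/B)" using r AB False by (intro Youngs_inequality_0) auto
  also have "(abs (f x) powr r/A) powr (1 - 1/r)*(abs (g x) powr r/B) powr (1/r)
   = abs (f x) powr (r - 1)*abs (g x)/c" using r by (simp add: powr_divide powr_powr c_def diff_divide_distrib right_diff_distrib)
  finally have "abs (f x) powr (r - 1)*abs (g x)/c <= (1 - 1/r)*(abs (f x) powr r/A) + 1/r*(abs (g x) powr r/B)" .
  moreover have "c > 0" using AB by (simp add: c_def)
  ultimately show ?thesis by (simp add: divide_simps mult_ac)
 qed
 have i: "integrable M (%x. abs (f x) powr r)" "integrable M (%x. abs (g x) powr r)" using f g by auto
 have "(\<integral>x. abs (f x) powr (r - 1)*abs (g x) \<partial>M) <=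
  (\<integral>x. c*((1 - 1/r)/A*abs (f x) powr r + 1/r/B*abs (g x) powr r) \<partial>M)"
  using pt f g r i by (intro integral_mono Lp_Young_integrable) auto
 also have "... = c*((1 - 1/r)/A*A + 1/r/B*B)" using i by (simp add: A_def B_def Lpi_def)
 also have "... = c" using AB by simp
 also have "... = Lpn M r f powr (r - 1)*Lpn M r g" by (simp add: c_def Lpn_def A_def B_def powr_powr)
 finally show ?thesis .
qed

text \<open>Convexity of t^r, with |f| + |g| written as A + B times the mean of |f|/A and |g|/B
  whose weights are proportional to the norms A and B.\<close>

lemma Minkowski:
 assumes f: "Lp M r f" and g: "Lp M r g" and r: "r >= 1"
 shows "Lpn M r (%x. f x + g x) <= Lpn M r f + Lpn M r g"
proof -
 have r0: "r > 0" using r by simp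
 define A where "A = Lpn M r f"
 define B where "B = Lpn M r g"
 have AB: "A >= 0" "B >= 0" by (auto simp: A_def B_def)
 have fg: "Lp M r (%x. f x + g x)" using Lp_add[OF f g r] .
 consider "A = 0" | "B = 0" | "A > 0" "B > 0" using AB by linarith
 then show ?thesis
 proof cases
  case 1
  then have "AE x in M. f x = 0" using Lpn_eq_0[OF f] by (simp add: A_def)
  then have "Lpi M r (%x. f x + g x) = Lpi M r g" using f g by (intro Lpi_cong_AE) (auto intro: borel_measurable_add)
  then show ?thesis using 1 by (simp add: Lpn_def)
 next
  case 2
  then have "AE x in M. g x = 0" using Lpn_eq_0[OF g] by (simp add: B_def)
  then have "Lpi M r (%x. f x + g x) = Lpi M r f" using f g by (intro Lpi_cong_AE) (auto intro: borel_measurable_add)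
  then show ?thesis using 2 by (simp add: Lpn_def)
 next
  case 3
  define t where "t = B/(A + B)"
  have t: "0 <= t" "t <= 1" "1 - t = A/(A + B)" using 3 by (auto simp: t_def divide_simps)
  have pt: "abs (f x + g x) powr r <= (A + B) powr r*((1 - t)/A powr r*abs (f x) powr r + t/B powr r*abs (g x) powr r)" for x
  proof -
   have eq: "abs (f x) + abs (g x) = (A + B)*((1 - t)*(abs (f x)/A) + t*(abs (g x)/B))"
   proof -
    have "(A + B)*(A/(A + B)*(abs (f x)/A)) = abs (f x)" "(A + B)*(B/(A + B)*(abs (g x)/B)) = abs (g x)" using 3 by auto
    then show ?thesis unfolding t(3) unfolding t_def distrib_left by presburger
   qed
   have "abs (f x + g x) powr r <= (abs (f x) + abs (g x)) powr r" using r by (intro powr_mono2) auto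
   also have "... = (A + B) powr r*((1 - t)*(abs (f x)/A) + t*(abs (g x)/B)) powr r" by (simp only: eq powr_mult)
   also have "... <= (A + B) powr r*((1 - t)*(abs (f x)/A) powr r + t*(abs (g x)/B) powr r)"
    using t 3 r by (intro mult_left_mono powr_convex_comb) auto
   finally show ?thesis by (simp add: powr_divide)
  qed
  have i: "integrable M (%x. abs (f x) powr r)" "integrable M (%x. abs (g x) powr r)" using f g by auto
  have "Lpi M r (%x. f x + g x) <= (\<integral>x. (A + B) powr r*((1 - t)/A powr r*abs (f x) powr r + t/B powr r*abs (g x) powr r) \<partial>M)"
   unfolding Lpi_def using pt fg i by (intro integral_mono) auto
  also have "... = (A + B) powr r*((1 - t)/A powr r*Lpi M r f + t/B powr r*Lpi M r g)" using i by (simp add: Lpi_def)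
  also have "... = (A + B) powr r*((1 - t)/A powr r*A powr r + t/B powr r*B powr r)" using r0 by (simp add: A_def B_def Lpn_powr)
  also have "... = (A + B) powr r" using 3 by simp
  finally have "Lpi M r (%x. f x + g x) powr (1/r) <= ((A + B) powr r) powr (1/r)" using r0 by (intro powr_mono2) auto
  then show ?thesis using 3 r0 by (simp add: powr_powr Lpn_def[of M r "%x. f x + g x"] A_def B_def)
 qed
qed

lemma Young_eps:
 fixes x y :: real
 assumes "r > 1" "e > 0" "x >= 0" "y >= 0"
 shows "x powr (r - 1)*y <= e*x powr r + (1/e) powr (r - 1)*y powr r"
proof (cases "y <= e*x")
 case True
 have "x powr (r - 1)*y <= x powr (r - 1)*(e*x)" using True by (intro mult_left_mono) auto
 also have "... = e*x powr r" using powr_mult_base[of x "r - 1"] assms by (simp add: mult_ac)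
 finally show ?thesis by (simp add: add_increasing2)
next
 case False
 then have "x <= (1/e)*y" using assms by (simp add: field_simps)
 then have "x powr (r - 1)*y <= ((1/e)*y) powr (r - 1)*y" using assms by (intro mult_right_mono powr_mono2) auto
 also have "... = (1/e) powr (r - 1)*y powr r" unfolding powr_mult using powr_mult_base[of y "r - 1"] assms by (simp add: mult_ac)
 finally show ?thesis using assms by (simp add: add_increasing)
qed

lemma powr_interpolate:
 fixes r m e :: real
 assumes "0 < r" "r < m" "e > 0"
 shows "EX C>0. ALL t>=0. t powr r <= e*t powr m + C"
proof (intro exI[of _ "((1/e) powr (1/(m - r))) powr r + 1"] conjI allI impI)
 define K where "K = (1/e) powr (1/(m - r))"
 show "((1/e) powr (1/(m - r))) powr r + 1 > 0" by (simp add: add_nonneg_pos)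
 fix t :: real assume t: "t >= 0"
 have "t powr r <= e*t powr m + (K powr r + 1)"
 proof (cases "t <= K")
  case True
  then have "t powr r <= K powr r" using t assms by (intro powr_mono2) auto
  moreover have "0 <= e*t powr m" using assms by simp
  ultimately show ?thesis by linarith
 next
  case False
  have K0: "K > 0" using assms by (simp add: K_def)
  have "1/e = K powr (m - r)" using assms by (simp add: K_def powr_powr)
  also have "... <= t powr (m - r)" using False K0 assms by (intro powr_mono2) auto
  finally have "1 <= e*t powr (m - r)" using assms by (simp add: field_simps)
  then have "t powr r*1 <= t powr r*(e*t powr (m - r))" by (intro mult_left_mono) auto
  also have "... = e*t powr m" by (simp add: powr_add[symmetric] mult.left_commute)
  finally show ?thesis by (simp add: add_increasing2 add_nonneg_nonneg)
 qed
 then show "t powr r <= e*t powr m + (((1/e) powr (1/(m - r))) powr r + 1)" by (simp add: K_def)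
qed

text \<open>The part of \<open>W n\<close> above \<open>e*B n\<close> is dominated by the fixed
  \<open>G\<close>, so dominated convergence removes it, and the rest contributes at most e |C|.
  This serves where no integrable majorant is common to all n: Brezis-Lieb splitting, weak
  continuity, subcritical convergence.\<close>

lemma integral_tendsto_0_eps:
 fixes W B :: "nat => 'a => real"
 assumes W: "!!n. integrable M (W n)" "!!n. AE x in M. 0 <= W n x"
  and lim: "AE x in M. (%n. W n x) ---> 0"
  and B: "!!n. integrable M (B n)" "!!n. AE x in M. 0 <= B n x" "!!n. (\<integral>x. B n x \<partial>M) <= C"
  and dom: "!!e. e > 0 ==> EX G. integrable M G \<and> (ALL n. AE x in M. W n x <= e*B n x + G x)"
 shows "(%n. \<integral>x. W n x \<partial>M) ---> 0"
proof (rule LIMSEQ_I)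
 fix e :: real assume e: "e > 0"
 \<comment> \<open>The summand 1 keeps the denominator positive when C = 0; the same device recurs
   in later choices of constants.\<close>
 define e1 where "e1 = e/(2*(abs C + 1))"
 have e1: "e1 > 0" using e by (simp add: e1_def)
 obtain G where G: "integrable M G" "!!n. AE x in M. W n x <= e1*B n x + G x" using dom[OF e1] by blast
 define V where "V = (%n x. max 0 (W n x - e1*B n x))"
 have iV: "integrable M (V n)" for n unfolding V_def using W B by (intro integrable_max) auto
 have "(%n. \<integral>x. V n x \<partial>M) ---> (\<integral>x. 0 \<partial>M)"
 proof (rule integral_dominated_convergence[where w = "%x. abs (G x)"])
  have allB: "AE x in M. ALL n. 0 <= B n x" "AE x in M. ALL n. 0 <= W n x" using B(2) W(2) by (auto simp: AE_all_countable)
  show "AE x in M. (%n. V n x) ---> 0" using lim allB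
  proof eventually_elim
   case (elim x)
   show ?case
   proof (rule tendsto_sandwich[OF _ _ tendsto_const elim(1)])
    show "EV n. 0 <= V n x" by (auto simp: V_def)
    show "EV n. V n x <= W n x" using elim e1 by (auto simp: V_def intro!: always_eventually mult_nonneg_nonneg)
   qed
  qed
  fix n
  show "AE x in M. norm (V n x) <= abs (G x)" using G(2)[of n] by eventually_elim (auto simp: V_def)
 qed (use iV G in auto)
 then have "EV n. (\<integral>x. V n x \<partial>M) < e/2" using e by (intro order_tendstoD(2)) auto
 then obtain N where N: "!!n. n >= N ==> (\<integral>x. V n x \<partial>M) < e/2" by (auto simp: eventually_sequentially)
 show "EX no. ALL n>=no. norm ((\<integral>x. W n x \<partial>M) - 0) < e"
 proof (intro exI allI impI)
  fix n assume n: "n >= N"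
  have "(\<integral>x. W n x \<partial>M) <= (\<integral>x. V n x + e1*B n x \<partial>M)" using W B iV by (intro integral_mono) (auto simp: V_def)
  also have "... = (\<integral>x. V n x \<partial>M) + e1*(\<integral>x. B n x \<partial>M)" using iV B by simp
  also have "... <= (\<integral>x. V n x \<partial>M) + e1*abs C" using e1 B(3)[of n] by (intro add_left_mono mult_left_mono) auto
  also have "... < e/2 + e/2"
  proof (rule add_less_le_mono[OF N[OF n]])
   have "e1*abs C <= e1*(abs C + 1)" using e1 by simp
   also have "... = e/2"
   proof -
    define y where "y = abs C + 1"
    have "y \<noteq> 0" unfolding y_def by linarith
    then show ?thesis unfolding e1_def y_def[symmetric] by simp
   qed
   finally show "e1*abs C <= e/2" .
  qed
  finally have "(\<integral>x. W n x \<partial>M) < e" by simp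
  moreover have "0 <= (\<integral>x. W n x \<partial>M)" by (rule integral_nonneg_AE[OF W(2)])
  ultimately show "norm ((\<integral>x. W n x \<partial>M) - 0) < e" by simp
 qed
qed

section \<open>Integral functionals and their first variations\<close>

definition T :: "'a measure => real => real => real => ('a => real) => real" where
 "T M r cp cm f = (\<integral>x. pw r cp cm (f x) \<partial>M)"

text \<open>The factor r of the derivative is left out, so that pairing with f itself returns
  \<open>T\<close> (Euler's identity, \<open>DT_self\<close>) and, for difference quotients, the
  form A(u) v.\<close>

definition DT :: "'a measure => real => real => real => ('a => real) => ('a => real) => real" where
 "DT M r cp cm f g = (\<integral>x. pw (r - 1) cp (- cm) (f x)*g x \<partial>M)"

lemma measurable_pw_comp [measurable (raw)]:
 "f : borel_measurable M ==> (%x. pw d cp cm (f x)) : borel_measurable M" using measurable_compose[OF _ measurable_pw] by blast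

lemma T_one_one: "T M r 1 1 f = Lpi M r f"
 by (simp add: T_def Lpi_def pw_one_one)

lemma T_integrable:
 assumes "Lp M r f"
 shows "integrable M (%x. pw r cp cm (f x))"
proof (rule Bochner_Integration.integrable_bound)
 show "integrable M (%x. (abs cp + abs cm)*abs (f x) powr r)" using assms by auto
 show "(%x. pw r cp cm (f x)) : borel_measurable M" using assms by measurable
qed (auto intro!: AE_I2 order_trans[OF pw_abs_le] simp: abs_mult)

lemma T_abs_le:
 assumes "Lp M r f"
 shows "abs (T M r cp cm f) <= (abs cp + abs cm)*Lpi M r f"
proof -
 have "abs (T M r cp cm f) <= (\<integral>x. abs (pw r cp cm (f x)) \<partial>M)" unfolding T_def by (rule integral_abs_bound)
 also have "... <= (\<integral>x. (abs cp + abs cm)*abs (f x) powr r \<partial>M)"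
  using assms T_integrable[OF assms] by (intro integral_mono) (auto intro: pw_abs_le)
 finally show ?thesis by (simp add: Lpi_def)
qed

lemma DT_integrable:
 assumes "Lp M r f" "Lp M r g" "r > 1"
 shows "integrable M (%x. pw (r - 1) cp cm (f x)*g x)"
proof (rule Bochner_Integration.integrable_bound)
 show "integrable M (%x. (abs cp + abs cm)*(abs (f x) powr (r - 1)*abs (g x)))" using Lp_Young_integrable[OF assms] by auto
 show "(%x. pw (r - 1) cp cm (f x)*g x) : borel_measurable M" using assms by measurable
 show "AE x in M. norm (pw (r - 1) cp cm (f x)*g x) <= norm ((abs cp + abs cm)*(abs (f x) powr (r - 1)*abs (g x)))"
  using pw_abs_le[of "r - 1" cp cm] by (auto simp: abs_mult mult.assoc[symmetric] intro!: AE_I2 mult_right_mono)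
qed

lemma DT_abs_le:
 assumes "Lp M r f" "Lp M r g" "r > 1"
 shows "abs (DT M r cp cm f g) <= (abs cp + abs cm)*(Lpn M r f powr (r - 1)*Lpn M r g)"
proof -
 have "abs (DT M r cp cm f g) <= (\<integral>x. abs (pw (r - 1) cp (- cm) (f x)*g x) \<partial>M)" unfolding DT_def by (rule integral_abs_bound)
 also have "... <= (\<integral>x. (abs cp + abs cm)*(abs (f x) powr (r - 1)*abs (g x)) \<partial>M)"
  using DT_integrable[OF assms, of cp "-cm"] Lp_Young_integrable[OF assms]
 proof (intro integral_mono)
  fix x
  show "abs (pw (r - 1) cp (- cm) (f x)*g x) <= (abs cp + abs cm)*(abs (f x) powr (r - 1)*abs (g x))"
   using pw_abs_le[of "r - 1" cp "-cm"] by (auto simp: abs_mult mult.assoc[symmetric] intro!: mult_right_mono)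
 qed auto
 also have "... = (abs cp + abs cm)*(\<integral>x. abs (f x) powr (r - 1)*abs (g x) \<partial>M)" by simp
 also have "... <= (abs cp + abs cm)*(Lpn M r f powr (r - 1)*Lpn M r g)" by (intro mult_left_mono Hoelder assms) auto
 finally show ?thesis .
qed

lemma DT_lin:
 assumes "Lp M r f" "Lp M r g" "Lp M r h" "r > 1"
 shows "DT M r cp cm f (%x. g x + c*h x) = DT M r cp cm f g + c*DT M r cp cm f h"
proof -
 have "DT M r cp cm f (%x. g x + c*h x) =
  (\<integral>x. pw (r - 1) cp (- cm) (f x)*g x + c*(pw (r - 1) cp (- cm) (f x)*h x) \<partial>M)" unfolding DT_def by (simp add: algebra_simps)
 also have "... = DT M r cp cm f g + c*DT M r cp cm f h" using DT_integrable[OF assms(1,2,4), of cp "-cm"] DT_integrable[OF assms(1,3,4), of cp "-cm"]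
  by (simp add: DT_def)
 finally show ?thesis .
qed

lemma DT_self:
 "r > 1 ==> DT M r cp cm f f = T M r cp cm f" unfolding DT_def T_def
proof (rule Bochner_Integration.integral_cong[OF refl])
 fix x assume "r > 1"
 have "y powr (r - 1)*y = y powr r" if "y >= 0" for y using powr_mult_base[OF that, of "r - 1"] by (simp add: mult.commute)
 from this[of "f x"] this[of "- f x"] show "pw (r - 1) cp (- cm) (f x)*f x = pw r cp cm (f x)"
  by (auto simp: pw_def) (metis minus_mult_right mult.assoc mult_minus_left)
qed

lemma T_cong_AE:
 assumes "f : borel_measurable M" "g : borel_measurable M" "AE x in M. f x = g x"
 shows "T M r cp cm f = T M r cp cm g" unfolding T_def by (rule integral_cong_AE) (use assms in \<open>auto intro: measurable_pw_comp\<close>)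

lemma DT_cong_AE:
 assumes [measurable]: "f : borel_measurable M" "g : borel_measurable M" "h : borel_measurable M" "k : borel_measurable M"
 and "AE x in M. f x = g x" "AE x in M. h x = k x"
 shows "DT M r cp cm f h = DT M r cp cm g k" unfolding DT_def by (rule integral_cong_AE) (use assms in auto)

lemma T_diff_bound:
 assumes r: "r >= 1" and e: "e > 0"
 obtains C where "C > 0" "!!f h. Lp M r f ==> Lp M r h ==>
  abs (T M r cp cm (%x. f x + h x) - T M r cp cm f) <= e*Lpi M r f + C*Lpi M r h"
proof -
 have "r > 0" using r by simp
 obtain C where C: "C > 0" "!!a b. abs (pw r cp cm (a + b) - pw r cp cm a) <= e*abs a powr r + C*abs b powr r"
  using pw_add_bound[OF \<open>r > 0\<close> e, of cp cm] by metis
 show ?thesis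
 proof (rule that[OF C(1)])
  fix f h assume f: "Lp M r f" and h: "Lp M r h"
  note i = T_integrable[OF Lp_add[OF f h r], of cp cm] T_integrable[OF f, of cp cm]
  have "abs (T M r cp cm (%x. f x + h x) - T M r cp cm f)
   = abs (\<integral>x. pw r cp cm (f x + h x) - pw r cp cm (f x) \<partial>M)" unfolding T_def using i by simp
  also have "... <= (\<integral>x. abs (pw r cp cm (f x + h x) - pw r cp cm (f x)) \<partial>M)" by (rule integral_abs_bound)
  also have "... <= (\<integral>x. e*abs (f x) powr r + C*abs (h x) powr r \<partial>M)"
   using i LpD(2)[OF f] LpD(2)[OF h] by (intro integral_mono C(2)) auto
  also have "... = e*Lpi M r f + C*Lpi M r h" using f h by (simp add: Lpi_def LpD)
  finally show "abs (T M r cp cm (%x. f x + h x) - T M r cp cm f) <= e*Lpi M r f + C*Lpi M r h" .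
 qed
qed

lemma DT_diff_bound:
 assumes r: "r > 1" and e: "e > 0"
 obtains C where "C > 0" "!!f h g. Lp M r f ==> Lp M r h ==> Lp M r g ==>
  abs (DT M r cp cm (%x. f x + h x) g - DT M r cp cm f g)
   <= (e*Lpn M r f powr (r - 1) + C*Lpn M r h powr (r - 1))*Lpn M r g"
proof -
 have "r - 1 > 0" using r by simp
 obtain C where C: "C > 0" "!!a b. abs (pw (r - 1) cp (-cm) (a + b) - pw (r - 1) cp (-cm) a)
   <= e*abs a powr (r - 1) + C*abs b powr (r - 1)" using pw_add_bound[OF \<open>r - 1 > 0\<close> e, of cp "-cm"] by metis
 show ?thesis
 proof (rule that[OF C(1)])
  fix f h g assume f: "Lp M r f" and h: "Lp M r h" and g: "Lp M r g"
  have fh: "Lp M r (%x. f x + h x)" using f h r by auto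
  note i = DT_integrable[OF fh g r, of cp "-cm"] DT_integrable[OF f g r, of cp "-cm"]
   Lp_Young_integrable[OF f g r] Lp_Young_integrable[OF h g r]
  have "abs (DT M r cp cm (%x. f x + h x) g - DT M r cp cm f g)
   = abs (\<integral>x. pw (r - 1) cp (-cm) (f x + h x)*g x - pw (r - 1) cp (-cm) (f x)*g x \<partial>M)" unfolding DT_def using i by simp
  also have "... <= (\<integral>x. abs (pw (r - 1) cp (-cm) (f x + h x)*g x - pw (r - 1) cp (-cm) (f x)*g x) \<partial>M)"
   by (rule integral_abs_bound)
  also have "... <= (\<integral>x. e*(abs (f x) powr (r - 1)*abs (g x)) + C*(abs (h x) powr (r - 1)*abs (g x)) \<partial>M)"
  proof (intro integral_mono)
   fix x
   have "abs (pw (r - 1) cp (-cm) (f x + h x)*g x - pw (r - 1) cp (-cm) (f x)*g x)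
    = abs (pw (r - 1) cp (-cm) (f x + h x) - pw (r - 1) cp (-cm) (f x))*abs (g x)" by (simp add: abs_mult[symmetric] left_diff_distrib)
   also have "... <= (e*abs (f x) powr (r - 1) + C*abs (h x) powr (r - 1))*abs (g x)" by (intro mult_right_mono C) auto
   finally show "abs (pw (r - 1) cp (-cm) (f x + h x)*g x - pw (r - 1) cp (-cm) (f x)*g x)
    <= e*(abs (f x) powr (r - 1)*abs (g x)) + C*(abs (h x) powr (r - 1)*abs (g x))" by (simp add: algebra_simps)
  qed (use i in auto)
  also have "... = e*(\<integral>x. abs (f x) powr (r - 1)*abs (g x) \<partial>M) + C*(\<integral>x. abs (h x) powr (r - 1)*abs (g x) \<partial>M)"
   using i by simp
  also have "... <= e*(Lpn M r f powr (r - 1)*Lpn M r g) + C*(Lpn M r h powr (r - 1)*Lpn M r g)"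
   using C e by (intro add_mono mult_left_mono Hoelder f g h r) auto
  finally show "abs (DT M r cp cm (%x. f x + h x) g - DT M r cp cm f g)
   <= (e*Lpn M r f powr (r - 1) + C*Lpn M r h powr (r - 1))*Lpn M r g" by (simp add: algebra_simps)
 qed
qed

text \<open>The constant depends on e and the exponents but not on f or h. On bounded sets this is
  uniform differentiability, which later allows one step length for a whole compact family.\<close>

lemma T_taylor_bound:
 assumes r: "r > 1" and e: "e > 0"
 obtains C where "C > 0" "!!f h. Lp M r f ==> Lp M r h ==>
  abs (T M r cp cm (%x. f x + h x) - T M r cp cm f - r*DT M r cp cm f h)
   <= e*(Lpn M r f powr (r - 1)*Lpn M r h) + C*Lpi M r h"
proof -
 obtain C where C: "C > 0" "!!a b. abs (pw r cp cm (a + b) - pw r cp cm a - r*pw (r - 1) cp (- cm) a*b)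
  <= e*(abs a powr (r - 1)*abs b) + C*abs b powr r" using pw_taylor_bound[OF r e, of cp cm] by metis
 show ?thesis
 proof (rule that[OF C(1)])
  fix f h assume f: "Lp M r f" and h: "Lp M r h"
  have fh: "Lp M r (%x. f x + h x)" using f h r by auto
  note i = T_integrable[OF fh, of cp cm] T_integrable[OF f, of cp cm]
   DT_integrable[OF f h r, of cp "-cm"] Lp_Young_integrable[OF f h r] LpD(2)[OF h]
  have "abs (T M r cp cm (%x. f x + h x) - T M r cp cm f - r*DT M r cp cm f h)
   = abs (\<integral>x. pw r cp cm (f x + h x) - pw r cp cm (f x) - r*(pw (r - 1) cp (- cm) (f x)*h x) \<partial>M)"
   unfolding T_def DT_def using i by simp
  also have "... <= (\<integral>x. abs (pw r cp cm (f x + h x) - pw r cp cm (f x) - r*(pw (r - 1) cp (- cm) (f x)*h x)) \<partial>M)"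
   by (rule integral_abs_bound)
  also have "... <= (\<integral>x. e*(abs (f x) powr (r - 1)*abs (h x)) + C*abs (h x) powr r \<partial>M)"
   using i C(2) by (intro integral_mono) (auto simp: mult.assoc)
  also have "... = e*(\<integral>x. abs (f x) powr (r - 1)*abs (h x) \<partial>M) + C*Lpi M r h" using i by (simp add: Lpi_def)
  also have "... <= e*(Lpn M r f powr (r - 1)*Lpn M r h) + C*Lpi M r h" using e by (intro add_right_mono mult_left_mono Hoelder f h r) auto
  finally show "abs (T M r cp cm (%x. f x + h x) - T M r cp cm f - r*DT M r cp cm f h)
   <= e*(Lpn M r f powr (r - 1)*Lpn M r h) + C*Lpi M r h" .
 qed
qed

section \<open>Limit theorems: Fatou, Brezis-Lieb, weak continuity, subcritical convergence\<close>

lemma Lpi_nn: "Lp M r f ==> (\<integral>\<^sup>+x. en (abs (f x) powr r) \<partial>M) = en (Lpi M r f)"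
 unfolding Lpi_def by (rule nn_integral_eq_integral) auto

lemma Lp_nn_finite:
 assumes "f : borel_measurable M" "(\<integral>\<^sup>+x. en (abs (f x) powr r) \<partial>M) <= en C" "C >= 0"
 shows "Lp M r f" "Lpi M r f <= C"
proof -
 show *: "Lp M r f" unfolding Lp_def using assms by (auto intro!: integrableI_bounded simp: order_le_less_trans[OF _ ennreal_less_top])
 show "Lpi M r f <= C" using assms Lpi_nn[OF *] by (simp add: ennreal_le_iff)
qed

lemma Fatou_Lp:
 assumes "!!n. Lp M r (f n)" "!!n. Lpi M r (f n) <= C" "g : borel_measurable M"
  "AE x in M. (%n. f n x) ---> g x" "r > 0"
 shows "Lp M r g" "Lpi M r g <= C"
proof -
 have C0: "C >= 0" using assms(2)[of 0] Lpi_nonneg[of M r "f 0"] by linarith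
 have "(\<integral>\<^sup>+x. en (abs (g x) powr r) \<partial>M) = (\<integral>\<^sup>+x. liminf (%n. en (abs (f n x) powr r)) \<partial>M)"
 proof (rule nn_integral_cong_AE)
  show "AE x in M. en (abs (g x) powr r) = liminf (%n. en (abs (f n x) powr r))" using assms(4)
  proof eventually_elim
   case (elim x)
   have "(%n. abs (f n x) powr r) ---> abs (g x) powr r" using elim assms(5) by (intro tendsto_powr' tendsto_rabs) auto
   then have "(%n. en (abs (f n x) powr r)) ---> en (abs (g x) powr r)" by (rule tendsto_ennrealI)
   then show ?case using lim_imp_Liminf[OF sequentially_bot] by metis
  qed
 qed
 also have "... <= liminf (%n. \<integral>\<^sup>+x. en (abs (f n x) powr r) \<partial>M)" by (rule nn_integral_liminf) (use assms(1) in measurable)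
 also have "... = liminf (%n. en (Lpi M r (f n)))" using assms(1) by (simp add: Lpi_nn)
 also have "... <= liminf (%n. en C)" using assms(2) by (intro Liminf_mono always_eventually) (auto intro: ennreal_leI)
 finally have "(\<integral>\<^sup>+x. en (abs (g x) powr r) \<partial>M) <= en C" by (simp add: Liminf_const)
 from Lp_nn_finite[OF assms(3) this C0] show "Lp M r g" "Lpi M r g <= C" by auto
qed

text \<open>\<open>pw_add_bound\<close> at the base point f_n - g with increment g bounds the defect
  by e |f_n - g|^r plus a fixed multiple of |g|^r; the first summand has bounded integrals.\<close>

lemma Brezis_Lieb:
 assumes f: "!!n. Lp M r (f n)" "!!n. Lpi M r (f n) <= C" and g: "g : borel_measurable M"
  and lim: "AE x in M. (%n. f n x) ---> g x" and r: "r >= 1"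
 shows "(%n. Lpi M r (f n) - Lpi M r (%x. f n x - g x)) ---> Lpi M r g"
proof -
 have r0: "r > 0" using r by simp
 have gL: "Lp M r g" "Lpi M r g <= C" using Fatou_Lp[OF f g lim r0] by auto
 have z: "Lp M r (%x. f n x - g x)" for n using f(1) gL(1) r by auto
 define W where "W = (%n x. abs (abs (f n x) powr r - abs (f n x - g x) powr r - abs (g x) powr r))"
 have lim0: "(%n. \<integral>x. W n x \<partial>M) ---> 0"
 proof (rule integral_tendsto_0_eps[where B = "%n x. abs (f n x - g x) powr r" and C = "2 powr r*(C + C)"])
  show "integrable M (W n)" for n unfolding W_def using LpD(2)[OF f(1)[of n]] LpD(2)[OF gL(1)] LpD(2)[OF z[of n]] by auto
  show "AE x in M. (%n. W n x) ---> 0" using lim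
  proof eventually_elim
   case (elim x)
   have "(%n. W n x) ---> abs (abs (g x) powr r - abs (g x - g x) powr r - abs (g x) powr r)"
    unfolding W_def using elim r0 by (intro tendsto_intros tendsto_powr') auto
   then show ?case by simp
  qed
  show "integrable M (%x. abs (f n x - g x) powr r)" for n using z by auto
  show "(\<integral>x. abs (f n x - g x) powr r \<partial>M) <= 2 powr r*(C + C)" for n
  proof -
   have "(\<integral>x. abs (f n x - g x) powr r \<partial>M) <= (\<integral>x. 2 powr r*(abs (f n x) powr r + abs (g x) powr r) \<partial>M)"
   proof (rule integral_mono)
    fix x
    have "abs (f n x - g x) powr r <= (abs (f n x) + abs (g x)) powr r" using r0 by (intro powr_mono2) auto
    also have "... <= 2 powr r*(abs (f n x) powr r + abs (g x) powr r)" using r by (intro powr_add_le) auto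
    finally show "abs (f n x - g x) powr r <= 2 powr r*(abs (f n x) powr r + abs (g x) powr r)" .
   qed (use z[of n] f(1)[of n] gL in auto)
   also have "... = 2 powr r*(Lpi M r (f n) + Lpi M r g)" using LpD(2)[OF f(1)[of n]] LpD(2)[OF gL(1)] by (simp add: Lpi_def)
   also have "... <= 2 powr r*(C + C)" using f(2)[of n] gL by (intro mult_left_mono) auto
   finally show ?thesis .
  qed
  fix e :: real assume e: "e > 0"
  obtain K where K: "K > 0" "!!a b. abs (pw r 1 1 (a + b) - pw r 1 1 a) <= e*abs a powr r + K*abs b powr r"
   using pw_add_bound[OF r0 e, of 1 1] by metis
  have "W n x <= e*abs (f n x - g x) powr r + (K + 1)*abs (g x) powr r" for n x
  proof -
   have "W n x <= abs (pw r 1 1 ((f n x - g x) + g x) - pw r 1 1 (f n x - g x)) + abs (g x) powr r"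
    using abs_triangle_ineq4[of "abs (f n x) powr r - abs (f n x - g x) powr r" "abs (g x) powr r"] unfolding W_def pw_one_one by simp
   then show ?thesis using K(2)[of "f n x - g x" "g x"] by (simp add: algebra_simps)
  qed
  then show "EX G. integrable M G \<and> (ALL n. AE x in M. W n x <= e*abs (f n x - g x) powr r + G x)"
   using gL(1) by (intro exI[of _ "%x. (K + 1)*abs (g x) powr r"]) auto
 qed (auto simp: W_def)
 have bd: "abs (Lpi M r (f n) - Lpi M r (%x. f n x - g x) - Lpi M r g) <= (\<integral>x. W n x \<partial>M)" for n
 proof -
  have "Lpi M r (f n) - Lpi M r (%x. f n x - g x) - Lpi M r g =
    (\<integral>x. abs (f n x) powr r - abs (f n x - g x) powr r - abs (g x) powr r \<partial>M)"
   unfolding Lpi_def using LpD(2)[OF f(1)[of n]] LpD(2)[OF gL(1)] LpD(2)[OF z[of n]] by simp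
  then show ?thesis unfolding W_def by (simp add: integral_abs_bound)
 qed
 have "(%n. Lpi M r (f n) - Lpi M r (%x. f n x - g x) - Lpi M r g) ---> 0"
  by (rule Lim_null_comparison[OF always_eventually[OF allI] lim0]) (simp only: real_norm_def bd)
 then show ?thesis by (simp add: LIM_zero_iff)
qed

text \<open>Weak convergence enters only as almost everywhere convergence with bounded norms. That
  is enough, because \<open>Young_eps\<close> splits the integrand into e |f_n|^r and a fixed
  integrable function.\<close>

lemma DT_weak_convergence:
 assumes f: "!!n. Lp M r (f n)" "!!n. Lpi M r (f n) <= C" and g: "g : borel_measurable M"
  and lim: "AE x in M. (%n. f n x) ---> g x" and r: "r > 1" and h: "Lp M r h"
 shows "(%n. DT M r cp cm (f n) h) ---> DT M r cp cm g h"
proof -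
 have r0: "r > 0" "r - 1 > 0" using r by auto
 have gL: "Lp M r g" "Lpi M r g <= C" using Fatou_Lp[OF f g lim r0(1)] by auto
 define H where "H = pw (r - 1) cp (- cm)"
 have contH: "continuous_on UNIV H" unfolding H_def by (rule continuous_pw[OF r0(2)])
 define W where "W = (%n x. abs (H (f n x)*h x - H (g x)*h x))"
 define K where "K = abs cp + abs cm + 1"
 have K: "K > 0" "!!t. abs (H t) <= K*abs t powr (r - 1)"
 proof -
  show "K > 0" by (simp add: K_def add_nonneg_pos)
  fix t
  have "abs (H t) <= (abs cp + abs cm)*abs t powr (r - 1)" using pw_abs_le[of "r - 1" cp "-cm" t] by (simp add: H_def)
  also have "... <= K*abs t powr (r - 1)" by (intro mult_right_mono) (auto simp: K_def)
  finally show "abs (H t) <= K*abs t powr (r - 1)" .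
 qed
 have i: "integrable M (%x. H (f n x)*h x)" "integrable M (%x. H (g x)*h x)" for n
  unfolding H_def using DT_integrable[OF f(1) h r] DT_integrable[OF gL(1) h r] by auto
 have lim0: "(%n. \<integral>x. W n x \<partial>M) ---> 0"
 proof (rule integral_tendsto_0_eps[where B = "%n x. abs (f n x) powr r" and C = C])
  show "integrable M (W n)" for n unfolding W_def using i by auto
  show "AE x in M. (%n. W n x) ---> 0" using lim
  proof eventually_elim
   case (elim x)
   have "(%n. H (f n x)) ---> H (g x)" using continuous_on_tendsto_compose[OF contH elim] by auto
   then have "(%n. W n x) ---> abs (H (g x)*h x - H (g x)*h x)" unfolding W_def by (intro tendsto_intros)
   then show ?case by simp
  qed
  show "integrable M (%x. abs (f n x) powr r)" for n using f by auto
  show "(\<integral>x. abs (f n x) powr r \<partial>M) <= C" for n using f(2)[of n] by (simp add: Lpi_def)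
  fix e :: real assume e: "e > 0"
  define e1 where "e1 = e/K"
  have e1: "e1 > 0" using e K by (simp add: e1_def)
  define D where "D = (1/e1) powr (r - 1)"
  have "W n x <= e*abs (f n x) powr r + (K*D*abs (h x) powr r + abs (H (g x)*h x))" for n x
  proof -
   have "W n x <= abs (H (f n x))*abs (h x) + abs (H (g x)*h x)" unfolding W_def abs_mult[symmetric] by (rule abs_triangle_ineq4)
   also have "abs (H (f n x))*abs (h x) <= K*(abs (f n x) powr (r - 1)*abs (h x))"
    using K(2)[of "f n x"] by (simp add: mult.assoc[symmetric] mult_right_mono)
   also have "... <= K*(e1*abs (f n x) powr r + D*abs (h x) powr r)" unfolding D_def using K e1 r by (intro mult_left_mono Young_eps) auto
   also have "... = e*abs (f n x) powr r + K*D*abs (h x) powr r" using K by (simp add: e1_def algebra_simps)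
   finally show ?thesis by simp
  qed
  then show "EX G. integrable M G \<and> (ALL n. AE x in M. W n x <= e*abs (f n x) powr r + G x)"
   using LpD(2)[OF h] i(2) by (intro exI[of _ "%x. K*D*abs (h x) powr r + abs (H (g x)*h x)"]) auto
 qed (auto simp: W_def)
 have bd: "abs (DT M r cp cm (f n) h - DT M r cp cm g h) <= (\<integral>x. W n x \<partial>M)" for n
 proof -
  have "DT M r cp cm (f n) h - DT M r cp cm g h = (\<integral>x. H (f n x)*h x - H (g x)*h x \<partial>M)"
   unfolding DT_def using i(1)[of n] i(2) by (simp add: H_def)
  then show ?thesis unfolding W_def by (simp add: integral_abs_bound)
 qed
 have "(%n. DT M r cp cm (f n) h - DT M r cp cm g h) ---> 0"
  by (rule Lim_null_comparison[OF always_eventually[OF allI] lim0]) (simp only: real_norm_def bd)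
 then show ?thesis by (simp add: LIM_zero_iff)
qed

text \<open>On a set of finite measure t^r <= e t^m + D supplies the majorant. Combined with almost
  everywhere convergence this plays the part of Rellich's theorem below the critical
  exponent.\<close>

lemma Lpi_subcritical_convergence:
 assumes z: "!!n. Lp M m (z n)" "!!n. Lpi M m (z n) <= C"
  and lim: "AE x in M. (%n. z n x) ---> 0" and r: "0 < r" "r < m"
  and A: "A : sets M" "emeasure M A < \<infinity>" and off: "!!n. AE x in M. x \<notin> A --> z n x = 0"
 shows "!!n. Lp M r (z n)" "(%n. Lpi M r (z n)) ---> 0"
proof -
 have iA: "integrable M (%x. ind A x :: real)" using A by (auto intro: integrable_real_indicator)
 have dom: "EX D>0. ALL n. AE x in M. abs (z n x) powr r <= e*abs (z n x) powr m + D*ind A x" if e: "e > 0" for e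
 proof -
  obtain D where D: "D > 0" "!!t::real. t >= 0 ==> t powr r <= e*t powr m + D" using powr_interpolate[OF r e] by blast
  show ?thesis
  proof (intro exI[of _ D] conjI allI)
   fix n
   show "AE x in M. abs (z n x) powr r <= e*abs (z n x) powr m + D*ind A x" using off[of n]
   proof eventually_elim
    case (elim x)
    then show ?case using D(2)[of "abs (z n x)"] by (cases "x : A") auto
   qed
  qed (rule D)
 qed
 show L: "Lp M r (z n)" for n unfolding Lp_def
 proof
  obtain D where D: "D > 0" "!!n. AE x in M. abs (z n x) powr r <= 1*abs (z n x) powr m + D*ind A x" using dom[of 1] by auto
  show "integrable M (%x. abs (z n x) powr r)"
  proof (rule Bochner_Integration.integrable_bound)
   show "integrable M (%x. 1*abs (z n x) powr m + D*ind A x)" using z(1)[of n] iA by auto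
   show "(%x. abs (z n x) powr r) : borel_measurable M" using z(1)[of n] by measurable
   show "AE x in M. norm (abs (z n x) powr r) <= norm (1*abs (z n x) powr m + D*ind A x)" using D(2)[of n] by eventually_elim auto
  qed
 qed (use z(1)[of n] in auto)
 show "(%n. Lpi M r (z n)) ---> 0" unfolding Lpi_def
 proof (rule integral_tendsto_0_eps[where B = "%n x. abs (z n x) powr m" and C = C])
  show "AE x in M. (%n. abs (z n x) powr r) ---> 0" using lim by eventually_elim (use r in \<open>auto intro!: tendsto_eq_intros\<close>)
  fix e :: real assume "e > 0"
  then obtain D where "D > 0" "!!n. AE x in M. abs (z n x) powr r <= e*abs (z n x) powr m + D*ind A x" using dom by blast
  then show "EX G. integrable M G \<and> (ALL n. AE x in M. abs (z n x) powr r <= e*abs (z n x) powr m + G x)"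
   using iA by (intro exI[of _ "%x. D*ind A x"]) auto
 qed (use z L in \<open>auto simp: Lpi_def\<close>)
qed

section \<open>Difference quotients and the kernel\<close>

abbreviation "Ll r \<equiv> Lp (lebesgue :: 'a::euclidean_space measure) r"
abbreviation "Il r \<equiv> Lpi (lebesgue :: 'a::euclidean_space measure) r"
abbreviation "Nl r \<equiv> Lpn (lebesgue :: 'a::euclidean_space measure) r"
abbreviation "Tl r c d \<equiv> T (lebesgue :: 'a::euclidean_space measure) r c d"
abbreviation "DTl r c d \<equiv> DT (lebesgue :: 'a::euclidean_space measure) r c d"

lemma sigma_finite_lebesgue: "sigma_finite_measure (leb :: 'a::euclidean_space measure)"
proof
 obtain A :: "'a set set" where A: "countable A" "A \<subseteq> sets lborel" "\<Union>A = space lborel" "ALL a:A. emeasure lborel a \<noteq> \<infinity>"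
  using lborel.sigma_finite_countable by blast
 then show "EX A::'a set set. countable A \<and> A \<subseteq> sets leb \<and> \<Union>A = space leb \<and> (ALL a:A. emeasure leb a \<noteq> \<infinity>)"
  by (intro exI[of _ A]) (auto simp: main_part_sets)
qed

interpretation leb: sigma_finite_measure "leb :: 'a::euclidean_space measure" by (rule sigma_finite_lebesgue)

interpretation leb_pair: pair_sigma_finite "leb :: 'a::euclidean_space measure" "leb :: 'a measure" ..

abbreviation LL :: "('a::euclidean_space \<times> 'a) measure" where
 "LL \<equiv> leb \<Otimes>\<^sub>M leb"

lemma measurable_id_lebesgue [measurable]: "(%x. x) : (leb :: 'a::euclidean_space measure) \<rightarrow>\<^sub>M borel"
 by (rule measurable_completion) simp

lemma measurable_fst_borel [measurable]: "fst : (LL :: ('a::euclidean_space \<times> 'a) measure) \<rightarrow>\<^sub>M borel"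
 using measurable_compose[OF measurable_fst measurable_id_lebesgue] by simp

lemma measurable_snd_borel [measurable]: "snd : (LL :: ('a::euclidean_space \<times> 'a) measure) \<rightarrow>\<^sub>M borel"
 using measurable_compose[OF measurable_snd measurable_id_lebesgue] by simp

lemma measurable_borel_lebesgue:
 fixes g :: "'a::euclidean_space => 'b::topological_space"
 assumes "g : borel_measurable borel"
 shows "g : Bl" using assms by (intro measurable_completion) simp

text \<open>A null set N spoils only N x UNIV and UNIV x N, both null for the product. Thus almost
  everywhere statements about u pass to its difference quotients.\<close>

lemma AE_LL:
 assumes "AE x in leb. Q x"
 shows "AE z in (LL :: ('a::euclidean_space \<times> 'a) measure). Q (fst z) \<and> Q (snd z)"
proof -
 obtain N where N: "{x\<in>space leb. \<not> Q x} \<subseteq> N" "emeasure leb N = 0" "N : sets (leb :: 'a measure)" using assms by (rule AE_E)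
 have 1: "N \<times> UNIV : sets LL" "UNIV \<times> N : sets LL" using N(3) by (auto intro!: pair_measureI)
 have 2: "emeasure LL (N \<times> UNIV) = 0" "emeasure LL (UNIV \<times> N) = 0" using N by (auto simp: leb.emeasure_pair_measure_Times)
 have "emeasure LL (N \<times> UNIV \<union> UNIV \<times> N) = 0" using 1 2 by (metis emeasure_Un_null_set null_setsI)
 then show ?thesis using 1 N(1) by (intro AE_I[where N = "N \<times> UNIV \<union> UNIV \<times> N"]) auto
qed

text \<open>The p-th root of the kernel is taken, so that the Gagliardo seminorm becomes an ordinary
  L^p norm over the product and A(u) v becomes a \<open>DT\<close>; all L^p lemmas then apply to the
  energy. On the diagonal the quotient is 0/0, that is 0.\<close>

definition dq :: "real => real => (real^'n::finite => real) => (real^'n) \<times> (real^'n) => real" where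
 "dq s p u z = (u (fst z) - u (snd z))/norm (fst z - snd z) powr ((real CARD('n) + s*p)/p)"

lemma measurable_dq [measurable (raw)]:
 fixes u :: "real^'n::finite => real"
 assumes [measurable]: "u : Bl"
 shows "dq s p u : borel_measurable LL"
proof -
 have [measurable]: "(%z. u (fst z)) : borel_measurable (LL :: ((real^'n) \<times> (real^'n)) measure)"
  using measurable_compose[OF measurable_fst assms] by simp
 have [measurable]: "(%z. u (snd z)) : borel_measurable (LL :: ((real^'n) \<times> (real^'n)) measure)"
  using measurable_compose[OF measurable_snd assms] by simp
 show ?thesis unfolding dq_def[abs_def] by measurable
qed

lemma dq_lin: "dq s p (%x. u x + c * v x) z = dq s p u z + c*dq s p v z"
 by (simp add: dq_def add_divide_distrib[symmetric] algebra_simps)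

lemma dq_add: "dq s p (%x. u x + v x) z = dq s p u z + dq s p v z"
 using dq_lin[of s p u 1 v z] by simp

lemma dq_cmult: "dq s p (%x. c * v x) z = c*dq s p v z"
 using dq_lin[of s p "%x. 0" c v z] by (simp add: dq_def)

lemma dq_diff: "dq s p (%x. u x - v x) z = dq s p u z - dq s p v z"
 using dq_lin[of s p u "-1" v z] by simp

lemma dq_powr:
 fixes u :: "real^'n::finite => real"
 assumes "p > 0"
 shows "abs (dq s p u z) powr p = abs (u (fst z) - u (snd z)) powr p/norm (fst z - snd z) powr (real CARD('n) + s*p)"
 using assms by (simp add: dq_def powr_divide powr_powr abs_divide)

lemma dq_mono_abs:
 "abs (u (fst z) - u (snd z)) <= abs (v (fst z) - v (snd z)) ==> abs (dq s p u z) <= abs (dq s p v z)"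
 by (simp add: dq_def abs_divide divide_right_mono)

lemma gagliardo_dq:
 fixes u :: "real^'n::finite => real"
 assumes "p > 0"
 shows "gagliardo s p u = (\<integral>\<^sup>+ z. en (abs (dq s p u z) powr p) \<partial>LL)"
 unfolding gagliardo_def dq_powr[OF assms] by (simp add: case_prod_unfold)

lemma A_op_dq:
 fixes u :: "real^'n::finite => real"
 assumes "p > 1"
 shows "A_op s p u v = DT LL p 1 1 (dq s p u) (dq s p v)" unfolding A_op_def DT_def
proof (rule Bochner_Integration.integral_cong[OF refl])
 fix z :: "(real^'n) \<times> (real^'n)"
 let ?d = "norm (fst z - snd z)" and ?M = "real CARD('n) + s*p"
 let ?du = "u (fst z) - u (snd z)" and ?dv = "v (fst z) - v (snd z)"
 define E where "E = ?d powr (?M/p)"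
 have E: "E powr (p - 2)*E*E = ?d powr ?M"
 proof (cases "?d = 0")
  case True
  then show ?thesis by (simp add: E_def)
 next
  case False
  have "E powr (p - 2)*E*E = ?d powr (?M/p*(p - 2) + ?M/p + ?M/p)" by (simp only: E_def powr_powr powr_add)
  also have "?M/p*(p - 2) + ?M/p + ?M/p = ?M" using assms by (simp add: field_simps)
  finally show ?thesis .
 qed
 have "pw (p - 1) 1 (- 1) (dq s p u z)*dq s p v z
  = abs (?du) powr (p - 2) * ?du * ?dv/(E powr (p - 2)*E*E)" unfolding pw_odd dq_def E_def[symmetric] by (simp add: abs_divide powr_divide E_def)
 then show "(case z of (x, y) => abs (u x - u y) powr (p - 2)*(u x - u y)*(v x - v y)/norm (x - y) powr ?M)
  = pw (p - 1) 1 (- 1) (dq s p u z)*dq s p v z" unfolding E by (simp add: case_prod_unfold)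
qed

section \<open>Dilations, and the integral of the truncated kernel\<close>

lemma nn_integral_lebesgue_affine:
 fixes f :: "'a::euclidean_space => ennreal"
 assumes c: "c > 0" and f: "f : Bl"
 shows "(NI x. f (t + c *\<^sub>R x)) = en (1/c ^ DIM('a))*(NI x. f x)"
  and "(%x. t + c *\<^sub>R x) : leb \<rightarrow>\<^sub>M leb"
proof -
 define S where "S = (%x::'a. t + (\<Sum>j\<in>Basis. (c*(x \<bullet> j)) *\<^sub>R j))"
 have S: "S = (%x. t + c *\<^sub>R x)"
 proof
  fix x :: 'a
  have "(\<Sum>j\<in>Basis. (c*(x \<bullet> j)) *\<^sub>R j) = c *\<^sub>R (\<Sum>j\<in>Basis. (x \<bullet> j) *\<^sub>R j)"
   by (simp add: scaleR_sum_right)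
  then show "S x = t + c *\<^sub>R x" by (simp add: S_def euclidean_representation)
 qed
 have meas: "S : leb \<rightarrow>\<^sub>M leb" unfolding S_def using lebesgue_affine_measurable[of "%_. c" t] c by simp
 then show "(%x. t + c *\<^sub>R x) : leb \<rightarrow>\<^sub>M leb" by (simp add: S)
 have "(NI x. f x) = (\<integral>\<^sup>+x. f x \<partial>density (distr leb leb S) (%_. en (\<Prod>j\<in>(Basis::'a set). abs c)))"
  unfolding S_def using lebesgue_affine_euclidean[of "%_. c" t] c by simp
 also have "... = en (c ^ DIM('a))*(NI x. f (S x))" using meas f c by (simp add: nn_integral_density nn_integral_cmult nn_integral_distr)
 finally have "en (1/c ^ DIM('a))*(NI x. f x)
  = en (1/c ^ DIM('a))*en (c ^ DIM('a))*(NI x. f (S x))" by (simp add: mult.assoc)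
 also have "en (1/c ^ DIM('a))*en (c ^ DIM('a)) = 1" using c by (simp add: ennreal_mult'[symmetric])
 finally show "(NI x. f (t + c *\<^sub>R x)) = en (1/c ^ DIM('a))*(NI x. f x)" by (simp add: S)
qed

lemma nn_integral_LL:
 fixes f :: "('a::euclidean_space \<times> 'a) => ennreal"
 assumes "f : borel_measurable LL"
 shows "(\<integral>\<^sup>+z. f z \<partial>LL) = (NI x. (NI y. f (x, y)))" by (rule leb.nn_integral_fst[symmetric]) (use assms in simp)

lemma nn_integral_LL_swap:
 fixes f :: "('a::euclidean_space \<times> 'a) => ennreal"
 assumes "f : borel_measurable LL"
 shows "(\<integral>\<^sup>+z. f z \<partial>LL) = (NI y. (NI x. f (x, y)))" by (rule leb_pair.nn_integral_snd[symmetric]) (use assms in simp)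

text \<open>The exponent is c^(N + s p) from the kernel and c^(-N) from each of the two
  substitutions.\<close>

lemma gagliardo_affine:
 fixes u :: "real^'n::finite => real"
 assumes c: "c > 0" and p: "p > 0" and u: "u : Bl"
 shows "(\<integral>\<^sup>+z. en (abs (dq s p (%x. u (t + c *\<^sub>R x)) z) powr p) \<partial>LL)
  = en (c powr (s*p - real CARD('n)))*(\<integral>\<^sup>+z. en (abs (dq s p u z) powr p) \<partial>LL)"
proof -
 let ?N = "CARD('n)"
 define F where "F = (%z. en (abs (dq s p u z) powr p))"
 have Fm: "F : borel_measurable LL" unfolding F_def using u by measurable
 have am: "(%x::real^'n. t + c *\<^sub>R x) : leb \<rightarrow>\<^sub>M leb" using nn_integral_lebesgue_affine(2)[OF c, of "%x. 0" t] by simp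
 have um: "(%x. u (t + c *\<^sub>R x)) : Bl" using measurable_compose[OF am u] .
 have pt: "en (abs (dq s p (%x. u (t + c *\<^sub>R x)) (x, y)) powr p)
  = en (c powr (real ?N + s*p))*F (t + c *\<^sub>R x, t + c *\<^sub>R y)" for x y
 proof -
  have "norm ((t + c *\<^sub>R x) - (t + c *\<^sub>R y)) = c*norm (x - y)"
   using c by (metis (no_types) add_diff_cancel_left abs_of_pos norm_scaleR scaleR_right_diff_distrib)
  then have "abs (dq s p (%x. u (t + c *\<^sub>R x)) (x, y)) powr p
   = c powr (real ?N + s*p)*abs (dq s p u (t + c *\<^sub>R x, t + c *\<^sub>R y)) powr p" using c unfolding dq_powr[OF p] by (simp add: powr_mult)
  then show ?thesis by (simp add: F_def ennreal_mult')
 qed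
 have Fx: "(%y. F (x, y)) : Bl" for x using Fm by measurable
 have Fi: "(%x. (NI y. F (x, y))) : Bl" using Fm by measurable
 have "(\<integral>\<^sup>+z. en (abs (dq s p (%x. u (t + c *\<^sub>R x)) z) powr p) \<partial>LL)
  = (NI x. (NI y. en (abs (dq s p (%x. u (t + c *\<^sub>R x)) (x, y)) powr p)))" by (rule nn_integral_LL) (use um in measurable)
 also have "... = (NI x. (NI y. en (c powr (real ?N + s*p))*F (t + c *\<^sub>R x, t + c *\<^sub>R y)))" by (simp only: pt)
 also have "... = (NI x. en (c powr (real ?N + s*p))*(NI y. F (t + c *\<^sub>R x, t + c *\<^sub>R y)))"
  by (intro nn_integral_cong nn_integral_cmult measurable_compose[OF am Fx])
 also have "... = (NI x. en (c powr (real ?N + s*p))*(en (1/c ^ ?N)*(NI y. F (t + c *\<^sub>R x, y))))"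
  by (intro nn_integral_cong arg_cong2[where f = "(*)"] refl) (simp add: nn_integral_lebesgue_affine(1)[OF c Fx])
 also have "... = en (c powr (real ?N + s*p))*(en (1/c ^ ?N)*(NI x. (NI y. F (t + c *\<^sub>R x, y))))"
  using measurable_compose[OF am Fi] by (simp add: nn_integral_cmult)
 also have "(NI x. (NI y. F (t + c *\<^sub>R x, y))) = en (1/c ^ ?N)*(NI x. (NI y. F (x, y)))"
  using nn_integral_lebesgue_affine(1)[OF c Fi, of t] by simp
 also have "(NI x. (NI y. F (x, y))) = (\<integral>\<^sup>+z. F z \<partial>LL)" by (rule nn_integral_LL[symmetric, OF Fm])
 also have "en (c powr (real ?N + s*p))*(en (1/c ^ ?N)*(en (1/c ^ ?N)*(\<integral>\<^sup>+z. F z \<partial>LL)))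
  = en (c powr (real ?N + s*p)*(1/c ^ ?N)*(1/c ^ ?N))*(\<integral>\<^sup>+z. F z \<partial>LL)"
 proof -
  define B where "B = 1/c ^ ?N"
  have "B >= 0" using c by (simp add: B_def)
  then show ?thesis unfolding B_def[symmetric] by (simp add: ennreal_mult mult.assoc)
 qed
 also have "c powr (real ?N + s*p)*(1/c ^ ?N)*(1/c ^ ?N) = c powr (s*p - real ?N)" using c by (simp add: powr_add powr_diff powr_realpow field_simps)
 finally show ?thesis unfolding F_def .
qed

lemma emeasure_lebesgue_ball:
 fixes x :: "real^'n::finite"
 assumes "r >= 0"
 shows "emeasure leb (ball x r) = en (unit_ball_vol (real CARD('n))*r powr real CARD('n))"
  and "emeasure lborel (ball x r) = en (unit_ball_vol (real CARD('n))*r powr real CARD('n))"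
proof -
 show "emeasure lborel (ball x r) = en (unit_ball_vol (real CARD('n))*r powr real CARD('n))"
  using emeasure_ball[OF assms, of x] assms by (simp add: powr_realpow')
 then show "emeasure leb (ball x r) = en (unit_ball_vol (real CARD('n))*r powr real CARD('n))" by simp
qed

lemma ennreal_le_suminf: "f k <= (\<Sum>k. f k)" for f :: "nat => ennreal"
 using sum_le_suminf[of f "{k}"] by simp

text \<open>Dyadic balls replace polar coordinates. Near x the shells sum geometrically with ratio
  2^(-(p - s p)), which uses s < 1; far from x with ratio 2^(-s p). The bound R^(-s p) is the scale
  of every cut-off error below.\<close>

lemma kernel_nn_integral:
 fixes s p :: real
 assumes "0 < s" "s < 1" "1 < p"
 obtains \<kappa> where "\<kappa> > 0" "!!(x::real^'n::finite) R. R > 0 ==>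
  (NI y. en (min 1 (norm (x - y)/R) powr p/norm (x - y) powr (real CARD('n) + s*p)))
   <= en (\<kappa>*R powr (- (s*p)))"
proof -
 define N where "N = real CARD('n)"
 define m where "m = N + s*p"
 define \<omega> where "\<omega> = unit_ball_vol N"
 have N1: "N >= 1" unfolding N_def using zero_less_card_finite[where 'a='n] by linarith
 have \<omega>: "\<omega> > 0" by (simp add: \<omega>_def N_def)
 have sp: "s*p > 0" "p - s*p > 0" using assms by (auto simp: algebra_simps)
 have m: "m > 0" using N1 sp by (simp add: m_def)
 define h where "h = (1/2::real)"
 define q1 where "q1 = h powr (p - s*p)"
 define q2 where "q2 = h powr (s*p)"
 have q: "0 < q1" "q1 < 1" "0 < q2" "q2 < 1"
  using sp powr_less_mono2[of "p - s*p" h 1] powr_less_mono2[of "s*p" h 1] by (auto simp: q1_def q2_def h_def)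
 define \<kappa> where "\<kappa> = \<omega>*2 powr m*(1/(1 - q1)) + \<omega>*2 powr N*(1/(1 - q2)) "
 have \<kappa>: "\<kappa> > 0" unfolding \<kappa>_def using \<omega> q by (intro add_pos_pos mult_pos_pos) auto
 show ?thesis
 proof (rule that[OF \<kappa>])
  fix x :: "real^'n" and R :: real assume R: "R > 0"
  define a where "a = (%k::nat. (h ^ k) powr p/(R*h ^ Suc k) powr m)"
  define b where "b = (%k::nat. 1/(R*2 ^ k) powr m)"
  have hk: "h ^ k > 0" for k by (simp add: h_def)
  have a0: "a k >= 0" "b k >= 0" for k by (auto simp: a_def b_def)
  have pt: "en (min 1 (norm (x - y)/R) powr p/norm (x - y) powr m)
   <= (\<Sum>k. en (a k)*ind (ball x (R*h ^ k)) y) + (\<Sum>k. en (b k)*ind (ball x (R*2 ^ Suc k)) y)" for y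
  proof -
   define d where "d = norm (x - y)"
   have d0: "d >= 0" by (simp add: d_def)
   consider "d = 0" | "0 < d" "d < R" | "d >= R" using d0 by linarith
   then show ?thesis
   proof cases
    case 1
    then show ?thesis unfolding d_def[symmetric] by simp
   next
    case 2
    \<comment> \<open>The least such k places y in the shell between the radii R h^(k+1) and R
      h^k.\<close>
    define k where "k = (LEAST k. R*h ^ Suc k <= d)"
    have ex: "EX k. R*h ^ Suc k <= d"
    proof -
     obtain n where "h ^ n < d/R" using real_arch_pow_inv[of "d/R" h] 2 R by (auto simp: h_def)
     then have "R*h ^ n < d" using R by (simp add: field_simps)
     moreover have "R*h ^ Suc n <= R*h ^ n" using R by (simp add: h_def)
     ultimately show ?thesis by (intro exI[of _ n]) linarith
    qed
    have k1: "R*h ^ Suc k <= d" unfolding k_def by (rule LeastI_ex[OF ex])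
    have k2: "d < R*h ^ k"
    proof (cases k)
     case 0 then show ?thesis using 2 by simp
    next
     case (Suc j)
     then have "\<not> R*h ^ Suc j <= d" using not_less_Least[of j "%k. R*h ^ Suc k <= d"] unfolding k_def by simp
     then show ?thesis using Suc by simp
    qed
    have "min 1 (d/R) powr p/d powr m <= a k" unfolding a_def
    proof (rule frac_le)
     have "d/R <= h ^ k" using k2 R by (simp add: field_simps)
     then show "min 1 (d/R) powr p <= (h ^ k) powr p" using 2 R assms by (intro powr_mono2) auto
     show "(R*h ^ Suc k) powr m <= d powr m" using k1 m R hk[of "Suc k"] by (intro powr_mono2) auto
     show "0 < (R*h ^ Suc k) powr m" using R hk[of "Suc k"] by (metis powr_gt_zero mult_pos_pos less_irrefl)
    qed simp
    then have "en (min 1 (d/R) powr p/d powr m) <= en (a k)*ind (ball x (R*h ^ k)) y" using k2 by (simp add: d_def dist_norm ennreal_leI)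
    also have "... <= (\<Sum>k. en (a k)*ind (ball x (R*h ^ k)) y)" by (rule ennreal_le_suminf)
    finally show ?thesis unfolding d_def by (rule add_increasing2[OF zero_le])
   next
    case 3
    define k where "k = (LEAST k. d < R*2 ^ Suc k)"
    have ex: "EX k. d < R*2 ^ Suc k"
    proof -
     obtain n where "d/R < 2 ^ n" using real_arch_pow[of 2 "d/R"] by auto
     then have "d < R*2 ^ n" using R by (simp add: field_simps)
     moreover have "R*2 ^ n <= R*2 ^ Suc n" using R by simp
     ultimately show ?thesis by (intro exI[of _ n]) linarith
    qed
    have k1: "d < R*2 ^ Suc k" unfolding k_def by (rule LeastI_ex[OF ex])
    have k2: "R*2 ^ k <= d"
    proof (cases k)
     case 0 then show ?thesis using 3 by simp
    next
     case (Suc j)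
     then have "\<not> d < R*2 ^ Suc j" using not_less_Least[of j "%k. d < R*2 ^ Suc k"] unfolding k_def by simp
     then show ?thesis using Suc by simp
    qed
    have "min 1 (d/R) powr p/d powr m <= b k" unfolding b_def
    proof (rule frac_le)
     show "min 1 (d/R) powr p <= 1" using 3 R assms by (simp add: powr_le1)
     show "(R*2 ^ k) powr m <= d powr m" using k2 m R by (intro powr_mono2) auto
     show "0 < (R*2 ^ k) powr m" using R by simp
    qed simp
    then have "en (min 1 (d/R) powr p/d powr m) <= en (b k)*ind (ball x (R*2 ^ Suc k)) y" using k1 by (simp add: d_def dist_norm ennreal_leI)
    also have "... <= (\<Sum>k. en (b k)*ind (ball x (R*2 ^ Suc k)) y)" by (rule ennreal_le_suminf)
    finally show ?thesis unfolding d_def by (rule add_increasing[OF zero_le])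
   qed
  qed
  have A: "(\<Sum>k. en (a k)*emeasure leb (ball x (R*h ^ k))) = en (\<omega>*2 powr m*(1/(1 - q1))*R powr (- (s*p)))"
  proof -
   have e: "en (a k)*emeasure leb (ball x (R*h ^ k)) = en (\<omega>*2 powr m*R powr (- (s*p))*q1 ^ k)" for k
   proof -
    have "a k*(\<omega>*(R*h ^ k) powr N) = \<omega>*2 powr m*R powr (- (s*p))*q1 ^ k"
    proof -
     have hh: "(h ^ k) powr e = h powr (real k*e)" for e by (simp add: h_def powr_realpow[symmetric] powr_powr)
     have h2: "(h ^ Suc k) powr m = h powr (real k*m)/2 powr m"
     proof -
      have "h ^ Suc k = h ^ k/2" by (simp add: h_def)
      then show ?thesis by (simp only: powr_divide hh)
     qed
     have "q1 ^ k = h powr (real k*(p - s*p))" by (simp add: q1_def h_def powr_realpow[symmetric] powr_powr mult.commute)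
     also have "... = h powr (real k*p)*h powr (real k*N)/h powr (real k*m)"
      by (simp add: powr_add[symmetric] powr_diff[symmetric] m_def algebra_simps)
     finally have q1k: "q1 ^ k = h powr (real k*p)*h powr (real k*N)/h powr (real k*m)" .
     have Rm: "R powr (- (s*p)) = R powr N/R powr m" by (simp add: powr_diff[symmetric] m_def)
     show ?thesis unfolding a_def q1k Rm by (simp add: powr_mult h2 hh del: power_Suc)
    qed
    then have "en (a k)*en (\<omega>*(R*h ^ k) powr N) = en (\<omega>*2 powr m*R powr (- (s*p))*q1 ^ k)"
     by (simp only: ennreal_mult'[OF a0(1), symmetric])
    moreover have "0 <= R*h ^ k" using R hk[of k] by simp
    ultimately show ?thesis by (simp only: emeasure_lebesgue_ball \<omega>_def N_def)
   qed
   have "(%k. \<omega>*2 powr m*R powr (- (s*p))*q1 ^ k) sums (\<omega>*2 powr m*R powr (- (s*p))*(1/(1 - q1)))"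
    using q by (intro sums_mult geometric_sums) auto
   then have "(\<Sum>k. en (\<omega>*2 powr m*R powr (- (s*p))*q1 ^ k)) = en (\<omega>*2 powr m*R powr (- (s*p))*(1/(1 - q1)))"
    using \<omega> q by (intro suminf_ennreal_eq) auto
   then show ?thesis unfolding e by (simp add: mult_ac)
  qed
  have B: "(\<Sum>k. en (b k)*emeasure leb (ball x (R*2 ^ Suc k))) = en (\<omega>*2 powr N*(1/(1 - q2))*R powr (- (s*p)))"
  proof -
   have e: "en (b k)*emeasure leb (ball x (R*2 ^ Suc k)) = en (\<omega>*2 powr N*R powr (- (s*p))*q2 ^ k)" for k
   proof -
    have "b k*(\<omega>*(R*2 ^ Suc k) powr N) = \<omega>*2 powr N*R powr (- (s*p))*q2 ^ k"
    proof -
     have hh: "(2 ^ k) powr e = 2 powr (real k*e)" for e by (simp add: powr_realpow[symmetric] powr_powr)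
     have h2: "(2 ^ Suc k) powr N = 2 powr (real k*N)*2 powr N" by (simp add: powr_mult hh)
     have hm: "h powr e = 1/2 powr e" for e by (simp add: h_def powr_divide)
     have "q2 ^ k = h powr (real k*(s*p))" by (simp add: q2_def h_def powr_realpow[symmetric] powr_powr mult.commute)
     also have "... = 2 powr (real k*N)/2 powr (real k*m)" unfolding hm by (simp add: m_def distrib_left powr_add)
     finally have q2k: "q2 ^ k = 2 powr (real k*N)/2 powr (real k*m)" .
     have Rm: "R powr (- (s*p)) = R powr N/R powr m" by (simp add: powr_diff[symmetric] m_def)
     show ?thesis unfolding b_def q2k Rm by (simp add: powr_mult h2 hh del: power_Suc)
    qed
    then have "en (b k)*en (\<omega>*(R*2 ^ Suc k) powr N) = en (\<omega>*2 powr N*R powr (- (s*p))*q2 ^ k)"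
     by (simp only: ennreal_mult'[OF a0(2), symmetric])
    moreover have "0 <= R*2 ^ Suc k" using R by simp
    ultimately show ?thesis by (simp only: emeasure_lebesgue_ball \<omega>_def N_def)
   qed
   have "(%k. \<omega>*2 powr N*R powr (- (s*p))*q2 ^ k) sums (\<omega>*2 powr N*R powr (- (s*p))*(1/(1 - q2)))"
    using q by (intro sums_mult geometric_sums) auto
   then have "(\<Sum>k. en (\<omega>*2 powr N*R powr (- (s*p))*q2 ^ k)) = en (\<omega>*2 powr N*R powr (- (s*p))*(1/(1 - q2)))"
    using \<omega> q by (intro suminf_ennreal_eq) auto
   then show ?thesis unfolding e by (simp add: mult_ac)
  qed
  have "(NI y. en (min 1 (norm (x - y)/R) powr p/norm (x - y) powr m))
   <= (NI y. (\<Sum>k. en (a k)*ind (ball x (R*h ^ k)) y) + (\<Sum>k. en (b k)*ind (ball x (R*2 ^ Suc k)) y))" by (intro nn_integral_mono pt)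
  also have "... = (\<Sum>k. en (a k)*emeasure leb (ball x (R*h ^ k))) + (\<Sum>k. en (b k)*emeasure leb (ball x (R*2 ^ Suc k)))"
  proof -
   have mb: "(%y. en (c k)*ind (ball x (\<rho> k)) y) : Bl" for c \<rho> and k :: nat
    by (intro borel_measurable_times_ennreal borel_measurable_indicator) auto
   have iz: "(NI y. (\<Sum>k. en (c k)*ind (ball x (\<rho> k)) y)) = (\<Sum>k. en (c k)*emeasure leb (ball x (\<rho> k)))"
    for c and \<rho> :: "nat => real" by (subst nn_integral_suminf[OF mb]) (simp add: nn_integral_cmult_indicator del: emeasure_completion)
   show ?thesis by (subst nn_integral_add) (auto intro!: borel_measurable_suminf_order mb simp: iz simp del: power_Suc emeasure_completion)
  qed
  also have "... = en (\<kappa>*R powr (- (s*p)))"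
   unfolding A B \<kappa>_def using \<omega> q by (subst ennreal_plus[symmetric]) (auto simp: algebra_simps)
  finally show "(NI y. en (min 1 (norm (x - y)/R) powr p/norm (x - y) powr (real CARD('n) + s*p)))
   <= en (\<kappa>*R powr (- (s*p)))" unfolding m_def N_def .
 qed
qed

section \<open>Morrey and Sobolev inequalities\<close>

lemma le_eps_powr:
 fixes t e p :: real
 assumes "t >= 0" "e > 0" "p >= 1"
 shows "t <= e + e powr (1 - p)*t powr p"
proof (cases "t <= e")
 case True
 then show ?thesis by (simp add: add_increasing2)
next
 case False
 have "1 <= (t/e) powr (p - 1)" using False assms by (intro ge_one_powr_ge_zero) auto
 then have "t*1 <= t*(t/e) powr (p - 1)" using assms by (intro mult_left_mono) auto
 also have "... = e powr (1 - p)*t powr p" using assms False by (simp add: powr_divide powr_diff field_simps)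
 finally show ?thesis using assms by simp
qed

lemma comp_fst_measurable:
 "w : Bl ==> (%z. w (fst z)) : borel_measurable LL" by (rule measurable_compose[OF measurable_fst])

lemma comp_snd_measurable:
 "w : Bl ==> (%z. w (snd z)) : borel_measurable LL" by (rule measurable_compose[OF measurable_snd])

locale frac =
 fixes s p N ps :: real and TN :: "'n::finite itself"
 assumes s0: "0 < s" and s1: "s < 1" and p1: "1 < p" and sub: "s*p < N"
  and N_def: "N = real CARD('n)" and ps_def: "ps = N*p/(N - s*p)"
begin

abbreviation EE :: "(real^'n => real) => (real^'n => real) => real" where
 "EE u v \<equiv> DT LL p 1 1 (dq s p u) (dq s p v)"

abbreviation G :: "(real^'n => real) => real" where "G u \<equiv> Lpi LL p (dq s p u)"
abbreviation kR :: "real => (real^'n) \<times> (real^'n) => real" where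
 "kR R z \<equiv> min 1 (norm (fst z - snd z)/R) powr p/norm (fst z - snd z) powr (N + s*p)"

lemmas dq_powr_N = dq_powr[where 'n = 'n, folded N_def]
lemmas emeasure_ball_N = emeasure_lebesgue_ball[where 'n = 'n, folded N_def]
lemmas gagliardo_affine_N = gagliardo_affine[where 'n = 'n, folded N_def]

lemma sp0: "s*p > 0" using s0 p1 by simp

lemma N1: "N >= 1"
 unfolding N_def using zero_less_card_finite[where 'a='n] by linarith

lemma p0: "p > 0" using p1 by simp

lemma ps_facts: "ps > p" "ps > 1" "ps > 0" "ps - p = s*p*p/(N - s*p)" "p/ps = (N - s*p)/N"
 unfolding ps_def
proof -
 have d: "N - s*p > 0" using sub by simp
 have "p*(N - s*p) < N*p" using p1 sp0 by (simp add: algebra_simps)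
 then show 1: "N*p/(N - s*p) > p" using d by (simp add: field_simps)
 then show "N*p/(N - s*p) > 1" using p1 by simp
 then show "N*p/(N - s*p) > 0" by simp
 show "N*p/(N - s*p) - p = s*p*p/(N - s*p)" using d by (simp add: field_simps)
 show "p/(N*p/(N - s*p)) = (N - s*p)/N" using d p1 by simp
qed

lemma kR_measurable [measurable]: "(%z. en (kR R z)) : borel_measurable LL"
 by measurable

definition \<kappa> :: real where
 "\<kappa> = (SOME k. k > 0 \<and> (ALL (x::real^'n) R. R > 0 -->
  (NI y. en (min 1 (norm (x - y)/R) powr p/norm (x - y) powr (N + s*p)))
   <= en (k*R powr (- (s*p)))))"

lemma \<kappa>: "\<kappa> > 0" "R > 0 ==> (NI y. en (kR R (x, y))) <= en (\<kappa>*R powr (- (s*p)))"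
proof -
 have "EX k. k > 0 \<and> (ALL (x::real^'n) R. R > 0 -->
  (NI y. en (min 1 (norm (x - y)/R) powr p/norm (x - y) powr (N + s*p)))
   <= en (k*R powr (- (s*p))))"
 proof (rule kernel_nn_integral[OF s0 s1 p1, where 'n = 'n, folded N_def])
  fix k :: real
  assume "k > 0" "!!(x::real^'n) R. R > 0 ==>
   (NI y. en (min 1 (norm (x - y)/R) powr p/norm (x - y) powr (N + s*p)))
    <= en (k*R powr (- (s*p)))"
  then show ?thesis by (intro exI[of _ k]) blast
 qed
 from someI_ex[OF this] show "\<kappa> > 0" "R > 0 ==> (NI y. en (kR R (x, y))) <= en (\<kappa>*R powr (- (s*p)))" unfolding \<kappa>_def by auto
qed

lemma kR_weight_fst:
 assumes R: "R > 0" and w: "w : Bl"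
 shows "(\<integral>\<^sup>+z. w (fst z)*en (kR R z) \<partial>LL) <= en (\<kappa>*R powr (- (s*p)))*(NI x. w x)"
proof -
 note m = comp_fst_measurable[OF w]
 have k: "(%y. en (kR R (x, y))) : Bl" for x using measurable_compose[OF measurable_Pair1' kR_measurable, of x] by simp
 have "(\<integral>\<^sup>+z. w (fst z)*en (kR R z) \<partial>LL) = (NI x. (NI y. w x*en (kR R (x, y))))"
  by (subst nn_integral_LL) (use m in \<open>auto intro: borel_measurable_times_ennreal kR_measurable\<close>)
 also have "... = (NI x. w x*(NI y. en (kR R (x, y))))" by (intro nn_integral_cong nn_integral_cmult k)
 also have "... <= (NI x. w x*en (\<kappa>*R powr (- (s*p))))" by (intro nn_integral_mono mult_left_mono \<kappa>(2) R) auto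
 also have "... = en (\<kappa>*R powr (- (s*p)))*(NI x. w x)" using w by (simp add: nn_integral_multc mult.commute)
 finally show ?thesis .
qed

lemma kR_weight_snd:
 assumes R: "R > 0" and w: "w : Bl"
 shows "(\<integral>\<^sup>+z. w (snd z)*en (kR R z) \<partial>LL) <= en (\<kappa>*R powr (- (s*p)))*(NI x. w x)"
proof -
 note m = comp_snd_measurable[OF w] and m' = comp_fst_measurable[OF w]
 have "(\<integral>\<^sup>+z. w (snd z)*en (kR R z) \<partial>LL) = (NI y. (NI x. w y*en (kR R (x, y))))"
  by (subst nn_integral_LL_swap) (use m in \<open>auto intro: borel_measurable_times_ennreal kR_measurable\<close>)
 also have "... = (NI y. (NI x. w y*en (kR R (y, x))))" by (simp add: norm_minus_commute)
 also have "... = (\<integral>\<^sup>+z. w (fst z)*en (kR R z) \<partial>LL)"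
  by (subst nn_integral_LL) (use m' in \<open>auto intro: borel_measurable_times_ennreal kR_measurable\<close>)
 finally show ?thesis using kR_weight_fst[OF R w] by simp
qed

text \<open>Every cut-off estimate below ends here. Cut-offs at scale R vary by at most min(1,
  |x-y|/R), and integrating out one variable against the kernel leaves only the mass of the
  weight.\<close>

lemma kR_weight:
 assumes R: "R > 0" and w: "integrable leb w" "!!x. w x >= 0"
 shows "integrable LL (%z. (w (fst z) + w (snd z)) * kR R z)"
  "(\<integral>z. (w (fst z) + w (snd z)) * kR R z \<partial>LL) <= 2*\<kappa>*R powr (- (s*p))*(LI x. w x)"
proof -
 have wm: "w : Bl" using w by auto
 note [measurable] = comp_snd_measurable[OF wm] comp_fst_measurable[OF wm]
 have wn: "(NI x. en (w x)) = en (LI x. w x)" using w by (intro nn_integral_eq_integral) auto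
 have "(\<integral>\<^sup>+z. en ((w (fst z) + w (snd z)) * kR R z) \<partial>LL)
  = (\<integral>\<^sup>+z. en (w (fst z))*en (kR R z) + en (w (snd z))*en (kR R z) \<partial>LL)" using w(2) by (intro nn_integral_cong)
   (simp add: ennreal_mult[symmetric] ennreal_plus[symmetric] distrib_right add_divide_distrib del: ennreal_plus)
 also have "... = (\<integral>\<^sup>+z. en (w (fst z))*en (kR R z) \<partial>LL) + (\<integral>\<^sup>+z. en (w (snd z))*en (kR R z) \<partial>LL)"
  by (rule nn_integral_add) measurable
 also have "... <= en (\<kappa>*R powr (- (s*p)))*(NI x. en (w x)) + en (\<kappa>*R powr (- (s*p)))*(NI x. en (w x))"
  using wm R by (intro add_mono kR_weight_fst kR_weight_snd) auto
 also have "... = en (2*\<kappa>*R powr (- (s*p))*(LI x. w x))"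
  unfolding wn using \<kappa>(1) w(2) by (simp add: ennreal_mult'[symmetric] ennreal_plus[symmetric] del: ennreal_plus)
 finally have le: "(\<integral>\<^sup>+z. en ((w (fst z) + w (snd z)) * kR R z) \<partial>LL) <= en (2*\<kappa>*R powr (- (s*p))*(LI x. w x))" .
 have nn: "(w (fst z) + w (snd z)) * kR R z >= 0" for z using w(2) by simp
 show i: "integrable LL (%z. (w (fst z) + w (snd z)) * kR R z)"
 proof (rule integrableI_bounded)
  show "(%z. (w (fst z) + w (snd z)) * kR R z) : borel_measurable LL" by measurable
  show "(\<integral>\<^sup>+ z. en (norm ((w (fst z) + w (snd z)) * kR R z)) \<partial>LL) < \<infinity>"
   unfolding real_norm_def abs_of_nonneg[OF nn] infinity_ennreal_def by (rule order_le_less_trans[OF le ennreal_less_top])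
 qed
 have "en (\<integral>z. (w (fst z) + w (snd z)) * kR R z \<partial>LL) = (\<integral>\<^sup>+z. en ((w (fst z) + w (snd z)) * kR R z) \<partial>LL)"
  using i nn by (intro nn_integral_eq_integral[symmetric]) auto
 also note le
 finally have *: "en (\<integral>z. (w (fst z) + w (snd z)) * kR R z \<partial>LL) <= en (2*\<kappa>*R powr (- (s*p))*(LI x. w x))" .
 have "0 <= 2*\<kappa>*R powr (- (s*p))*(LI x. w x)" using \<kappa>(1) w(2) by (intro mult_nonneg_nonneg integral_nonneg) auto
 from iffD1[OF ennreal_le_iff[OF this] *] show "(\<integral>z. (w (fst z) + w (snd z)) * kR R z \<partial>LL) <= 2*\<kappa>*R powr (- (s*p))*(LI x. w x)" .
qed

lemma dq_kR:
 assumes "abs (u (fst z) - u (snd z)) powr p <= c*min 1 (norm (fst z - snd z)/R) powr p"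
 shows "abs (dq s p u z) powr p <= c * kR R z" unfolding dq_powr_N[OF p0] using assms by (simp add: divide_right_mono)

lemma Lp_dq_weight:
 assumes R: "R > 0" and w: "integrable leb w" "!!x. w x >= 0" and u: "u : Bl"
  and bd: "!!x y. abs (u x - u y) powr p <= (w x + w y)*min 1 (norm (x - y)/R) powr p"
 shows "Lp LL p (dq s p u)" "G u <= 2*\<kappa>*R powr (- (s*p))*(LI x. w x)"
proof -
 have le: "abs (dq s p u z) powr p <= (w (fst z) + w (snd z)) * kR R z" for z by (rule dq_kR[OF bd])
 show L: "Lp LL p (dq s p u)" unfolding Lp_def
 proof
  show "dq s p u : borel_measurable LL" using u by measurable
  then show "integrable LL (%x. abs (dq s p u x) powr p)" using w(2) le
   by (intro Bochner_Integration.integrable_bound[OF kR_weight(1)[OF R w]]) (auto intro!: AE_I2 order_trans[OF _ abs_ge_self])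
 qed
 have "G u <= (\<integral>z. (w (fst z) + w (snd z)) * kR R z \<partial>LL)"
  unfolding Lpi_def using L kR_weight(1)[OF R w] le by (intro integral_mono) auto
 also have "... <= 2*\<kappa>*R powr (- (s*p))*(LI x. w x)" by (rule kR_weight(2)[OF R w])
 finally show "G u <= 2*\<kappa>*R powr (- (s*p))*(LI x. w x)" .
qed

text \<open>The homogeneous space, with L^ps instead of L^p. It is invariant under the critical
  dilations and contains extremals before these are known to lie in L^p.\<close>

definition DD :: "(real^'n => real) set" where
 "DD = {u. u : Bl \<and> Lp LL p (dq s p u) \<and> Ll ps u}"

lemma DD_D [dest]: "u : DD ==> u : Bl" "u : DD ==> Lp LL p (dq s p u)" "u : DD ==> Ll ps u"
 by (auto simp: DD_def)

lemma dq_lin_fun: "dq s p (%x. u x + c * v x) = (%z. dq s p u z + c*dq s p v z)"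
 by (rule ext) (rule dq_lin)

lemma DD_lin: "u : DD ==> v : DD ==> (%x. u x + c * v x) : DD"
 using ps_facts p1 unfolding DD_def mem_Collect_eq dq_lin_fun by (intro conjI Lp_add Lp_cmult) auto

lemma DD_zero: "(%x. 0) : DD"
 unfolding DD_def by (auto simp: Lp_def dq_def)

lemma DD_bound:
 assumes u: "u : DD" and v: "v : Bl" "!!x. abs (v x) <= C*abs (u x)" "!!x y. abs (v x - v y) <= C*abs (u x - u y)"
 shows "v : DD"
proof -
 have "Ll ps v" by (rule Lp_bound[OF DD_D(3)[OF u] v(1), of C]) (use v ps_facts in auto)
 moreover have "Lp LL p (dq s p v)"
 proof (rule Lp_bound[OF DD_D(2)[OF u], of _ C])
  show "dq s p v : borel_measurable LL" using v by measurable
  show "AE z in LL. abs (dq s p v z) <= C*abs (dq s p u z)" using v(3) by (intro AE_I2) (simp add: dq_def abs_divide divide_right_mono mult.commute)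
 qed (use p0 in simp)
 ultimately show ?thesis using v by (simp add: DD_def)
qed

lemma G_mono:
 assumes u: "u : DD" and v: "v : Bl" "!!x y. abs (v x - v y) <= abs (u x - u y)"
 shows "G v <= G u" by (rule Lpi_mono) (use u v p0 in \<open>auto intro!: AE_I2 dq_mono_abs\<close>)

subsection \<open>The Sobolev inequality\<close>

lemma ubv: "unit_ball_vol N > 0"
 using N1 by (intro unit_ball_vol_pos) simp

definition Morrey_C :: real where
 "Morrey_C = 2*4 powr (p - 1)/unit_ball_vol N*(4/unit_ball_vol N) powr (ps - p)"

lemma Morrey_C_pos: "Morrey_C > 0"
 using ubv by (simp add: Morrey_C_def)

text \<open>A Hedberg type argument. Average |u(x)| <= |u(x) - u(y)| + |u(y)| over a ball whose
  radius makes the Morrey bound a quarter of the left side; a second quarter is spent on trading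
  |u(x) - u(y)| for its p-th power.\<close>

lemma Morrey_pointwise:
 fixes u :: "real^'n => real"
 assumes u: "u : Bl" and M: "M > 0"
  and Mb: "!!x r. r > 0 ==> (NI y. en (abs (u y))*ind (ball x r) y) <= en (M*r powr (N - (N - s*p)/p))"
 shows "en (abs (u x) powr ps) <= en (Morrey_C*M powr (ps - p))*(NI y. en (abs (dq s p u (x, y)) powr p))"
proof (cases "u x = 0")
 case True
 then show ?thesis by simp
next
 case False
 define A where "A = abs (u x)"
 have A: "A > 0" using False by (simp add: A_def)
 define \<omega> where "\<omega> = unit_ball_vol N"
 have \<omega>: "\<omega> > 0" using ubv by (simp add: \<omega>_def)
 define D where "D = (NI y. en (abs (dq s p u (x, y)) powr p))"
 have Cp: "Morrey_C*M powr (ps - p) > 0" using Morrey_C_pos M by simp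
 show ?thesis
 proof (cases "D = \<infinity>")
  case True
  have "en (Morrey_C*M powr (ps - p))*D = \<infinity>"
   using True Cp by (simp only: infinity_ennreal_def ennreal_mult_eq_top_iff) (metis ennreal_eq_0_iff not_le)
  then show ?thesis unfolding D_def[symmetric] by simp
 next
  case False
  then obtain d where d: "D = en d" "d >= 0" by (cases D) auto
  \<comment> \<open>The radius r below satisfies r^((N - s p)/p) = \<open>\<rho>\<close>, which is
    what makes M r^(N - (N - s p)/p) equal to a quarter of |u(x)| times the volume of the
    ball.\<close>
  define \<rho> where "\<rho> = 4*M/(\<omega>*A)"
  have \<rho>: "\<rho> > 0" using M A \<omega> by (simp add: \<rho>_def)
  define r where "r = \<rho> powr (p/(N - s*p))"
  have r: "r > 0" using \<rho> by (simp add: r_def)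
  have dsp: "N - s*p > 0" using sub by simp
  have r1: "r powr ((N - s*p)/p) = \<rho>" using dsp p0 \<rho> by (simp add: r_def powr_powr)
  have r2: "r powr (s*p) = \<rho> powr (ps - p)" unfolding ps_facts(4) by (simp add: r_def powr_powr mult_ac)
  define V where "V = \<omega>*r powr N"
  have V: "V > 0" "emeasure leb (ball x r) = en V" using \<omega> r by (auto simp: V_def emeasure_ball_N \<omega>_def)
  define K where "K = (A/4) powr (1 - p)*r powr (N + s*p)"
  have K: "K >= 0" by (simp add: K_def)
  have pt: "en A*ind (ball x r) y <= en (A/4)*ind (ball x r) y
   + en K*en (abs (dq s p u (x, y)) powr p) + en (abs (u y))*ind (ball x r) y" for y
  proof (cases "y : ball x r")
   case True
   define e where "e = abs (u x - u y)"
   have "A <= e + abs (u y)" unfolding A_def e_def by linarith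
   also have "e <= A/4 + (A/4) powr (1 - p)*e powr p" using A p1 by (intro le_eps_powr) (auto simp: e_def)
   also have "e powr p <= r powr (N + s*p)*abs (dq s p u (x, y)) powr p"
   proof (cases "x = y")
    case False
    then have "norm (x - y) powr (N + s*p) <= r powr (N + s*p)" using True sp0 N1 by (intro powr_mono2) (auto simp: dist_norm)
    then have "e powr p*norm (x - y) powr (N + s*p) <= e powr p*r powr (N + s*p)" by (intro mult_left_mono) auto
    then show ?thesis using False unfolding dq_powr_N[OF p0] by (simp add: e_def field_simps)
   qed (simp add: e_def)
   finally have "A <= A/4 + K*abs (dq s p u (x, y)) powr p + abs (u y)" by (simp add: K_def mult.assoc mult_left_mono)
   then have "en A <= en (A/4 + K*abs (dq s p u (x, y)) powr p + abs (u y))" by (rule ennreal_leI)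
   also have "... = en (A/4) + en K*en (abs (dq s p u (x, y)) powr p) + en (abs (u y))" using A K by (simp add: ennreal_mult)
   finally show ?thesis using True by simp
  qed simp
  have mq: "(%y. en (abs (dq s p u (x, y)) powr p)) : Bl" using measurable_compose[OF measurable_Pair1' measurable_dq[OF u], of x] by measurable
  have mi: "(%y. en (abs (u y))*ind (ball x r) y) : Bl" using u by (intro borel_measurable_times_ennreal) (auto intro!: borel_measurable_indicator)
  have "en (A*V) = (NI y. en A*ind (ball x r) y)" using A V by (simp add: nn_integral_cmult_indicator ennreal_mult)
  also have "... <= (NI y. en (A/4)*ind (ball x r) y
   + en K*en (abs (dq s p u (x, y)) powr p) + en (abs (u y))*ind (ball x r) y)" by (intro nn_integral_mono pt)
  also have "... = (NI y. en (A/4)*ind (ball x r) y)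
   + en K*D + (NI y. en (abs (u y))*ind (ball x r) y)"
  proof -
   have mA: "(%y. en (A/4)*ind (ball x r) y) : Bl" by (intro borel_measurable_times_ennreal borel_measurable_indicator) auto
   have mK: "(%y. en K*en (abs (dq s p u (x, y)) powr p)) : Bl" by (intro borel_measurable_times_ennreal mq) auto
   show ?thesis unfolding D_def nn_integral_add[OF borel_measurable_add[OF mA mK] mi] nn_integral_add[OF mA mK] nn_integral_cmult[OF mq] ..
  qed
  also have "... <= en (A/4)*en V + en K*en d + en (M*r powr (N - (N - s*p)/p))"
   using V A by (intro add_mono Mb r) (auto simp: nn_integral_cmult_indicator d)
  also have "... = en (A/4*V + K*d + M*r powr (N - (N - s*p)/p))"
  proof -
   have "en (A/4)*en V = en (A/4*V)" "en K*en d = en (K*d)" using A V K d by (intro ennreal_mult[symmetric]; simp)+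
   moreover have "0 <= A/4*V" "0 <= K*d" "0 <= M*r powr (N - (N - s*p)/p)" using A V K d M by auto
   ultimately show ?thesis by (simp only: ennreal_plus add_nonneg_nonneg)
  qed
  finally have "A*V <= A/4*V + K*d + M*r powr (N - (N - s*p)/p)" using A V K d M by (subst (asm) ennreal_le_iff) (auto intro!: add_nonneg_nonneg)
  also have "M*r powr (N - (N - s*p)/p) = A/4*V"
  proof -
   have "M*r powr (N - (N - s*p)/p) = M*r powr N/\<rho>" using r1 by (simp add: powr_diff)
   also have "... = A/4*V" unfolding \<rho>_def V_def using M A \<omega> by (simp add: field_simps)
   finally show ?thesis .
  qed
  finally have "A/2*V <= K*d" by (simp add: field_simps)
  then have "A/2*\<omega>*r powr N <= (A/4) powr (1 - p)*r powr (s*p)*d*r powr N" by (simp add: V_def K_def powr_add mult_ac)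
  then have "A/2*\<omega> <= (A/4) powr (1 - p)*r powr (s*p)*d" using r by (subst (asm) mult_le_cancel_right) auto
  then have "A powr ps*(A/2*\<omega>) <= A powr ps*((A/4) powr (1 - p)*r powr (s*p)*d)" by (intro mult_left_mono) auto
  also have "... = A*(4 powr (p - 1)*(4/\<omega>) powr (ps - p)*M powr (ps - p)*d)" unfolding r2 \<rho>_def using A \<omega> M
   by (simp add: powr_divide powr_mult powr_diff field_simps)
  finally have "A powr ps <= 2*4 powr (p - 1)/\<omega>*(4/\<omega>) powr (ps - p)*M powr (ps - p)*d" using A \<omega> by (simp add: field_simps)
  then have "A powr ps <= Morrey_C*M powr (ps - p)*d" by (simp add: Morrey_C_def \<omega>_def)
  then have "en (A powr ps) <= en (Morrey_C*M powr (ps - p))*en d" using Cp d by (simp add: ennreal_mult[symmetric] ennreal_leI)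
  then show ?thesis unfolding A_def using d by (simp add: D_def)
 qed
qed

text \<open>Integrated over x, the pointwise bound is an improved Sobolev inequality. With M
  estimated by the L^ps norm it gives the Sobolev inequality; with M small it excludes vanishing of
  minimising sequences.\<close>

lemma Sobolev_Morrey:
 fixes u :: "real^'n => real"
 assumes u: "u : Bl" and M: "M > 0" and uG: "Lp LL p (dq s p u)"
  and Mb: "!!x r. r > 0 ==> (NI y. en (abs (u y))*ind (ball x r) y) <= en (M*r powr (N - (N - s*p)/p))"
 shows "Ll ps u" "Il ps u <= Morrey_C*M powr (ps - p)*G u"
proof -
 have Cp: "Morrey_C*M powr (ps - p) >= 0" using Morrey_C_pos M by simp
 have mq: "(%z. en (abs (dq s p u z) powr p)) : borel_measurable LL" using u by measurable
 have mi: "(%x. (NI y. en (abs (dq s p u (x, y)) powr p))) : Bl" using mq by measurable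
 have "(NI x. en (abs (u x) powr ps))
  <= (NI x. en (Morrey_C*M powr (ps - p))*(NI y. en (abs (dq s p u (x, y)) powr p)))" by (intro nn_integral_mono Morrey_pointwise[OF u M Mb])
 also have "... = en (Morrey_C*M powr (ps - p))*(\<integral>\<^sup>+z. en (abs (dq s p u z) powr p) \<partial>LL)"
  unfolding nn_integral_LL[OF mq] by (rule nn_integral_cmult[OF mi])
 also have "... = en (Morrey_C*M powr (ps - p)*G u)" unfolding Lpi_nn[OF uG] using Cp by (simp add: ennreal_mult)
 finally show "Ll ps u" "Il ps u <= Morrey_C*M powr (ps - p)*G u" using Lp_nn_finite[OF u, of ps] Cp by auto
qed

lemma Lp_indicator:
 assumes "A : sets M" "emeasure M A < \<infinity>" "r > 0"
 shows "Lp M r (%x. ind A x)" "Lpi M r (%x. ind A x) = measure M A"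
proof -
 have e: "abs (ind A x :: real) powr r = ind A x" for x using assms by (auto simp: indicator_def)
 show "Lp M r (%x. ind A x)" "Lpi M r (%x. ind A x) = measure M A" unfolding Lp_def Lpi_def e using assms by (auto simp: integrable_real_indicator)
qed

lemma ball_L1:
 fixes u :: "real^'n => real"
 assumes u: "Ll r u" "r > 1" and rad: "rad > 0"
 shows "(NI y. en (abs (u y))*ind (ball x rad) y) <=
   en ((unit_ball_vol N*rad powr N) powr ((r - 1)/r)*Nl r u)"
proof -
 have r: "r > 1" "r > 0" using u by auto
 have B: "ball x rad : sets leb" "emeasure leb (ball x rad) < \<infinity>" using rad by (auto simp: emeasure_ball_N)
 have mB: "measure leb (ball x rad) = unit_ball_vol N*rad powr N" using rad ubv by (simp add: measure_def emeasure_ball_N)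
 have e: "abs (ind (ball x rad) y) powr (r - 1)*abs (u y) = abs (u y)*ind (ball x rad) y" for y using r by (auto simp: indicator_def)
 note L = Lp_indicator[OF B r(2)]
 have i: "integrable leb (%y. abs (u y)*ind (ball x rad) y)" using Lp_Young_integrable[OF L(1) u(1) r(1)] unfolding e .
 have "(NI y. en (abs (u y))*ind (ball x rad) y) = (NI y. en (abs (u y)*ind (ball x rad) y))" by (intro nn_integral_cong) (auto simp: indicator_def)
 also have "... = en (LI y. abs (u y)*ind (ball x rad) y)" using i by (intro nn_integral_eq_integral) auto
 also have "(LI y. abs (u y)*ind (ball x rad) y) <= Nl r (%y. ind (ball x rad) y) powr (r - 1)*Nl r u" using Hoelder[OF L(1) u(1) r(1)] unfolding e .
 also have "Nl r (%y. ind (ball x rad) y) powr (r - 1) = (unit_ball_vol N*rad powr N) powr ((r - 1)/r)"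
  unfolding Lpn_def L(2) mB by (simp add: powr_powr)
 finally show ?thesis by (simp add: ennreal_leI)
qed

definition Sob_C :: real where
 "Sob_C = Morrey_C*(unit_ball_vol N powr ((ps - 1)/ps)) powr (ps - p)"

lemma Sob_C_pos: "Sob_C > 0"
 using Morrey_C_pos ubv by (simp add: Sob_C_def)

text \<open>By Hoelder on balls the Morrey constant is a multiple of L = \<open>Nl ps u\<close>. The
  improved inequality then reads L^ps <= C L^(ps-p) G(u), and the power of L cancels because L is
  finite in \<open>DD\<close>.\<close>

lemma Sobolev_DD:
 assumes u: "u : DD"
 shows "Nl ps u powr p <= Sob_C*G u"
proof (cases "Nl ps u = 0")
 case True
 then show ?thesis using Sob_C_pos by simp
next
 case False
 define L where "L = Nl ps u"
 have L: "L > 0" using False Lpn_nonneg[of leb ps u] by (auto simp: L_def less_le)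
 define M where "M = unit_ball_vol N powr ((ps - 1)/ps)*L"
 have M: "M > 0" using L ubv by (simp add: M_def)
 have ex: "N*((ps - 1)/ps) = N - (N - s*p)/p"
 proof -
  have "N/ps = (N - s*p)/p" using ps_facts(5) N1 p0 ps_facts(3) by (simp add: field_simps)
  moreover have "N*((ps - 1)/ps) = N - N/ps" using ps_facts(3) by (simp add: field_simps)
  ultimately show ?thesis by simp
 qed
 have "Il ps u <= Morrey_C*M powr (ps - p)*G u"
 proof (rule Sobolev_Morrey(2)[OF DD_D(1)[OF u] M DD_D(2)[OF u]])
  fix x :: "real^'n" and r :: real assume r: "r > 0"
  have "(unit_ball_vol N*r powr N) powr ((ps - 1)/ps)*Nl ps u = M*r powr (N - (N - s*p)/p)"
   unfolding M_def L_def[symmetric] powr_mult powr_powr ex by simp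
  then show "(NI y. en (abs (u y))*ind (ball x r) y) <= en (M*r powr (N - (N - s*p)/p))" using ball_L1[OF DD_D(3)[OF u] ps_facts(2) r, of x] by simp
 qed
 also have "M powr (ps - p) = (unit_ball_vol N powr ((ps - 1)/ps)) powr (ps - p)*L powr (ps - p)" by (simp add: M_def powr_mult)
 also have "Il ps u = L powr (ps - p)*L powr p" using Lpn_powr[of ps leb u] ps_facts(3) by (simp add: L_def powr_add[symmetric])
 finally have "L powr (ps - p)*L powr p <= L powr (ps - p)*(Sob_C*G u)" by (simp add: Sob_C_def mult_ac)
 then show ?thesis using L by (simp add: L_def)
qed

text \<open>The cancellation in \<open>Sobolev_DD\<close> presupposes a finite L^ps norm, which
  truncation at height k supplies. The resulting bound is independent of k and passes to the limit
  by Fatou.\<close>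

lemma Sobolev_Lp:
 assumes u: "Ll p u" "Lp LL p (dq s p u)"
 shows "u : DD"
proof -
 define v where "v = (%(k::nat) x. min (abs (u x)) (real k))"
 have um: "u : Bl" using u by auto
 have vm: "v k : Bl" for k unfolding v_def using um by measurable
 have vD: "v k : DD" for k
 proof -
  have "Lp LL p (dq s p (v k))"
  proof (rule Lp_bound[OF u(2), of _ 1])
   show "dq s p (v k) : borel_measurable LL" using vm by measurable
   have "abs (v k x - v k y) <= abs (u x - u y)" for x y unfolding v_def by (auto simp: min_def)
   then show "AE z in LL. abs (dq s p (v k) z) <= 1*abs (dq s p u z)" by (intro AE_I2) (simp add: dq_mono_abs)
  qed (use p0 in simp)
  moreover have "Ll ps (v k)" unfolding Lp_def
  proof
   show "integrable leb (%x. abs (v k x) powr ps)"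
   proof (rule Bochner_Integration.integrable_bound)
    show "integrable leb (%x. real k powr (ps - p)*abs (u x) powr p)" using u by auto
    show "(%x. abs (v k x) powr ps) : Bl" using vm by measurable
    show "AE x in leb. norm (abs (v k x) powr ps) <= norm (real k powr (ps - p)*abs (u x) powr p)"
    proof (rule AE_I2)
     fix x
     have "abs (v k x) powr ps = abs (v k x) powr (ps - p)*abs (v k x) powr p" by (simp add: powr_add[symmetric])
     also have "... <= real k powr (ps - p)*abs (u x) powr p" using ps_facts p0 by (intro mult_mono powr_mono2) (auto simp: v_def)
     finally show "norm (abs (v k x) powr ps) <= norm (real k powr (ps - p)*abs (u x) powr p)" by simp
    qed
   qed
  qed (rule vm)
  ultimately show ?thesis using vm by (simp add: DD_def)
 qed
 have Gv: "G (v k) <= G u" for k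
 proof (rule Lpi_mono[OF u(2)])
  show "dq s p (v k) : borel_measurable LL" using vm by measurable
  have "abs (v k x - v k y) <= abs (u x - u y)" for x y unfolding v_def by (auto simp: min_def)
  then show "AE z in LL. abs (dq s p (v k) z) <= abs (dq s p u z)" by (intro AE_I2) (simp add: dq_mono_abs)
 qed (use p0 in simp)
 have bd: "Il ps (v k) <= (Sob_C*G u) powr (ps/p)" for k
 proof -
  have "Il ps (v k) = (Nl ps (v k) powr p) powr (ps/p)" using Lpn_powr[of ps leb "v k"] ps_facts(3) p0 by (simp add: powr_powr)
  also have "... <= (Sob_C*G u) powr (ps/p)"
  proof (rule powr_mono2)
   have "Nl ps (v k) powr p <= Sob_C*G (v k)" by (rule Sobolev_DD[OF vD])
   also have "... <= Sob_C*G u" using Gv Sob_C_pos by (intro mult_left_mono) auto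
   finally show "Nl ps (v k) powr p <= Sob_C*G u" .
  qed (use ps_facts p0 in auto)
  finally show ?thesis .
 qed
 have "Ll ps (%x. abs (u x))"
 proof (rule Fatou_Lp(1)[OF DD_D(3)[OF vD] bd])
  show "AE x in leb. (%n. v n x) ---> abs (u x)"
  proof (rule AE_I2)
   fix x
   obtain n0 :: nat where n0: "abs (u x) <= real n0" using real_arch_simple by blast
   have "EV n. v n x = abs (u x)" using eventually_ge_at_top[of n0] by eventually_elim (use n0 in \<open>auto simp: v_def min_def\<close>)
   then show "(%n. v n x) ---> abs (u x)" by (rule tendsto_eventually)
  qed
 qed (use um ps_facts in auto)
 then have "Ll ps u" using um by (simp add: Lp_def)
 then show ?thesis using u um by (simp add: DD_def)
qed

lemma bump_DD:
 fixes x0 :: "real^'n"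
 assumes R: "R > 0"
 shows "(%x. max 0 (1 - norm (x - x0)/R)) : DD"
proof -
 define f where "f = (%x. max 0 (1 - norm (x - x0)/R))"
 have fm: "f : Bl" unfolding f_def by (intro measurable_borel_lebesgue) measurable
 have B: "ball x0 R : sets leb" "emeasure leb (ball x0 R) < \<infinity>" using R by (auto simp: emeasure_ball_N)
 have iB: "integrable leb (%x. ind (ball x0 R) x :: real)" using B by (auto simp: integrable_real_indicator)
 have f01: "0 <= f x" "f x <= 1" "x \<notin> ball x0 R ==> f x = 0" for x using R by (auto simp: f_def dist_norm norm_minus_commute)
 have fL: "abs (f x - f y) <= min 1 (norm (x - y)/R)" for x y
 proof -
  have "abs (f x - f y) <= abs (norm (x - x0)/R - norm (y - x0)/R)" unfolding f_def by (auto simp: max_def)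
  also have "... = abs (norm (x - x0) - norm (y - x0))/R" using R by (simp add: diff_divide_distrib[symmetric] abs_divide)
  also have "... <= norm (x - y)/R" using norm_triangle_ineq3[of "x - x0" "y - x0"] R by (intro divide_right_mono) auto
  finally show ?thesis using f01(1,2)[of x] f01(1,2)[of y] by auto
 qed
 have "Lp LL p (dq s p f)"
 proof (rule Lp_dq_weight(1)[OF R iB])
  fix x y
  show "abs (f x - f y) powr p <= (ind (ball x0 R) x + ind (ball x0 R) y)*min 1 (norm (x - y)/R) powr p"
  proof (cases "x : ball x0 R \<or> y : ball x0 R")
   case True
   have "abs (f x - f y) powr p <= 1*min 1 (norm (x - y)/R) powr p" using fL[of x y] p0 by (simp add: powr_mono2)
   also have "... <= (ind (ball x0 R) x + ind (ball x0 R) y)*min 1 (norm (x - y)/R) powr p"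
    using True by (intro mult_right_mono) (auto simp: indicator_def)
   finally show ?thesis .
  next
   case False
   then show ?thesis using f01(3)[of x] f01(3)[of y] by simp
  qed
 qed (use fm in auto)
 moreover have "Ll p f" by (rule Lp_bound[OF Lp_indicator(1)[OF B p0] fm, of 1]) (use f01 p0 in \<open>auto intro!: AE_I2 simp: indicator_def\<close>)
 ultimately show ?thesis using Sobolev_Lp unfolding f_def by blast
qed

definition Sob :: real where
 "Sob = Inf {G u | u. u : DD \<and> Il ps u = 1}"

lemma normalize_DD:
 assumes u: "u : DD" and L: "Il ps u > 0"
 defines "c \<equiv> 1/Nl ps u"
 shows "(%x. c*u x) : DD" "Il ps (%x. c*u x) = 1" "G (%x. c*u x) = G u/Nl ps u powr p"
  "c > 0"
proof -
 have Ln: "Nl ps u > 0" using L by (simp add: Lpn_def)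
 then show c: "c > 0" by (simp add: c_def)
 show "(%x. c*u x) : DD" using DD_lin[OF DD_zero u, of c] by simp
 show "Il ps (%x. c*u x) = 1" unfolding Lpi_cmult using Ln c Lpn_powr[of ps leb u] ps_facts(3) L by (simp add: c_def powr_divide)
 have eq: "dq s p (%x. c*u x) = (%z. c*dq s p u z)" by (rule ext) (rule dq_cmult)
 show "G (%x. c*u x) = G u/Nl ps u powr p" using Ln unfolding eq Lpi_cmult c_def[symmetric] by (simp add: c_def powr_divide)
qed

text \<open>The two facts that give the real infimum \<open>Sob\<close> its meaning; a normalised
  bump is the element of the set.\<close>

lemma Sob_set: "{G u | u. u : DD \<and> Il ps u = 1} \<noteq> {}"
  "bdd_below {G u | u. u : DD \<and> Il ps u = 1}"
proof -
 define f where "f = (%x::real^'n. max 0 (1 - norm (x - 0)/1))"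
 have f: "f : DD" unfolding f_def by (rule bump_DD) simp
 have "Il ps f \<noteq> 0"
 proof
  assume "Il ps f = 0"
  then have "AE x in leb. f x = 0" using Lpi_eq_0[OF DD_D(3)[OF f]] by simp
  then have "AE x::real^'n in leb. x \<notin> ball 0 1" by eventually_elim (auto simp: f_def)
  then have "emeasure leb (ball (0::real^'n) 1) = 0" by (subst (asm) AE_iff_measurable[where N = "ball 0 1"]) auto
  then show False using ubv by (simp add: emeasure_ball_N)
 qed
 then have "Il ps f > 0" using Lpi_nonneg[of leb ps f] by linarith
 from normalize_DD[OF f this] show "{G u | u. u : DD \<and> Il ps u = 1} \<noteq> {}" by blast
 show "bdd_below {G u | u. u : DD \<and> Il ps u = 1}" by (rule bdd_belowI[of _ 0]) auto
qed

lemma Sob_pos: "Sob > 0"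
proof -
 have "1/Sob_C <= Sob" unfolding Sob_def
 proof (rule cInf_greatest[OF Sob_set(1)])
  fix x assume "x : {G u | u. u : DD \<and> Il ps u = 1}"
  then obtain u where u: "x = G u" "u : DD" "Il ps u = 1" by blast
  then have "1 <= Sob_C*G u" using Sobolev_DD[OF u(2)] by (simp add: Lpn_def)
  then show "1/Sob_C <= x" using Sob_C_pos u by (simp add: field_simps)
 qed
 then show ?thesis using Sob_C_pos by (meson less_le_trans zero_less_divide_1_iff)
qed

lemma Sobolev:
 assumes u: "u : DD"
 shows "Sob*Nl ps u powr p <= G u"
proof (cases "Il ps u = 0")
 case True
 then show ?thesis by (simp add: Lpn_def)
next
 case False
 then have L: "Il ps u > 0" using Lpi_nonneg[of leb ps u] by linarith
 then have Ln: "Nl ps u > 0" by (simp add: Lpn_def)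
 note n = normalize_DD[OF u L]
 have "Sob <= G u/Nl ps u powr p" unfolding Sob_def using n by (intro cInf_lower[OF _ Sob_set(2)]) (auto intro!: exI)
 then show ?thesis using Ln by (simp add: field_simps)
qed

end

section \<open>Local compactness\<close>

text \<open>A half-open grid of cubes with side 1/(j+1). The cells of one grid are disjoint and
  countably many, which is what the diagonal argument for cell averages uses.\<close>

definition cell :: "nat => int^'n::finite => (real^'n) set" where
 "cell j k = {x. ALL i. \<lfloor>x $ i*real (Suc j)\<rfloor> = k $ i}"

definition cellof :: "nat => real^'n::finite => int^'n" where
 "cellof j x = (\<chi> i. \<lfloor>x $ i*real (Suc j)\<rfloor>)"

lemma mem_cell: "x : cell j k \<longleftrightarrow> cellof j x = k"
 by (auto simp: cell_def cellof_def vec_eq_iff)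

lemma cell_eq_prod:
 "cell j (k :: int^'n::finite) = {x. ALL i:Basis. (\<chi> i. real_of_int (k $ i)/real (Suc j)) \<bullet> i <= x \<bullet> i \<and> x \<bullet> i < (\<chi> i. (real_of_int (k $ i) + 1)/real (Suc j)) \<bullet> i}"
proof -
 have "\<lfloor>x $ i*real (Suc j)\<rfloor> = k $ i \<longleftrightarrow> real_of_int (k $ i)/real (Suc j) <= x $ i \<and> x $ i < (real_of_int (k $ i) + 1)/real (Suc j)" for x :: "real^'n" and i
  by (simp add: floor_eq_iff field_simps del: of_nat_Suc)
 then show ?thesis unfolding cell_def Basis_vec_def by (auto simp: inner_axis)
qed

lemma cell_borel [measurable]: "cell j (k :: int^'n::finite) : sets borel"
proof -
 have e: "cell j k = (\<Inter>i. {x. real_of_int (k $ i)/real (Suc j) <= x $ i} \<inter> {x. x $ i < (real_of_int (k $ i) + 1)/real (Suc j)})"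
  unfolding cell_def by (auto simp: floor_eq_iff field_simps simp del: of_nat_Suc)
 show ?thesis unfolding e
  by (intro sets.finite_INT sets.Int borel_closed borel_open) (auto intro!: closed_Collect_le open_Collect_less continuous_intros)
qed

lemma cell_leb: "cell j (k :: int^'n::finite) : sets leb"
 using cell_borel by auto

lemma emeasure_cell: "emeasure leb (cell j (k :: int^'n::finite)) = en (1/real (Suc j) ^ CARD('n))"
proof -
 define a where "a = (\<chi> i. real_of_int (k $ i)/real (Suc j))"
 define b where "b = (\<chi> i. (real_of_int (k $ i) + 1)/real (Suc j))"
 have ab: "a $ i <= b $ i" for i by (simp add: a_def b_def divide_right_mono)
 have ba: "b $ i - a $ i = 1/real (Suc j)" for i by (simp add: a_def b_def diff_divide_distrib[symmetric])
 have v: "emeasure lborel (cbox a b) = en (1/real (Suc j) ^ CARD('n))" "emeasure lborel (box a b) = en (1/real (Suc j) ^ CARD('n))"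
 proof -
  have le: "a \<bullet> i <= b \<bullet> i" if "i : Basis" for i using that ab by (auto simp: Basis_vec_def inner_axis)
  have "(\<Prod>i\<in>Basis. (b - a) \<bullet> i) = (\<Prod>i\<in>(Basis::(real^'n) set). 1/real (Suc j))"
   by (intro prod.cong refl) (auto simp: Basis_vec_def inner_axis ba simp del: of_nat_Suc)
  also have "... = 1/real (Suc j) ^ CARD('n)" by (simp add: power_divide del: of_nat_Suc)
  finally have pr: "(\<Prod>i\<in>Basis. (b - a) \<bullet> i) = 1/real (Suc j) ^ CARD('n)" .
  show "emeasure lborel (cbox a b) = en (1/real (Suc j) ^ CARD('n))" "emeasure lborel (box a b) = en (1/real (Suc j) ^ CARD('n))"
   using le by (auto simp: emeasure_lborel_cbox_eq emeasure_lborel_box_eq pr simp del: of_nat_Suc)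
 qed
 have 1: "box a b \<subseteq> cell j k" "cell j k \<subseteq> cbox a b"
  unfolding cell_eq_prod a_def[symmetric] b_def[symmetric] by (auto simp: box_def cbox_def less_imp_le)
 have "emeasure lborel (cell j k) = en (1/real (Suc j) ^ CARD('n))"
 proof (rule antisym)
  show "emeasure lborel (cell j k) <= en (1/real (Suc j) ^ CARD('n))" unfolding v(1)[symmetric] using 1 by (intro emeasure_mono) auto
  show "en (1/real (Suc j) ^ CARD('n)) <= emeasure lborel (cell j k)" unfolding v(2)[symmetric] using 1 cell_borel by (intro emeasure_mono) auto
 qed
 then show ?thesis by simp
qed

lemma cell_diam:
 fixes x y :: "real^'n::finite"
 assumes "cellof j x = cellof j y"
 shows "norm (x - y) <= real CARD('n)/real (Suc j)"
proof -
 have "abs ((x - y) $ i) <= 1/real (Suc j)" for i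
 proof -
  have "\<lfloor>x $ i*real (Suc j)\<rfloor> = \<lfloor>y $ i*real (Suc j)\<rfloor>" using assms by (metis cellof_def vec_lambda_beta)
  then have "abs (x $ i*real (Suc j) - y $ i*real (Suc j)) <= 1" by linarith
  then have "abs ((x - y) $ i)*real (Suc j) <= 1" by (simp add: left_diff_distrib[symmetric] abs_mult del: of_nat_Suc)
  then show ?thesis by (simp add: field_simps del: of_nat_Suc)
 qed
 then have "(\<Sum>i\<in>UNIV. abs ((x - y) $ i)) <= (\<Sum>i\<in>(UNIV::'n set). 1/real (Suc j))" by (intro sum_mono)
 then show ?thesis using norm_le_l1_cart[of "x - y"] by (simp del: of_nat_Suc)
qed

text \<open>Choose indices along which the L^1 distance of neighbours on \<open>B j\<close> is at
  most 2^(-j). The differences are then absolutely summable almost everywhere on each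
  \<open>B k\<close>.\<close>

lemma AE_convergent_subseq:
 fixes u :: "nat => 'a => real" and B :: "nat => 'a set"
 assumes u: "!!n. u n : borel_measurable M" and B: "!!k. B k : sets M" "incseq B" "(\<Union>k. B k) = space M"
  and cau: "!!k e. e > 0 ==> EX m. ALL n>=m. ALL n'>=m. (\<integral>\<^sup>+x. en (abs (u n x - u n' x))*ind (B k) x \<partial>M) <= en e"
 shows "EX r w. strict_mono r \<and> w : borel_measurable M \<and> (AE x in M. (%n. u (r n) x) ---> w x)"
proof -
 define P where "P = (%j m. ALL n>=m. ALL n'>=m. (\<integral>\<^sup>+x. en (abs (u n x - u n' x))*ind (B j) x \<partial>M) <= en ((1/2)^j))"
 have exP: "EX m. P j m" for j unfolding P_def using cau[of "(1/2)^j" j] by simp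
 define m where "m = (%j. SOME m. P j m)"
 have Pm: "P j (m j)" for j unfolding m_def by (rule someI_ex[OF exP])
 \<comment> \<open>Adding up all earlier thresholds makes r strictly increasing and at least
   \<open>m j\<close>.\<close>
 define r where "r = (%j. j + (\<Sum>i\<le>j. m i))"
 have r: "strict_mono r" unfolding r_def strict_mono_Suc_iff by simp
 have rm: "m j <= r j" for j unfolding r_def by (simp add: member_le_sum trans_le_add2)
 have rj: "(\<integral>\<^sup>+x. en (abs (u (r (Suc j)) x - u (r j) x))*ind (B j) x \<partial>M) <= en ((1/2)^j)" for j
 proof -
  have "m j <= r (Suc j)" using rm[of j] strict_mono_less_eq[OF r, of j "Suc j"] by simp
  then show ?thesis using Pm[of j] rm[of j] unfolding P_def by blast
 qed
 have conv: "AE x in M. x : B k --> convergent (%j. u (r j) x)" for k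
 proof -
  define f where "f = (%j x. en (abs (u (r (Suc (j + k))) x - u (r (j + k)) x))*ind (B k) x)"
  have fm: "f j : borel_measurable M" for j unfolding f_def using u B(1) by measurable
  have fj: "(\<integral>\<^sup>+x. f j x \<partial>M) <= en ((1/2)^j)" for j
  proof -
   have "B k \<subseteq> B (j + k)" using B(2) by (simp add: incseq_def)
   then have "(\<integral>\<^sup>+x. f j x \<partial>M) <= (\<integral>\<^sup>+x. en (abs (u (r (Suc (j + k))) x - u (r (j + k)) x))*ind (B (j + k)) x \<partial>M)"
    unfolding f_def by (intro nn_integral_mono mult_left_mono) (auto simp: indicator_def)
   also have "... <= en ((1/2)^(j + k))" by (rule rj)
   also have "... <= en ((1/2)^j)" by (intro ennreal_leI power_decreasing) auto
   finally show ?thesis .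
  qed
  have "(\<integral>\<^sup>+x. (\<Sum>j. f j x) \<partial>M) = (\<Sum>j. (\<integral>\<^sup>+x. f j x \<partial>M))"
   by (rule nn_integral_suminf[OF fm])
  also have "... <= (\<Sum>j. en ((1/2)^j))" by (intro suminf_le fj) auto
  also have "... = en (1/(1 - 1/2))" by (intro suminf_ennreal_eq geometric_sums) auto
  also have "... < \<infinity>" by simp
  finally have "(\<integral>\<^sup>+x. (\<Sum>j. f j x) \<partial>M) \<noteq> \<infinity>" by simp
  then have "AE x in M. (\<Sum>j. f j x) \<noteq> \<infinity>"
   by (rule nn_integral_noteq_infinite[rotated]) (use fm in \<open>auto intro: borel_measurable_suminf_order\<close>)
  then show ?thesis
  proof eventually_elim
   case (elim x)
   show ?case
   proof
    assume x: "x : B k"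
    define d where "d = (%j. u (r (Suc (j + k))) x - u (r (j + k)) x)"
    have "(\<Sum>j. en (abs (d j))) \<noteq> top" using elim x by (simp add: f_def d_def)
    then have "summable (%j. abs (d j))" by (intro summable_suminf_not_top) auto
    then have "summable d" by (rule summable_rabs_cancel)
    then have "convergent (%n. \<Sum>j<n. d j)" by (simp add: summable_iff_convergent)
    moreover have "(\<Sum>j<n. d j) = u (r (n + k)) x - u (r k) x" for n
     unfolding d_def using sum_lessThan_telescope[of "%j. u (r (j + k)) x" n] by simp
    ultimately have "convergent (%n. u (r (n + k)) x - u (r k) x)" by simp
    then have "convergent (%n. (u (r (n + k)) x - u (r k) x) + u (r k) x)" by (intro convergent_add convergent_const)
    then show "convergent (%j. u (r j) x)" using convergent_ignore_initial_segment[of "%j. u (r j) x" k] by simp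
   qed
  qed
 qed
 then have "AE x in M. ALL k. x : B k --> convergent (%j. u (r j) x)" by (intro iffD2[OF AE_all_countable] allI)
 then have ae: "AE x in M. (%j. u (r j) x) ---> lim (%j. u (r j) x)" using AE_space
 proof eventually_elim
  case (elim x)
  then obtain k where "x : B k" using B(3) by auto
  then show ?case using elim(1) by (auto simp: convergent_LIMSEQ_iff)
 qed
 have "(%x. lim (%j. u (r j) x)) : borel_measurable M" using u by (intro borel_measurable_lim_metric)
 then show ?thesis using r ae by blast
qed

lemma common_convergent_subseq:
 fixes a :: "nat => nat => real"
 assumes "!!i. bounded (range (a i))"
 shows "EX r. strict_mono r \<and> (ALL i. convergent (%n. a i (r n)))"
proof -
 interpret subseqs "%i r. convergent (%n. a i (r n))"
 proof
  fix i and r :: "nat => nat" assume "strict_mono r"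
  have "bounded (range (%n. a i (r n)))" using assms[of i] by (rule bounded_subset) auto
  then obtain l r' where "strict_mono r'" "((%n. a i (r n)) \<circ> r') ---> l" using bounded_imp_convergent_subsequence by blast
  then show "EX r'. strict_mono r' \<and> convergent (%n. a i ((r \<circ> r') n))" by (intro exI[of _ r']) (auto simp: o_def convergent_def)
 qed
 have "convergent (%n. a i (diagseq n))" for i
 proof -
  have "convergent (%n. a i ((diagseq \<circ> (+) (Suc i)) n))"
  proof (rule diagseq_holds)
   fix r q :: "nat => nat" and n assume "strict_mono r" "convergent (%k. a n (q k))"
   then show "convergent (%k. a n ((q \<circ> r) k))" using convergent_subseq_convergent[of "%k. a n (q k)" r] by (simp add: o_def)
  qed
  then have "convergent (%n. a i (diagseq (n + Suc i)))" by (simp add: o_def add.commute)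
  then show ?thesis using convergent_ignore_initial_segment[of "%n. a i (diagseq n)" "Suc i"] by simp
 qed
 then show ?thesis using subseq_diagseq by blast
qed

context frac
begin

text \<open>Inside a cell |x-y| <= N/(j+1), so the kernel is bounded below there and the energy
  controls the oscillation with the factor (j+1)^(-s p). \<open>le_eps_powr\<close> trades the first
  power for the p-th at the price e.\<close>

lemma cell_average_error:
 fixes u :: "real^'n => real"
 assumes u: "u : Bl" and e: "e > 0" and B: "B : sets leb"
 shows "(NI x. (NI y. en (real (Suc j) ^ CARD('n))*en (abs (u x - u y))*ind (cell j (cellof j x)) y)*ind B x)
  <= en e*emeasure leb B +
   en (e powr (1 - p)*N powr (N + s*p)*real (Suc j) powr (- (s*p)))*(\<integral>\<^sup>+z. en (abs (dq s p u z) powr p) \<partial>LL)"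
proof -
 define h where "h = real (Suc j)"
 have h: "h > 0" by (simp add: h_def)
 define c where "c = e powr (1 - p)*N powr (N + s*p)*h powr (- (s*p))"
 have c: "c >= 0" by (simp add: c_def)
 have hN: "h ^ CARD('n) = h powr N" using h by (simp add: N_def powr_realpow)
 have pt: "en (h ^ CARD('n))*en (abs (u x - u y))*ind (cell j (cellof j x)) y
  <= en (h ^ CARD('n)*e)*ind (cell j (cellof j x)) y + en c*en (abs (dq s p u (x, y)) powr p)" for x y
 proof (cases "y : cell j (cellof j x)")
  case True
  define t where "t = abs (u x - u y)"
  have t: "t >= 0" by (simp add: t_def)
  have d: "norm (x - y) <= N/h" using cell_diam[of j x y] True by (simp add: mem_cell h_def N_def)
  have tp: "t powr p <= (N/h) powr (N + s*p)*abs (dq s p u (x, y)) powr p"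
  proof (cases "x = y")
   case False
   then have "norm (x - y) powr (N + s*p) <= (N/h) powr (N + s*p)" using d sp0 N1 by (intro powr_mono2) auto
   then have "t powr p*norm (x - y) powr (N + s*p) <= t powr p*(N/h) powr (N + s*p)" by (intro mult_left_mono) auto
   then show ?thesis using False unfolding dq_powr_N[OF p0] by (simp add: t_def field_simps)
  qed (simp add: t_def)
  have "t <= e + e powr (1 - p)*t powr p" using t e p1 by (intro le_eps_powr) auto
  also have "... <= e + e powr (1 - p)*((N/h) powr (N + s*p)*abs (dq s p u (x, y)) powr p)" using tp by (intro add_left_mono mult_left_mono) auto
  finally have "h powr N*t <= h powr N*(e + e powr (1 - p)*((N/h) powr (N + s*p)*abs (dq s p u (x, y)) powr p))" by (intro mult_left_mono) auto
  also have "... = h powr N*e + c*abs (dq s p u (x, y)) powr p"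
  proof -
   have "h powr N*(N/h) powr (N + s*p) = N powr (N + s*p)*h powr (- (s*p))" using h by (simp add: powr_divide powr_add powr_minus field_simps)
   then show ?thesis by (simp add: c_def distrib_left mult_ac)
  qed
  finally have "en (h ^ CARD('n)*t) <= en (h ^ CARD('n)*e + c*abs (dq s p u (x, y)) powr p)" unfolding hN by (rule ennreal_leI)
  then show ?thesis using True h e c t unfolding t_def[symmetric] by (simp add: ennreal_mult[symmetric])
 qed simp
 have mq: "(%z. en (abs (dq s p u z) powr p)) : borel_measurable LL" using u by measurable
 have mq1: "(%y. en (abs (dq s p u (x, y)) powr p)) : Bl" for x using measurable_compose[OF measurable_Pair1' mq, of x] by simp
 have mi: "(%x. (NI y. en (abs (dq s p u (x, y)) powr p))) : Bl" using mq by measurable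
 have inner: "(NI y. en (h ^ CARD('n))*en (abs (u x - u y))*ind (cell j (cellof j x)) y)
  <= en e + en c*(NI y. en (abs (dq s p u (x, y)) powr p))" for x
 proof -
  have "(NI y. en (h ^ CARD('n))*en (abs (u x - u y))*ind (cell j (cellof j x)) y)
   <= (NI y. en (h ^ CARD('n)*e)*ind (cell j (cellof j x)) y + en c*en (abs (dq s p u (x, y)) powr p))" by (intro nn_integral_mono pt)
  also have "... = en (h ^ CARD('n)*e)*emeasure leb (cell j (cellof j x)) + en c*(NI y. en (abs (dq s p u (x, y)) powr p))"
   using cell_leb[of j "cellof j x"] mq1[of x]
   by (subst nn_integral_add) (auto simp: nn_integral_cmult_indicator nn_integral_cmult intro!: borel_measurable_times_ennreal borel_measurable_indicator)
  also have "en (h ^ CARD('n)*e)*emeasure leb (cell j (cellof j x)) = en e"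
   unfolding emeasure_cell h_def[symmetric] using h e by (simp add: ennreal_mult[symmetric])
  finally show ?thesis .
 qed
 have "(NI x. (NI y. en (h ^ CARD('n))*en (abs (u x - u y))*ind (cell j (cellof j x)) y)*ind B x)
  <= (NI x. en e*ind B x + en c*(NI y. en (abs (dq s p u (x, y)) powr p)))" using inner by (intro nn_integral_mono) (auto simp: indicator_def)
 also have "... = en e*emeasure leb B + en c*(NI x. (NI y. en (abs (dq s p u (x, y)) powr p)))"
  using mi B by (subst nn_integral_add) (auto simp: nn_integral_cmult_indicator nn_integral_cmult intro!: borel_measurable_times_ennreal borel_measurable_indicator)
 also have "(NI x. (NI y. en (abs (dq s p u (x, y)) powr p))) = (\<integral>\<^sup>+z. en (abs (dq s p u z) powr p) \<partial>LL)"
  by (rule nn_integral_LL[OF mq, symmetric])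
 finally show ?thesis unfolding c_def h_def .
qed

lemma measurable_cellof: "cellof j : (leb :: (real^'n) measure) \<rightarrow>\<^sub>M count_space UNIV"
proof (subst measurable_count_space_eq_countable)
 show "cellof j : space (leb :: (real^'n) measure) \<rightarrow> UNIV \<and> (ALL a:UNIV. cellof j -` {a} \<inter> space (leb :: (real^'n) measure) : sets leb)"
 proof (intro conjI ballI)
  fix a :: "int^'n"
  have "cellof j -` {a} \<inter> space leb = cell j a" by (auto simp: mem_cell)
  then show "cellof j -` {a} \<inter> space (leb :: (real^'n) measure) : sets leb" using cell_leb by simp
 qed simp
qed simp

text \<open>A Kolmogorov-Riesz argument. The integrals over the countably many cells are bounded
  numbers, so a diagonal subsequence makes all cell means converge; on a fine grid the functions are
  close to their cell means uniformly in n. Hence the sequence is Cauchy in L^1 on balls.\<close>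

lemma compactness:
 fixes u :: "nat => real^'n => real"
 assumes u: "!!n. u n : DD" and C: "!!n. G (u n) <= C" "!!n. Il ps (u n) <= C"
 shows "EX r w. strict_mono r \<and> w : Bl \<and> (AE x in leb. (%n. u (r n) x) ---> w x)"
proof -
 have C0: "C >= 0" using C(1)[of 0] Lpi_nonneg[of LL p "dq s p (u 0)"] by linarith
 define A where "A = (%n (jk :: nat \<times> (int^'n)). (LI x. ind (cell (fst jk) (snd jk)) x*u n x))"
 have mc: "measure leb (cell j k) <= 1" "emeasure leb (cell j k) < \<infinity>" for j and k :: "int^'n"
  unfolding measure_def emeasure_cell by (auto simp: divide_le_eq_1 simp del: of_nat_Suc)
 have ic: "integrable leb (%x. ind (cell j k) x :: real)" for j and k :: "int^'n" using cell_leb mc by (auto simp: integrable_real_indicator)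
 have pw_le: "abs (ind (cell j k) x*u n x) <= ind (cell j k) x + abs (u n x) powr ps" for j and k :: "int^'n" and n x
 proof (cases "abs (u n x) <= 1")
  case True
  have "0 <= abs (u n x) powr ps" by simp
  then show ?thesis using True by (cases "x : cell j k") (auto simp del: powr_ge_zero)
 next
  case False
  then have "abs (u n x) powr 1 <= abs (u n x) powr ps" using ps_facts by (intro powr_mono) auto
  then show ?thesis using False by (auto simp: indicator_def)
 qed
 have ub: "integrable leb (%x. abs (u n x) powr ps)" for n using u by auto
 have iu: "integrable leb (%x. ind (cell j k) x*u n x)" for j and k :: "int^'n" and n
 proof (rule Bochner_Integration.integrable_bound)
  show "integrable leb (%x. ind (cell j k) x + abs (u n x) powr ps)" using ic ub by auto
  show "(%x. ind (cell j k) x*u n x) : Bl" using DD_D(1)[OF u[of n]] cell_leb by (intro borel_measurable_times borel_measurable_indicator) auto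
  show "AE x in leb. norm (ind (cell j k) x*u n x) <= norm (ind (cell j k) x + abs (u n x) powr ps)"
   using pw_le by (intro AE_I2) (simp add: order_trans[OF _ abs_ge_self])
 qed
 have Ab: "abs (A n jk) <= 1 + C" for n jk
 proof -
  obtain j k where jk: "jk = (j, k)" by fastforce
  have "abs (A n jk) <= (LI x. abs (ind (cell j k) x*u n x))" unfolding A_def jk by (simp add: integral_abs_bound)
  also have "... <= (LI x. ind (cell j k) x + abs (u n x) powr ps)" using iu ic ub pw_le by (intro integral_mono) auto
  also have "... = measure leb (cell j k) + Il ps (u n)" using ic ub by (simp add: Lpi_def)
  finally show ?thesis using mc(1)[of j k] C(2)[of n] by linarith
 qed
 obtain r0 where r0: "strict_mono r0" "!!i. convergent (%n. A (r0 n) (from_nat i))"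
 proof -
  have "bounded (range (%n. A n (from_nat i)))" for i
  proof (rule boundedI[of _ "1 + C"])
   fix y assume "y : range (%n. A n (from_nat i))"
   then obtain n where "y = A n (from_nat i)" by blast
   then show "norm y <= 1 + C" using Ab[of n "from_nat i"] by (simp only: real_norm_def)
  qed
  then show ?thesis using common_convergent_subseq[of "%i n. A n (from_nat i)"] that by blast
 qed
 have conv: "convergent (%n. A (r0 n) jk)" for jk using r0(2)[of "to_nat jk"] by simp
 define v where "v = (%n. u (r0 n))"
 have vD: "v n : DD" "G (v n) <= C" for n using u C by (auto simp: v_def)
 have vm: "v n : Bl" for n using vD(1)[of n] by auto
 define h where "h = (%j. real (Suc j) ^ CARD('n))"
 have h0: "h j > 0" for j by (simp add: h_def)
 \<comment> \<open>The mean of \<open>v n\<close> over the cell of x, since \<open>h j\<close> is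
   the reciprocal of the cell volume.\<close>
 define E where "E = (%j n x. h j*A (r0 n) (j, cellof j x))"
 have Em: "E j n : Bl" for j n unfolding E_def by (rule measurable_compose_countable[OF _ measurable_cellof]) simp
 define L where "L = (%j x. lim (%n. E j n x))"
 have Lm: "L j : Bl" for j unfolding L_def using Em by (intro borel_measurable_lim_metric)
 have EL: "(%n. E j n x) ---> L j x" for j x unfolding L_def convergent_LIMSEQ_iff[symmetric] E_def by (intro convergent_mult convergent_const conv)
 have Eb: "abs (E j n x) <= h j*(1 + C)" for j n x unfolding E_def abs_mult using Ab h0[of j] by (simp add: mult_left_mono)
 have Lb: "abs (L j x) <= h j*(1 + C)" for j x by (rule LIMSEQ_le_const2[OF tendsto_rabs[OF EL]]) (use Eb in auto)
 have err: "en (abs (v n x - E j n x)) <= (NI y. en (real (Suc j) ^ CARD('n))*en (abs (v n x - v n y))*ind (cell j (cellof j x)) y)" for n j x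
 proof -
  let ?I = "%y. ind (cell j (cellof j x)) y :: real"
  have 1: "integrable leb (%y. h j*(?I y*(v n x - v n y)))"
   using ic[of j "cellof j x"] iu[of j "cellof j x" "r0 n"] unfolding v_def by (simp add: right_diff_distrib)
  have "(LI y. h j*(?I y*(v n x - v n y))) = (LI y. h j*(v n x * ?I y - ?I y * v n y))" by (simp add: algebra_simps)
  also have "... = h j*(v n x*measure leb (cell j (cellof j x)) - (LI y. ?I y * v n y))"
   using ic[of j "cellof j x"] iu[of j "cellof j x" "r0 n"] unfolding v_def by simp
  also have "measure leb (cell j (cellof j x)) = 1/h j" unfolding measure_def emeasure_cell h_def by simp
  also have "h j*(v n x*(1/h j) - (LI y. ?I y * v n y)) = v n x - E j n x" using h0[of j] by (simp add: E_def A_def v_def right_diff_distrib)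
  finally have eq: "abs (v n x - E j n x) = abs (\<integral>y. h j*(?I y*(v n x - v n y)) \<partial>leb)" by simp
  have "en (abs (v n x - E j n x)) <= en (LI y. abs (h j*(?I y*(v n x - v n y))))" unfolding eq by (intro ennreal_leI integral_abs_bound)
  also have "... = (NI y. en (abs (h j*(?I y*(v n x - v n y)))))" using 1 by (intro nn_integral_eq_integral[symmetric]) auto
  also have "... = (NI y. en (real (Suc j) ^ CARD('n))*en (abs (v n x - v n y))*ind (cell j (cellof j x)) y)"
   using h0[of j] by (intro nn_integral_cong) (auto simp: indicator_def h_def abs_mult ennreal_mult simp del: of_nat_Suc)
  finally show ?thesis .
 qed
 define B where "B = (%k::nat. ball (0::real^'n) (real k))"
 have B: "B k : sets leb" "emeasure leb (B k) < \<infinity>" for k by (auto simp: B_def emeasure_ball_N)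
 have Bm: "(%x. f x*ind (B k) x) : Bl" if "f : Bl" for f :: "real^'n => ennreal" and k
  using that B by (intro borel_measurable_times_ennreal borel_measurable_indicator) auto
 have second: "(%n. (NI x. en (abs (E j n x - L j x))*ind (B k) x)) ---> 0" for j k
 proof -
  have "(%n. (NI x. en (abs (E j n x - L j x))*ind (B k) x)) ---> (\<integral>\<^sup>+x. 0 \<partial>(leb :: (real^'n) measure))"
  proof (rule nn_integral_dominated_convergence[where w = "%x. en (2*(h j*(1 + C)))*ind (B k) x"])
   show "(%x. en (abs (E j n x - L j x))*ind (B k) x) : Bl" for n
    by (intro Bm measurable_compose[OF borel_measurable_abs[OF borel_measurable_diff[OF Em Lm]] measurable_ennreal])
   show "(%x. en (2*(h j*(1 + C)))*ind (B k) x) : Bl" by (intro Bm) simp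
   show "(NI x. en (2*(h j*(1 + C)))*ind (B k) x) < \<infinity>" using B by (simp add: nn_integral_cmult_indicator ennreal_mult_less_top)
   show "AE x in leb. en (abs (E j n x - L j x))*ind (B k) x <= en (2*(h j*(1 + C)))*ind (B k) x" for n
   proof (rule AE_I2)
    fix x
    have "abs (E j n x - L j x) <= 2*(h j*(1 + C))" using Eb[of j n x] Lb[of j x] by linarith
    then show "en (abs (E j n x - L j x))*ind (B k) x <= en (2*(h j*(1 + C)))*ind (B k) x" by (intro mult_right_mono ennreal_leI) auto
   qed
   show "AE x in leb. (%n. en (abs (E j n x - L j x))*ind (B k) x) ---> 0"
   proof (rule AE_I2)
    fix x
    have "(%n. abs (E j n x - L j x)) ---> abs (L j x - L j x)" by (intro tendsto_intros EL)
    then have "(%n. en (abs (E j n x - L j x))) ---> en 0" by (intro tendsto_ennrealI) simp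
    then show "(%n. en (abs (E j n x - L j x))*ind (B k) x) ---> 0" by (cases "x : B k") auto
   qed
  qed simp
  then show ?thesis by simp
 qed
 have cau: "EX m. ALL n>=m. ALL n'>=m. (NI x. en (abs (v n x - v n' x))*ind (B k) x) <= en e" if e: "e > 0" for k e
 proof -
  obtain \<beta> where \<beta>: "emeasure leb (B k) = en \<beta>" "\<beta> >= 0" using B(2)[of k] by (cases "emeasure leb (B k)") auto
  define e1 where "e1 = e/(8*(\<beta> + 1))"
  have e1: "e1 > 0" "e1*\<beta> <= e/8"
  proof -
   show "e1 > 0" using e \<beta> by (simp add: e1_def)
   have "e1*\<beta> <= e1*(\<beta> + 1)" using \<open>e1 > 0\<close> by simp
   also have "... = e/8"
   proof -
    define y where "y = \<beta> + 1"
    have "y \<noteq> 0" using \<beta>(2) by (simp add: y_def)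
    then show ?thesis unfolding e1_def y_def[symmetric] by simp
   qed
   finally show "e1*\<beta> <= e/8" .
  qed
  define c where "c = e1 powr (1 - p)*N powr (N + s*p)"
  have "((%j. c*real (Suc j) powr (- (s*p))*C) \<longlongrightarrow> c*0*C) sequentially"
  proof (intro tendsto_intros)
   show "(%j. real (Suc j) powr (- (s*p))) ---> 0"
    using sp0 by (intro tendsto_neg_powr filterlim_compose[OF filterlim_real_sequentially filterlim_Suc]) auto
  qed
  then have "\<forall>\<^sub>F j in sequentially. c*real (Suc j) powr (- (s*p))*C < e/8" using e by (intro order_tendstoD(2)) auto
  then obtain j where j: "c*real (Suc j) powr (- (s*p))*C < e/8" by (auto simp: eventually_sequentially)
  have first: "(NI x. en (abs (v n x - E j n x))*ind (B k) x) <= en (e/4)" for n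
  proof -
   have "(NI x. en (abs (v n x - E j n x))*ind (B k) x) <=
    (NI x. (NI y. en (real (Suc j) ^ CARD('n))*en (abs (v n x - v n y))*ind (cell j (cellof j x)) y)*ind (B k) x)"
    by (intro nn_integral_mono mult_right_mono err) auto
   also have "... <= en e1*emeasure leb (B k) + en (e1 powr (1 - p)*N powr (N + s*p)*real (Suc j) powr (- (s*p)))*(\<integral>\<^sup>+z. en (abs (dq s p (v n) z) powr p) \<partial>LL)"
    by (rule cell_average_error[OF vm e1(1) B(1)])
   also have "... = en (e1*\<beta> + c*real (Suc j) powr (- (s*p))*G (v n))"
    using e1 \<beta> Lpi_nn[OF DD_D(2)[OF vD(1)[of n]]] unfolding c_def by (simp add: ennreal_mult)
   also have "... <= en (e1*\<beta> + c*real (Suc j) powr (- (s*p))*C)"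
    using vD(2)[of n] by (intro ennreal_leI add_left_mono mult_left_mono) (auto simp: c_def)
   also have "... <= en (e/4)" using e1 j by (intro ennreal_leI) linarith
   finally show ?thesis .
  qed
  have "EV n. (NI x. en (abs (E j n x - L j x))*ind (B k) x) < en (e/4)" using e by (intro order_tendstoD(2)[OF second]) auto
  then obtain m where m: "!!n. n >= m ==> (NI x. en (abs (E j n x - L j x))*ind (B k) x) < en (e/4)" by (auto simp: eventually_sequentially)
  show ?thesis
  proof (intro exI[of _ m] allI impI)
   fix n n' assume n: "n >= m" "n' >= m"
   define a where "a = (%n x. en (abs (v n x - E j n x))*ind (B k) x)"
   define b where "b = (%n x. en (abs (E j n x - L j x))*ind (B k) x)"
   have abm: "a n : Bl" "b n : Bl" for n unfolding a_def b_def using vm Em Lm by (auto intro!: Bm)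
   have "(NI x. en (abs (v n x - v n' x))*ind (B k) x) <= (NI x. a n x + b n x + (a n' x + b n' x))"
   proof (rule nn_integral_mono)
    fix x
    have "en (abs (v n x - v n' x)) <= en (abs (v n x - E j n x) + abs (E j n x - L j x) + (abs (v n' x - E j n' x) + abs (E j n' x - L j x)))"
     by (intro ennreal_leI) linarith
    then show "en (abs (v n x - v n' x))*ind (B k) x <= a n x + b n x + (a n' x + b n' x)" by (auto simp: a_def b_def indicator_def ennreal_plus)
   qed
   also have "... = (NI x. a n x) + (NI x. b n x) + ((NI x. a n' x) + (NI x. b n' x))" using abm by (simp add: nn_integral_add)
   also have "... <= en (e/4) + en (e/4) + (en (e/4) + en (e/4))" unfolding a_def b_def by (intro add_mono first less_imp_le[OF m] n)
   also have "... = en e" using e by (simp add: ennreal_plus[symmetric] del: ennreal_plus)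
   finally show "(NI x. en (abs (v n x - v n' x))*ind (B k) x) <= en e" .
  qed
 qed
 have incB: "incseq B" unfolding B_def incseq_def by auto
 have unB: "(\<Union>k. B k) = space leb"
 proof -
  have "EX k. x : B k" for x using reals_Archimedean2[of "norm x"] by (auto simp: B_def)
  then show ?thesis by auto
 qed
 have "EX r w. strict_mono r \<and> w : Bl \<and> (AE x in leb. (%n. v (r n) x) ---> w x)"
  by (rule AE_convergent_subseq[OF vm B(1) incB unB]) (rule cau)
 then obtain r w where "strict_mono r" "w : Bl" "AE x in leb. (%n. v (r n) x) ---> w x" by blast
 then show ?thesis using r0(1) by (intro exI[of _ "r0 \<circ> r"] exI[of _ w]) (auto simp: v_def intro: strict_mono_o)
qed

end

section \<open>Extremals of the Sobolev inequality\<close>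

lemma T_has_derivative:
 assumes r: "r > 1" and f: "Lp M r f" and h: "Lp M r h"
 shows "((%t. T M r cp cm (%x. f x + t*h x)) has_real_derivative r*DT M r cp cm f h) (at 0)"
proof -
 define Q where "Q = (%t. (T M r cp cm (%x. f x + t*h x) - T M r cp cm f)/t - r*DT M r cp cm f h)"
 have "(Q \<longlongrightarrow> 0) (at 0)"
 proof (rule tendstoI)
  fix e :: real assume e: "e > 0"
  define A where "A = Lpn M r f powr (r - 1)*Lpn M r h"
  have A: "A >= 0" by (simp add: A_def)
  define e1 where "e1 = e/(2*(A + 1))"
  have e1: "e1 > 0" using e A by (simp add: e1_def)
  have e1A: "e1*A < e"
  proof -
   have "e1*A <= e1*(A + 1)" using e1 by simp
   also have "... = e/2"
   proof -
    define y where "y = A + 1"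
    have "y \<noteq> 0" using A by (simp add: y_def)
    then show ?thesis unfolding e1_def y_def[symmetric] by simp
   qed
   finally show ?thesis using e by simp
  qed
  obtain C where C: "C > 0" "!!f h. Lp M r f ==> Lp M r h ==>
   abs (T M r cp cm (%x. f x + h x) - T M r cp cm f - r*DT M r cp cm f h)
   <= e1*(Lpn M r f powr (r - 1)*Lpn M r h) + C*Lpi M r h" using T_taylor_bound[OF r e1, of M cp cm] by blast
  have bound: "abs (Q t) <= e1*A + C*Lpi M r h*abs t powr (r - 1)" if t: "t \<noteq> 0" for t
  proof -
   have th: "Lp M r (%x. t*h x)" using h r by auto
   have "DT M r cp cm f (%x. t*h x) = t*DT M r cp cm f h" using DT_lin[OF f Lp_zero h r, of cp cm t] by (simp add: DT_def)
   then have "abs (T M r cp cm (%x. f x + t*h x) - T M r cp cm f - r*(t*DT M r cp cm f h))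
    <= e1*(abs t*A) + C*(abs t powr r*Lpi M r h)" using C(2)[OF f th] r by (simp add: Lpn_cmult Lpi_cmult A_def mult_ac)
   also have "... = abs t*(e1*A + C*Lpi M r h*abs t powr (r - 1))" using powr_mult_base[of "abs t" "r - 1"] by (simp add: algebra_simps)
   finally have *: "abs (T M r cp cm (%x. f x + t*h x) - T M r cp cm f - r*(t*DT M r cp cm f h))
    <= abs t*(e1*A + C*Lpi M r h*abs t powr (r - 1))" .
   have "t*Q t = T M r cp cm (%x. f x + t*h x) - T M r cp cm f - r*(t*DT M r cp cm f h)" using t unfolding Q_def right_diff_distrib by simp
   with*have "abs (t*Q t) <= abs t*(e1*A + C*Lpi M r h*abs t powr (r - 1))" by simp
   then show ?thesis using t by (simp add: abs_mult)
  qed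
  have "((%t. e1*A + C*Lpi M r h*abs t powr (r - 1)) \<longlongrightarrow> e1*A + C*Lpi M r h*0) (at (0::real))"
   using r by (intro tendsto_intros) (auto intro!: tendsto_eq_intros)
  then have "\<forall>\<^sub>F t in at 0. e1*A + C*Lpi M r h*abs t powr (r - 1) < e" using e1A by (intro order_tendstoD(2)) auto
  moreover have "\<forall>\<^sub>F t in at (0::real). t \<noteq> 0" by (simp add: eventually_at_filter)
  ultimately show "\<forall>\<^sub>F t in at 0. dist (Q t) 0 < e"
  proof eventually_elim
   case (elim t)
   then show ?case using bound[of t] by simp
  qed
 qed
 then have "((%t. Q t + r*DT M r cp cm f h) \<longlongrightarrow> 0 + r*DT M r cp cm f h) (at 0)" by (intro tendsto_intros)
 then show ?thesis by (simp add: DERIV_def Q_def)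
qed

text \<open>Scaled to x = B/A with 0 < x <= 1, the upper bound is x <= x^k and the lower one the
  weighted mean inequality x^k <= k x + 1 - k.\<close>

lemma powr_concave_bounds:
 fixes A B k :: real
 assumes "0 < k" "k < 1" "B > 0" "A >= B"
 shows "A powr k - B powr k <= A powr (k - 1)*(A - B)"
  and "k*(A powr (k - 1)*(A - B)) <= A powr k - B powr k"
proof -
 have A: "A > 0" using assms by simp
 define x where "x = B/A"
 have x: "0 < x" "x <= 1" using assms A by (auto simp: x_def)
 have B: "B = x*A" using A by (simp add: x_def)
 have Ak: "A powr k = A powr (k - 1)*A" using A powr_add[of A "k - 1" 1] by simp
 have "x powr 1 <= x powr k" using x assms by (intro powr_mono') auto
 then have 1: "1 - x powr k <= 1 - x" using x by simp
 have "x powr k*1 powr (1 - k) <= k*x + (1 - k)*1" using x assms by (intro Youngs_inequality_0) auto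
 then have 2: "k*(1 - x) <= 1 - x powr k" by (simp add: algebra_simps)
 have e: "A powr k - B powr k = A powr k*(1 - x powr k)" "A powr (k - 1)*(A - B) = A powr k*(1 - x)"
  unfolding B powr_mult Ak by (simp_all add: algebra_simps)
 show "A powr k - B powr k <= A powr (k - 1)*(A - B)" unfolding e using 1 by (intro mult_left_mono) auto
 show "k*(A powr (k - 1)*(A - B)) <= A powr k - B powr k" unfolding e using mult_left_mono[OF 2, of "A powr k"] by (simp add: mult_ac)
qed

lemma Hoelder_powers:
 assumes a: "Lp M m a" and b: "Lp M m b" and pm: "0 < p" "p < m"
 shows "integrable M (%x. abs (a x) powr (m - p)*abs (b x) powr p)"
  and "(\<integral>x. abs (a x) powr (m - p)*abs (b x) powr p \<partial>M) <= Lpi M m a powr (1 - p/m)*Lpn M m b powr p"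
proof -
 define r where "r = m/p"
 have r: "r > 1" using pm by (simp add: r_def)
 define f where "f = (%x. abs (a x) powr p)"
 define g where "g = (%x. abs (b x) powr p)"
 have pr: "p*r = m" using pm by (simp add: r_def)
 have pwf: "abs (f x) powr r = abs (a x) powr m" "abs (g x) powr r = abs (b x) powr m" for x by (simp_all add: f_def g_def powr_powr pr)
 have fg: "Lp M r f" "Lp M r g" using a b unfolding Lp_def pwf by (auto simp: f_def g_def)
 have e: "abs (f x) powr (r - 1)*abs (g x) = abs (a x) powr (m - p)*abs (b x) powr p" for x by (simp add: f_def g_def powr_powr right_diff_distrib pr)
 show "integrable M (%x. abs (a x) powr (m - p)*abs (b x) powr p)" using Lp_Young_integrable[OF fg r] unfolding e .
 have n: "Lpi M r f = Lpi M m a" "Lpi M r g = Lpi M m b" by (simp_all add: Lpi_def pwf)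
 have ex: "1/r*(r - 1) = 1 - p/m" "1/m*p = 1/r" using pm by (simp_all add: r_def field_simps)
 show "(\<integral>x. abs (a x) powr (m - p)*abs (b x) powr p \<partial>M) <= Lpi M m a powr (1 - p/m)*Lpn M m b powr p"
  using Hoelder[OF fg r] unfolding e Lpn_def n powr_powr ex .
qed

context frac
begin

lemma dq_pair:
 fixes u v :: "real^'n => real"
 shows "pw (p - 1) 1 (- 1) (dq s p u z)*dq s p v z
  = pw (p - 1) 1 (- 1) (u (fst z) - u (snd z))*(v (fst z) - v (snd z))/norm (fst z - snd z) powr (N + s*p)"
proof (cases "fst z = snd z")
 case True
 then show ?thesis by (simp add: dq_def)
next
 case False
 define E where "E = norm (fst z - snd z) powr ((N + s*p)/p)"
 have E: "E > 0" using False by (simp add: E_def)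
 have EE: "E powr (p - 1)*E = norm (fst z - snd z) powr (N + s*p)"
 proof -
  have "E powr (p - 1)*E = E powr p" using powr_mult_base[of E "p - 1"] E by (simp add: mult.commute)
  also have "... = norm (fst z - snd z) powr (N + s*p)" using p0 by (simp add: E_def powr_powr)
  finally show ?thesis .
 qed
 have dqe: "dq s p u z = (1/E)*(u (fst z) - u (snd z))" by (simp add: dq_def E_def N_def)
 have "pw (p - 1) 1 (- 1) (dq s p u z) = (1/E) powr (p - 1)*pw (p - 1) 1 (- 1) (u (fst z) - u (snd z))" unfolding dqe using E by (intro pw_scale) simp
 moreover have "dq s p v z = (v (fst z) - v (snd z))/E" by (simp add: dq_def E_def N_def)
 ultimately show ?thesis using E by (simp add: powr_divide EE[symmetric])
qed

lemma A_lower_bound: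
 fixes u v w :: "real^'n => real"
 assumes u: "u : DD" and v: "v : DD" and w: "w : DD" and c: "c >= 0"
  and pt: "!!x y. c*abs (w x - w y) powr p <= pw (p - 1) 1 (- 1) (u x - u y)*(v x - v y)"
 shows "c*G w <= EE u v"
proof -
 have "c*G w = (\<integral>z. c*abs (dq s p w z) powr p \<partial>LL)" by (simp add: Lpi_def)
 also have "... <= EE u v" unfolding DT_def
 proof (rule integral_mono)
  show "integrable LL (%z. c*abs (dq s p w z) powr p)" using w by auto
  show "integrable LL (%z. pw (p - 1) 1 (- 1) (dq s p u z)*dq s p v z)" by (rule DT_integrable) (use u v p1 in auto)
  fix z
  show "c*abs (dq s p w z) powr p <= pw (p - 1) 1 (- 1) (dq s p u z)*dq s p v z"
   unfolding dq_pair dq_powr_N[OF p0] using divide_right_mono[OF pt[of "fst z" "snd z"], of "norm (fst z - snd z) powr (N + s*p)"] by simp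
 qed
 finally show ?thesis .
qed

text \<open>The exponent (N - s p)/p is the one that leaves energy and critical norm invariant; the
  p-th power integral picks up r^(-s p). This noncompact group is the obstacle in the critical term
  and also the means to recentre sequences.\<close>

lemma rescale_DD:
 fixes u :: "real^'n => real" and t :: "real^'n"
 assumes u: "u : DD" and r: "r > 0"
 defines "v \<equiv> (%y. r powr ((N - s*p)/p)*u (t + r *\<^sub>R y))"
 shows "v : DD" "G v = G u" "Il ps v = Il ps u"
  "q > 0 ==> Ll q u ==> Ll q v \<and> Il q v = r powr ((N - s*p)/p*q - N)*Il q u"
proof -
 define c where "c = r powr ((N - s*p)/p)"
 have um: "u : Bl" using u by auto
 have am: "(%x::real^'n. t + r *\<^sub>R x) : leb \<rightarrow>\<^sub>M leb" using nn_integral_lebesgue_affine(2)[OF r, of "%x. 0" t] by simp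
 define w where "w = (%y. u (t + r *\<^sub>R y))"
 have wm: "w : Bl" unfolding w_def using measurable_compose[OF am um] .
 have vw: "v = (%y. c*w y)" by (simp add: v_def w_def c_def)
 have vm: "v : Bl" unfolding vw using wm by measurable
 have rN: "r ^ CARD('n) = r powr N" using r by (simp add: N_def powr_realpow)
 have q: "Ll q v \<and> Il q v = r powr ((N - s*p)/p*q - N)*Il q u" if q: "q > 0" "Ll q u" for q
 proof -
  have "(NI y. en (abs (v y) powr q)) = (NI y. en (c powr q)*en (abs (u (t + r *\<^sub>R y)) powr q))"
   by (intro nn_integral_cong) (simp add: vw w_def abs_mult powr_mult ennreal_mult c_def)
  also have "... = en (c powr q)*(NI y. en (abs (u (t + r *\<^sub>R y)) powr q))"
   by (rule nn_integral_cmult) (use wm in \<open>simp add: w_def\<close>)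
  also have "(NI y. en (abs (u (t + r *\<^sub>R y)) powr q)) = en (1/r powr N)*(NI y. en (abs (u y) powr q))"
   using nn_integral_lebesgue_affine(1)[OF r, of "%y. en (abs (u y) powr q)" t] um rN by simp
  also have "(NI y. en (abs (u y) powr q)) = en (Il q u)" using q by (simp add: Lpi_nn)
  also have "en (c powr q)*(en (1/r powr N)*en (Il q u)) = en (c powr q*(1/r powr N)*Il q u)"
   by (simp add: ennreal_mult[symmetric] mult.assoc[symmetric])
  also have "c powr q*(1/r powr N) = r powr ((N - s*p)/p*q - N)" by (simp add: c_def powr_powr powr_diff)
  finally have e: "(NI y. en (abs (v y) powr q)) = en (r powr ((N - s*p)/p*q - N)*Il q u)" .
  have L: "Ll q v" by (rule Lp_nn_finite(1)[OF vm]) (use e in auto)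
  then show ?thesis using e Lpi_nn[OF L] by simp
 qed
 then show "q > 0 ==> Ll q u ==> Ll q v \<and> Il q v = r powr ((N - s*p)/p*q - N)*Il q u" by blast
 have e0: "(N - s*p)/p*ps - N = 0"
 proof -
  have "N - s*p \<noteq> 0" using sub by simp
  then show ?thesis unfolding ps_def using p0 by simp
 qed
 have L: "Ll ps v" "Il ps v = Il ps u" using q[OF ps_facts(3)] u r unfolding e0 by auto
 then show "Il ps v = Il ps u" by simp
 have dv: "dq s p v z = c*dq s p w z" for z unfolding vw by (rule dq_cmult)
 have "(\<integral>\<^sup>+z. en (abs (dq s p v z) powr p) \<partial>LL) = (\<integral>\<^sup>+z. en (c powr p)*en (abs (dq s p w z) powr p) \<partial>LL)"
  by (intro nn_integral_cong) (simp add: dv abs_mult powr_mult ennreal_mult c_def)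
 also have "... = en (c powr p)*(\<integral>\<^sup>+z. en (abs (dq s p w z) powr p) \<partial>LL)" by (rule nn_integral_cmult) (use wm in measurable)
 also have "(\<integral>\<^sup>+z. en (abs (dq s p w z) powr p) \<partial>LL) = en (r powr (s*p - N))*en (G u)"
  unfolding w_def gagliardo_affine_N[OF r p0 um] using u by (simp add: Lpi_nn DD_D)
 also have "en (c powr p)*(en (r powr (s*p - N))*en (G u)) = en (c powr p*r powr (s*p - N)*G u)"
  by (simp add: ennreal_mult[symmetric] mult.assoc[symmetric])
 also have "c powr p*r powr (s*p - N) = 1"
 proof -
  have "c powr p = r powr (N - s*p)" using p0 by (simp add: c_def powr_powr)
  then show ?thesis using r by (simp add: powr_add[symmetric])
 qed
 finally have e: "(\<integral>\<^sup>+z. en (abs (dq s p v z) powr p) \<partial>LL) = en (G u)" by simp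
 have L2: "Lp LL p (dq s p v)" by (rule Lp_nn_finite(1)[of _ _ _ "G u"]) (use e vm in auto)
 then show "G v = G u" using e Lpi_nn[OF L2] by simp
 show "v : DD" using L L2 vm by (simp add: DD_def)
qed

lemma DD_abs: "u : DD ==> (%x. abs (u x)) : DD" "u : DD ==> G (%x. abs (u x)) <= G u"
proof -
 assume u: "u : DD"
 then have m: "(%x. abs (u x)) : Bl" by auto
 have l: "abs (abs (u x) - abs (u y)) <= abs (u x - u y)" for x y by linarith
 show "(%x. abs (u x)) : DD" by (rule DD_bound[OF u m, of 1]) (use l in auto)
 show "G (%x. abs (u x)) <= G u" by (rule G_mono[OF u m l])
qed

lemma AE_dq_limit:
 assumes "AE x in leb. (%n. u n x) ---> (w x :: real)"
 shows "AE z in LL. (%n. dq s p (u n) z) ---> dq s p w z" using AE_LL[OF assms]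
proof eventually_elim
 case (elim z)
 then show ?case unfolding dq_def divide_inverse by (intro tendsto_intros) auto
qed

lemma DD_limit:
 assumes u: "!!n. u n : DD" "!!n. G (u n) <= C" "!!n. Il ps (u n) <= C'"
  and w: "w : Bl" "AE x in leb. (%n. u n x) ---> w x"
 shows "w : DD" "G w <= C" "Il ps w <= C'"
proof -
 have dw: "dq s p w : borel_measurable LL" using w(1) by measurable
 have 1: "Lp LL p (dq s p w)" "G w <= C" using Fatou_Lp[OF DD_D(2)[OF u(1)] u(2) dw AE_dq_limit[OF w(2)] p0] by auto
 have 2: "Ll ps w" "Il ps w <= C'" using Fatou_Lp[OF DD_D(3)[OF u(1)] u(3) w ps_facts(3)] by auto
 show "w : DD" "G w <= C" "Il ps w <= C'" using 1 2 w by (auto simp: DD_def)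
qed

text \<open>By \<open>Sobolev_Morrey\<close> a normalised minimising sequence carries a definite
  amount of mass in some ball; translation and dilation move it to the unit ball, so the limit is
  not 0. Brezis-Lieb splits energy and critical mass, and m^\<open>\<tau>\<close> +
  (1-m)^\<open>\<tau>\<close> > 1 for 0 < m < 1 leaves only m = 1.\<close>

lemma extremal_exists:
 obtains U where "U : DD" "!!x. U x >= 0" "Il ps U = 1" "G U = Sob"
proof -
 have "EX u. u : DD \<and> Il ps u = 1 \<and> G u < Sob + 1/real (Suc n)" for n
 proof -
  have "Inf {G u | u. u : DD \<and> Il ps u = 1} < Sob + 1/real (Suc n)" by (simp add: Sob_def)
  from cInf_lessD[OF Sob_set(1) this] show ?thesis by blast
 qed
 then obtain u where u: "!!n. u n : DD" "!!n. Il ps (u n) = 1" "!!n. G (u n) < Sob + 1/real (Suc n)" by metis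
 have uG: "G (u n) <= Sob + 1" for n
 proof -
  have "1/real (Suc n) <= 1" by simp
  then show ?thesis using u(3)[of n] by linarith
 qed
 \<comment> \<open>Chosen so that the improved Sobolev inequality would give critical mass at most
   1/2 if no ball carried this much.\<close>
 define M where "M = (1/(2*Morrey_C*(Sob + 1))) powr (1/(ps - p))"
 have psp: "ps - p > 0" using ps_facts by simp
 have D0: "2*Morrey_C*(Sob + 1) > 0" using Morrey_C_pos Sob_pos by simp
 have M: "M > 0" "Morrey_C*M powr (ps - p)*(Sob + 1) = 1/2"
 proof -
  show "M > 0" using Morrey_C_pos Sob_pos by (simp add: M_def)
  have "M powr (ps - p) = 1/(2*Morrey_C*(Sob + 1))" using psp D0 by (simp add: M_def powr_powr)
  then show "Morrey_C*M powr (ps - p)*(Sob + 1) = 1/2" using Morrey_C_pos Sob_pos by simp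
 qed
 define \<theta> where "\<theta> = N - (N - s*p)/p"
 have "EX x r. r > 0 \<and> (NI y. en (abs (u n y))*ind (ball x r) y) > en (M*r powr \<theta>)" for n
 proof (rule ccontr)
  assume "\<not> ?thesis"
  then have "!!x r. r > 0 ==> (NI y. en (abs (u n y))*ind (ball x r) y) <= en (M*r powr \<theta>)" by (meson not_le)
  from Sobolev_Morrey(2)[OF DD_D(1)[OF u(1)] M(1) DD_D(2)[OF u(1)] this[unfolded \<theta>_def]]
  have "1 <= Morrey_C*M powr (ps - p)*G (u n)" using u(2)[of n] by simp
  also have "... <= Morrey_C*M powr (ps - p)*(Sob + 1)" using uG[of n] Morrey_C_pos by (intro mult_left_mono) auto
  finally show False using M(2) by simp
 qed
 then obtain x r where xr: "!!n. r n > 0" "!!n. (NI y. en (abs (u n y))*ind (ball (x n) (r n)) y) > en (M*r n powr \<theta>)" by metis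
 define v where "v = (%n y. r n powr ((N - s*p)/p)*u n (x n + r n *\<^sub>R y))"
 have vD: "v n : DD" "G (v n) = G (u n)" "Il ps (v n) = 1" for n
  using rescale_DD(1-3)[OF u(1)[of n] xr(1)[of n], where t = "x n"] u(2)[of n] unfolding v_def by auto
 have vM: "(NI y. en (abs (v n y))*ind (ball 0 1) y) > en M" for n
 proof -
  define f where "f = (%y. en (abs (u n y))*ind (ball (x n) (r n)) y)"
  define \<alpha> where "\<alpha> = (N - s*p)/p"
  have fm: "f : Bl" unfolding f_def using DD_D(1)[OF u(1)[of n]] by (intro borel_measurable_times_ennreal borel_measurable_indicator) auto
  have am: "(%y::real^'n. x n + r n *\<^sub>R y) : leb \<rightarrow>\<^sub>M leb"
   using nn_integral_lebesgue_affine(2)[OF xr(1)[of n], where f = "%x. 0" and t = "x n"] by simp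
  have e: "en (abs (v n y))*ind (ball 0 1) y = en (r n powr \<alpha>)*f (x n + r n *\<^sub>R y)" for y
  proof -
   have "x n + r n *\<^sub>R y : ball (x n) (r n) \<longleftrightarrow> y : ball 0 1" using xr(1)[of n] by (simp add: dist_norm)
   then show ?thesis by (auto simp: f_def v_def abs_mult ennreal_mult indicator_def \<alpha>_def)
  qed
  have rN: "r n ^ CARD('n) = r n powr N" using xr(1)[of n] by (simp add: N_def powr_realpow)
  have "(NI y. en (abs (v n y))*ind (ball 0 1) y) = en (r n powr \<alpha>)*(NI y. f (x n + r n *\<^sub>R y))"
   unfolding e by (rule nn_integral_cmult) (rule measurable_compose[OF am fm])
  also have "... = en (r n powr \<alpha>)*(en (1/r n powr N)*(NI y. f y))"
   using nn_integral_lebesgue_affine(1)[OF xr(1)[of n] fm, where t = "x n"] rN by simp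
  also have "... = en (r n powr \<alpha>/r n powr N)*(NI y. f y)" by (simp add: mult.assoc[symmetric] ennreal_mult[symmetric])
  also have "... > en (r n powr \<alpha>/r n powr N)*en (M*r n powr \<theta>)"
   unfolding f_def using xr(1)[of n] by (intro ennreal_mult_strict_left_mono[OF xr(2)]) auto
  also have "en (r n powr \<alpha>/r n powr N)*en (M*r n powr \<theta>) = en M"
  proof -
   have "r n powr \<alpha>/r n powr N*(M*r n powr \<theta>) = M"
    unfolding \<theta>_def \<alpha>_def[symmetric] using xr(1)[of n] by (simp add: powr_diff)
   then show ?thesis using M by (simp add: ennreal_mult[symmetric])
  qed
  finally show ?thesis .
 qed
 obtain k w where kw: "strict_mono k" "w : Bl" "AE x in leb. (%n. v (k n) x) ---> w x"
 proof -
  have "G (v n) <= Sob + 1" "Il ps (v n) <= Sob + 1" for n using uG[of n] vD[of n] Sob_pos by auto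
  then show ?thesis using compactness[of v "Sob + 1"] vD(1) that by blast
 qed
 have wD: "w : DD" "Il ps w <= 1" using DD_limit[of "%n. v (k n)" "Sob + 1" 1 w] vD uG kw by auto
 define m where "m = Il ps w"
 have Bs: "ball 0 1 : sets (leb :: (real^'n) measure)" "emeasure leb (ball (0::real^'n) 1) < \<infinity>" by (auto simp: emeasure_ball_N)
 have m0: "m > 0"
 proof (rule ccontr)
  assume "\<not> m > 0"
  then have "Il ps w = 0" using Lpi_nonneg[of leb ps w] by (simp add: m_def)
  then have w0: "AE x in leb. w x = 0" using Lpi_eq_0[OF DD_D(3)[OF wD(1)]] by simp
  define z where "z = (%n y. ind (ball 0 1) y * v (k n) y)"
  have zm: "z n : Bl" for n unfolding z_def using DD_D(1)[OF vD(1)[of "k n"]] by (intro borel_measurable_times borel_measurable_indicator) auto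
  have zL: "Ll ps (z n)" for n
   by (rule Lp_bound[OF DD_D(3)[OF vD(1)[of "k n"]] zm[of n], where C = 1]) (use ps_facts in \<open>auto simp: z_def indicator_def\<close>)
  have zb: "Il ps (z n) <= 1" for n
  proof -
   have "Il ps (z n) <= Il ps (v (k n))" by (rule Lpi_mono[OF DD_D(3)[OF vD(1)] zm]) (use ps_facts in \<open>auto simp: z_def indicator_def\<close>)
   then show ?thesis using vD(3) by simp
  qed
  have zlim: "AE x in leb. (%n. z n x) ---> 0" using kw(3) w0
  proof eventually_elim
   case (elim x)
   have "(%n. z n x) ---> ind (ball 0 1) x*w x" unfolding z_def by (intro tendsto_intros elim)
   then show ?case using elim by simp
  qed
  have zoff: "AE x in leb. x \<notin> ball 0 1 --> z n x = 0" for n by (auto simp: z_def)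
  note sub = Lpi_subcritical_convergence[OF zL zb zlim zero_less_one ps_facts(2) Bs zoff]
  from sub(2) have "EV n. Il 1 (z n) < M" using M by (intro order_tendstoD(2)) auto
  then obtain n where n: "Il 1 (z n) < M" by (auto simp: eventually_sequentially)
  have "en (Il 1 (z n)) = (NI y. en (abs (z n y) powr 1))" by (rule Lpi_nn[OF sub(1), symmetric])
  also have "... = (NI y. en (abs (v (k n) y))*ind (ball 0 1) y)" by (intro nn_integral_cong) (auto simp: z_def indicator_def)
  finally have "en M < en (Il 1 (z n))" using vM[of "k n"] by simp
  then show False using n M by (simp add: ennreal_less_iff)
 qed
 have GL: "(%n. G (v (k n))) ---> Sob"
 proof (rule tendsto_sandwich[OF _ _ tendsto_const])
  show "EV n. Sob <= G (v (k n))" using Sobolev[OF vD(1)] vD(3) by (simp add: Lpn_def)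
  show "EV n. G (v (k n)) <= Sob + 1/real (Suc (k n))" using u(3) vD(2) by (intro always_eventually) (auto intro: less_imp_le)
  have "(%n. Sob + 1/real (Suc n)) ---> Sob + 0" by (intro tendsto_intros LIMSEQ_Suc[OF lim_1_over_n])
  from LIMSEQ_subseq_LIMSEQ[OF this kw(1)] show "(%n. Sob + 1/real (Suc (k n))) ---> Sob" by (simp add: o_def)
 qed
 have BG: "(%n. G (v (k n)) - Lpi LL p (%z. dq s p (v (k n)) z - dq s p w z)) ---> G w"
  by (rule Brezis_Lieb[where C = "Sob + 1"]) (use vD uG wD p1 AE_dq_limit[OF kw(3)] in auto)
 have BL: "(%n. Il ps (v (k n)) - Il ps (%x. v (k n) x - w x)) ---> m"
  unfolding m_def by (rule Brezis_Lieb[where C = 1]) (use vD wD ps_facts kw(3) in auto)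
 define z where "z = (%n x. v (k n) x - w x)"
 have zD: "z n : DD" for n using DD_lin[OF vD(1) wD(1), of "k n" "-1"] by (simp add: z_def)
 have dz: "dq s p (z n) = (%z. dq s p (v (k n)) z - dq s p w z)" for n unfolding z_def by (rule ext) (rule dq_diff)
 have Gz: "(%n. G (z n)) ---> Sob - G w" using tendsto_diff[OF GL BG] unfolding dz by simp
 have Lz: "(%n. Il ps (z n)) ---> 1 - m" using tendsto_diff[OF tendsto_const BL, of 1] vD(3) unfolding z_def by simp
 define \<tau> where "\<tau> = p/ps"
 have \<tau>: "0 < \<tau>" "\<tau> < 1" using ps_facts(1-3) p0 by (simp_all add: \<tau>_def del: ps_facts(5))
 have SL: "Sob*Il ps f powr \<tau> <= G f" if "f : DD" for f using Sobolev[OF that] by (simp add: Lpn_def powr_powr \<tau>_def)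
 have "Sob*(1 - m) powr \<tau> <= Sob - G w"
 proof (rule LIMSEQ_le[OF _ Gz])
  show "(%n. Sob*Il ps (z n) powr \<tau>) ---> Sob*(1 - m) powr \<tau>"
   by (intro tendsto_mult tendsto_const tendsto_powr'[OF Lz tendsto_const]) (use \<tau> in auto)
 qed (use SL zD in auto)
 moreover have "Sob*m powr \<tau> <= G w" using SL[OF wD(1)] by (simp add: m_def)
 moreover have "0 <= Sob*(1 - m) powr \<tau>" using Sob_pos by simp
 ultimately have Gw: "G w <= Sob" and "Sob*(m powr \<tau> + (1 - m) powr \<tau>) <= Sob*1" by (auto simp: distrib_left)
 then have s1: "m powr \<tau> + (1 - m) powr \<tau> <= 1" using Sob_pos by simp
 have m1: "m = 1"
 proof (rule ccontr)
  assume "m \<noteq> 1"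
  then have mm: "0 < m" "m < 1" using m0 wD(2) by (auto simp: m_def)
  have "m powr 1 < m powr \<tau>" using mm \<tau> by (intro powr_less_mono') auto
  moreover have "(1 - m) powr 1 <= (1 - m) powr \<tau>" using mm \<tau> by (intro powr_mono') auto
  ultimately show False using s1 mm by simp
 qed
 show ?thesis
 proof (rule that[of "%x. abs (w x)"])
  show D: "(%x. abs (w x)) : DD" using DD_abs(1)[OF wD(1)] .
  show L1: "Il ps (%x. abs (w x)) = 1" using m1 by (simp add: m_def Lpi_def)
  show "G (%x. abs (w x)) = Sob"
  proof (rule antisym)
   show "G (%x. abs (w x)) <= Sob" using DD_abs(2)[OF wD(1)] Gw by simp
   show "Sob <= G (%x. abs (w x))" using Sobolev[OF D] L1 by (simp add: Lpn_def)
  qed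
 qed simp
qed

text \<open>The difference of the two sides of the p-homogeneous Sobolev inequality is nonnegative
  and vanishes at U, so its derivative in direction v is 0. In this form the multiplier is
  \<open>Sob\<close> from the start.\<close>

lemma extremal_EL:
 assumes U: "U : DD" "Il ps U = 1" "G U = Sob" and v: "v : DD"
 shows "EE U v = Sob*DTl ps 1 1 U v"
proof -
 define f where "f = (%t. T LL p 1 1 (%z. dq s p U z + t*dq s p v z) - Sob*(Tl ps 1 1 (%x. U x + t * v x)) powr (p/ps))"
 have f0: "f 0 = 0" using U by (simp add: f_def T_one_one)
 have fn: "f t >= 0" for t
 proof -
  have D: "(%x. U x + t * v x) : DD" using DD_lin[OF U(1) v] .
  have e: "dq s p (%x. U x + t * v x) = (%z. dq s p U z + t*dq s p v z)" by (rule dq_lin_fun)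
  show ?thesis using Sobolev[OF D] unfolding f_def T_one_one e[symmetric] by (simp add: Lpn_def powr_powr)
 qed
 have T0: "Tl ps 1 1 (%x. U x + 0 * v x) = 1" using U by (simp add: T_one_one)
 have d1: "((%t. T LL p 1 1 (%z. dq s p U z + t*dq s p v z)) has_real_derivative p*EE U v) (at 0)" by (rule T_has_derivative) (use U v p1 in auto)
 have d2: "((%t. Tl ps 1 1 (%x. U x + t * v x)) has_real_derivative ps*DTl ps 1 1 U v) (at 0)" by (rule T_has_derivative) (use U v ps_facts in auto)
 have d3: "((%t. (Tl ps 1 1 (%x. U x + t * v x)) powr (p/ps)) has_real_derivative p*DTl ps 1 1 U v) (at 0)"
  using DERIV_fun_powr[OF d2, of "p/ps", unfolded T0] ps_facts(3) by simp
 have "(f has_real_derivative p*EE U v - Sob*(p*DTl ps 1 1 U v)) (at 0)" unfolding f_def by (intro DERIV_diff DERIV_cmult d1 d3)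
 from DERIV_local_min[OF this, of 1] fn f0
 have "p*EE U v - Sob*(p*DTl ps 1 1 U v) = 0" by simp
 then have "p*EE U v = p*(Sob*DTl ps 1 1 U v)" by simp
 then show ?thesis using p0 by simp
qed

end

section \<open>Integrability of the extremals\<close>

context frac
begin

lemma dq_pair_nonneg_pw:
 "pw (p - 1) 1 (- 1) t*t = abs t powr p" using powr_mult_base[of "abs t" "p - 1"] by (auto simp: pw_def mult.commute)

text \<open>Testing the Euler--Lagrange equation with \<open>(U + \<epsilon>) powr \<beta> - \<epsilon> powr \<beta>\<close>
 controls \<open>U powr \<gamma>\<close> in \<open>L^ps\<close>; the exponent \<open>\<beta> = 1 - s p^2/N\<close> is chosen such that \<open>\<gamma> ps = p\<close>.\<close>
lemma extremal_Lp:
 assumes U: "U : DD" "!!x. U x >= 0" "Il ps U = 1" "G U = Sob" and Nsp: "s*p^2 < N"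
 shows "Ll p U"
proof -
 define b where "b = 1 - s*p^2/N"
 define g where "g = (N - s*p)/N"
 have N0: "N > 0" using N1 by simp
 have b: "0 < b" "b < 1" using Nsp N0 s0 p1 by (auto simp: b_def)
 have g: "0 < g" "g < 1" using sub sp0 N0 by (auto simp: g_def)
 have gb: "p*(g - 1) = b - 1" using N0 by (simp add: b_def g_def field_simps power2_eq_square)
 have gps: "g*ps = p" using N0 sub unfolding g_def ps_def by simp
 \<comment> \<open>\<open>ge\<close> is the test function and \<open>Ga\<close> the function whose
   energy it controls, because p (g - 1) = b - 1. The shift by e makes both Lipschitz functions of
   U, hence admissible.\<close>
 define ge where "ge = (%e x. (U x + e) powr b - e powr b)"
 define Ga where "Ga = (%e x. (U x + e) powr g - e powr g)"
 have Um: "U : Bl" using U by auto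
 have lipk: "abs ((A + e) powr k - (B + e) powr k) <= e powr (k - 1)*abs (A - B)"
  if "0 < k" "k < 1" "e > 0" "A >= 0" "B >= 0" for A B k e :: real
 proof -
  have *: "abs ((A + e) powr k - (B + e) powr k) <= e powr (k - 1)*abs (A - B)" if AB: "A >= B" "B >= 0" for A B
  proof -
   have "(A + e) powr k - (B + e) powr k <= (A + e) powr (k - 1)*(A + e - (B + e))"
    by (rule powr_concave_bounds(1)) (use that \<open>0 < k\<close> \<open>k < 1\<close> \<open>e > 0\<close> in auto)
   also have "... <= e powr (k - 1)*(A - B)"
   proof -
    have "(A + e) powr (k - 1) <= e powr (k - 1)"
     by (rule powr_mono2') (use that \<open>0 < k\<close> \<open>k < 1\<close> \<open>e > 0\<close> in auto)
    then show ?thesis using AB by (simp add: mult_right_mono)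
   qed
   moreover have "(B + e) powr k <= (A + e) powr k" using AB \<open>e > 0\<close> \<open>0 < k\<close> by (intro powr_mono2) auto
   ultimately show ?thesis using AB by simp
  qed
  show ?thesis
  proof (cases "A >= B")
   case True then show ?thesis using *[OF True that(5)] by simp
  next
   case False
   then show ?thesis using *[of A B] *[of B A] that by (simp add: abs_minus_commute)
  qed
 qed
 have inDD: "(%x. (U x + e) powr k - e powr k) : DD" if "0 < k" "k < 1" "e > 0" for k e
 proof (rule DD_bound[OF U(1), where C = "e powr (k - 1)"])
  show "(%x. (U x + e) powr k - e powr k) : Bl" using Um by measurable
  show "abs ((U x + e) powr k - e powr k) <= e powr (k - 1)*abs (U x)" for x using lipk[OF that U(2)[of x], of 0] by simp
  show "abs ((U x + e) powr k - e powr k - ((U y + e) powr k - e powr k)) <= e powr (k - 1)*abs (U x - U y)" for x y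
   using lipk[OF that U(2)[of x] U(2)[of y]] by simp
 qed
 have geD: "ge e : DD" and GaD: "Ga e : DD" if "e > 0" for e unfolding ge_def Ga_def using inDD b g that by auto
 have pt: "b*abs (Ga e x - Ga e y) powr p <= pw (p - 1) 1 (- 1) (U x - U y)*(ge e x - ge e y)" if e: "e > 0" for e x y
 proof -
  have *: "b*abs ((A + e) powr g - (B + e) powr g) powr p <= (A - B) powr (p - 1)*((A + e) powr b - (B + e) powr b)"
   if AB: "A >= B" "B >= 0" for A B
  proof -
   have 1: "abs ((A + e) powr g - (B + e) powr g) <= (A + e) powr (g - 1)*(A - B)"
   proof -
    have "(A + e) powr g - (B + e) powr g <= (A + e) powr (g - 1)*(A + e - (B + e))" by (rule powr_concave_bounds(1)) (use AB g e in auto)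
    moreover have "(B + e) powr g <= (A + e) powr g" using AB e g by (intro powr_mono2) auto
    ultimately show ?thesis by simp
   qed
   have "abs ((A + e) powr g - (B + e) powr g) powr p <= ((A + e) powr (g - 1)*(A - B)) powr p" using 1 p0 by (intro powr_mono2) auto
   also have "... = (A + e) powr (b - 1)*(A - B) powr p" by (simp add: powr_mult powr_powr mult.commute[of _ p] gb)
   also have "(A - B) powr p = (A - B) powr (p - 1)*(A - B)" using powr_mult_base[of "A - B" "p - 1"] AB by (simp add: mult.commute)
   finally have "b*abs ((A + e) powr g - (B + e) powr g) powr p <= (A - B) powr (p - 1)*(b*((A + e) powr (b - 1)*(A - B)))"
    using b by (simp add: mult_ac)
   also have "... <= (A - B) powr (p - 1)*((A + e) powr b - (B + e) powr b)"
    using powr_concave_bounds(2)[of b "B + e" "A + e"] AB e b by (intro mult_left_mono) auto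
   finally show ?thesis .
  qed
  show ?thesis
  proof (cases "U x >= U y")
   case True
   then show ?thesis using *[OF True U(2)] by (simp add: pw_def ge_def Ga_def)
  next
   case False
   then have "U y >= U x" by simp
   from *[OF this U(2)] False show ?thesis by (simp add: pw_def ge_def Ga_def abs_minus_commute algebra_simps)
  qed
 qed
 have powps: "U x powr (ps - 1)*U x = U x powr ps" for x using powr_mult_base[of "U x" "ps - 1"] U(2)[of x] by (simp add: mult.commute)
 \<comment> \<open>Where U > d the factor (U + e)^(b-1) is at most d^(b-1). Where U <= d the L^ps
   mass of U tends to 0 with d, so Hoelder makes that contribution small enough to be
   absorbed.\<close>
 define cut where "cut = (%d x. if U x <= d then U x else 0)"
 have cutm: "cut d : Bl" for d unfolding cut_def using Um by measurable
 have cutL: "Ll ps (cut d)" for d by (rule Lp_bound[OF DD_D(3)[OF U(1)] cutm, where C = 1]) (use ps_facts in \<open>auto simp: cut_def\<close>)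
 have cut0: "(%n. Il ps (cut (1/real (Suc n)))) ---> 0"
 proof -
  have "(%n. (LI x. abs (cut (1/real (Suc n)) x) powr ps)) ---> (\<integral>x. 0 \<partial>(leb :: (real^'n) measure))"
  proof (rule integral_dominated_convergence[where w = "%x. abs (U x) powr ps"])
   show "AE x in leb. (%n. abs (cut (1/real (Suc n)) x) powr ps) ---> 0"
   proof (rule AE_I2)
    fix x
    show "(%n. abs (cut (1/real (Suc n)) x) powr ps) ---> 0"
    proof (cases "U x = 0")
     case True then show ?thesis by (simp add: cut_def)
    next
     case False
     then have "U x > 0" using U(2)[of x] by simp
     then obtain n0 where n0: "1/real (Suc n0) < U x" using nat_approx_posE by blast
     have "EV n. abs (cut (1/real (Suc n)) x) powr ps = 0" using eventually_ge_at_top[of n0]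
     proof eventually_elim
      case (elim n)
      have "1/real (Suc n) <= 1/real (Suc n0)" using elim by (intro divide_left_mono) auto
      then show ?case using n0 by (simp add: cut_def del: of_nat_Suc)
     qed
     then show ?thesis by (rule tendsto_eventually)
    qed
   qed
   show "(%x. abs (cut (1/real (Suc n)) x) powr ps) : Bl" for n using cutm by measurable
   show "AE x in leb. norm (abs (cut (1/real (Suc n)) x) powr ps) <= abs (U x) powr ps" for n by (intro AE_I2) (auto simp: cut_def)
  qed (use LpD(2)[OF DD_D(3)[OF U(1)]] U(2) in auto)
  then show ?thesis by (simp add: Lpi_def)
 qed
 define \<sigma> where "\<sigma> = 1 - p/ps"
 have \<sigma>: "\<sigma> > 0" using ps_facts(1,3) p0 by (simp add: \<sigma>_def del: ps_facts(5))
 define c0 where "c0 = 1/(g powr p*b)"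
 have c0: "c0 > 0" using g b by (simp add: c0_def)
 have "(%n. c0*Il ps (cut (1/real (Suc n))) powr \<sigma>) ---> c0*0 powr \<sigma>"
  using \<sigma> by (intro tendsto_mult tendsto_const tendsto_powr'[OF cut0 tendsto_const]) auto
 then have "EV n. c0*Il ps (cut (1/real (Suc n))) powr \<sigma> < 1/2" by (intro order_tendstoD(2)) auto
 then obtain n1 where n1: "c0*Il ps (cut (1/real (Suc n1))) powr \<sigma> < 1/2" by (auto simp: eventually_sequentially)
 define d where "d = 1/real (Suc n1)"
 have d: "d > 0" "c0*Il ps (cut d) powr \<sigma> < 1/2" using n1 by (auto simp: d_def)
 define K where "K = 2*(d powr (b - 1)/b)"
 have bound: "Nl ps (Ga e) powr p <= K" if e: "e > 0" for e
 proof -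
  have "b*G (Ga e) <= EE U (ge e)" by (rule A_lower_bound[OF U(1) geD[OF e] GaD[OF e] _ pt[OF e]]) (use b in auto)
  also have "... = Sob*DTl ps 1 1 U (ge e)" by (rule extremal_EL[OF U(1,3,4) geD[OF e]])
  finally have 1: "b*(Sob*Nl ps (Ga e) powr p) <= Sob*DTl ps 1 1 U (ge e)" using mult_left_mono[OF Sobolev[OF GaD[OF e]], of b] b by linarith
  have 2: "b*Nl ps (Ga e) powr p <= DTl ps 1 1 U (ge e)"
  proof -
   have "Sob*(b*Nl ps (Ga e) powr p) <= Sob*DTl ps 1 1 U (ge e)" using 1 by (simp add: mult_ac)
   then show ?thesis using Sob_pos by simp
  qed
  note Hp = Hoelder_powers[OF cutL DD_D(3)[OF GaD[OF e]] p0 ps_facts(1), of d]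
  have iU: "integrable leb (%x. abs (U x) powr ps)" by (rule LpD(2)[OF DD_D(3)[OF U(1)]])
  have "DTl ps 1 1 U (ge e) <= (LI x. d powr (b - 1)*abs (U x) powr ps + (1/g powr p)*(abs (cut d x) powr (ps - p)*abs (Ga e x) powr p))"
   unfolding DT_def
  proof (rule integral_mono)
   show "integrable leb (%x. pw (ps - 1) 1 (- 1) (U x)*ge e x)" by (rule DT_integrable) (use U geD[OF e] ps_facts in auto)
   show "integrable leb (%x. d powr (b - 1)*abs (U x) powr ps + (1/g powr p)*(abs (cut d x) powr (ps - p)*abs (Ga e x) powr p))"
    using iU Hp(1) by auto
   fix x
   define t where "t = U x"
   have t: "t >= 0" using U(2) by (simp add: t_def)
   have gle: "ge e x <= (t + e) powr (b - 1)*t" unfolding ge_def t_def[symmetric] using powr_concave_bounds(1)[of b e "t + e"] b e t by simp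
   have "pw (ps - 1) 1 (- 1) (U x)*ge e x = t powr (ps - 1)*ge e x" using t by (simp add: pw_def t_def)
   also have "... <= t powr (ps - 1)*((t + e) powr (b - 1)*t)" using gle by (intro mult_left_mono) auto
   also have "... = (t + e) powr (b - 1)*t powr ps" using powps[of x] by (simp add: t_def mult_ac)
   finally have 3: "pw (ps - 1) 1 (- 1) (U x)*ge e x <= (t + e) powr (b - 1)*t powr ps" .
   show "pw (ps - 1) 1 (- 1) (U x)*ge e x <= d powr (b - 1)*abs (U x) powr ps + (1/g powr p)*(abs (cut d x) powr (ps - p)*abs (Ga e x) powr p)"
   proof (cases "t <= d")
    case False
    have "(t + e) powr (b - 1) <= d powr (b - 1)" by (rule powr_mono2') (use False d e b in auto)
    then have "(t + e) powr (b - 1)*t powr ps <= d powr (b - 1)*t powr ps" by (intro mult_right_mono) auto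
    then show ?thesis using 3 t False by (simp add: t_def[symmetric] cut_def)
   next
    case True
    have "g*((t + e) powr (g - 1)*t) <= Ga e x" unfolding Ga_def t_def[symmetric] using powr_concave_bounds(2)[of g e "t + e"] g e t by simp
    then have "(g*((t + e) powr (g - 1)*t)) powr p <= abs (Ga e x) powr p" using g t p0 by (intro powr_mono2) auto
    also have "(g*((t + e) powr (g - 1)*t)) powr p = g powr p*((t + e) powr (b - 1)*t powr p)"
     by (simp add: powr_mult powr_powr mult.commute[of _ p] gb)
    finally have "(t + e) powr (b - 1)*t powr p <= (1/g powr p)*abs (Ga e x) powr p" using g by (simp add: field_simps)
    then have "t powr (ps - p)*((t + e) powr (b - 1)*t powr p) <= t powr (ps - p)*((1/g powr p)*abs (Ga e x) powr p)" by (intro mult_left_mono) auto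
    moreover have "t powr (ps - p)*t powr p = t powr ps" by (simp add: powr_add[symmetric])
    ultimately have "(t + e) powr (b - 1)*t powr ps <= (1/g powr p)*(abs (cut d x) powr (ps - p)*abs (Ga e x) powr p)"
     using True t by (simp add: cut_def t_def[symmetric] mult_ac) (metis mult.left_commute mult.commute)
    then show ?thesis using 3 by (simp add: add_increasing)
   qed
  qed
  also have "... = d powr (b - 1) + (1/g powr p)*(LI x. abs (cut d x) powr (ps - p)*abs (Ga e x) powr p)" using iU Hp(1) U(3) by (simp add: Lpi_def)
  also have "... <= d powr (b - 1) + (1/g powr p)*(Il ps (cut d) powr \<sigma>*Nl ps (Ga e) powr p)"
   using Hp(2) unfolding \<sigma>_def by (intro add_left_mono mult_left_mono) auto
  finally have "b*Nl ps (Ga e) powr p <= d powr (b - 1) + (1/g powr p)*(Il ps (cut d) powr \<sigma>*Nl ps (Ga e) powr p)" using 2 by linarith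
  then have "Nl ps (Ga e) powr p <= d powr (b - 1)/b + c0*Il ps (cut d) powr \<sigma>*Nl ps (Ga e) powr p" using b g by (simp add: c0_def field_simps)
  also have "... <= d powr (b - 1)/b + 1/2*Nl ps (Ga e) powr p" using d by (intro add_left_mono mult_right_mono) auto
  finally show ?thesis by (simp add: K_def)
 qed
 have bd: "Il ps (Ga (1/real (Suc n))) <= K powr (ps/p)" for n
 proof -
  have "Il ps (Ga (1/real (Suc n))) = (Nl ps (Ga (1/real (Suc n))) powr p) powr (ps/p)"
   using Lpn_powr[of ps leb "Ga (1/real (Suc n))"] ps_facts(3) p0 by (simp add: powr_powr)
  also have "... <= K powr (ps/p)" using bound[of "1/real (Suc n)"] ps_facts p0 by (intro powr_mono2) auto
  finally show ?thesis .
 qed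
 have "Ll ps (%x. U x powr g)"
 proof (rule Fatou_Lp(1)[OF DD_D(3)[OF GaD] bd])
  show "(%x. U x powr g) : Bl" using Um by measurable
  show "AE x in leb. (%n. Ga (1/real (Suc n)) x) ---> U x powr g"
  proof (rule AE_I2)
   fix x
   have l: "(%n. 1/real (Suc n)) ---> 0" by (rule LIMSEQ_Suc[OF lim_1_over_n])
   have "(%n. Ga (1/real (Suc n)) x) ---> (U x + 0) powr g - 0 powr g" unfolding Ga_def
    by (intro tendsto_diff tendsto_powr' tendsto_add tendsto_const l) (use U(2)[of x] g in \<open>auto intro!: always_eventually add_nonneg_nonneg\<close>)
   then show "(%n. Ga (1/real (Suc n)) x) ---> U x powr g" by simp
  qed
 qed (use ps_facts in auto)
 then have "integrable leb (%x. abs (U x powr g) powr ps)" by auto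
 moreover have "abs (U x powr g) powr ps = abs (U x) powr p" for x using U(2)[of x] by (simp add: powr_powr gps)
 ultimately show ?thesis using Um by (simp add: Lp_def)
qed

end

section \<open>Truncated extremals\<close>

text \<open>For a >= b expand a z^p - b x^p around a - b: the main term is ((a-b) z)^p, the rest
  carries z^p - x^p, which Taylor and Young bound by half of the main term plus multiples of |z -
  x|^p. This is the algebra of testing an equation for U with U times the p-th power of a
  cut-off.\<close>

lemma Caccioppoli_pointwise:
 fixes p :: real
 assumes p: "p > 1"
 obtains c C where "c > 0" "C > 0"
  "!!a b z x. a >= 0 ==> b >= 0 ==> z : {0..1} ==> x : {0..1} ==>
   c*abs (a*z - b*x) powr p - C*(a powr p + b powr p)*abs (z - x) powr p
    <= pw (p - 1) 1 (- 1) (a - b)*(a*z powr p - b*x powr p)"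
proof -
 obtain K where K: "K > 0" "!!a b. abs (pw p 1 1 (a + b) - pw p 1 1 a - p*pw (p - 1) 1 (- 1) a*b)
  <= 1*(abs a powr (p - 1)*abs b) + K*abs b powr p" using pw_taylor_bound[OF p zero_less_one, of 1 1] by auto
 \<comment> \<open>Makes the p + 1 copies of the Young error equal to half of the main term.\<close>
 define e where "e = 1/(2*(p + 1))"
 have e: "e > 0" "(p + 1)*e = 1/2" using p by (auto simp: e_def)
 define D where "D = (1/e) powr (p - 1)"
 have D: "D >= 0" by (simp add: D_def)
 define c where "c = 1/2/2 powr p"
 define C where "C = (p + 1)*D + K + 1/2"
 have C: "C > 0" using p D K by (auto simp: C_def intro!: add_nonneg_pos add_nonneg_nonneg)
 have main: "c*abs (a*z - b*x) powr p - C*(a powr p + b powr p)*abs (z - x) powr p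
    <= (a - b) powr (p - 1)*(a*z powr p - b*x powr p)"
  if ab: "a >= b" "b >= 0" and zx: "0 <= z" "0 <= x" for a b z x :: real
 proof -
  define d where "d = a - b"
  define h where "h = abs (z - x)"
  have d: "d >= 0" "a = d + b" using ab by (auto simp: d_def)
  have h: "h >= 0" by (simp add: h_def)
  have zpx: "abs (z powr p - x powr p) <= (p + 1)*(z powr (p - 1)*h) + K*h powr p"
  proof -
   have "abs (x powr p - z powr p - p*z powr (p - 1)*(x - z)) <= z powr (p - 1)*h + K*h powr p"
    using K(2)[of z "x - z"] zx by (simp add: pw_def h_def abs_minus_commute)
   moreover have "abs (p*z powr (p - 1)*(x - z)) = p*(z powr (p - 1)*h)" using p by (simp add: abs_mult h_def abs_minus_commute)
   ultimately show ?thesis by (simp add: distrib_right)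
  qed
  have dd: "d powr (p - 1)*d = d powr p" using powr_mult_base[OF d(1), of "p - 1"] by (simp add: mult.commute)
  have "d powr (p - 1)*(a*z powr p - b*x powr p) = d powr p*z powr p + d powr (p - 1)*b*(z powr p - x powr p)"
   unfolding d(2) dd[symmetric] by (simp add: algebra_simps)
  also have "... >= (d*z) powr p - d powr (p - 1)*b*((p + 1)*(z powr (p - 1)*h) + K*h powr p)"
  proof -
   have "d powr (p - 1)*b*abs (z powr p - x powr p) <= d powr (p - 1)*b*((p + 1)*(z powr (p - 1)*h) + K*h powr p)"
    using ab zpx by (intro mult_left_mono) auto
   moreover have "- (d powr (p - 1)*b*abs (z powr p - x powr p)) <= d powr (p - 1)*b*(z powr p - x powr p)"
    using ab by (cases "z powr p >= x powr p") (auto simp: algebra_simps mult_left_mono mult_right_mono intro: order_trans[of _ 0])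
   ultimately show ?thesis by (simp add: powr_mult)
  qed
  finally have 1: "(d*z) powr p - d powr (p - 1)*b*((p + 1)*(z powr (p - 1)*h) + K*h powr p) <= d powr (p - 1)*(a*z powr p - b*x powr p)" .
  have 2: "(d*z) powr (p - 1)*(b*h) <= e*(d*z) powr p + D*(b*h) powr p" unfolding D_def using p e ab d h zx by (intro Young_eps) auto
  have 3: "d powr (p - 1)*b <= a powr p"
  proof -
   have "d powr (p - 1)*b <= a powr (p - 1)*a" using ab p d by (intro mult_mono powr_mono2) auto
   also have "... = a powr p" using powr_mult_base[of a "p - 1"] ab by (simp add: mult.commute)
   finally show ?thesis .
  qed
  have "d powr (p - 1)*b*((p + 1)*(z powr (p - 1)*h) + K*h powr p)
   = (p + 1)*((d*z) powr (p - 1)*(b*h)) + K*(d powr (p - 1)*b*h powr p)" by (simp add: powr_mult algebra_simps)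
  also have "... <= (p + 1)*(e*(d*z) powr p + D*(b*h) powr p) + K*(a powr p*h powr p)"
   using 2 3 p K by (intro add_mono mult_left_mono mult_right_mono) auto
  also have "... = 1/2*(d*z) powr p + (p + 1)*D*(b powr p*h powr p) + K*(a powr p*h powr p)"
   using e(2) by (simp add: distrib_left mult.assoc[symmetric] powr_mult)
  finally have 4: "1/2*(d*z) powr p - (p + 1)*D*(b powr p*h powr p) - K*(a powr p*h powr p) <= d powr (p - 1)*(a*z powr p - b*x powr p)"
   using 1 by linarith
  have "abs (a*z - b*x) powr p <= (d*z + b*h) powr p"
  proof (rule powr_mono2)
   have "a*z - b*x = d*z + b*(z - x)" unfolding d(2) by (simp add: algebra_simps)
   then have "abs (a*z - b*x) <= abs (d*z) + abs (b*(z - x))" by (simp only: abs_triangle_ineq)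
   then show "abs (a*z - b*x) <= d*z + b*h" using d zx ab by (simp add: abs_mult h_def)
  qed (use p in auto)
  also have "... <= 2 powr p*((d*z) powr p + (b*h) powr p)" using p d zx ab h by (intro powr_add_le) auto
  finally have "c*abs (a*z - b*x) powr p <= c*(2 powr p*((d*z) powr p + (b*h) powr p))" by (intro mult_left_mono) (auto simp: c_def)
  also have "... = 1/2*(d*z) powr p + 1/2*(b powr p*h powr p)" by (simp add: c_def powr_mult distrib_left)
  finally have 5: "c*abs (a*z - b*x) powr p <= 1/2*(d*z) powr p + 1/2*(b powr p*h powr p)" .
  have "(p + 1)*D*(b powr p*h powr p) + K*(a powr p*h powr p) + 1/2*(b powr p*h powr p)
   <= C*(b powr p*h powr p) + C*(a powr p*h powr p)"
  proof -
   have "((p + 1)*D + 1/2)*(b powr p*h powr p) <= C*(b powr p*h powr p)" using K by (intro mult_right_mono) (auto simp: C_def)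
   moreover have "K*(a powr p*h powr p) <= C*(a powr p*h powr p)" using D p by (intro mult_right_mono) (auto simp: C_def)
   ultimately show ?thesis by (simp add: distrib_right)
  qed
  also have "... = C*(a powr p + b powr p)*abs (z - x) powr p" by (simp add: h_def algebra_simps)
  finally show ?thesis using 4 5 unfolding d_def by linarith
 qed
 show ?thesis
 proof (rule that[of c C])
  show "c > 0" by (simp add: c_def)
  fix a b z x :: real assume *: "a >= 0" "b >= 0" "z : {0..1}" "x : {0..1}"
  show "c*abs (a*z - b*x) powr p - C*(a powr p + b powr p)*abs (z - x) powr p
    <= pw (p - 1) 1 (- 1) (a - b)*(a*z powr p - b*x powr p)"
  proof (cases "a >= b")
   case True
   then show ?thesis using main[of b a z x] * by (simp add: pw_def)
  next
   case False
   then show ?thesis using main[of a b x z] * by (simp add: pw_def abs_minus_commute[of "b*x"] abs_minus_commute[of x] algebra_simps)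
  qed
 qed (rule C)
qed

context frac
begin

lemma mult_DD:
 assumes u: "u : DD" "Ll p u" and f: "f : Bl" "!!x. 0 <= f x" "!!x. f x <= 1"
  and R: "R > 0" and L: "!!x y. abs (f x - f y) <= L*min 1 (norm (x - y)/R)" and L0: "L >= 0"
 shows "(%x. f x*u x) : DD"
proof -
 have um: "u : Bl" using u by auto
 have m: "(%x. f x*u x) : Bl" using f um by measurable
 have le: "abs (f x*u x) <= 1*abs (u x)" for x using f(2,3)[of x] by (simp add: abs_mult mult_left_le_one_le)
 have 1: "Ll ps (%x. f x*u x)" by (rule Lp_bound[OF DD_D(3)[OF u(1)] m, where C = 1]) (use le ps_facts in auto)
 define w where "w = (%x. 2 powr p*L powr p*abs (u x) powr p)"
 have w: "integrable leb w" "!!x. w x >= 0" using u by (auto simp: w_def)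
 have "Lp LL p (dq s p (%x. f x*u x))" unfolding Lp_def
 proof
  show dm: "dq s p (%x. f x*u x) : borel_measurable LL" using m by measurable
  show "integrable LL (%z. abs (dq s p (%x. f x*u x) z) powr p)"
  proof (rule Bochner_Integration.integrable_bound)
   show "integrable LL (%z. 2 powr p*abs (dq s p u z) powr p + (w (fst z) + w (snd z)) * kR R z)"
    by (intro Bochner_Integration.integrable_add integrable_mult_right kR_weight(1)[OF R w]) (use u in auto)
   show "(%z. abs (dq s p (%x. f x*u x) z) powr p) : borel_measurable LL" using dm by measurable
   show "AE z in LL. norm (abs (dq s p (%x. f x*u x) z) powr p) <= norm (2 powr p*abs (dq s p u z) powr p + (w (fst z) + w (snd z)) * kR R z)"
   proof (rule AE_I2)
    fix z :: "(real^'n) \<times> (real^'n)"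
    define x where "x = fst z"
    define y where "y = snd z"
    define \<rho> where "\<rho> = min 1 (norm (x - y)/R)"
    have \<rho>: "\<rho> >= 0" using R by (simp add: \<rho>_def)
    have "abs (f x*u x - f y*u y) = abs (f x*(u x - u y) + u y*(f x - f y))" by (simp add: algebra_simps)
    also have "... <= abs (f x*(u x - u y)) + abs (u y*(f x - f y))" by (rule abs_triangle_ineq)
    also have "... <= abs (u x - u y) + abs (u y)*(L*\<rho>)"
     using f(2,3)[of x] L[of x y] by (intro add_mono) (auto simp: abs_mult mult_left_le_one_le \<rho>_def intro!: mult_left_mono)
    finally have "abs (f x*u x - f y*u y) powr p <= (abs (u x - u y) + abs (u y)*(L*\<rho>)) powr p" using p0 by (intro powr_mono2) auto
    also have "... <= 2 powr p*(abs (u x - u y) powr p + (abs (u y)*(L*\<rho>)) powr p)" using p1 \<rho> L0 by (intro powr_add_le) auto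
    also have "... = 2 powr p*abs (u x - u y) powr p + w y*\<rho> powr p" by (simp add: w_def powr_mult algebra_simps)
    also have "... <= 2 powr p*abs (u x - u y) powr p + (w x + w y)*\<rho> powr p" using w(2) by (intro add_left_mono mult_right_mono) auto
    finally have "abs (f x*u x - f y*u y) powr p/norm (x - y) powr (N + s*p) <=
     (2 powr p*abs (u x - u y) powr p + (w x + w y)*\<rho> powr p)/norm (x - y) powr (N + s*p)" by (intro divide_right_mono) auto
    then have "abs (dq s p (%x. f x*u x) z) powr p <= 2 powr p*abs (dq s p u z) powr p + (w (fst z) + w (snd z)) * kR R z"
     unfolding dq_powr_N[OF p0] by (simp add: x_def y_def \<rho>_def add_divide_distrib)
    then show "norm (abs (dq s p (%x. f x*u x) z) powr p) <= norm (2 powr p*abs (dq s p u z) powr p + (w (fst z) + w (snd z)) * kR R z)" by simp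
   qed
  qed
 qed
 then show ?thesis using 1 m by (simp add: DD_def)
qed

text \<open>A cut-off that keeps the tail: 0 on the ball of radius R and 1 beyond 2R. The truncation
  of an extremal is therefore 1 - \<open>cut R\<close> times it.\<close>

definition cut :: "real => real^'n => real" where
 "cut R x = min 1 (max 0 (norm x/R - 1))"

lemma cut_facts:
 assumes R: "R > 0"
 shows "0 <= cut R x" "cut R x <= 1" "norm x <= R ==> cut R x = 0" "norm x >= 2*R ==> cut R x = 1"
  "abs (cut R x - cut R y) <= min 1 (norm (x - y)/R)" "cut R : Bl"
proof -
 have c0: "0 <= cut R x" and c1: "cut R x <= 1" for x by (auto simp: cut_def)
 show "0 <= cut R x" "cut R x <= 1" by (rule c0, rule c1)
 show "norm x <= R ==> cut R x = 0" using R by (simp add: cut_def divide_le_eq_1)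
 show "norm x >= 2*R ==> cut R x = 1"
 proof -
  assume "norm x >= 2*R"
  then have "norm x/R >= 2" using R by (simp add: le_divide_eq)
  then show ?thesis by (simp add: cut_def)
 qed
 have "abs (cut R x - cut R y) <= abs (norm x/R - norm y/R)" by (auto simp: cut_def min_def max_def)
 also have "... = abs (norm x - norm y)/R" using R by (simp add: diff_divide_distrib[symmetric] abs_divide)
 also have "... <= norm (x - y)/R" using norm_triangle_ineq3[of x y] R by (intro divide_right_mono) auto
 finally have "abs (cut R x - cut R y) <= norm (x - y)/R" .
 moreover have "abs (cut R x - cut R y) <= 1" using c0[of x] c0[of y] c1[of x] c1[of y] by linarith
 ultimately show "abs (cut R x - cut R y) <= min 1 (norm (x - y)/R)" by simp
 have "cut R : borel_measurable borel" unfolding cut_def[abs_def] by measurable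
 then show "cut R : Bl" by (rule measurable_borel_lebesgue)
qed

lemma tail_tendsto_0:
 fixes f :: "real^'n => real"
 assumes f: "integrable leb f" and e: "e > 0"
 obtains R0 where "R0 > 0" "!!R. R >= R0 ==> abs (\<integral>x. ind {x. norm x >= R} x*f x \<partial>leb) < e"
proof -
 define g where "g = (%R. (LI x. ind {x. norm x >= R} x*abs (f x)))"
 have S: "{x::real^'n. norm x >= R} : sets leb" for R
  using borel_closed[of "{x::real^'n. norm x >= R}"] by (auto intro!: closed_Collect_le continuous_intros)
 have i: "integrable leb (%x. ind {x. norm x >= R} x*abs (f x))" for R
  using f S by (intro Bochner_Integration.integrable_bound[OF integrable_abs[OF f]]) (auto simp: indicator_def)
 have "(%n. g (real n)) ---> (\<integral>x. 0 \<partial>(leb :: (real^'n) measure))" unfolding g_def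
 proof (rule integral_dominated_convergence[where w = "%x. abs (f x)"])
  show "AE x in leb. (%n. ind {x. norm x >= real n} x*abs (f x)) ---> 0"
  proof (rule AE_I2)
   fix x :: "real^'n"
   obtain n0 :: nat where n0: "norm x < real n0" using reals_Archimedean2 by blast
   have "EV n. ind {x. norm x >= real n} x*abs (f x) = 0"
    using eventually_ge_at_top[of n0] by eventually_elim (use n0 in \<open>auto simp: indicator_def\<close>)
   then show "(%n. ind {x. norm x >= real n} x*abs (f x)) ---> 0" by (rule tendsto_eventually)
  qed
  show "(%x. ind {x. norm x >= real n} x*abs (f x)) : Bl" for n using i by auto
  show "AE x in leb. norm (ind {x. norm x >= real n} x*abs (f x)) <= abs (f x)" for n by (intro AE_I2) (auto simp: indicator_def)
 qed (use f in auto)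
 then have "EV n. g (real n) < e" using e by (intro order_tendstoD(2)) auto
 then obtain n where n: "g (real n) < e" "n >= 1"
  using eventually_happens'[OF sequentially_bot eventually_conj[OF _ eventually_ge_at_top[of 1]]] by blast
 show ?thesis
 proof (rule that[of "real n"])
  show "real n > 0" using n by simp
  fix R assume R: "R >= real n"
  have "abs (\<integral>x. ind {x. norm x >= R} x*f x \<partial>leb) <= (LI x. abs (ind {x. norm x >= R} x*f x))" by (rule integral_abs_bound)
  also have "... = (LI x. ind {x. norm x >= R} x*abs (f x))" by (simp add: abs_mult)
  also have "... <= g (real n)" unfolding g_def using R by (intro integral_mono i mult_right_mono) (auto simp: indicator_def)
  finally show "abs (\<integral>x. ind {x. norm x >= R} x*f x \<partial>leb) < e" using n by simp
 qed
qed

text \<open>The weight of the cut-off errors at scale R: a large constant only beyond R/2, where U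
  in L^p has little mass, and a small one elsewhere. This turns errors of order R^(-s p) into
  o(R^(-s p)).\<close>

definition wt :: "(real^'n => real) => real => real => real => real^'n => real" where
 "wt U C e R x = (C*ind {x. norm x >= R/2} x + e)*abs (U x) powr p"

lemma wt_small:
 assumes U: "Ll p U" and C: "C >= 0" and e: "e > 0"
 obtains R0 where "R0 > 0" "!!R. R >= R0 ==> integrable LL (%z. (wt U C e R (fst z) + wt U C e R (snd z)) * kR R z)"
  "!!R. R >= R0 ==> (\<integral>z. (wt U C e R (fst z) + wt U C e R (snd z)) * kR R z \<partial>LL) <= 2*\<kappa>*(e*(1 + Il p U))*R powr (- (s*p))"
proof -
 define f where "f = (%x. abs (U x) powr p)"
 have f: "integrable leb f" using U by (auto simp: f_def)
 obtain R0 where R0: "R0 > 0" "!!R. R >= R0 ==> abs (\<integral>x. ind {x. norm x >= R} x*f x \<partial>leb) < e/(C + 1)"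
  using tail_tendsto_0[OF f, of "e/(C + 1)"] e C by auto
 have S: "{x::real^'n. norm x >= R} : sets leb" for R
  using borel_closed[of "{x::real^'n. norm x >= R}"] by (auto intro!: closed_Collect_le continuous_intros)
 have i: "integrable leb (%x. ind {x. norm x >= R} x*f x)" for R
  using f S by (intro Bochner_Integration.integrable_bound[OF f]) (auto simp: indicator_def)
 have w: "integrable leb (wt U C e R)" "!!x. wt U C e R x >= 0"
  "(LI x. wt U C e R x) = C*(LI x. ind {x. norm x >= R/2} x*f x) + e*Il p U" for R
 proof -
  have eq: "wt U C e R = (%x. C*(ind {x. norm x >= R/2} x*f x) + e*f x)" by (rule ext) (simp add: wt_def f_def algebra_simps)
  show "integrable leb (wt U C e R)" unfolding eq by (intro Bochner_Integration.integrable_add integrable_mult_right i f)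
  show "wt U C e R x >= 0" for x using C e by (simp add: wt_def)
  show "(LI x. wt U C e R x) = C*(LI x. ind {x. norm x >= R/2} x*f x) + e*Il p U" unfolding eq using i[of "R/2"] f by (simp add: Lpi_def f_def)
 qed
 show ?thesis
 proof (rule that[of "2*R0"])
  show "2*R0 > 0" using R0 by simp
  fix R assume R: "R >= 2*R0"
  then have R': "R > 0" "R/2 >= R0" using R0 by auto
  show "integrable LL (%z. (wt U C e R (fst z) + wt U C e R (snd z)) * kR R z)" by (rule kR_weight(1)[OF R'(1) w(1,2)])
  have "C*(LI x. ind {x. norm x >= R/2} x*f x) <= C*(e/(C + 1))" using R0(2)[OF R'(2)] C by (intro mult_left_mono) auto
  also have "... <= e" using C e by (simp add: field_simps)
  finally have "(LI x. wt U C e R x) <= e*(1 + Il p U)" unfolding w(3) by (simp add: distrib_left)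
  then have "2*\<kappa>*R powr (- (s*p))*(LI x. wt U C e R x) <= 2*\<kappa>*R powr (- (s*p))*(e*(1 + Il p U))"
   using \<kappa>(1) by (intro mult_left_mono) auto
  then show "(\<integral>z. (wt U C e R (fst z) + wt U C e R (snd z)) * kR R z \<partial>LL) <= 2*\<kappa>*(e*(1 + Il p U))*R powr (- (s*p))"
   using kR_weight(2)[OF R'(1) w(1,2), of R] by (simp add: mult_ac)
 qed
qed

text \<open>Test the Euler-Lagrange equation with U times the p-th power of \<open>cut R\<close>.
  The Caccioppoli inequality yields the energy of the tail, the critical term is absorbed since U
  has little L^ps mass beyond R, and the cut-off errors have the form \<open>wt\<close>.\<close>

lemma exterior_energy:
 assumes U: "U : DD" "!!x. U x >= 0" "Il ps U = 1" "G U = Sob" and UL: "Ll p U" and e: "e > 0"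
 obtains R0 where "R0 > 0" "!!R. R >= R0 ==> G (%x. cut R x*U x) <= e*R powr (- (s*p))"
proof -
 obtain c C where cC: "c > 0" "C > 0"
  "!!a b z x. a >= 0 ==> b >= 0 ==> z : {0..1} ==> x : {0..1} ==>
   c*abs (a*z - b*x) powr p - C*(a powr p + b powr p)*abs (z - x) powr p
    <= pw (p - 1) 1 (- 1) (a - b)*(a*z powr p - b*x powr p)" by (rule Caccioppoli_pointwise[OF p1]) (rule that; assumption)
 define q where "q = c*e/(4*\<kappa>*(1 + Il p U))"
 have q: "q > 0" using cC e \<kappa>(1) by (simp add: q_def add_pos_nonneg)
 define e' where "e' = q/2 powr p"
 have e': "e' > 0" using q by (simp add: e'_def)
 define D where "D = (1/e') powr (p - 1)"
 define K where "K = C + 2 powr p*(D + c)"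
 have K: "K >= 0" using cC by (simp add: K_def D_def)
 obtain R1 where R1: "R1 > 0" "!!R. R >= R1 ==> integrable LL (%z. (wt U K q R (fst z) + wt U K q R (snd z)) * kR R z)"
  "!!R. R >= R1 ==> (\<integral>z. (wt U K q R (fst z) + wt U K q R (snd z)) * kR R z \<partial>LL) <= 2*\<kappa>*(q*(1 + Il p U))*R powr (- (s*p))"
  by (rule wt_small[OF UL K q]) (rule that; assumption)
 define \<sigma> where "\<sigma> = 1 - p/ps"
 have \<sigma>: "\<sigma> > 0" using ps_facts(1,3) p0 by (simp add: \<sigma>_def del: ps_facts(5))
 have "(c/2) powr (1/\<sigma>) > 0" using cC by simp
 then obtain R2 where R2: "R2 > 0" "!!R. R >= R2 ==> abs (\<integral>x. ind {x. norm x >= R} x*abs (U x) powr ps \<partial>leb) < (c/2) powr (1/\<sigma>)"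
  by (rule tail_tendsto_0[OF LpD(2)[OF DD_D(3)[OF U(1)]]]) (rule that; assumption)
 show ?thesis
 proof (rule that[of "max R1 R2"])
  show "max R1 R2 > 0" using R1 by simp
  fix R assume "R >= max R1 R2"
  then have R: "R >= R1" "R >= R2" "R > 0" using R1 by auto
  note cf = cut_facts[OF R(3)]
  define Z where "Z = (%x. cut R x*U x)"
  define Zp where "Zp = (%x. cut R x powr p*U x)"
  have ZD: "Z : DD" unfolding Z_def by (rule mult_DD[OF U(1) UL cf(6) cf(1) cf(2) R(3), where L = 1]) (use cf(5) in auto)
  have ZpD: "Zp : DD" unfolding Zp_def
  proof (rule mult_DD[OF U(1) UL _ _ _ R(3), where L = p])
   show "(%x. cut R x powr p) : Bl" using cf(6) by measurable
   show "0 <= cut R x powr p" for x by simp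
   show "cut R x powr p <= 1" for x using cf(1,2)[of x] p0 by (simp add: powr_le1)
   fix x y
   have L: "a powr p - b powr p <= p*(a - b)" if "0 <= b" "b <= a" "a <= 1" for a b :: real
   proof (cases "a = b")
    case False
    then have ab: "b < a" using that by simp
    have "EX z. b < z \<and> z < a \<and> pw p 1 1 a - pw p 1 1 b = (a - b)*(p*pw (p - 1) 1 (- 1) z)"
     using ab has_derivative_pw[OF p1, of 1 1] by (intro MVT2) auto
    then obtain z where z: "b < z" "z < a" "pw p 1 1 a - pw p 1 1 b = (a - b)*(p*pw (p - 1) 1 (- 1) z)" by blast
    have "pw (p - 1) 1 (- 1) z <= 1" using z that p1 by (auto simp: pw_def powr_le1)
    then have "(a - b)*(p*pw (p - 1) 1 (- 1) z) <= (a - b)*(p*1)" using ab p0 by (intro mult_left_mono) auto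
    then show ?thesis using z that by (simp add: pw_def mult.commute)
   qed simp
   have "abs (cut R x powr p - cut R y powr p) <= p*abs (cut R x - cut R y)"
   proof (cases "cut R y <= cut R x")
    case True
    then show ?thesis using L[of "cut R y" "cut R x"] cf(1,2) p0 by (auto simp: powr_mono2)
   next
    case False
    then show ?thesis using L[of "cut R x" "cut R y"] cf(1,2) p0 powr_mono2[of p "cut R x" "cut R y"] by auto
   qed
   also have "... <= p*min 1 (norm (x - y)/R)" using cf(5)[of x y] p0 by (intro mult_left_mono) auto
   finally show "abs (cut R x powr p - cut R y powr p) <= p*min 1 (norm (x - y)/R)" .
  qed (use p0 in simp)
  have pt: "c*abs (Z x - Z y) powr p <= pw (p - 1) 1 (- 1) (U x - U y)*(Zp x - Zp y) + (wt U K q R x + wt U K q R y)*min 1 (norm (x - y)/R) powr p" for x y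
  proof -
   define \<rho> where "\<rho> = min 1 (norm (x - y)/R)"
   have \<rho>: "\<rho> >= 0" using R by (simp add: \<rho>_def)
   have wt0: "wt U K q R x >= 0" for x using K q by (simp add: wt_def)
   \<comment> \<open>A point deep inside, with value a, against one beyond R, with value b. Their
     distance is at least R/2, hence r >= 2^(-p). Young with the small \<open>e'\<close> leaves only
     a small coefficient on the inner value, whose total mass is not small.\<close>
   have far: "c*abs (b*\<xi>) powr p <= pw (p - 1) 1 (- 1) (a - b)*(- (b*\<xi> powr p)) + (q*a powr p + (K + q)*b powr p)*r"
    if ab: "a >= 0" "b >= 0" "0 <= \<xi>" "\<xi> <= 1" "r >= 1/2 powr p" for a b \<xi> r
   proof -
    have \<xi>p: "\<xi> powr p <= 1" using ab p0 by (simp add: powr_le1)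
    have 1: "c*abs (b*\<xi>) powr p <= c*b powr p" using ab cC \<xi>p by (simp add: powr_mult abs_mult mult_left_le)
    have 2: "- (e'*a powr p + D*b powr p) <= pw (p - 1) 1 (- 1) (a - b)*(- (b*\<xi> powr p))"
    proof (cases "a >= b")
     case True
     have "(a - b) powr (p - 1)*(b*\<xi> powr p) <= a powr (p - 1)*(b*1)" using True ab p1 \<xi>p by (intro mult_mono powr_mono2) auto
     also have "... <= e'*a powr p + D*b powr p" unfolding D_def mult_1_right using p1 e' ab by (intro Young_eps) auto
     finally show ?thesis using True by (simp add: pw_def)
    next
     case False
     then have "0 <= pw (p - 1) 1 (- 1) (a - b)*(- (b*\<xi> powr p))" using ab by (simp add: pw_def)
     moreover have "0 <= e'*a powr p + D*b powr p" using e' by (simp add: D_def)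
     ultimately show ?thesis by linarith
    qed
    have "e'*a powr p + D*b powr p + c*b powr p <= (q*a powr p + (K + q)*b powr p)*(1/2 powr p)"
    proof -
     have "(D + c)*b powr p <= (K + q)*(1/2 powr p)*b powr p" using cC q by (intro mult_right_mono) (auto simp: K_def field_simps)
     then show ?thesis by (simp add: e'_def algebra_simps add_divide_distrib)
    qed
    also have "... <= (q*a powr p + (K + q)*b powr p)*r" using K q ab by (intro mult_left_mono) auto
    finally show ?thesis using 1 2 by linarith
   qed
   have rr: "\<rho> powr p >= 1/2 powr p" if "norm x < R/2 \<and> norm y > R \<or> norm y < R/2 \<and> norm x > R"
   proof -
    have "norm (x - y) >= R/2" using that norm_triangle_ineq3[of x y] by linarith
    then have "norm (x - y)/R >= 1/2" using R by (simp add: field_simps)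
    then have "1/2 <= \<rho>" by (simp add: \<rho>_def)
    then have "(1/2) powr p <= \<rho> powr p" using p0 by (intro powr_mono2) auto
    then show ?thesis by (simp add: powr_divide)
   qed
   have c0x: "norm x < R/2 ==> cut R x = 0" and c0y: "norm y < R/2 ==> cut R y = 0" using cf(3)[of x] cf(3)[of y] R(3) by auto
   consider "cut R x = 0" "cut R y = 0" | "norm x >= R/2" "norm y >= R/2" | "norm x < R/2" "cut R y \<noteq> 0" | "norm y < R/2" "cut R x \<noteq> 0"
    using c0x c0y by (meson not_le)
   then show ?thesis
   proof cases
    case 1
    then show ?thesis using wt0[of x] wt0[of y] by (simp add: Z_def Zp_def)
   next
    case 2
    have "C*(U x powr p + U y powr p)*abs (cut R x - cut R y) powr p <= (wt U K q R x + wt U K q R y)*\<rho> powr p"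
    proof (rule mult_mono)
     have "C*t <= (K + q)*t" if "t >= 0" for t
     proof (rule mult_right_mono[OF _ that])
      have "0 <= 2 powr p*(D + c)" using cC by (simp add: D_def)
      then show "C <= K + q" using q by (simp add: K_def)
     qed
     then have "C*U x powr p + C*U y powr p <= (K + q)*U x powr p + (K + q)*U y powr p" by (intro add_mono) auto
     then show "C*(U x powr p + U y powr p) <= wt U K q R x + wt U K q R y" using 2 U(2) by (simp add: wt_def distrib_left)
     show "abs (cut R x - cut R y) powr p <= \<rho> powr p" using cf(5)[of x y] p0 by (intro powr_mono2) (auto simp: \<rho>_def)
    qed (use wt0 in auto)
    moreover have "c*abs (Z x - Z y) powr p - C*(U x powr p + U y powr p)*abs (cut R x - cut R y) powr p <= pw (p - 1) 1 (- 1) (U x - U y)*(Zp x - Zp y)"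
     using cC(3)[OF U(2)[of x] U(2)[of y], of "cut R x" "cut R y"] cf(1,2) by (simp add: Z_def Zp_def mult.commute)
    ultimately show ?thesis unfolding \<rho>_def by linarith
   next
    case 3
    then have nx: "cut R x = 0" and ny: "norm y > R" using cf(3)[of x] cf(3)[of y] R(3) by (auto simp: not_le[symmetric])
    have "c*abs (U y*cut R y) powr p <= pw (p - 1) 1 (- 1) (U x - U y)*(- (U y*cut R y powr p)) + (q*U x powr p + (K + q)*U y powr p)*\<rho> powr p"
     by (rule far) (use U(2) cf(1,2) rr 3 ny in auto)
    also have "q*U x powr p + (K + q)*U y powr p = wt U K q R x + wt U K q R y" using 3 ny U(2) R(3) by (simp add: wt_def indicator_def)
    finally show ?thesis using nx by (simp add: Z_def Zp_def \<rho>_def mult.commute)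
   next
    case 4
    then have ny: "cut R y = 0" and nx: "norm x > R" using cf(3)[of x] cf(3)[of y] R(3) by (auto simp: not_le[symmetric])
    have "c*abs (U x*cut R x) powr p <= pw (p - 1) 1 (- 1) (U y - U x)*(- (U x*cut R x powr p)) + (q*U y powr p + (K + q)*U x powr p)*\<rho> powr p"
     by (rule far) (use U(2) cf(1,2) rr 4 nx in auto)
    also have "q*U y powr p + (K + q)*U x powr p = wt U K q R x + wt U K q R y" using 4 nx U(2) R(3) by (simp add: wt_def indicator_def)
    also have "pw (p - 1) 1 (- 1) (U y - U x)*(- (U x*cut R x powr p)) = pw (p - 1) 1 (- 1) (U x - U y)*(U x*cut R x powr p)" by (simp add: pw_def)
    finally show ?thesis using ny by (simp add: Z_def Zp_def \<rho>_def mult.commute)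
   qed
  qed
  have "c*G Z = (\<integral>z. c*abs (dq s p Z z) powr p \<partial>LL)" by (simp add: Lpi_def)
  also have "... <= (\<integral>z. pw (p - 1) 1 (- 1) (dq s p U z)*dq s p Zp z + (wt U K q R (fst z) + wt U K q R (snd z)) * kR R z \<partial>LL)"
  proof (rule integral_mono)
   show "integrable LL (%z. c*abs (dq s p Z z) powr p)" using ZD by auto
   show "integrable LL (%z. pw (p - 1) 1 (- 1) (dq s p U z)*dq s p Zp z + (wt U K q R (fst z) + wt U K q R (snd z)) * kR R z)"
    using DT_integrable[OF DD_D(2)[OF U(1)] DD_D(2)[OF ZpD] p1, of 1 "-1"] R1(2)[OF R(1)] by auto
   fix z
   show "c*abs (dq s p Z z) powr p <= pw (p - 1) 1 (- 1) (dq s p U z)*dq s p Zp z + (wt U K q R (fst z) + wt U K q R (snd z)) * kR R z"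
    unfolding dq_pair dq_powr_N[OF p0] using divide_right_mono[OF pt[of "fst z" "snd z"], of "norm (fst z - snd z) powr (N + s*p)"]
    by (simp add: add_divide_distrib)
  qed
  also have "... = EE U Zp + (\<integral>z. (wt U K q R (fst z) + wt U K q R (snd z)) * kR R z \<partial>LL)"
   using DT_integrable[OF DD_D(2)[OF U(1)] DD_D(2)[OF ZpD] p1, of 1 "-1"] R1(2)[OF R(1)]
   by (subst Bochner_Integration.integral_add) (auto simp: DT_def)
  also have "EE U Zp = Sob*DTl ps 1 1 U Zp" by (rule extremal_EL[OF U(1,3,4) ZpD])
  also have "Sob*DTl ps 1 1 U Zp <= c/2*G Z"
  proof -
   define V where "V = (%x. ind {x. norm x >= R} x*U x)"
   have Vm: "V : Bl" unfolding V_def using DD_D(1)[OF U(1)] borel_closed[of "{x::real^'n. norm x >= R}"]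
    by (intro borel_measurable_times borel_measurable_indicator) (auto intro!: closed_Collect_le continuous_intros)
   have VL: "Ll ps V" by (rule Lp_bound[OF DD_D(3)[OF U(1)] Vm, where C = 1]) (use ps_facts in \<open>auto simp: V_def indicator_def\<close>)
   have "DTl ps 1 1 U Zp = (LI x. abs (V x) powr (ps - p)*abs (Z x) powr p)" unfolding DT_def
   proof (rule Bochner_Integration.integral_cong[OF refl])
    fix x
    show "pw (ps - 1) 1 (- 1) (U x)*Zp x = abs (V x) powr (ps - p)*abs (Z x) powr p"
    proof (cases "norm x >= R")
     case True
     have "U x powr (ps - 1)*U x = U x powr (ps - p)*U x powr p"
      using powr_mult_base[of "U x" "ps - 1"] U(2)[of x] by (simp add: mult.commute powr_add[symmetric])
     then show ?thesis using True U(2)[of x] cf(1)[of x] by (simp add: V_def Z_def Zp_def pw_def powr_mult abs_mult mult_ac)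
    next
     case False
     then show ?thesis using cf(3)[of x] by (simp add: Z_def Zp_def)
    qed
   qed
   also have "... <= Il ps V powr \<sigma>*Nl ps Z powr p" unfolding \<sigma>_def by (rule Hoelder_powers(2)[OF VL DD_D(3)[OF ZD] p0 ps_facts(1)])
   also have "... <= c/2*Nl ps Z powr p"
   proof (rule mult_right_mono)
    have "Il ps V = (LI x. ind {x. norm x >= R} x*abs (U x) powr ps)"
     unfolding Lpi_def by (intro Bochner_Integration.integral_cong refl) (auto simp: V_def indicator_def)
    then have "Il ps V <= (c/2) powr (1/\<sigma>)" using R2(2)[OF R(2)] by simp
    then have "Il ps V powr \<sigma> <= ((c/2) powr (1/\<sigma>)) powr \<sigma>" using \<sigma> by (intro powr_mono2) auto
    then show "Il ps V powr \<sigma> <= c/2" using \<sigma> cC by (simp add: powr_powr)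
   qed simp
   finally have "Sob*DTl ps 1 1 U Zp <= Sob*(c/2*Nl ps Z powr p)" using Sob_pos by (intro mult_left_mono) auto
   also have "... <= c/2*G Z" using mult_left_mono[OF Sobolev[OF ZD], of "c/2"] cC by (simp add: mult_ac)
   finally show ?thesis .
  qed
  finally have "c*G Z <= c/2*G Z + (\<integral>z. (wt U K q R (fst z) + wt U K q R (snd z)) * kR R z \<partial>LL)" by simp
  then have "c/2*G Z <= 2*\<kappa>*(q*(1 + Il p U))*R powr (- (s*p))" using R1(3)[OF R(1)] by linarith
  also have "... = c/2*(e*R powr (- (s*p)))"
  proof -
   define y where "y = 1 + Il p U"
   have "y > 0" by (simp add: y_def add_pos_nonneg)
   then show ?thesis using \<kappa>(1) unfolding q_def y_def[symmetric] by (simp add: field_simps)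
  qed
  finally show "G (%x. cut R x*U x) <= e*R powr (- (s*p))" using cC unfolding Z_def by simp
 qed
qed

end

section \<open>Truncation into a ball and the strict deficit\<close>

context frac
begin

text \<open>Pairs are sorted by position. Where the cut-off vanishes at both points, the truncation
  equals U; beyond R/2 it is the difference of two tails, small by \<open>exterior_energy\<close>; a
  pair across the annulus is handled with a small \<open>e2\<close>. Only U itself contributes at
  order 1.\<close>

lemma interior_energy:
 assumes U: "U : DD" "!!x. U x >= 0" "Il ps U = 1" "G U = Sob" and UL: "Ll p U" and e: "e > 0"
 obtains R0 where "R0 > 0" "!!R. R >= R0 ==> (%x. (1 - cut R x)*U x) : DD"
  "!!R. R >= R0 ==> G (%x. (1 - cut R x)*U x) <= Sob + e*R powr (- (s*p))"
  "!!R. R >= R0 ==> 1 - Il ps (%x. (1 - cut R x)*U x) <= e*R powr (- (s*p))"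
proof -
 define M where "M = 1 + Il p U"
 have M: "M > 0" by (simp add: M_def add_pos_nonneg)
 define q where "q = e/(8*\<kappa>*M)"
 have q: "q > 0" using e \<kappa>(1) M by (simp add: q_def)
 define e2 where "e2 = q/(4 powr p)"
 have e2: "e2 > 0" using q by (simp add: e2_def)
 obtain C where C: "C > 0" "!!a b. abs (pw p 1 1 (a + b) - pw p 1 1 a) <= e2*abs a powr p + C*abs b powr p"
  by (rule pw_add_bound[OF p0 e2, of 1 1]) (rule that; assumption)
 define K where "K = 2 powr p*C"
 have K: "K >= 0" using C by (simp add: K_def)
 \<comment> \<open>Three demands on the tails: an energy error of at most a quarter of e, a mass
   loss of at most e, both in units of R^(-s p), and a quotient \<open>t\<close> of at most 1, so
   that raising it to the power ps/p >= 1 does not increase it.\<close>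
 define e1 where "e1 = min (e/(4*2 powr p*(1 + 4 powr (s*p)))) (min (e*Sob/4 powr (s*p)) (Sob/4 powr (s*p)))"
 have e1: "e1 > 0" using e Sob_pos by (simp add: e1_def add_pos_pos)
 obtain R1 where R1: "R1 > 0" "!!R. R >= R1 ==> integrable LL (%z. (wt U K q R (fst z) + wt U K q R (snd z)) * kR R z)"
  "!!R. R >= R1 ==> (\<integral>z. (wt U K q R (fst z) + wt U K q R (snd z)) * kR R z \<partial>LL) <= 2*\<kappa>*(q*(1 + Il p U))*R powr (- (s*p))"
  by (rule wt_small[OF UL K q]) (rule that; assumption)
 obtain R2 where R2: "R2 > 0" "!!R. R >= R2 ==> G (%x. cut R x*U x) <= e1*R powr (- (s*p))"
  by (rule exterior_energy[OF U UL e1]) (rule that; assumption)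
 define R0 where "R0 = max 1 (max R1 (4*R2))"
 have props: "(%x. (1 - cut R x)*U x) : DD \<and> G (%x. (1 - cut R x)*U x) <= Sob + e*R powr (- (s*p))
  \<and> 1 - Il ps (%x. (1 - cut R x)*U x) <= e*R powr (- (s*p))" if "R >= R0" for R
 proof -
  have R: "R >= 1" "R >= R1" "R >= R2" "R/4 >= R2" "R > 0" "R/4 > 0" using that R2 by (auto simp: R0_def)
  note cf = cut_facts[OF R(5)] and cf' = cut_facts[OF R(6)]
  define Z where "Z = (%x. cut R x*U x)"
  \<comment> \<open>With radius R/4 this cut-off already equals 1 from R/2 on.\<close>
  define Z' where "Z' = (%x. cut (R/4) x*U x)"
  define H where "H = (%x. (1 - cut R x)*U x)"
  have ZD: "Z : DD" unfolding Z_def by (rule mult_DD[OF U(1) UL cf(6) cf(1) cf(2) R(5), where L = 1]) (use cf(5) in auto)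
  have Z'D: "Z' : DD" unfolding Z'_def by (rule mult_DD[OF U(1) UL cf'(6) cf'(1) cf'(2) R(6), where L = 1]) (use cf'(5) in auto)
  have Heq: "H = (%x. U x + (- 1)*Z x)" by (simp add: H_def Z_def fun_eq_iff algebra_simps)
  have HD: "H : DD" unfolding Heq by (rule DD_lin[OF U(1) ZD])
  define P where "P = R powr (- (s*p))"
  have P: "P > 0" "P <= 1"
  proof -
   show "P > 0" using R by (simp add: P_def)
   have "R powr (- (s*p)) <= R powr 0" using R sp0 by (intro powr_mono) auto
   then show "P <= 1" using R by (simp add: P_def)
  qed
  have GZ: "G Z <= e1*P" "G Z' <= e1*4 powr (s*p)*P"
  proof -
   show "G Z <= e1*P" unfolding Z_def P_def by (rule R2(2)[OF R(3)])
   have "(R/4) powr (- (s*p)) = 4 powr (s*p)*P" using R by (simp add: P_def powr_divide powr_minus field_simps)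
   then show "G Z' <= e1*4 powr (s*p)*P" using R2(2)[OF R(4)] by (simp add: Z'_def)
  qed
  have pt: "abs (H x - H y) powr p <= abs (U x - U y) powr p + 2 powr p*(abs (Z x - Z y) powr p + abs (Z' x - Z' y) powr p)
    + (wt U K q R x + wt U K q R y)*min 1 (norm (x - y)/R) powr p" for x y
  proof -
   define \<rho> where "\<rho> = min 1 (norm (x - y)/R)"
   have wt0: "wt U K q R x >= 0" for x using K q by (simp add: wt_def)
   have nn: "0 <= 2 powr p*(abs (Z x - Z y) powr p + abs (Z' x - Z' y) powr p)" by simp
   have far: "abs (a - (1 - \<xi>)*b) powr p <= abs (a - b) powr p + (q*a powr p + (K + q)*b powr p)*r"
    if ab: "a >= 0" "b >= 0" "0 <= \<xi>" "\<xi> <= 1" "r >= 1/2 powr p" for a b \<xi> r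
   proof -
    have "abs (a - (1 - \<xi>)*b) powr p = pw p 1 1 ((a - b) + \<xi>*b)" by (simp add: pw_one_one algebra_simps)
    also have "... <= pw p 1 1 (a - b) + e2*abs (a - b) powr p + C*abs (\<xi>*b) powr p" using C(2)[of "a - b" "\<xi>*b"] by linarith
    also have "abs (a - b) powr p <= 2 powr p*(a powr p + b powr p)"
    proof -
     have "abs (a - b) powr p <= (a + b) powr p" using ab p0 by (intro powr_mono2) auto
     also have "... <= 2 powr p*(a powr p + b powr p)" using ab p1 by (intro powr_add_le) auto
     finally show ?thesis .
    qed
    also have "abs (\<xi>*b) powr p <= b powr p" using ab p0 by (intro powr_mono2) (auto simp: abs_mult mult_left_le_one_le)
    finally have "abs (a - (1 - \<xi>)*b) powr p <= abs (a - b) powr p + (e2*2 powr p*(a powr p + b powr p) + C*b powr p)"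
     using e2 C by (simp add: pw_one_one mult.assoc)
    also have "e2*2 powr p*(a powr p + b powr p) + C*b powr p = (q*a powr p + (K + q)*b powr p)*(1/2 powr p)"
    proof -
     have "(4::real) powr p = 2 powr p*2 powr p" using powr_mult[of 2 2 p] by simp
     then show ?thesis by (simp add: e2_def K_def field_simps)
    qed
    also have "... <= (q*a powr p + (K + q)*b powr p)*r" using K q ab by (intro mult_left_mono) auto
    finally show ?thesis by simp
   qed
   have rr: "\<rho> powr p >= 1/2 powr p" if "norm x < R/2 \<and> norm y > R \<or> norm y < R/2 \<and> norm x > R"
   proof -
    have "norm (x - y) >= R/2" using that norm_triangle_ineq3[of x y] by linarith
    then have "norm (x - y)/R >= 1/2" using R by (simp add: field_simps)
    then have "1/2 <= \<rho>" by (simp add: \<rho>_def)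
    then have "(1/2) powr p <= \<rho> powr p" using p0 by (intro powr_mono2) auto
    then show ?thesis by (simp add: powr_divide)
   qed
   have c0x: "norm x < R/2 ==> cut R x = 0" and c0y: "norm y < R/2 ==> cut R y = 0" using cf(3)[of x] cf(3)[of y] R(5) by auto
   consider "cut R x = 0" "cut R y = 0" | "norm x >= R/2" "norm y >= R/2" | "norm x < R/2" "cut R y \<noteq> 0" | "norm y < R/2" "cut R x \<noteq> 0"
    using c0x c0y by (meson not_le)
   then show ?thesis
   proof cases
    case 1
    then show ?thesis using wt0[of x] wt0[of y] nn by (simp add: H_def)
   next
    case 2
    then have c1: "cut (R/4) x = 1" "cut (R/4) y = 1" using cf'(4)[of x] cf'(4)[of y] by auto
    have "abs (H x - H y) = abs ((Z' x - Z' y) - (Z x - Z y))" using c1 by (simp add: H_def Z_def Z'_def algebra_simps)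
    also have "... <= abs (Z x - Z y) + abs (Z' x - Z' y)" by linarith
    finally have "abs (H x - H y) powr p <= (abs (Z x - Z y) + abs (Z' x - Z' y)) powr p" using p0 by (intro powr_mono2) auto
    also have "... <= 2 powr p*(abs (Z x - Z y) powr p + abs (Z' x - Z' y) powr p)" using p1 by (intro powr_add_le) auto
    finally show ?thesis using wt0[of x] wt0[of y] by (simp add: add_increasing add_increasing2)
   next
    case 3
    then have nx: "cut R x = 0" and ny: "norm y > R" using cf(3)[of x] cf(3)[of y] R(5) by (auto simp: not_le[symmetric])
    have "abs (U x - (1 - cut R y)*U y) powr p <= abs (U x - U y) powr p + (q*U x powr p + (K + q)*U y powr p)*\<rho> powr p"
     by (rule far) (use U(2) cf(1,2) rr 3 ny in auto)
    also have "q*U x powr p + (K + q)*U y powr p = wt U K q R x + wt U K q R y" using 3 ny U(2) R(5) by (simp add: wt_def indicator_def)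
    finally have *: "abs (U x - (1 - cut R y)*U y) powr p <= abs (U x - U y) powr p + (wt U K q R x + wt U K q R y)*\<rho> powr p" .
    have "H x - H y = U x - (1 - cut R y)*U y" using nx by (simp add: H_def)
    then have "abs (H x - H y) powr p = abs (U x - (1 - cut R y)*U y) powr p" by (simp only:)
    then show ?thesis unfolding \<rho>_def[symmetric] using*nn by linarith
   next
    case 4
    then have ny: "cut R y = 0" and nx: "norm x > R" using cf(3)[of x] cf(3)[of y] R(5) by (auto simp: not_le[symmetric])
    have "abs (U y - (1 - cut R x)*U x) powr p <= abs (U y - U x) powr p + (q*U y powr p + (K + q)*U x powr p)*\<rho> powr p"
     by (rule far) (use U(2) cf(1,2) rr 4 nx in auto)
    also have "q*U y powr p + (K + q)*U x powr p = wt U K q R x + wt U K q R y" using 4 nx U(2) R(5) by (simp add: wt_def indicator_def)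
    finally have *: "abs (U y - (1 - cut R x)*U x) powr p <= abs (U x - U y) powr p + (wt U K q R x + wt U K q R y)*\<rho> powr p"
     by (simp add: abs_minus_commute)
    have "abs (H x - H y) = abs (U y - (1 - cut R x)*U x)" using ny by (simp add: H_def abs_minus_commute)
    then have "abs (H x - H y) powr p = abs (U y - (1 - cut R x)*U x) powr p" by (simp only:)
    then show ?thesis unfolding \<rho>_def[symmetric] using*nn by linarith
   qed
  qed
  have "G H = (\<integral>z. abs (dq s p H z) powr p \<partial>LL)" by (simp add: Lpi_def)
  also have "... <= (\<integral>z. (abs (dq s p U z) powr p + 2 powr p*(abs (dq s p Z z) powr p + abs (dq s p Z' z) powr p)) + (wt U K q R (fst z) + wt U K q R (snd z)) * kR R z \<partial>LL)"
  proof (rule integral_mono)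
   show "integrable LL (%z. abs (dq s p H z) powr p)" using HD by auto
   show "integrable LL (%z. (abs (dq s p U z) powr p + 2 powr p*(abs (dq s p Z z) powr p + abs (dq s p Z' z) powr p)) + (wt U K q R (fst z) + wt U K q R (snd z)) * kR R z)"
    by (intro Bochner_Integration.integrable_add integrable_mult_right R1(2)[OF R(2)]) (use U(1) ZD Z'D in auto)
   fix z
   show "abs (dq s p H z) powr p <= (abs (dq s p U z) powr p + 2 powr p*(abs (dq s p Z z) powr p + abs (dq s p Z' z) powr p)) + (wt U K q R (fst z) + wt U K q R (snd z)) * kR R z"
    unfolding dq_powr_N[OF p0] using divide_right_mono[OF pt[of "fst z" "snd z"], of "norm (fst z - snd z) powr (N + s*p)"]
    by (simp add: add_divide_distrib distrib_left)
  qed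
  also have "... = (G U + 2 powr p*(G Z + G Z')) + (\<integral>z. (wt U K q R (fst z) + wt U K q R (snd z)) * kR R z \<partial>LL)"
  proof -
   have 1: "integrable LL (%z. abs (dq s p U z) powr p)" "integrable LL (%z. abs (dq s p Z z) powr p)" "integrable LL (%z. abs (dq s p Z' z) powr p)"
    using U(1) ZD Z'D by auto
   then have 2: "integrable LL (%z. abs (dq s p U z) powr p + 2 powr p*(abs (dq s p Z z) powr p + abs (dq s p Z' z) powr p))" by auto
   show ?thesis unfolding Bochner_Integration.integral_add[OF 2 R1(2)[OF R(2)]] using 1 by (simp add: Lpi_def)
  qed
  also have "... <= Sob + e*P"
  proof -
   have "2 powr p*(G Z + G Z') <= 2 powr p*(e1*P + e1*4 powr (s*p)*P)" using GZ by (intro mult_left_mono) auto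
   also have "... = (2 powr p*(1 + 4 powr (s*p))*P)*e1" by (simp add: algebra_simps)
   also have "... <= (2 powr p*(1 + 4 powr (s*p))*P)*(e/(4*2 powr p*(1 + 4 powr (s*p))))" using P by (intro mult_left_mono) (auto simp: e1_def)
   also have "... = e/4*P"
   proof -
    define y where "y = 1 + (4::real) powr (s*p)"
    have "y > 0" by (simp add: y_def add_pos_nonneg)
    then show ?thesis unfolding y_def[symmetric] by (simp add: field_simps)
   qed
   finally have 1: "2 powr p*(G Z + G Z') <= e/4*P" .
   have k4: "2*\<kappa>*(q*(1 + Il p U)) = e/4" using \<kappa>(1) M unfolding M_def[symmetric] q_def by (simp add: field_simps)
   have 2: "(\<integral>z. (wt U K q R (fst z) + wt U K q R (snd z)) * kR R z \<partial>LL) <= e/4*P" using R1(3)[OF R(2)] unfolding k4 P_def .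
   have "0 <= e*P" using e P by simp
   then show ?thesis using 1 2 U(4) by linarith
  qed
  finally have A: "G H <= Sob + e*P" .
  have "1 - Il ps H <= Il ps Z'"
  proof -
   have "1 = Il ps U" using U by simp
   also have "... <= (LI x. abs (H x) powr ps + abs (Z' x) powr ps)" unfolding Lpi_def
   proof (rule integral_mono)
    show "integrable leb (%x. abs (U x) powr ps)" by (rule LpD(2)[OF DD_D(3)[OF U(1)]])
    show "integrable leb (%x. abs (H x) powr ps + abs (Z' x) powr ps)"
     by (rule Bochner_Integration.integrable_add[OF LpD(2)[OF DD_D(3)[OF HD]] LpD(2)[OF DD_D(3)[OF Z'D]]])
    fix x
    show "abs (U x) powr ps <= abs (H x) powr ps + abs (Z' x) powr ps"
    proof (cases "norm x <= R")
     case True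
     then show ?thesis using cf(3)[of x] by (simp add: H_def)
    next
     case False
     then show ?thesis using cf'(4)[of x] R by (simp add: Z'_def)
    qed
   qed
   also have "... = Il ps H + Il ps Z'"
    unfolding Lpi_def by (rule Bochner_Integration.integral_add[OF LpD(2)[OF DD_D(3)[OF HD]] LpD(2)[OF DD_D(3)[OF Z'D]]])
   finally show ?thesis by simp
  qed
  also have "... <= e*P"
  proof -
   define t where "t = G Z'/Sob"
   have t0: "t >= 0" using Sob_pos by (simp add: t_def)
   have t1: "t <= 1" "t <= e*P"
   proof -
    have "t <= e1*4 powr (s*p)*P/Sob" unfolding t_def using GZ(2) Sob_pos by (intro divide_right_mono) auto
    moreover have "e1*4 powr (s*p) <= e*Sob"
    proof -
     have "e1 <= e*Sob/4 powr (s*p)" by (simp add: e1_def)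
     then show ?thesis by (simp add: field_simps)
    qed
    then have "e1*4 powr (s*p)*P/Sob <= e*Sob*P/Sob" using P Sob_pos by (intro divide_right_mono mult_right_mono) auto
    moreover have "e1*4 powr (s*p) <= Sob"
    proof -
     have "e1 <= Sob/4 powr (s*p)" by (simp add: e1_def)
     then show ?thesis by (simp add: field_simps)
    qed
    then have "e1*4 powr (s*p)*P/Sob <= Sob*1/Sob" using P Sob_pos e1 by (intro divide_right_mono mult_mono) auto
    moreover have "Sob*1/Sob = 1" "e*Sob*P/Sob = e*P" using Sob_pos by auto
    ultimately show "t <= 1" "t <= e*P" by linarith+
   qed
   have "Il ps Z' = (Nl ps Z' powr p) powr (ps/p)" using Lpn_powr[of ps leb Z'] ps_facts(3) p0 by (simp add: powr_powr)
   also have "... <= t powr (ps/p)" using Sobolev[OF Z'D] Sob_pos ps_facts(3) p0 by (intro powr_mono2) (auto simp: t_def field_simps)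
   also have "... <= t powr 1" using t0 t1 ps_facts(1) p0 by (intro powr_mono') (auto simp: le_divide_eq)
   finally show ?thesis using t0 t1 by simp
  qed
  finally show ?thesis using HD A unfolding H_def P_def by blast
 qed
 have "R0 > 0" by (simp add: R0_def)
 from that[OF this] props show ?thesis by blast
qed

text \<open>Truncation costs at most d R^(-s p) in energy and in mass, with d as small as desired,
  whereas after dilation into the ball the L^p term gains at least a fixed multiple of R^(-s
  p).\<close>

lemma strict_Sobolev_deficit:
 assumes Nsp: "s*p^2 < N" and \<rho>: "\<rho> > 0" and a: "a > 0"
 obtains e where "e : DD" "!!x. e x >= 0" "!!x. x \<notin> ball x0 \<rho> ==> e x = 0" "Ll p e"
  "G e - a*Il p e < Sob*Nl ps e powr p"
proof -
 obtain U where U: "U : DD" "!!x. U x >= 0" "Il ps U = 1" "G U = Sob" by (rule extremal_exists) (rule that; assumption)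
 have UL: "Ll p U" by (rule extremal_Lp[OF U Nsp])
 define m where "m = Il p U"
 have m: "m > 0"
 proof (rule ccontr)
  assume "\<not> m > 0"
  then have "Il p U = 0" using Lpi_nonneg[of leb p U] by (simp add: m_def)
  then have "AE x in leb. U x = 0" using Lpi_eq_0[OF UL] by simp
  then have "Il ps U = 0" using Lpi_eq_0[OF DD_D(3)[OF U(1)]] by simp
  then show False using U by simp
 qed
 \<comment> \<open>The coefficient of the L^p term after shrinking the support from radius 2R to
   \<open>\<rho>\<close>, with R^(-s p) factored out.\<close>
 define a' where "a' = a*(2/\<rho>) powr (- (s*p))"
 have a': "a' > 0" using a \<rho> by (simp add: a'_def)
 define d where "d = a'*(m/2)/(2*(1 + Sob))"
 have d: "d > 0" using a' m Sob_pos by (simp add: d_def)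
 have d2: "d*(1 + Sob) < a'*(m/2)"
 proof -
  have "1 + Sob > 0" using Sob_pos by simp
  then have "d*(1 + Sob) = a'*(m/2)/2" unfolding d_def by (simp add: field_simps)
  then show ?thesis using a' m by (simp only: mult_less_cancel_left_pos) simp
 qed
 obtain R0 where R0: "R0 > 0" "!!R. R >= R0 ==> (%x. (1 - cut R x)*U x) : DD"
  "!!R. R >= R0 ==> G (%x. (1 - cut R x)*U x) <= Sob + d*R powr (- (s*p))"
  "!!R. R >= R0 ==> 1 - Il ps (%x. (1 - cut R x)*U x) <= d*R powr (- (s*p))" by (rule interior_energy[OF U UL d]) (rule that; assumption)
 have "m/2 > 0" using m by simp
 then obtain R1 where R1: "R1 > 0" "!!R. R >= R1 ==> abs (\<integral>x. ind {x. norm x >= R} x*abs (U x) powr p \<partial>leb) < m/2"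
  by (rule tail_tendsto_0[OF LpD(2)[OF UL]]) (rule that; assumption)
 define R where "R = max R0 R1"
 have R: "R >= R0" "R >= R1" "R > 0" using R0(1) by (auto simp: R_def)
 note cf = cut_facts[OF R(3)]
 define H where "H = (%x. (1 - cut R x)*U x)"
 define P where "P = R powr (- (s*p))"
 have P: "P > 0" using R by (simp add: P_def)
 have HD: "H : DD" and HG: "G H <= Sob + d*P" and HL: "1 - Il ps H <= d*P" using R0(2-4)[OF R(1)] by (auto simp: H_def P_def)
 have H0: "H x >= 0" "H x <= U x" for x using cf(1,2)[of x] U(2)[of x] by (auto simp: H_def mult_left_le_one_le)
 have HLp: "Ll p H" by (rule Lp_bound[OF UL DD_D(1)[OF HD], where C = 1]) (use H0 p0 U(2) in auto)
 have Hm: "Il p H >= m/2"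
 proof -
  have S: "{x::real^'n. norm x >= R} : sets leb"
   using borel_closed[of "{x::real^'n. norm x >= R}"] by (auto intro!: closed_Collect_le continuous_intros)
  have iU: "integrable leb (%x. abs (U x) powr p)" by (rule LpD(2)[OF UL])
  have i: "integrable leb (%x. ind {x. norm x >= R} x*abs (U x) powr p)"
   by (rule Bochner_Integration.integrable_bound[OF iU]) (use S UL in \<open>auto simp: indicator_def\<close>)
  have "m <= (LI x. abs (H x) powr p + ind {x. norm x >= R} x*abs (U x) powr p)" unfolding m_def Lpi_def
  proof (rule integral_mono[OF iU Bochner_Integration.integrable_add[OF LpD(2)[OF HLp] i]])
   fix x
   show "abs (U x) powr p <= abs (H x) powr p + ind {x. norm x >= R} x*abs (U x) powr p"
   proof (cases "norm x >= R")
    case False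
    then have "cut R x = 0" using cf(3)[of x] by simp
    then show ?thesis by (simp add: H_def)
   qed simp
  qed
  also have "... = Il p H + (LI x. ind {x. norm x >= R} x*abs (U x) powr p)"
   unfolding Lpi_def by (rule Bochner_Integration.integral_add[OF LpD(2)[OF HLp] i])
  finally show ?thesis using R1(2)[OF R(2)] by linarith
 qed
 have deficit: "G H - a'*P*Il p H < Sob*Nl ps H powr p"
 proof -
  have "Il ps H <= 1" unfolding U(3)[symmetric] by (rule Lpi_mono[OF DD_D(3)[OF U(1)] DD_D(1)[OF HD]]) (use H0 U(2) ps_facts in auto)
  then have "Il ps H powr 1 <= Il ps H powr (p/ps)" using ps_facts(1,3) by (intro powr_mono') auto
  then have 1: "Il ps H <= Nl ps H powr p" by (simp add: Lpn_def powr_powr)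
  have "a'*P*(m/2) <= a'*P*Il p H" using a' P Hm by (intro mult_left_mono) auto
  moreover have "d*(1 + Sob)*P < a'*(m/2)*P" using d2 P by (intro mult_strict_right_mono)
  ultimately have "d*P + Sob*(d*P) < a'*P*Il p H" by (simp add: algebra_simps)
  moreover have "Sob*(1 - d*P) <= Sob*Nl ps H powr p" using HL 1 Sob_pos by (intro mult_left_mono) auto
  ultimately show ?thesis using HG by (simp add: right_diff_distrib)
 qed
 define r where "r = 2*R/\<rho>"
 have r: "r > 0" using R \<rho> by (simp add: r_def)
 define t where "t = - (r *\<^sub>R x0)"
 define e where "e = (%y. r powr ((N - s*p)/p)*H (t + r *\<^sub>R y))"
 note re = rescale_DD[OF HD r, where t = t]
 have eD: "e : DD" "G e = G H" "Il ps e = Il ps H" using re(1-3) unfolding e_def by auto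
 have eL: "Ll p e" "Il p e = r powr (- (s*p))*Il p H" using re(4)[OF p0 HLp] p0 unfolding e_def by auto
 have rP: "a*r powr (- (s*p)) = a'*P"
 proof -
  have "r powr (- (s*p)) = (2/\<rho>) powr (- (s*p))*R powr (- (s*p))" unfolding r_def by (simp flip: powr_mult)
  then show ?thesis by (simp add: a'_def P_def)
 qed
 show ?thesis
 proof (rule that[OF eD(1)])
  show "e x >= 0" for x using H0 by (simp add: e_def)
  show "e x = 0" if "x \<notin> ball x0 \<rho>" for x
  proof -
   have "norm (t + r *\<^sub>R x) = norm (r *\<^sub>R (x - x0))" by (simp add: t_def scaleR_right_diff_distrib)
   also have "... = r*norm (x - x0)" using r by simp
   also have "... >= r*\<rho>" using that r by (intro mult_left_mono) (auto simp: dist_norm norm_minus_commute)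
   finally have "norm (t + r *\<^sub>R x) >= 2*R" using \<rho> by (simp add: r_def)
   then show ?thesis using cf(4) by (simp add: e_def H_def)
  qed
  show "Ll p e" by (rule eL)
  have "a*Il p e = a'*P*Il p H" unfolding eL(2) rP[symmetric] by simp
  moreover have "Nl ps e = Nl ps H" by (simp add: Lpn_def eD)
  ultimately show "G e - a*Il p e < Sob*Nl ps e powr p" using deficit eD(2) by simp
 qed
qed

end

section \<open>The space over a bounded set\<close>

text \<open>The error has a part linear in t with a small coefficient and a part of order t^r; as r
  > 1, the second is also below half of e t for all small t, uniformly over the ball of radius
  R.\<close>

lemma T_uniform_diff:
 assumes r: "r > 1" and e: "e > 0" and R: "R > 0"
 shows "EX d>0. ALL f g t. Lp M r f --> Lp M r g --> Lpn M r f <= R --> Lpn M r g <= R --> 0 <= t --> t <= d -->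
  abs (T M r cp cm (%x. f x + t*g x) - T M r cp cm f - r*(t*DT M r cp cm f g)) <= e*t"
proof -
 define B where "B = R powr r"
 have B: "B > 0" using R by (simp add: B_def)
 define e1 where "e1 = e/(2*B)"
 have e1: "e1 > 0" "e1*B = e/2" using e B by (auto simp: e1_def)
 obtain C where C: "C > 0" "!!f h. Lp M r f ==> Lp M r h ==>
   abs (T M r cp cm (%x. f x + h x) - T M r cp cm f - r*DT M r cp cm f h)
   <= e1*(Lpn M r f powr (r - 1)*Lpn M r h) + C*Lpi M r h" by (rule T_taylor_bound[OF r e1(1), of M cp cm]) (rule that; assumption)
 define d where "d = (e/(2*C*B)) powr (1/(r - 1))"
 have CB: "2*C*B > 0" using C B by simp
 have d: "d > 0" "C*B*d powr (r - 1) = e/2" using e C B r by (auto simp: d_def powr_powr)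
 have "abs (T M r cp cm (%x. f x + t*g x) - T M r cp cm f - r*(t*DT M r cp cm f g)) <= e*t"
  if f: "Lp M r f" and g: "Lp M r g" and n: "Lpn M r f <= R" "Lpn M r g <= R" and t: "0 <= t" "t <= d" for f g t
 proof -
  have tg: "Lp M r (%x. t*g x)" using g r by auto
  have "DT M r cp cm f (%x. t*g x) = t*DT M r cp cm f g" using DT_lin[OF f Lp_zero g r, of cp cm t] by (simp add: DT_def)
  then have "abs (T M r cp cm (%x. f x + t*g x) - T M r cp cm f - r*(t*DT M r cp cm f g))
   <= e1*(Lpn M r f powr (r - 1)*(t*Lpn M r g)) + C*(t powr r*Lpi M r g)" using C(2)[OF f tg] t r by (simp add: Lpn_cmult Lpi_cmult)
  also have "... <= e1*(R powr (r - 1)*(t*R)) + C*((t*d powr (r - 1))*B)"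
  proof (intro add_mono mult_left_mono mult_mono)
   show "Lpn M r f powr (r - 1) <= R powr (r - 1)" using n r by (intro powr_mono2) auto
   show "t powr r <= t*d powr (r - 1)"
   proof -
    have "t powr r = t*t powr (r - 1)" using powr_mult_base[OF t(1), of "r - 1"] by simp
    also have "... <= t*d powr (r - 1)" using t r by (intro mult_left_mono powr_mono2) auto
    finally show ?thesis .
   qed
   show "Lpi M r g <= B" unfolding B_def using Lpn_powr[of r M g] powr_mono2[OF _ _ n(2), of r] r by simp
  qed (use e1 C t n R in auto)
  also have "... = t*(e1*B) + t*(C*B*d powr (r - 1))" using powr_mult_base[of R "r - 1"] R by (simp add: B_def mult_ac)
  also have "... = e*t" unfolding e1(2) d(2) by simp
  finally show ?thesis .
 qed
 then show ?thesis using d(1) by blast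
qed

lemma T_continuous:
 assumes r: "r >= 1" and e: "e > 0" and f: "Lp M r f"
 shows "EX d>0. ALL g. Lp M r g --> Lpn M r (%x. g x - f x) < d --> abs (T M r cp cm g - T M r cp cm f) < e"
proof -
 define e1 where "e1 = e/(2*(Lpi M r f + 1))"
 have y: "Lpi M r f + 1 > 0" by (simp add: add_nonneg_pos)
 have e1: "e1 > 0" using e y by (simp add: e1_def)
 have e1B: "e1*Lpi M r f < e/2"
 proof -
  have "e1*Lpi M r f < e1*(Lpi M r f + 1)" using e1 by simp
  also have "... = e/2" using y unfolding e1_def by (simp add: field_simps)
  finally show ?thesis .
 qed
 obtain C where C: "C > 0" "!!f h. Lp M r f ==> Lp M r h ==>
   abs (T M r cp cm (%x. f x + h x) - T M r cp cm f) <= e1*Lpi M r f + C*Lpi M r h"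
  by (rule T_diff_bound[OF r e1, of M cp cm]) (rule that; assumption)
 define d where "d = (e/(2*C)) powr (1/r)"
 have d: "d > 0" "C*d powr r = e/2" using e C r by (auto simp: d_def powr_powr)
 have "abs (T M r cp cm g - T M r cp cm f) < e" if g: "Lp M r g" and l: "Lpn M r (%x. g x - f x) < d" for g
 proof -
  have gf: "Lp M r (%x. g x - f x)" using g f r by auto
  have "Lpi M r (%x. g x - f x) <= d powr r" using Lpn_powr[of r M "%x. g x - f x"] powr_mono2[OF _ _ less_imp_le[OF l], of r] r by simp
  then have "C*Lpi M r (%x. g x - f x) <= e/2" using C d by (metis mult_left_mono less_imp_le)
  then show ?thesis using C(2)[OF f gf] e1B by simp
 qed
 then show ?thesis using d(1) by blast
qed

lemma DT_continuous:
 assumes r: "r > 1" and e: "e > 0" and f: "Lp M r f" and h: "Lp M r h"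
 shows "EX d>0. ALL g. Lp M r g --> Lpn M r (%x. g x - f x) < d --> abs (DT M r cp cm g h - DT M r cp cm f h) < e"
proof -
 define B where "B = Lpn M r h + 1"
 define F where "F = Lpn M r f powr (r - 1) + 1"
 have B: "B > 0" and F: "F > 0" by (auto simp: B_def F_def add_nonneg_pos)
 define e1 where "e1 = e/(2*F*B)"
 have e1: "e1 > 0" using e B F by (simp add: e1_def)
 obtain C where C: "C > 0" "!!f h g. Lp M r f ==> Lp M r h ==> Lp M r g ==>
   abs (DT M r cp cm (%x. f x + h x) g - DT M r cp cm f g)
   <= (e1*Lpn M r f powr (r - 1) + C*Lpn M r h powr (r - 1))*Lpn M r g" by (rule DT_diff_bound[OF r e1, of M cp cm]) (rule that; assumption)
 define d where "d = (e/(2*C*B)) powr (1/(r - 1))"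
 have d: "d > 0" "C*d powr (r - 1)*B = e/2" using e C B r by (auto simp: d_def powr_powr)
 have "abs (DT M r cp cm g h - DT M r cp cm f h) < e" if g: "Lp M r g" and l: "Lpn M r (%x. g x - f x) < d" for g
 proof -
  have gf: "Lp M r (%x. g x - f x)" using g f r by auto
  have "abs (DT M r cp cm g h - DT M r cp cm f h) <= (e1*Lpn M r f powr (r - 1) + C*Lpn M r (%x. g x - f x) powr (r - 1))*Lpn M r h"
   using C(2)[OF f gf h] by simp
  also have "... <= (e1*Lpn M r f powr (r - 1) + C*d powr (r - 1))*Lpn M r h"
   using C l r by (intro mult_right_mono add_left_mono mult_left_mono powr_mono2) auto
  also have "... < (e1*F + C*d powr (r - 1))*B"
   using e1 C d by (intro mult_le_less_imp_less add_right_mono mult_left_mono) (auto simp: F_def B_def add_nonneg_pos add_pos_pos intro!: add_nonneg_pos)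
  also have "... = e"
  proof -
   have "e1*F*B = e/2" using B F by (simp add: e1_def)
   then show ?thesis using d(2) by (simp add: distrib_right)
  qed
  finally show ?thesis .
 qed
 then show ?thesis using d(1) by blast
qed

lemma T_tendsto:
 assumes r: "r >= 1" and f: "Lp M r f" and g: "!!n. Lp M r (g n)" and lim: "(%n. Lpi M r (%x. g n x - f x)) ---> 0"
 shows "(%n. T M r cp cm (g n)) ---> T M r cp cm f"
proof (rule tendstoI)
 fix e :: real assume e: "e > 0"
 obtain d where d: "d > 0" "!!g. Lp M r g ==> Lpn M r (%x. g x - f x) < d ==> abs (T M r cp cm g - T M r cp cm f) < e"
  using T_continuous[OF r e f] by blast
 have "(%n. Lpn M r (%x. g n x - f x)) ---> 0 powr (1/r)" unfolding Lpn_def by (intro tendsto_powr'[OF lim tendsto_const]) (use r in auto)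
 then have "EV n. Lpn M r (%x. g n x - f x) < d" using d by (intro order_tendstoD(2)) auto
 then show "EV n. dist (T M r cp cm (g n)) (T M r cp cm f) < e" by eventually_elim (use d(2)[OF g] in \<open>simp add: dist_real_def\<close>)
qed

lemma pw_cmult_pos: "c > 0 ==> T M r cp cm (%x. c*f x) = c powr r*T M r cp cm f"
 by (simp add: T_def pw_scale)

lemma DT_cmult_pos: "c > 0 ==> DT M r cp cm (%x. c*f x) g = c powr (r - 1)*DT M r cp cm f g"
 by (simp add: DT_def pw_scale mult.assoc)

lemma T_nonneg: "cp >= 0 ==> cm >= 0 ==> T M r cp cm f >= 0"
 unfolding T_def by (rule integral_nonneg_AE) (auto simp: pw_def)

lemma T_pos_part: "r > 0 ==> T M r 1 0 f = Lpi M r (%x. max (f x) 0)"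
 unfolding T_def Lpi_def by (intro Bochner_Integration.integral_cong refl) (auto simp: pw_def max_def)

lemma DT_pos_part: "r > 1 ==> DT M r 1 0 f g = DT M r 1 1 (%x. max (f x) 0) g"
 unfolding DT_def by (intro Bochner_Integration.integral_cong refl) (auto simp: pw_def max_def)

lemma Lp_lower:
 assumes u: "Lp M m u" and r: "0 < r" "r <= m" and A: "A : sets M" "emeasure M A < \<infinity>"
  and off: "AE x in M. x \<notin> A --> u x = 0"
 shows "Lp M r u" "Lpi M r u <= Lpi M m u + measure M A"
proof -
 have iA: "integrable M (%x. ind A x :: real)" using A by (auto intro: integrable_real_indicator)
 have le: "AE x in M. abs (u x) powr r <= abs (u x) powr m + ind A x" using off
 proof eventually_elim
  case (elim x)
  show ?case
  proof (cases "abs (u x) <= 1")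
   case True
   then have "abs (u x) powr r <= 1" using r by (simp add: powr_le1)
   then show ?thesis using elim by (cases "x : A") (auto simp: add_increasing)
  next
   case False
   then have "abs (u x) powr r <= abs (u x) powr m" using r by (intro powr_mono) auto
   then show ?thesis by (simp add: add_increasing2)
  qed
 qed
 have i: "integrable M (%x. abs (u x) powr m + ind A x)" using u iA by auto
 have "integrable M (%x. abs (u x) powr r)"
 proof (rule Bochner_Integration.integrable_bound[OF i])
  show "(%x. abs (u x) powr r) : borel_measurable M" using u by measurable
  show "AE x in M. norm (abs (u x) powr r) <= norm (abs (u x) powr m + ind A x)" using le by eventually_elim auto
 qed
 then show L: "Lp M r u" using u by (auto simp: Lp_def)
 have "Lpi M r u <= (\<integral>x. abs (u x) powr m + ind A x \<partial>M)" unfolding Lpi_def by (rule integral_mono_AE[OF LpD(2)[OF L] i le])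
 also have "... = Lpi M m u + measure M A" using u iA A by (simp add: Lpi_def LpD)
 finally show "Lpi M r u <= Lpi M m u + measure M A" .
qed

locale fracX = frac s p N ps TN for s p N ps and TN :: "'n::finite itself" +
 fixes Om :: "(real^'n) set"
 assumes Om_sets: "Om : sets leb" and Om_bounded: "bounded Om"
begin

lemma Om_finite: "emeasure leb Om < \<infinity>"
proof -
 obtain r where r: "r > 0" "Om \<subseteq> ball 0 r" using bounded_subset_ballD[OF Om_bounded] by blast
 have "emeasure leb Om <= emeasure leb (ball (0::real^'n) r)" by (rule emeasure_mono[OF r(2)]) simp
 also have "... < \<infinity>" using r by (auto simp: emeasure_ball_N)
 finally show ?thesis .
qed

text \<open>Built on \<open>DD\<close> rather than on W^(s,p): over a bounded set membership in L^p
  follows from L^ps, and \<open>Xsp_XX\<close> proves that the two spaces agree.\<close>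

definition XX :: "(real^'n => real) set" where
 "XX = {u : DD. AE x in leb. x \<notin> Om --> u x = 0}"

definition Nn :: "(real^'n => real) => real" where
 "Nn u = Lpn LL p (dq s p u)"

lemma XX_DD: "u : XX ==> u : DD" by (simp add: XX_def)

lemma XX_off: "u : XX ==> AE x in leb. x \<notin> Om --> u x = 0" by (simp add: XX_def)

lemma XX_lin: "u : XX ==> v : XX ==> (%x. u x + c * v x) : XX"
 unfolding XX_def using DD_lin[of u v c] by auto

lemma XX_zero: "(%x. 0) : XX"
 by (simp add: XX_def DD_zero)

lemma XX_cmult: "v : XX ==> (%x. c * v x) : XX"
 using XX_lin[OF XX_zero, of v c] by simp

lemma XX_diff: "u : XX ==> v : XX ==> (%x. u x - v x) : XX"
 using XX_lin[of u v "-1"] by simp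

lemma Nn_nonneg [simp]: "Nn u >= 0" by (simp add: Nn_def)

lemma Nn_powr: "Nn u powr p = G u"
 unfolding Nn_def using p0 by (intro Lpn_powr) simp

lemma Nn_cmult: "Nn (%x. c*u x) = abs c*Nn u"
proof -
 have "dq s p (%x. c*u x) = (%z. c*dq s p u z)" by (rule ext) (rule dq_cmult)
 then show ?thesis using p0 by (simp add: Nn_def Lpn_cmult)
qed

lemma Nn_add:
 assumes "u : XX" "v : XX"
 shows "Nn (%x. u x + v x) <= Nn u + Nn v"
proof -
 have "dq s p (%x. u x + v x) = (%z. dq s p u z + dq s p v z)" by (rule ext) (rule dq_add)
 then show ?thesis using Minkowski[OF DD_D(2)[OF XX_DD[OF assms(1)]] DD_D(2)[OF XX_DD[OF assms(2)]]] p1 by (simp add: Nn_def)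
qed

lemma XX_Lp: "u : XX ==> 0 < r ==> r <= ps ==> Ll r u"
 using Lp_lower(1)[OF DD_D(3)[OF XX_DD] _ _ Om_sets Om_finite XX_off] by blast

text \<open>One crude constant for all exponents 1 <= r <= ps at once: after normalising the L^ps
  norm, the L^r integral is at most 1 plus the volume, and the r-th root of a number above 1 is at
  most that number.\<close>

definition emb :: real where
 "emb = Sob powr (- 1/p)*(1 + measure leb Om + 1)"

lemma Lpn_ps_le: "u : DD ==> Nl ps u <= Sob powr (- 1/p)*Lpn LL p (dq s p u)"
proof -
 assume u: "u : DD"
 have "Nl ps u powr p <= G u/Sob" using Sobolev[OF u] Sob_pos by (simp add: field_simps)
 then have "(Nl ps u powr p) powr (1/p) <= (G u/Sob) powr (1/p)" using p0 by (intro powr_mono2) auto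
 then show ?thesis using p0 Sob_pos by (simp add: powr_powr powr_divide Lpn_def[of LL] powr_minus field_simps)
qed

lemma embedding:
 assumes u: "u : XX" and r: "1 <= r" "r <= ps"
 shows "Nl r u <= emb*Nn u"
proof -
 define \<mu> where "\<mu> = measure leb Om"
 define L where "L = Nl ps u"
 have L: "L <= Sob powr (- 1/p)*Nn u" unfolding L_def Nn_def by (rule Lpn_ps_le[OF XX_DD[OF u]])
 have "Nl r u <= (1 + \<mu> + 1)*L"
 proof (cases "L = 0")
  case True
  then have "AE x in leb. u x = 0" using Lpn_eq_0[OF DD_D(3)[OF XX_DD[OF u]]] by (simp add: L_def)
  then have "Nl r u = 0" using Lpn_eq_0[OF XX_Lp[OF u, of r]] r by simp
  then show ?thesis using True by simp
 next
  case False
  then have L0: "L > 0" by (simp add: L_def less_le)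
  define v where "v = (%x. (1/L)*u x)"
  have v: "v : XX" unfolding v_def by (rule XX_cmult[OF u])
  have vps: "Il ps v = 1"
  proof -
   have "Il ps v = (1/L) powr ps*Il ps u" unfolding v_def Lpi_cmult using L0 by simp
   also have "Il ps u = L powr ps" unfolding L_def using ps_facts(3) by (intro Lpn_powr[symmetric]) simp
   finally show ?thesis using L0 by (simp add: powr_divide)
  qed
  have "Il r v <= 1 + \<mu>" using Lp_lower(2)[OF DD_D(3)[OF XX_DD[OF v]] _ r(2) Om_sets Om_finite XX_off[OF v]] r vps by (simp add: \<mu>_def)
  then have "Nl r v <= (1 + \<mu>) powr (1/r)" unfolding Lpn_def using r by (intro powr_mono2) auto
  also have "... <= (1 + \<mu> + 1) powr 1"
  proof -
   have "(1 + \<mu>) powr (1/r) <= (1 + \<mu> + 1) powr (1/r)" using r by (intro powr_mono2) (auto simp: \<mu>_def)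
   also have "... <= (1 + \<mu> + 1) powr 1" using r by (intro powr_mono) (auto simp: \<mu>_def)
   finally show ?thesis .
  qed
  finally have "Nl r v <= 1 + \<mu> + 1" by (simp add: \<mu>_def)
  moreover have "Nl r u = L*Nl r v" unfolding v_def using r L0 by (simp only: Lpn_cmult) simp
  ultimately show ?thesis using L0 by (simp add: mult.commute)
 qed
 also have "... <= (1 + \<mu> + 1)*(Sob powr (- 1/p)*Nn u)" using L by (intro mult_left_mono) (auto simp: \<mu>_def)
 finally show ?thesis by (simp add: emb_def \<mu>_def mult_ac)
qed

lemma emb_pos: "emb > 0"
 unfolding emb_def using Sob_pos measure_nonneg[of leb Om] by (intro mult_pos_pos) (simp, linarith)

lemma Nn_eq_0: "u : XX ==> Nn u = 0 ==> AE x in leb. u x = 0"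
 using Lpn_ps_le[OF XX_DD, of u] Lpn_eq_0[OF DD_D(3)[OF XX_DD], of u] Lpn_nonneg[of leb ps u] unfolding Nn_def[symmetric] by simp

lemma embedding_le:
 assumes "u : XX" "1 <= r" "r <= ps" "Nn u <= C"
 shows "Nl r u <= emb*C" "Il r u <= (emb*C) powr r"
proof -
 show *: "Nl r u <= emb*C" by (rule order_trans[OF embedding[OF assms(1-3)] mult_left_mono[OF assms(4) less_imp_le[OF emb_pos]]])
 have "Nl r u powr r <= (emb*C) powr r" using assms*by (intro powr_mono2) auto
 then show "Il r u <= (emb*C) powr r" using assms Lpn_powr[of r leb u] by simp
qed

lemma XX_compact:
 fixes u :: "nat => real^'n => real"
 assumes u: "!!n. u n : XX" and C: "!!n. Nn (u n) <= C"
 shows "EX k w. strict_mono k \<and> w : XX \<and> (AE x in leb. (%n. u (k n) x) ---> w x)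
  \<and> (ALL r. 1 <= r \<and> r < ps --> (%n. Il r (%x. u (k n) x - w x)) ---> 0) \<and> Nn w <= C"
proof -
 have C0: "C >= 0" using C[of 0] Nn_nonneg[of "u 0"] by linarith
 have GC: "G (u n) <= C powr p" for n unfolding Nn_powr[symmetric] using C[of n] p0 by (intro powr_mono2) auto
 have ps1: "1 <= ps" using ps_facts(2) by linarith
 have LC: "Il ps (u n) <= (emb*C) powr ps" for n by (rule embedding_le(2)[OF u ps1 order_refl C])
 define D where "D = max (C powr p) ((emb*C) powr ps)"
 have D: "G (u n) <= D" "Il ps (u n) <= D" for n using GC LC by (auto simp: D_def le_max_iff_disj)
 obtain k w where kw: "strict_mono k" "w : Bl" "AE x in leb. (%n. u (k n) x) ---> w x" using compactness[of u D, OF XX_DD[OF u] D] by blast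
 have wD: "w : DD" "G w <= C powr p" using DD_limit[of "%n. u (k n)", OF XX_DD[OF u] GC LC kw(2,3)] by auto
 have "AE x in leb. ALL n. x \<notin> Om --> u (k n) x = 0" by (intro iffD2[OF AE_all_countable] allI XX_off u)
 then have "AE x in leb. x \<notin> Om --> w x = 0" using kw(3)
 proof eventually_elim
  case (elim x)
  then show ?case using LIMSEQ_unique[of "%n. u (k n) x" "w x" 0] by auto
 qed
 then have w: "w : XX" using wD by (simp add: XX_def)
 have "Nn w <= C"
 proof -
  have "Nn w = G w powr (1/p)" by (simp add: Nn_def Lpn_def)
  also have "... <= (C powr p) powr (1/p)" using wD p0 by (intro powr_mono2) auto
  finally show ?thesis using C0 p0 by (simp add: powr_powr)
 qed
 define z where "z = (%n x. u (k n) x - w x)"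
 have z: "z n : XX" for n unfolding z_def by (rule XX_diff[OF u w])
 have zN: "Nn (z n) <= C + C" for n
 proof -
  have "Nn (z n) = Nn (%x. u (k n) x + (-1)*w x)" by (simp add: z_def)
  also have "... <= Nn (u (k n)) + Nn (%x. (-1)*w x)" by (rule Nn_add[OF u XX_cmult[OF w]])
  also have "Nn (%x. (-1)*w x) = Nn w" using Nn_cmult[of "-1" w] by simp
  finally show ?thesis using C[of "k n"] \<open>Nn w <= C\<close> by linarith
 qed
 have zL: "Il ps (z n) <= (emb*(C + C)) powr ps" for n by (rule embedding_le(2)[OF z ps1 order_refl zN])
 have zlim: "AE x in leb. (%n. z n x) ---> 0" using kw(3)
 proof eventually_elim
  case (elim x)
  have "(%n. u (k n) x - w x) ---> w x - w x" by (intro tendsto_intros elim)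
  then show ?case by (simp add: z_def)
 qed
 have "(%n. Il r (z n)) ---> 0" if "1 <= r" "r < ps" for r
  by (rule Lpi_subcritical_convergence(2)[OF DD_D(3)[OF XX_DD[OF z]] zL zlim _ that(2) Om_sets Om_finite XX_off[OF z]])
   (use that in auto)
 then show ?thesis using kw w \<open>Nn w <= C\<close> unfolding z_def by blast
qed

text \<open>Truncation at 0 shrinks increments and keeps their sign, so the negative part is a test
  function that controls its own energy, and a nonlinearity built from the positive part vanishes
  against it. Signs of limits and of critical points come from here.\<close>

lemma min_test:
 assumes w: "w : XX"
 shows "(%x. min (w x) 0) : XX" "G (%x. min (w x) 0) <= EE w (%x. min (w x) 0)"
  "r > 1 ==> DTl r 1 0 w (%x. min (w x) 0) = 0"
proof -
 have wm: "w : Bl" using XX_DD[OF w] by auto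
 have mm: "(%x. min (w x) 0) : Bl" using wm by measurable
 have D: "(%x. min (w x) 0) : DD" by (rule DD_bound[OF XX_DD[OF w] mm, where C = 1]) (auto simp: min_def)
 show "(%x. min (w x) 0) : XX" using D XX_off[OF w] by (auto simp: XX_def)
 have pt: "1*abs (min (w x) 0 - min (w y) 0) powr p <= pw (p - 1) 1 (- 1) (w x - w y)*(min (w x) 0 - min (w y) 0)" for x y
 proof -
  have *: "abs (min a 0 - min b 0) powr p <= (a - b) powr (p - 1)*(min a 0 - min b 0)" if "a >= b" for a b :: real
  proof -
   define m where "m = min a 0 - min b 0"
   have m: "0 <= m" "m <= a - b" using that by (auto simp: m_def min_def)
   have "abs m powr p = m powr (p - 1)*m" using powr_mult_base[OF m(1), of "p - 1"] m by (simp add: mult.commute)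
   also have "... <= (a - b) powr (p - 1)*m" using m p1 by (intro mult_right_mono powr_mono2) auto
   finally show ?thesis by (simp add: m_def)
  qed
  show ?thesis
  proof (cases "w x >= w y")
   case True
   then show ?thesis using *[OF True] by (simp add: pw_def)
  next
   case False
   then show ?thesis using *[of "w x" "w y"] by (simp add: pw_def abs_minus_commute algebra_simps)
  qed
 qed
 show "G (%x. min (w x) 0) <= EE w (%x. min (w x) 0)" using A_lower_bound[OF XX_DD[OF w] D D _ pt] by simp
 show "r > 1 ==> DTl r 1 0 w (%x. min (w x) 0) = 0"
 proof -
  assume "r > 1"
  have "(%x. pw (r - 1) 1 (- 0) (w x)*min (w x) 0) = (%x. 0)" by (rule ext) (auto simp: pw_def min_def)
  then show ?thesis unfolding DT_def by (simp only: lebesgue_integral_const scaleR_zero_right Bochner_Integration.integral_zero)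
 qed
qed

end

section \<open>Picone inequality and eigenfunctions\<close>

text \<open>By homogeneity and symmetry only t = B/A < 1 matters. Write c as (1-t) times (c-d)/(1-t)
  plus t times d/t and use convexity of the p-th power; for c <= d the left side is not
  positive.\<close>

lemma Picone_pointwise:
 fixes p :: real
 assumes p: "p > 1" and A: "A > 0" and B: "B > 0" and c: "c >= 0" and d: "d >= 0"
 shows "pw (p - 1) 1 (- 1) (A - B)*(c powr p/A powr (p - 1) - d powr p/B powr (p - 1)) <= abs (c - d) powr p"
proof -
 have main: "pw (p - 1) 1 (- 1) (A - B)*(c powr p/A powr (p - 1) - d powr p/B powr (p - 1)) <= abs (c - d) powr p"
  if AB: "A > B" and B: "B > 0" and c: "c >= 0" and d: "d >= 0" for A B c d :: real
 proof -
  define t where "t = B/A"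
  have A: "A > 0" using AB B by simp
  have t: "0 < t" "t < 1" using AB B A by (auto simp: t_def)
  have BA: "B = t*A" using A by (simp add: t_def)
  have AmB: "A - B = (1 - t)*A" by (simp add: BA algebra_simps)
  have "pw (p - 1) 1 (- 1) (A - B)*(c powr p/A powr (p - 1) - d powr p/B powr (p - 1))
   = (1 - t) powr (p - 1)*A powr (p - 1)*(c powr p/A powr (p - 1) - d powr p/(t powr (p - 1)*A powr (p - 1)))"
  proof -
   have "(A - B) powr (p - 1) = (1 - t) powr (p - 1)*A powr (p - 1)" "B powr (p - 1) = t powr (p - 1)*A powr (p - 1)"
    using t A powr_mult[of "1 - t" A "p - 1"] powr_mult[of t A "p - 1"] unfolding AmB BA[symmetric] by auto
   then show ?thesis using AB by (simp add: pw_def)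
  qed
  also have "... = (1 - t) powr (p - 1)*(c powr p - d powr p/t powr (p - 1))" using A t by (simp add: field_simps)
  also have "... <= abs (c - d) powr p"
  proof (cases "c <= d")
   case True
   have "c powr p <= d powr p" using True c p by (intro powr_mono2) auto
   also have "... <= d powr p/t powr (p - 1)"
   proof -
    have "t powr (p - 1) <= 1" using t p by (intro powr_le1) auto
    then show ?thesis using t by (simp add: le_divide_eq mult_left_le)
   qed
   finally have "(1 - t) powr (p - 1)*(c powr p - d powr p/t powr (p - 1)) <= 0" by (intro mult_nonneg_nonpos) auto
   then show ?thesis by (rule order_trans) simp
  next
   case False
   define e where "e = c - d"
   have e: "e > 0" using False by (simp add: e_def)
   have "((1 - t)*(e/(1 - t)) + t*(d/t)) powr p <= (1 - t)*(e/(1 - t)) powr p + t*(d/t) powr p" using t e d p by (intro powr_convex_comb) auto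
   also have "(1 - t)*(e/(1 - t)) + t*(d/t) = c" using t by (simp add: e_def)
   also have "(1 - t)*(e/(1 - t)) powr p = e powr p/(1 - t) powr (p - 1)" using t e by (simp add: powr_divide powr_diff)
   also have "t*(d/t) powr p = d powr p/t powr (p - 1)" using t d by (simp add: powr_divide powr_diff)
   finally have "c powr p - d powr p/t powr (p - 1) <= e powr p/(1 - t) powr (p - 1)" by simp
   then have "(1 - t) powr (p - 1)*(c powr p - d powr p/t powr (p - 1)) <= (1 - t) powr (p - 1)*(e powr p/(1 - t) powr (p - 1))"
    by (intro mult_left_mono) auto
   also have "... = e powr p" using t by simp
   finally show ?thesis using e by (simp add: e_def)
  qed
  finally show ?thesis .
 qed
 consider "A > B" | "A = B" | "A < B" by linarith
 then show ?thesis
 proof cases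
  case 1 then show ?thesis using main[OF 1 B c d] by simp
 next
  case 2 then show ?thesis by simp
 next
  case 3
  have "pw (p - 1) 1 (- 1) (A - B) = - pw (p - 1) 1 (- 1) (B - A)" using 3 by (simp add: pw_def)
  then show ?thesis using main[OF 3 A d c] by (simp add: abs_minus_commute algebra_simps)
 qed
qed

lemma lipschitz_from_derivative:
 fixes f f' :: "real => real"
 assumes I: "is_interval I" and der: "!!t. t : I ==> (f has_real_derivative f' t) (at t)"
  and bd: "!!t. t : I ==> abs (f' t) <= C" and xy: "x : I" "y : I"
 shows "abs (f x - f y) <= C*abs (x - y)"
proof -
 have "norm (f x - f y) <= C*norm (x - y)" by (rule field_differentiable_bound[of I f f'])
   (use I der bd xy in \<open>auto simp: is_interval_convex intro: has_field_derivative_at_within\<close>)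
 then show ?thesis by simp
qed

text \<open>Picone's quotient is Lipschitz in both arguments as long as the numerator is bounded and
  the denominator stays away from 0. Hence the truncation at k and the shift \<open>\<delta>\<close>
  in the test functions.\<close>

lemma powr_quotient_diff:
 fixes p k \<delta> :: real
 assumes p: "p > 1" and k: "k > 0" and \<delta>: "\<delta> > 0"
  and AB: "A >= \<delta>" "B >= \<delta>" and cd: "0 <= c" "c <= k" "0 <= d" "d <= k"
 shows "abs (c powr p/A powr (p - 1) - d powr p/B powr (p - 1))
  <= (p * k powr (p - 1)*\<delta> powr (1 - p) + k powr p*((p - 1)*\<delta> powr (- p)))*(abs (c - d) + abs (A - B))"
proof -
 have 1: "abs (pw p 1 1 c - pw p 1 1 d) <= (p * k powr (p - 1))*abs (c - d)"
 proof (rule lipschitz_from_derivative[of "{0..k}" "pw p 1 1" "%t. p*pw (p - 1) 1 (- 1) t"])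
  show "abs (p*pw (p - 1) 1 (- 1) t) <= p * k powr (p - 1)" if "t : {0..k}" for t using that p by (auto simp: pw_def abs_mult intro!: powr_mono2)
 qed (use cd has_derivative_pw[OF p, of 1 1] in auto)
 have 2: "abs (A powr (1 - p) - B powr (1 - p)) <= ((p - 1)*\<delta> powr (- p))*abs (A - B)"
 proof (rule lipschitz_from_derivative[of "{\<delta>..}" "%t. t powr (1 - p)" "%t. (1 - p)*t powr (- p)"])
  show "abs ((1 - p)*t powr (- p)) <= (p - 1)*\<delta> powr (- p)" if "t : {\<delta>..}" for t
   using that p \<delta> by (auto simp: abs_mult intro!: powr_mono2')
  show "((%t. t powr (1 - p)) has_real_derivative (1 - p)*t powr (- p)) (at t)" if "t : {\<delta>..}" for t
   using has_real_derivative_powr[of t "1 - p"] that \<delta> by simp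
 qed (use AB in auto)
 have A: "A > 0" "B > 0" using AB \<delta> by auto
 have "c powr p/A powr (p - 1) - d powr p/B powr (p - 1)
   = (pw p 1 1 c - pw p 1 1 d)*A powr (1 - p) + d powr p*(A powr (1 - p) - B powr (1 - p))" using A cd by (simp add: pw_def powr_diff field_simps)
 also have "abs ... <= abs (pw p 1 1 c - pw p 1 1 d)*A powr (1 - p) + d powr p*abs (A powr (1 - p) - B powr (1 - p))"
  by (rule order_trans[OF abs_triangle_ineq]) (simp add: abs_mult)
 also have "... <= ((p * k powr (p - 1))*abs (c - d))*\<delta> powr (1 - p) + k powr p*(((p - 1)*\<delta> powr (- p))*abs (A - B))"
  using 1 2 p cd AB \<delta> k by (intro add_mono mult_mono powr_mono2 powr_mono2') auto
 also have "... <= (p * k powr (p - 1)*\<delta> powr (1 - p) + k powr p*((p - 1)*\<delta> powr (- p)))*(abs (c - d) + abs (A - B))"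
 proof -
  have *: "P*X*D + Q*Y <= (P*D + Q)*(X + Y)" if "P >= 0" "Q >= 0" "X >= 0" "Y >= 0" "D >= 0" for P Q X Y D :: real
  proof -
   have "0 <= P*D*Y" "0 <= Q*X" using that by auto
   then show ?thesis by (simp add: algebra_simps)
  qed
  show ?thesis using *[of "p * k powr (p - 1)" "k powr p*((p - 1)*\<delta> powr (- p))" "abs (c - d)" "abs (A - B)" "\<delta> powr (1 - p)"] p
   by (simp add: mult.assoc)
 qed
 finally show ?thesis .
qed

context fracX
begin

lemma powr_quotient_XX:
 assumes u: "u : XX" "!!x. 0 <= u x" "!!x. u x <= k" and k: "k > 0" and z: "z : XX" "!!x. 0 <= z x" and \<delta>: "\<delta> > 0"
 shows "(%x. u x powr p/(z x + \<delta>) powr (p - 1)) : XX" (is "?v : XX")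
proof -
 have um [measurable]: "u : Bl" and zm [measurable]: "z : Bl" using XX_DD[OF u(1)] XX_DD[OF z(1)] by auto
 have vm [measurable]: "?v : Bl" by measurable
 define C where "C = p * k powr (p - 1)*\<delta> powr (1 - p) + k powr p*((p - 1)*\<delta> powr (- p))"
 have pt: "abs (?v x - ?v y) <= C*(abs (u x - u y) + abs (z x - z y))" for x y
  using powr_quotient_diff[OF p1 k \<delta>, of "z x + \<delta>" "z y + \<delta>" "u x" "u y"] u z by (simp add: C_def)
 have "Lp LL p (%w. abs (dq s p u w) + abs (dq s p z w))"
 proof -
  have "Lp LL p (%w. abs (dq s p u w))" "Lp LL p (%w. abs (dq s p z w))"
   using DD_D(2)[OF XX_DD[OF u(1)]] DD_D(2)[OF XX_DD[OF z(1)]] by (auto simp: Lp_def)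
  then show ?thesis using p1 by auto
 qed
 then have L1: "Lp LL p (dq s p ?v)"
 proof (rule Lp_bound[where C = C])
  show "AE w in LL. abs (dq s p ?v w) <= C*abs (abs (dq s p u w) + abs (dq s p z w))"
  proof (intro AE_I2)
   fix w :: "(real^'n) \<times> (real^'n)"
   define h where "h = norm (fst w - snd w) powr ((real CARD('n) + s*p)/p)"
   have "abs (?v (fst w) - ?v (snd w))/h <= C*(abs (u (fst w) - u (snd w)) + abs (z (fst w) - z (snd w)))/h"
    using pt[of "fst w" "snd w"] by (intro divide_right_mono) (auto simp: h_def)
   also have "... = C*(abs (u (fst w) - u (snd w))/h + abs (z (fst w) - z (snd w))/h)"
    by (simp only: times_divide_eq_right add_divide_distrib[symmetric])
   finally show "abs (dq s p ?v w) <= C*abs (abs (dq s p u w) + abs (dq s p z w))" by (simp add: dq_def h_def abs_divide)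
  qed
 qed (use p1 in auto)
 have bd: "abs (?v x) <= (k powr (p - 1)*\<delta> powr (1 - p))*abs (u x)" for x
 proof -
  have "u x powr p = u x powr (p - 1)*u x" using powr_mult_base[of "u x" "p - 1"] u(2)[of x] by (simp add: mult.commute)
  also have "... <= k powr (p - 1)*u x" using u(2,3)[of x] p1 by (intro mult_right_mono powr_mono2) auto
  finally have 1: "u x powr p <= k powr (p - 1)*u x" .
  have "?v x = u x powr p*(z x + \<delta>) powr (1 - p)" using powr_minus[of "z x + \<delta>" "p - 1"] by (simp add: divide_inverse)
  also have "... <= (k powr (p - 1)*u x)*\<delta> powr (1 - p)" using 1 z(2)[of x] \<delta> p1 u(2)[of x] by (intro mult_mono powr_mono2') auto
  finally have "?v x <= (k powr (p - 1)*u x)*\<delta> powr (1 - p)" .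
  then show ?thesis using u(2)[of x] by (simp add: mult_ac)
 qed
 have L2: "Ll ps ?v" by (rule Lp_bound[OF DD_D(3)[OF XX_DD[OF u(1)]] vm, where C = "k powr (p - 1)*\<delta> powr (1 - p)"])
   (use bd ps_facts(3) in auto)
 have "AE x in leb. x \<notin> Om --> ?v x = 0" using XX_off[OF u(1)] by eventually_elim (use p0 in auto)
 then show ?thesis using vm L1 L2 by (simp add: XX_def DD_def)
qed

text \<open>Test with the Picone quotient of the truncated phi over z + \<open>\<delta> n\<close>.
  This bounds a \<open>Il p (g n)\<close> by G(phi), and g_n tends to phi provided z > 0 almost
  everywhere where phi > 0; then a <= G(phi), a contradiction. That positivity comes from the Picone
  defect \<open>D\<close>: its integrals are bounded, yet it blows up on pairs with z = 0 < phi at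
  one point and z > 0 at the other.\<close>

lemma nonneg_eigenfunction_zero:
 assumes phi: "phi : XX" "!!x. 0 <= phi x" "AE x in leb. x : Om --> 0 < phi x" "Il p phi = 1" and a: "G phi < a"
  and z: "z : XX" "!!x. 0 <= z x"
  and eig: "!!v. v : XX ==> EE z v = a*DTl p 1 1 z v"
 shows "AE x in leb. z x = 0"
proof (rule ccontr)
 assume contra: "\<not> (AE x in leb. z x = 0)"
 have phim [measurable]: "phi : Bl" and zm [measurable]: "z : Bl" using XX_DD[OF phi(1)] XX_DD[OF z(1)] by auto
 have a0: "a > 0" using a Lpi_nonneg[of LL p "dq s p phi"] by linarith
 define \<delta> where "\<delta> n = 1/(real n + 1)" for n
 define f where "f n x = min (phi x) (real n + 1)" for n x
 define v where "v n x = f n x powr p/(z x + \<delta> n) powr (p - 1)" for n x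
 have \<delta>: "\<delta> n > 0" for n by (simp add: \<delta>_def add_nonneg_pos)
 have fm [measurable]: "f n : Bl" for n unfolding f_def by measurable
 have fD: "f n : DD" for n by (rule DD_bound[OF XX_DD[OF phi(1)] fm, where C = 1]) (use phi(2) in \<open>auto simp: f_def min_def abs_if\<close>)
 have fX: "f n : XX" for n using fD XX_off[OF phi(1)] by (auto simp: XX_def f_def)
 have f0: "0 <= f n x" "f n x <= real n + 1" "f n x <= phi x" for n x using phi(2)[of x] by (auto simp: f_def)
 have fG: "G (f n) <= G phi" for n by (rule G_mono[OF XX_DD[OF phi(1)] fm]) (auto simp: f_def min_def)
 have vX: "v n : XX" for n unfolding v_def by (rule powr_quotient_XX[OF fX f0(1,2) _ z \<delta>]) simp
 define g where "g n x = (z x/(z x + \<delta> n)) powr ((p - 1)/p)*f n x" for n x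
 have gm [measurable]: "g n : Bl" for n unfolding g_def by measurable
 have DTv: "DTl p 1 1 z (v n) = Il p (g n)" for n unfolding DT_def Lpi_def
 proof (rule Bochner_Integration.integral_cong[OF refl])
  fix x
  have "abs (g n x) powr p = (z x/(z x + \<delta> n)) powr (p - 1)*f n x powr p"
   using z(2)[of x] f0(1)[of n x] p0 by (simp add: g_def abs_mult powr_mult powr_powr)
  also have "... = pw (p - 1) 1 (- 1) (z x) * v n x" using z(2)[of x] \<delta>[of n] by (simp add: pw_def v_def powr_divide)
  finally show "pw (p - 1) 1 (- 1) (z x) * v n x = abs (g n x) powr p" by simp
 qed
 define D where "D n w = abs (dq s p (f n) w) powr p - pw (p - 1) 1 (- 1) (dq s p z w)*dq s p (v n) w" for n w
 have Deq: "D n w = (abs (f n (fst w) - f n (snd w)) powr p - pw (p - 1) 1 (- 1) (z (fst w) - z (snd w))*(v n (fst w) - v n (snd w)))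
   / norm (fst w - snd w) powr (N + s*p)" for n w unfolding D_def dq_pair dq_powr[OF p0] N_def by (simp add: diff_divide_distrib)
 have Dnn: "D n w >= 0" for n w
 proof -
  have "pw (p - 1) 1 (- 1) (z (fst w) - z (snd w))*(v n (fst w) - v n (snd w)) <= abs (f n (fst w) - f n (snd w)) powr p"
   using Picone_pointwise[OF p1, of "z (fst w) + \<delta> n" "z (snd w) + \<delta> n" "f n (fst w)" "f n (snd w)"]
    z(2) \<delta> f0(1) by (simp add: v_def add_nonneg_pos)
  then show ?thesis unfolding Deq by simp
 qed
 have i1: "integrable LL (%w. abs (dq s p (f n) w) powr p)" for n using DD_D(2)[OF fD] by auto
 have i2: "integrable LL (%w. pw (p - 1) 1 (- 1) (dq s p z w)*dq s p (v n) w)" for n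
  by (rule DT_integrable[OF DD_D(2)[OF XX_DD[OF z(1)]] DD_D(2)[OF XX_DD[OF vX]] p1])
 have Dint: "integrable LL (D n)" for n unfolding D_def using i1 i2 by auto
 have Dval: "(\<integral>w. D n w \<partial>LL) = G (f n) - a*Il p (g n)" for n
 proof -
  have "(\<integral>w. D n w \<partial>LL) = G (f n) - EE z (v n)" unfolding D_def DT_def Lpi_def using i1 i2 by simp
  then show ?thesis using eig[OF vX] DTv by simp
 qed
 have Dle: "(\<integral>\<^sup>+w. en (D n w) \<partial>LL) <= en (G phi)" for n
 proof -
  have "(\<integral>\<^sup>+w. en (D n w) \<partial>LL) = en (\<integral>w. D n w \<partial>LL)"
   by (rule nn_integral_eq_integral[OF Dint]) (simp add: Dnn)
  also have "... <= en (G phi)"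
  proof (rule ennreal_leI)
   have "a*Il p (g n) >= 0" using a0 by simp
   then show "(\<integral>w. D n w \<partial>LL) <= G phi" unfolding Dval using fG[of n] by linarith
  qed
  finally show ?thesis .
 qed
 have gle: "Il p (g n) <= G phi/a" for n
 proof -
  have "0 <= (\<integral>w. D n w \<partial>LL)" by (rule integral_nonneg_AE) (simp add: Dnn)
  then have "a*Il p (g n) <= G phi" unfolding Dval using fG[of n] by linarith
  then show ?thesis using a0 by (simp add: field_simps)
 qed
 have Dm: "(%w. en (D n w)) : borel_measurable LL" for n using Dint[of n] by auto
 have "(\<integral>\<^sup>+w. liminf (%n. en (D n w)) \<partial>LL) <= liminf (%n. \<integral>\<^sup>+w. en (D n w) \<partial>LL)"
  by (rule nn_integral_liminf[OF Dm])
 also have "... <= en (G phi)" by (rule Liminf_le) (use Dle in auto)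
 also have "... < \<infinity>" by simp
 finally have fin: "AE w in LL. liminf (%n. en (D n w)) \<noteq> \<infinity>" using Dm by (intro nn_integral_PInf_AE borel_measurable_liminf) auto
 define E where "E = {x. z x = 0 \<and> phi x > 0}"
 define F where "F = {x. z x > 0}"
 have Es: "E : sets leb" and Fs: "F : sets leb"
 proof -
  have "E = z -` {0} \<inter> space leb \<inter> (phi -` {0<..} \<inter> space leb)" "F = z -` {0<..} \<inter> space leb" by (auto simp: E_def F_def)
  then show "E : sets leb" "F : sets leb"
   using measurable_sets[OF zm, of "{0}"] measurable_sets[OF phim, of "{0<..}"] measurable_sets[OF zm, of "{0<..}"]
   by (simp_all only: sets.Int borel_closed closed_singleton borel_open open_greaterThan)
 qed
 have inf: "liminf (%n. en (D n (x, y))) = \<infinity>" if x: "x : E" and y: "y : F" for x y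
 proof (rule ccontr)
  assume "liminf (%n. en (D n (x, y))) \<noteq> \<infinity>"
  then obtain l where l: "l >= 0" "liminf (%n. en (D n (x, y))) = en l" by (metis ennreal_cases infinity_ennreal_def)
  define B where "B = z y"
  define K where "K = norm (x - y) powr (N + s*p)"
  define m where "m = min (phi x) 1"
  have B: "B > 0" and zx: "z x = 0" and m: "m > 0" using x y by (auto simp: E_def F_def B_def m_def)
  have "x \<noteq> y" using B zx by (auto simp: B_def)
  then have K: "K > 0" by (simp add: K_def)
  have low: "D n (x, y) >= (B powr (p - 1)*m powr p*(real n + 1) powr (p - 1) - phi y powr p)/K" for n
  proof -
   have mf: "m powr p <= f n x powr p" using m p0 by (intro powr_mono2) (auto simp: m_def f_def)
   have fy: "f n y powr p <= phi y powr p" using f0 p0 by (intro powr_mono2) auto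
   have 1: "B powr (p - 1)*(f n x powr p/\<delta> n powr (p - 1)) >= B powr (p - 1)*m powr p*(real n + 1) powr (p - 1)"
   proof -
    have "f n x powr p/\<delta> n powr (p - 1) = f n x powr p*(real n + 1) powr (p - 1)" by (simp add: \<delta>_def powr_divide)
    then show ?thesis using mf by (simp add: mult.assoc mult_left_mono mult_right_mono)
   qed
   have 2: "B powr (p - 1)*(f n y powr p/(B + \<delta> n) powr (p - 1)) <= phi y powr p"
   proof -
    have "B powr (p - 1)/(B + \<delta> n) powr (p - 1) <= 1" using B \<delta>[of n] p1 by (auto simp: divide_le_eq add_pos_pos intro!: powr_mono2)
    then have "(B powr (p - 1)/(B + \<delta> n) powr (p - 1))*f n y powr p <= 1*f n y powr p" by (intro mult_right_mono) auto
    then show ?thesis using fy by (simp add: field_simps)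
   qed
   have "D n (x, y) = (abs (f n x - f n y) powr p + B powr (p - 1)*(f n x powr p/\<delta> n powr (p - 1)) - B powr (p - 1)*(f n y powr p/(B + \<delta> n) powr (p - 1)))/K"
    unfolding Deq using B zx by (simp add: pw_def v_def K_def B_def[symmetric] algebra_simps)
   also have "... >= (B powr (p - 1)*m powr p*(real n + 1) powr (p - 1) - phi y powr p)/K"
    using 1 2 powr_ge_zero[of "abs (f n x - f n y)" p] K by (intro divide_right_mono) linarith+
   finally show ?thesis .
  qed
  define c where "c = B powr (p - 1)*m powr p"
  have c: "c > 0" using B m by (simp add: c_def)
  define M where "M = ((l + 1)*K + phi y powr p)/c"
  have M: "M >= 0" using l K c by (simp add: M_def)
  obtain n0 :: nat where n0: "M powr (1/(p - 1)) <= real n0" using real_arch_simple by blast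
  have "EV n. M <= (real n + 1) powr (p - 1)" unfolding eventually_sequentially
  proof (intro exI[of _ n0] allI impI)
   fix n assume "n0 <= n"
   then have "(M powr (1/(p - 1))) powr (p - 1) <= (real n + 1) powr (p - 1)" using n0 p1 by (intro powr_mono2) auto
   then show "M <= (real n + 1) powr (p - 1)" using M p1 by (simp add: powr_powr)
  qed
  then have "EV n. en (l + 1) <= en (D n (x, y))"
  proof eventually_elim
   case (elim n)
   then have "(l + 1)*K <= c*(real n + 1) powr (p - 1) - phi y powr p" using c by (simp add: M_def field_simps)
   then have "l + 1 <= (c*(real n + 1) powr (p - 1) - phi y powr p)/K" using K by (simp add: field_simps)
   then show ?case using low[of n] unfolding c_def by (intro ennreal_leI) linarith
  qed
  then have "en (l + 1) <= liminf (%n. en (D n (x, y)))" by (rule Liminf_bounded)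
  then show False using l by simp
 qed
 \<comment> \<open>By Fatou the lower limit of the defect is finite almost everywhere, so the
   product of \<open>E\<close> and \<open>F\<close> is null. Since z is not 0 almost everywhere,
   \<open>F\<close> is not null, so \<open>E\<close> is.\<close>
 have "AE w in LL. w \<notin> E \<times> F" using fin by eventually_elim (use inf in auto)
 then have "emeasure LL (E \<times> F) = 0" using Es Fs by (subst (asm) AE_iff_measurable[OF pair_measureI[OF Es Fs]]) (auto simp: space_pair_measure)
 then have "emeasure leb E*emeasure leb F = 0" by (subst (asm) leb.emeasure_pair_measure_Times[OF Es Fs])
 moreover have "emeasure leb F \<noteq> 0"
 proof
  assume "emeasure leb F = 0"
  then have "AE x in leb. x \<notin> F" using Fs by (intro AE_not_in) auto
  then have "AE x in leb. z x = 0" by eventually_elim (use z(2) in \<open>auto simp: F_def less_le\<close>)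
  then show False using contra by simp
 qed
 ultimately have "emeasure leb E = 0" by simp
 then have Enull: "AE x in leb. x \<notin> E" using Es by (intro AE_not_in) auto
 have glim: "AE x in leb. (%n. g n x) ---> phi x" using Enull
 proof eventually_elim
  case (elim x)
  have \<delta>lim: "\<delta> ---> 0" unfolding \<delta>_def using lim_1_over_n[THEN LIMSEQ_Suc] by (simp add: add.commute)
  show ?case
  proof (cases "phi x = 0")
   case True
   then have "g n x = 0" for n by (simp add: g_def f_def)
   then show ?thesis using True by simp
  next
   case False
   then have "phi x > 0" using phi(2)[of x] by simp
   then have zx: "z x > 0" using elim z(2)[of x] by (auto simp: E_def less_le)
   have "(%n. (z x/(z x + \<delta> n)) powr ((p - 1)/p)) ---> (z x/(z x + 0)) powr ((p - 1)/p)" by (intro tendsto_intros \<delta>lim) (use zx in auto)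
   moreover have "(%n. f n x) ---> phi x"
   proof (rule tendsto_eventually)
    obtain n0 :: nat where "phi x <= real n0" using real_arch_simple by blast
    then show "EV n. f n x = phi x" unfolding eventually_sequentially by (intro exI[of _ n0]) (auto simp: f_def min_def)
   qed
   ultimately have "(%n. g n x) ---> (z x/(z x + 0)) powr ((p - 1)/p)*phi x" unfolding g_def by (intro tendsto_mult)
   then show ?thesis using zx by simp
  qed
 qed
 have gL: "Ll p (g n)" for n
 proof (rule Lp_bound[OF XX_Lp[OF phi(1)] gm, where C = 1])
  show "AE x in leb. abs (g n x) <= 1*abs (phi x)"
  proof (intro AE_I2)
   fix x
   have "(z x/(z x + \<delta> n)) powr ((p - 1)/p) <= 1" using z(2)[of x] \<delta>[of n] p1 by (intro powr_le1) (auto simp: divide_le_eq)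
   then have "(z x/(z x + \<delta> n)) powr ((p - 1)/p)*f n x <= 1*f n x" using f0(1) by (intro mult_right_mono) auto
   then show "abs (g n x) <= 1*abs (phi x)" using f0[of n x] phi(2)[of x] by (simp add: g_def abs_mult)
  qed
 qed (use p0 ps_facts(1) in auto)
 have "Il p phi <= G phi/a" by (rule Fatou_Lp(2)[OF gL gle phim glim p0])
 then show False using phi(4) a a0 by (simp add: le_divide_eq)
qed

end

section \<open>The energy functional and its Cerami sequences\<close>

lemma DT_uminus: "DT M r 1 1 (%x. - f x) g = - DT M r 1 1 f g"
proof -
 have "pw (r - 1) 1 (- 1) (- f x)*g x = - (pw (r - 1) 1 (- 1) (f x)*g x)" for x by (simp add: pw_def)
 then show ?thesis unfolding DT_def by simp
qed

lemma T_tendsto_filter: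
 assumes r: "r >= 1" and f: "Lp M r f" and g: "!!y. Lp M r (g y)" and lim: "((%y. Lpn M r (%x. g y x - f x)) \<longlongrightarrow> 0) F"
 shows "((%y. T M r cp cm (g y)) \<longlongrightarrow> T M r cp cm f) F"
proof (rule tendstoI)
 fix e :: real assume e: "e > 0"
 obtain d where d: "d > 0" "!!g. Lp M r g ==> Lpn M r (%x. g x - f x) < d ==> abs (T M r cp cm g - T M r cp cm f) < e"
  using T_continuous[OF r e f] by blast
 have "\<forall>\<^sub>F y in F. Lpn M r (%x. g y x - f x) < d" using order_tendstoD(2)[OF lim d(1)] .
 then show "\<forall>\<^sub>F y in F. dist (T M r cp cm (g y)) (T M r cp cm f) < e"
  by eventually_elim (use d(2)[OF g] in \<open>simp add: dist_real_def\<close>)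
qed

lemma DT_tendsto_filter:
 assumes r: "r > 1" and f: "Lp M r f" and g: "!!y. Lp M r (g y)" and h: "Lp M r h"
  and lim: "((%y. Lpn M r (%x. g y x - f x)) \<longlongrightarrow> 0) F"
 shows "((%y. DT M r cp cm (g y) h) \<longlongrightarrow> DT M r cp cm f h) F"
proof (rule tendstoI)
 fix e :: real assume e: "e > 0"
 obtain d where d: "d > 0" "!!g. Lp M r g ==> Lpn M r (%x. g x - f x) < d ==> abs (DT M r cp cm g h - DT M r cp cm f h) < e"
  using DT_continuous[OF r e f h] by blast
 have "\<forall>\<^sub>F y in F. Lpn M r (%x. g y x - f x) < d" using order_tendstoD(2)[OF lim d(1)] .
 then show "\<forall>\<^sub>F y in F. dist (DT M r cp cm (g y) h) (DT M r cp cm f h) < e"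
  by eventually_elim (use d(2)[OF g] in \<open>simp add: dist_real_def\<close>)
qed

lemma T_uniform_diff_cmult:
 assumes r: "r > 1" and e: "e > 0" and R: "R > 0"
 shows "EX d>0. ALL f g t. Lp M r f --> Lp M r g --> Lpn M r f <= R --> Lpn M r g <= R --> 0 <= t --> t <= d -->
  abs (c/r*T M r cp cm (%x. f x + t*g x) - c/r*T M r cp cm f - t*(c*DT M r cp cm f g)) <= e*t"
proof -
 define k where "k = abs (c/r) + 1"
 have k: "k > 0" by (simp add: k_def add_nonneg_pos)
 obtain d where d: "d > 0" "!!f g t. Lp M r f ==> Lp M r g ==> Lpn M r f <= R ==> Lpn M r g <= R ==> 0 <= t ==> t <= d ==>
  abs (T M r cp cm (%x. f x + t*g x) - T M r cp cm f - r*(t*DT M r cp cm f g)) <= (e/k)*t"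
  using T_uniform_diff[OF r divide_pos_pos[OF e k] R, of M cp cm] by blast
 have "abs (c/r*T M r cp cm (%x. f x + t*g x) - c/r*T M r cp cm f - t*(c*DT M r cp cm f g)) <= e*t"
  if "Lp M r f" "Lp M r g" "Lpn M r f <= R" "Lpn M r g <= R" "0 <= t" "t <= d" for f g t
 proof -
  have "c/r*T M r cp cm (%x. f x + t*g x) - c/r*T M r cp cm f - t*(c*DT M r cp cm f g)
   = (c/r)*(T M r cp cm (%x. f x + t*g x) - T M r cp cm f - r*(t*DT M r cp cm f g))" using r by (simp add: field_simps)
  also have "abs ... <= k*((e/k)*t)" unfolding abs_mult using d(2)[OF that] by (intro mult_mono) (auto simp: k_def)
  finally show ?thesis using k by simp
 qed
 then show ?thesis using d(1) by blast
qed

context fracX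
begin

lemma Nn_minus_commute: "Nn (%x. u x - v x) = Nn (%x. v x - u x)"
proof -
 have "(%x. (-1)*(v x - u x)) = (%x. u x - v x)" by auto
 then show ?thesis using Nn_cmult[of "-1" "%x. v x - u x"] by simp
qed

lemma Nn_diff:
 assumes "u : XX" "v : XX"
 shows "abs (Nn u - Nn v) <= Nn (%x. u x - v x)"
proof -
 have "Nn u <= Nn v + Nn (%x. u x - v x)" using Nn_add[OF assms(2) XX_diff[OF assms]] by simp
 moreover have "Nn v <= Nn u + Nn (%x. v x - u x)" using Nn_add[OF assms(1) XX_diff[OF assms(2,1)]] by simp
 ultimately show ?thesis using Nn_minus_commute[of u v] by linarith
qed

lemma max_XX: "u : XX ==> (%x. max (u x) 0) : XX"
proof -
 assume u: "u : XX"
 have [measurable]: "u : Bl" using XX_DD[OF u] by auto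
 have m: "(%x. max (u x) 0) : Bl" by measurable
 have "(%x. max (u x) 0) : DD" by (rule DD_bound[OF XX_DD[OF u] m, where C = 1]) (auto simp: max_def)
 then show ?thesis using XX_off[OF u] by (auto simp: XX_def)
qed

lemma XX_T_tendsto:
 assumes r: "1 <= r" "r <= ps" and u: "u : XX" and g: "!!y. g y : XX" and lim: "((%y. Nn (%x. g y x - u x)) \<longlongrightarrow> 0) F"
 shows "((%y. Nl r (%x. g y x - u x)) \<longlongrightarrow> 0) F"
proof (rule tendsto_sandwich[OF _ _ tendsto_const])
 show "\<forall>\<^sub>F y in F. Nl r (%x. g y x - u x) <= emb*Nn (%x. g y x - u x)" by (intro always_eventually allI embedding XX_diff g u r)
 show "((%y. emb*Nn (%x. g y x - u x)) \<longlongrightarrow> 0) F" using tendsto_mult[OF tendsto_const lim, of emb] by simp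
qed auto

lemma Nn_dq: "Lpn LL p (%z. dq s p u z - dq s p v z) = Nn (%x. u x - v x)"
proof -
 have "dq s p (%x. u x - v x) = (%z. dq s p u z - dq s p v z)" by (rule ext) (rule dq_diff)
 then show ?thesis by (simp add: Nn_def)
qed

lemma XX_dq: "u : XX ==> Lp LL p (dq s p u)" using XX_DD by auto

lemma ps1: "1 <= ps" using ps_facts(2) by linarith

lemma eigen_zero:
 assumes phi: "phi : XX" "!!x. 0 <= phi x" "AE x in leb. x : Om --> 0 < phi x" "Il p phi = 1" and a: "G phi < a"
  and z: "z : XX" "AE x in leb. 0 <= z x"
  and eig: "!!v. v : XX ==> EE z v = a*DTl p 1 1 z v"
 shows "AE x in leb. z x = 0"
proof -
 define y where "y = (%x. max (z x) 0)"
 have y: "y : XX" unfolding y_def by (rule max_XX[OF z(1)])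
 have yz: "AE x in leb. y x = z x" using z(2) by eventually_elim (simp add: y_def)
 have dyz: "AE w in LL. dq s p y w = dq s p z w" using AE_LL[OF yz] by eventually_elim (simp add: dq_def)
 have m: "z : Bl" "y : Bl" using XX_DD[OF z(1)] XX_DD[OF y] by auto
 have "AE x in leb. y x = 0"
 proof (rule nonneg_eigenfunction_zero[OF phi a y])
  fix v assume v: "v : XX"
  then have vm: "v : Bl" using XX_DD[OF v] by auto
  have "EE y v = EE z v" by (rule DT_cong_AE[OF measurable_dq[OF m(2)] measurable_dq[OF m(1)] measurable_dq[OF vm] measurable_dq[OF vm] dyz]) simp
  also have "... = a*DTl p 1 1 z v" by (rule eig[OF v])
  also have "DTl p 1 1 z v = DTl p 1 1 y v" by (rule DT_cong_AE[OF m(2) m(1) vm vm yz, symmetric]) simp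
  finally show "EE y v = a*DTl p 1 1 y v" .
 qed (simp add: y_def)
 then show ?thesis using yz by eventually_elim simp
qed

text \<open>The switch \<open>th\<close> is the weight of the negative part: 1 gives the problem
  itself, 0 the version in which only the positive part of u enters. The three functionals used have
  (\<open>th\<close>, critical coefficient) = (0, 0), (0, b) and (1, b).\<close>

definition JJ :: "real => real => real => real => real => (real^'n => real) => real" where
 "JJ q lam a b th u = 1/p*T LL p 1 1 (dq s p u) + lam/q*Tl q 1 th u - a/p*Tl p 1 th u - b/ps*Tl ps 1 0 u"

definition JJd :: "real => real => real => real => real => (real^'n => real) => (real^'n => real) => real" where
 "JJd q lam a b th u v = EE u v + lam*DTl q 1 th u v - a*DTl p 1 th u v - b*DTl ps 1 0 u v"

text \<open>Since 1/p - 1/ps = s/N, this is the usual threshold (s/N) Sob^(N/(s p)) b^(1 - N/(s p)):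
  the least energy that concentrating mass can carry away.\<close>

definition cst :: "real => real" where
 "cst b = (1/p - 1/ps)*b*(Sob/b) powr (ps/(ps - p))"

end

text \<open>The condition on \<open>th\<close> fits the sign argument for normalised Cerami
  sequences: with \<open>th\<close> = 0 their limits are nonnegative, with \<open>th\<close> = 1 a
  positive b forces them to be nonpositive. Otherwise a sign-changing eigenfunction with eigenvalue
  a would not be excluded by Picone.\<close>

locale func = fracX s p N ps TN Om for s p N ps and TN :: "'n::finite itself" and Om +
 fixes phi :: "real^'n => real" and q lam a b th :: real
 assumes phi: "phi : XX" "!!x. 0 <= phi x" "AE x in leb. x : Om --> 0 < phi x" "Il p phi = 1" and a: "G phi < a"
  and q1: "1 < q" and qp: "q < p" and lam0: "lam > 0" and b0: "b >= 0" and th: "th = 0 \<or> (th = 1 \<and> b > 0)"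
begin

abbreviation J :: "(real^'n => real) => real" where
 "J \<equiv> JJ q lam a b th"

abbreviation Jd :: "(real^'n => real) => (real^'n => real) => real" where
 "Jd \<equiv> JJd q lam a b th"

lemmas J_def = JJ_def and Jd_def = JJd_def

lemma exps: "q <= ps" "p <= ps" "1 <= p" "1 <= q" "q > 0" "ps > 1"
 using ps_facts(1,2) q1 qp p1 by auto

lemma Lps: "u : XX ==> Ll q u" "u : XX ==> Ll p u" "u : XX ==> Ll ps u"
 using exps p0 by (auto intro!: XX_Lp)

lemma Jd_lin:
 assumes "u : XX" "v : XX" "w : XX"
 shows "Jd u (%x. v x + c*w x) = Jd u v + c*Jd u w" unfolding Jd_def dq_lin_fun using assms p1 q1 exps by (simp add: DT_lin Lps XX_dq algebra_simps)

lemma Jd_uminus: "u : XX ==> v : XX ==> Jd u (%x. - v x) = - Jd u v"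
proof -
 assume "u : XX" "v : XX"
 moreover have "Jd u (%x. 0) = 0" by (simp add: Jd_def DT_def dq_def)
 ultimately show ?thesis using Jd_lin[of u "%x. 0" v "-1"] XX_zero by simp
qed

lemma J_self: "u : XX ==> J u - Jd u u/p = lam*(1/q - 1/p)*Tl q 1 th u + b*(1/p - 1/ps)*Tl ps 1 0 u"
 unfolding J_def Jd_def using p1 q1 exps by (simp add: DT_self field_simps)

lemma th_nonneg: "th >= 0" using th by auto

lemma T_nn: "Tl q 1 th u >= 0" "Tl p 1 th u >= 0" "Tl ps 1 0 u >= 0"
 using th_nonneg by (auto intro!: T_nonneg)

lemma J_tendsto:
 assumes u: "u : XX" and g: "!!y. g y : XX" and lim: "((%y. Nn (%x. g y x - u x)) \<longlongrightarrow> 0) F"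
 shows "((%y. J (g y)) \<longlongrightarrow> J u) F" unfolding J_def
 by (intro tendsto_intros T_tendsto_filter XX_T_tendsto XX_dq Lps exps ps1 order_refl u g lim)
  (simp add: Nn_dq lim)

lemma Jd_tendsto:
 assumes u: "u : XX" and g: "!!y. g y : XX" and lim: "((%y. Nn (%x. g y x - u x)) \<longlongrightarrow> 0) F" and v: "v : XX"
 shows "((%y. Jd (g y) v) \<longlongrightarrow> Jd u v) F" unfolding Jd_def
 by (intro tendsto_intros DT_tendsto_filter XX_T_tendsto XX_dq Lps exps order_refl u g lim v q1 p1 ps1)
  (simp add: Nn_dq lim)

lemma J_uniform_diff:
 assumes e: "e > 0" and R: "R > 0"
 shows "EX d>0. ALL u v t. u : XX --> v : XX --> Nn u <= R --> Nn v <= R --> 0 <= t --> t <= d -->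
  J (%x. u x + t * v x) <= J u + t*Jd u v + e*t"
proof -
 have e4: "e/4 > 0" using e by simp
 define R' where "R' = emb*R"
 have R': "R' > 0" using emb_pos R by (simp add: R'_def)
 have "EX d>0. ALL f g t. Lp LL p f --> Lp LL p g --> Lpn LL p f <= R --> Lpn LL p g <= R --> 0 <= t --> t <= d -->
  abs (1/p*T (LL :: ((real^'n) \<times> (real^'n)) measure) p 1 1 (%x. f x + t*g x) - 1/p*T LL p 1 1 f - t*(1*DT LL p 1 1 f g)) <= e/4*t"
  by (rule T_uniform_diff_cmult[OF p1 e4 R])
 then obtain d1 where d1: "d1 > 0" "!!f g t. Lp LL p f ==> Lp LL p g ==> Lpn LL p f <= R ==> Lpn LL p g <= R ==> 0 <= t ==> t <= d1 ==>
  abs (1/p*T (LL :: ((real^'n) \<times> (real^'n)) measure) p 1 1 (%x. f x + t*g x) - 1/p*T LL p 1 1 f - t*(1*DT LL p 1 1 f g)) <= e/4*t" by blast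
 have *: "EX d>0. ALL u v t. u : XX --> v : XX --> Nn u <= R --> Nn v <= R --> 0 <= t --> t <= d -->
  abs (c/r*Tl r cp cm (%x. u x + t * v x) - c/r*Tl r cp cm u - t*(c*DTl r cp cm u v)) <= e/4*t"
  if r: "1 < r" "r <= ps" for r c cp cm
 proof -
  obtain d where d: "d > 0" "!!f g t. Ll r f ==> Ll r g ==> Nl r f <= R' ==> Nl r g <= R' ==> 0 <= t ==> t <= d ==>
  abs (c/r*T (leb :: (real^'n) measure) r cp cm (%x. f x + t*g x) - c/r*Tl r cp cm f - t*(c*DTl r cp cm f g)) <= e/4*t"
   using T_uniform_diff_cmult[OF r(1) e4 R', of leb c cp cm] by blast
  have "ALL u v t. u : XX --> v : XX --> Nn u <= R --> Nn v <= R --> 0 <= t --> t <= d -->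
  abs (c/r*Tl r cp cm (%x. u x + t * v x) - c/r*Tl r cp cm u - t*(c*DTl r cp cm u v)) <= e/4*t" using r unfolding R'_def[symmetric]
   by (intro allI impI d(2) XX_Lp; (assumption | simp add: embedding_le(1)[where C = R, folded R'_def] less_imp_le)?)
  then show ?thesis using d(1) by blast
 qed
 obtain d2 where d2: "d2 > 0" "!!u v t. u : XX ==> v : XX ==> Nn u <= R ==> Nn v <= R ==> 0 <= t ==> t <= d2 ==>
  abs (lam/q*Tl q 1 th (%x. u x + t * v x) - lam/q*Tl q 1 th u - t*(lam*DTl q 1 th u v)) <= e/4*t" using *[OF q1 exps(1), of lam 1 th] by blast
 obtain d3 where d3: "d3 > 0" "!!u v t. u : XX ==> v : XX ==> Nn u <= R ==> Nn v <= R ==> 0 <= t ==> t <= d3 ==>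
  abs (a/p*Tl p 1 th (%x. u x + t * v x) - a/p*Tl p 1 th u - t*(a*DTl p 1 th u v)) <= e/4*t" using *[OF p1 exps(2), of a 1 th] by blast
 obtain d4 where d4: "d4 > 0" "!!u v t. u : XX ==> v : XX ==> Nn u <= R ==> Nn v <= R ==> 0 <= t ==> t <= d4 ==>
  abs (b/ps*Tl ps 1 0 (%x. u x + t * v x) - b/ps*Tl ps 1 0 u - t*(b*DTl ps 1 0 u v)) <= e/4*t" using *[OF exps(6) order_refl, of b 1 0] by blast
 define d where "d = min (min d1 d2) (min d3 d4)"
 have "J (%x. u x + t * v x) <= J u + t*Jd u v + e*t"
  if u: "u : XX" and v: "v : XX" and n: "Nn u <= R" "Nn v <= R" and t: "0 <= t" "t <= d" for u v t
 proof -
  have t': "t <= d1" "t <= d2" "t <= d3" "t <= d4" using t by (auto simp: d_def)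
  note b1 = d1(2)[OF XX_dq[OF u] XX_dq[OF v] n[unfolded Nn_def] t(1) t'(1), folded dq_lin_fun]
  note b2 = d2(2)[OF u v n t(1) t'(2)] and b3 = d3(2)[OF u v n t(1) t'(3)] and b4 = d4(2)[OF u v n t(1) t'(4)]
  have "J (%x. u x + t * v x) - J u - t*Jd u v
   = (1/p*T LL p 1 1 (dq s p (%x. u x + t * v x)) - 1/p*T LL p 1 1 (dq s p u) - t*(1*EE u v))
   + (lam/q*Tl q 1 th (%x. u x + t * v x) - lam/q*Tl q 1 th u - t*(lam*DTl q 1 th u v))
   - (a/p*Tl p 1 th (%x. u x + t * v x) - a/p*Tl p 1 th u - t*(a*DTl p 1 th u v))
   - (b/ps*Tl ps 1 0 (%x. u x + t * v x) - b/ps*Tl ps 1 0 u - t*(b*DTl ps 1 0 u v))" unfolding J_def Jd_def by (simp add: algebra_simps)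
  then show ?thesis using b1 b2 b3 b4 by linarith
 qed
 moreover have "d > 0" using d1(1) d2(1) d3(1) d4(1) by (simp add: d_def)
 ultimately show ?thesis by blast
qed

text \<open>The set of directions is symmetric, so a bound from one side suffices. The radius 2 +
  \<open>Nn u\<close>, rather than a constant, encodes Cerami's condition and admits v = u.\<close>

lemma Jd_small:
 assumes u: "u : XX" and hyp: "!!v. v : XX ==> Nn v <= 2 + Nn u ==> - e <= Jd u v" and v: "v : XX" "Nn v <= 2 + Nn u"
 shows "abs (Jd u v) <= e"
proof -
 have "Nn (%x. - v x) = Nn v" using Nn_cmult[of "-1" v] by simp
 moreover have "(%x. - v x) : XX" using XX_cmult[OF v(1), of "-1"] by simp
 ultimately show ?thesis using hyp[OF v] hyp[of "%x. - v x"] v Jd_uminus[OF u v(1)] by auto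
qed

lemma critical_term_bound:
 assumes K: "!!n. b*Tl ps 1 0 (u n) <= K" and u: "!!n. u n : XX" and v: "v : XX"
 shows "EX K'. ALL n::nat. abs (b*DTl ps 1 0 (u n) v) <= K'"
proof (cases "b = 0")
 case False
 then have b: "b > 0" using b0 by simp
 have "abs (b*DTl ps 1 0 (u n) v) <= b*(2*((K/b) powr ((ps - 1)/ps)*Nl ps v))" for n
 proof -
  have m: "Ll ps (%x. max (u n x) 0)" by (intro Lps max_XX u)
  have "Il ps (%x. max (u n x) 0) <= K/b" using K[of n] b T_pos_part[of ps leb "u n"] exps by (simp add: field_simps)
  then have "Nl ps (%x. max (u n x) 0) powr (ps - 1) <= (K/b) powr ((ps - 1)/ps)" unfolding Lpn_def powr_powr using exps by (simp add: powr_mono2)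
  moreover have "abs (DTl ps 1 0 (u n) v) <= 2*(Nl ps (%x. max (u n x) 0) powr (ps - 1)*Nl ps v)"
   using DT_abs_le[OF m Lps(3)[OF v] exps(6), of 1 1] DT_pos_part[OF exps(6), of leb "u n" v] by simp
  ultimately have "abs (DTl ps 1 0 (u n) v) <= 2*((K/b) powr ((ps - 1)/ps)*Nl ps v)"
   by (meson order_trans mult_left_mono mult_right_mono Lpn_nonneg zero_le_numeral)
  then show ?thesis using b by (simp add: abs_mult)
 qed
 then show ?thesis by blast
qed auto

text \<open>If the norms were unbounded, the limit z of the normalised sequence would solve the
  eigenvalue equation for a and have a sign, so z = 0 by \<open>eigen_zero\<close>. But the
  derivative tested with u itself, divided by the p-th power of the norm, leaves 1 = a
  \<open>Tl p 1 th z\<close> = 0 in the limit.\<close>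

lemma Cerami_bounded:
 assumes u: "!!n. u n : XX" and le: "!!n. J (u n) <= \<beta>"
  and hyp: "!!n v. v : XX ==> Nn v <= 2 + Nn (u n) ==> - (1/(real n + 1)) <= Jd (u n) v"
 shows "EX C. ALL n. Nn (u n) <= C"
proof (rule ccontr)
 assume unb: "\<not> (EX C. ALL n. Nn (u n) <= C)"
 have "EX m>=n. real n + 1 < Nn (u m)" for n
 proof (rule ccontr)
  assume "\<not> (EX m>=n. real n + 1 < Nn (u m))"
  then have "Nn (u m) <= (real n + 1) + (\<Sum>i<n. Nn (u i))" for m
  proof (cases "m < n")
   case True
   then have "Nn (u m) <= (\<Sum>i<n. Nn (u i))" by (intro member_le_sum) auto
   then show ?thesis by simp
  next
   case False
   then have "Nn (u m) <= real n + 1" using \<open>\<not> (EX m>=n. real n + 1 < Nn (u m))\<close> by (meson not_le not_less)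
   moreover have "0 <= (\<Sum>i<n. Nn (u i))" by (intro sum_nonneg) simp
   ultimately show ?thesis by linarith
  qed
  then show False using unb by blast
 qed
 then obtain k where k: "!!n. k n >= n" "!!n. real n + 1 < Nn (u (k n))" by metis
 define w where "w n = (%x. (1/Nn (u (k n)))*u (k n) x)" for n
 have wX: "w n : XX" for n unfolding w_def by (rule XX_cmult[OF u])
 have wN: "Nn (w n) = 1" for n
 proof -
  have "Nn (u (k n)) > 0" using k(2)[of n] by linarith
  then show ?thesis unfolding w_def Nn_cmult by simp
 qed
 obtain j z where j: "strict_mono j" "z : XX" "AE x in leb. (%n. w (j n) x) ---> z x"
  "!!r. 1 <= r ==> r < ps ==> (%n. Il r (%x. w (j n) x - z x)) ---> 0" using XX_compact[of w 1, OF wX] wN by auto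
 define U where "U n = u (k (j n))" for n
 define t where "t n = Nn (U n)" for n
 define W where "W n = w (j n)" for n
 have UX: "U n : XX" for n unfolding U_def by (rule u)
 have WX: "W n : XX" for n unfolding W_def by (rule wX)
 have jn: "n <= j n" for n using j(1) by (rule strict_mono_imp_increasing)
 have t1: "t n >= real n + 1" for n using k(2)[of "j n"] jn[of n] by (simp add: t_def U_def)
 have tpos: "t n > 0" for n using t1[of n] by linarith
 have UW: "U n = (%x. t n*W n x)" for n using tpos[of n] by (simp add: W_def w_def t_def U_def)
 have small: "abs (Jd (U n) v) <= 1" if "v : XX" "Nn v <= 2 + t n" for n v
 proof (rule Jd_small[OF UX _ that(1)])
  fix v assume "v : XX" "Nn v <= 2 + Nn (U n)"
  then have "- (1/(real (k (j n)) + 1)) <= Jd (U n) v" unfolding U_def by (intro hyp) auto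
  moreover have "1/(real (k (j n)) + 1) <= 1" by simp
  ultimately show "- 1 <= Jd (U n) v" by linarith
 qed (use that in \<open>simp add: t_def\<close>)
 have t_inf: "filterlim t at_top sequentially"
  by (rule filterlim_at_top_mono[OF filterlim_real_sequentially]) (use t1 in \<open>auto intro!: always_eventually order_trans[OF _ t1]\<close>)
 have tneg: "(%n. t n powr c) ---> 0" if "c < 0" for c using tendsto_neg_powr[OF that t_inf] .
 have tsmall: "(%n. X n*t n powr c) ---> 0" if c: "c < 0" and X: "EV n. abs (X n) <= C" for X C c
 proof (rule Lim_null_comparison)
  show "EV n. norm (X n*t n powr c) <= C*t n powr c" using X by eventually_elim (simp add: abs_mult mult_right_mono)
  show "(%n. C*t n powr c) ---> 0" using tendsto_mult[OF tendsto_const tneg[OF c], of C] by simp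
 qed
 \<comment> \<open>Subtracting \<open>Jd\<close>/p from \<open>J\<close> cancels both p-homogeneous
   terms and leaves nonnegative multiples of the lam-term and the critical term. So the latter stays
   bounded although the norms do not.\<close>
 have K: "b*Tl ps 1 0 (U n) <= (\<beta> + 1)/(1/p - 1/ps)" for n
 proof -
  have "abs (Jd (U n) (U n)) <= 1" by (rule small[OF UX]) (simp add: t_def)
  then have "- (Jd (U n) (U n))/p <= 1/p" using p0 by (intro divide_right_mono) auto
  moreover have "1/p <= 1" using p1 by simp
  ultimately have 1: "J (U n) - Jd (U n) (U n)/p <= \<beta> + 1" using le[of "k (j n)"] by (simp add: U_def)
  have "lam*(1/q - 1/p)*Tl q 1 th (U n) >= 0" using lam0 q1 qp T_nn(1)[of "U n"] by (intro mult_nonneg_nonneg) (auto simp: field_simps)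
  then have "b*(1/p - 1/ps)*Tl ps 1 0 (U n) <= \<beta> + 1" using 1 J_self[OF UX[of n]] by linarith
  moreover have "1/p - 1/ps > 0" using ps_facts(1) p0 by (simp add: field_simps)
  ultimately show ?thesis by (simp add: field_simps)
 qed
 define K0 where "K0 = (\<beta> + 1)/(1/p - 1/ps)"
 have WL: "Lpi LL p (dq s p (W n)) <= 1" for n unfolding Nn_powr[symmetric] using wN[of "j n"] by (simp add: W_def)
 have WN1: "Nn (W n) <= 1" for n using wN by (simp add: W_def)
 have zm: "z : Bl" using XX_DD[OF j(2)] by auto
 have lim: "AE x in leb. (%n. W n x) ---> z x" using j(3) by (simp add: W_def)
 have limdq: "AE w in LL. (%n. dq s p (W n) w) ---> dq s p z w" by (rule AE_dq_limit[OF lim])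
 have Tlim: "(%n. Tl r cp cm (W n)) ---> Tl r cp cm z" if "1 <= r" "r < ps" for r cp cm
  using that by (intro T_tendsto XX_Lp[OF WX] XX_Lp[OF j(2)]) (auto simp: W_def j(4))
 have eq: "EE z v = a*DTl p 1 th z v" if v: "v : XX" for v
 proof -
  obtain K' where K': "!!n. abs (b*DTl ps 1 0 (U n) v) <= K'" using critical_term_bound[of U, OF K UX v] by blast
  have l1: "(%n. EE (W n) v) ---> EE z v" by (rule DT_weak_convergence[OF XX_dq[OF WX] WL measurable_dq[OF zm] limdq p1 XX_dq[OF v]])
  have l2: "(%n. DTl r 1 th (W n) v) ---> DTl r 1 th z v" if r: "1 < r" "r <= ps" for r
   by (rule DT_weak_convergence[OF XX_Lp[OF WX] embedding_le(2)[OF WX _ r(2) WN1] zm lim r(1) XX_Lp[OF v]]) (use r in auto)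
  have idn: "EE (W n) v - a*DTl p 1 th (W n) v
   = Jd (U n) v * t n powr (1 - p) - lam*(t n powr (q - p)*DTl q 1 th (W n) v) + b*DTl ps 1 0 (U n) v * t n powr (1 - p)" for n
  proof -
   have "Jd (U n) v = t n powr (p - 1)*EE (W n) v
    + lam*(t n powr (q - 1)*DTl q 1 th (W n) v) - a*(t n powr (p - 1)*DTl p 1 th (W n) v) - b*DTl ps 1 0 (U n) v"
   proof -
    have "dq s p (U n) = (%z. t n*dq s p (W n) z)" unfolding UW by (rule ext) (rule dq_cmult)
    moreover have "DTl r 1 th (U n) v = t n powr (r - 1)*DTl r 1 th (W n) v" for r unfolding UW by (rule DT_cmult_pos[OF tpos])
    ultimately show ?thesis unfolding Jd_def by (simp add: DT_cmult_pos[OF tpos])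
   qed
   then have e: "Jd (U n) v + b*DTl ps 1 0 (U n) v = t n powr (p - 1)*EE (W n) v
    + lam*(t n powr (q - 1)*DTl q 1 th (W n) v) - a*(t n powr (p - 1)*DTl p 1 th (W n) v)" by linarith
   have "(Jd (U n) v + b*DTl ps 1 0 (U n) v)*t n powr (1 - p)
    = (t n powr (p - 1)*t n powr (1 - p))*(EE (W n) v - a*DTl p 1 th (W n) v)
     + lam*((t n powr (q - 1)*t n powr (1 - p))*DTl q 1 th (W n) v)" unfolding e by (simp add: algebra_simps)
   also have "t n powr (p - 1)*t n powr (1 - p) = 1" using tpos[of n] by (simp add: powr_add[symmetric])
   also have "t n powr (q - 1)*t n powr (1 - p) = t n powr (q - p)" by (simp add: powr_add[symmetric])
   finally show ?thesis by (simp add: algebra_simps)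
  qed
  have ev: "EV n. abs (Jd (U n) v) <= 1"
  proof -
   have "EV n. Nn v <= t n" using t_inf by (simp add: filterlim_at_top)
   then show ?thesis by eventually_elim (use small[OF v] in auto)
  qed
  have "(%n. Jd (U n) v * t n powr (1 - p) - lam*(t n powr (q - p)*DTl q 1 th (W n) v) + b*DTl ps 1 0 (U n) v * t n powr (1 - p))
   ---> 0 - lam*(0*DTl q 1 th z v) + 0"
   by (intro tendsto_intros tsmall[OF _ ev] tneg l2 q1 exps tsmall[OF _ always_eventually[OF allI[OF K']]]) (use p1 qp in auto)
  then have "(%n. EE (W n) v - a*DTl p 1 th (W n) v) ---> 0" unfolding idn by simp
  moreover have "(%n. EE (W n) v - a*DTl p 1 th (W n) v)
   ---> EE z v - a*DTl p 1 th z v" by (intro tendsto_intros l1 l2 p1 exps)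
  ultimately show ?thesis using LIMSEQ_unique by fastforce
 qed
 have z0: "AE x in leb. z x = 0" using th
 proof
  assume t0: "th = 0"
  note mt = min_test[OF j(2)]
  have "G (%x. min (z x) 0) <= 0" using mt(2) eq[OF mt(1)] mt(3)[OF p1] by (simp add: t0)
  then have "Nn (%x. min (z x) 0) = 0" using Lpi_nonneg[of LL p "dq s p (%x. min (z x) 0)"] by (simp add: Nn_def Lpn_def)
  then have "AE x in leb. min (z x) 0 = 0" by (rule Nn_eq_0[OF mt(1)])
  then have zn: "AE x in leb. 0 <= z x" by eventually_elim (auto simp: min_def split: if_splits)
  show ?thesis
  proof (rule eigen_zero[OF phi a j(2) zn])
   fix v assume v: "v : XX"
   have vm: "v : Bl" using XX_DD[OF v] by auto
   have mm: "(%x. max (z x) 0) : Bl" using zm by measurable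
   have "DTl p 1 0 z v = DTl p 1 1 (%x. max (z x) 0) v" by (rule DT_pos_part[OF p1])
   also have "... = DTl p 1 1 z v" by (rule DT_cong_AE[OF mm zm vm vm]) (use zn in auto)
   finally show "EE z v = a*DTl p 1 1 z v" using eq[OF v] by (simp add: t0)
  qed
 next
  assume th1: "th = 1 \<and> b > 0"
  \<comment> \<open>Bounded critical mass of \<open>U n\<close>, divided by the ps-th power of its
    norm, makes the positive part of the limit vanish.\<close>
  have Tps: "Il ps (%x. max (W n x) 0) <= K0/b*t n powr (- ps)" for n
  proof -
   have "b*(t n powr ps*Tl ps 1 0 (W n)) <= K0" using K[of n] pw_cmult_pos[OF tpos[of n], of leb ps 1 0 "W n"] unfolding K0_def UW by simp
   then have "Tl ps 1 0 (W n) <= K0/b*t n powr (- ps)" using th1 tpos[of n] by (simp add: powr_minus field_simps)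
   then show ?thesis using exps by (simp add: T_pos_part)
  qed
  have mz: "(%x. max (z x) 0) : XX" by (rule max_XX[OF j(2)])
  have "Il ps (%x. max (z x) 0) <= e" if e: "e > 0" for e
  proof -
   have "(%n. K0/b*t n powr (- ps)) ---> K0/b*0" by (intro tendsto_intros tneg) (use exps in auto)
   then have "EV n. K0/b*t n powr (- ps) < e" using e by (intro order_tendstoD(2)) auto
   then obtain m where m: "!!n. n >= m ==> K0/b*t n powr (- ps) < e" by (auto simp: eventually_sequentially)
   show ?thesis
   proof (rule Fatou_Lp(2)[of leb ps "%n x. max (W (n + m) x) 0"])
    show "Il ps (%x. max (W (n + m) x) 0) <= e" for n using Tps[of "n + m"] m[of "n + m"] by simp
    show "AE x in leb. (%n. max (W (n + m) x) 0) ---> max (z x) 0" using lim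
    proof eventually_elim
     case (elim x)
     show ?case by (intro tendsto_max tendsto_const LIMSEQ_ignore_initial_segment[OF elim])
    qed
   qed (use exps Lps(3)[OF max_XX[OF WX]] XX_DD[OF mz] in auto)
  qed
  then have "Il ps (%x. max (z x) 0) <= 0" by (rule field_le_epsilon[of _ 0, simplified])
  then have "Il ps (%x. max (z x) 0) = 0" by (simp add: antisym)
  then have "AE x in leb. max (z x) 0 = 0" using Lpi_eq_0[OF Lps(3)[OF mz]] by simp
  then have zn: "AE x in leb. 0 <= - z x" by eventually_elim (auto simp: max_def split: if_splits)
  have "AE x in leb. - z x = 0"
  proof (rule eigen_zero[OF phi a _ zn])
   show "(%x. - z x) : XX" using XX_cmult[OF j(2), of "-1"] by simp
   fix v assume v: "v : XX"
   have "dq s p (%x. - z x) = (%w. - dq s p z w)" using dq_cmult[of s p "-1" z] by (auto simp: fun_eq_iff)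
   then show "EE (%x. - z x) v = a*DTl p 1 1 (%x. - z x) v" using eq[OF v] th1 by (simp add: DT_uminus)
  qed
  then show ?thesis by simp
 qed
 have Tz: "Tl r cp cm z = 0" for r cp cm using T_cong_AE[OF zm _ z0, of r cp cm] by (simp add: T_def)
 have id1: "1 = Jd (U n) (U n)*t n powr (- p) - lam*(t n powr (q - p)*Tl q 1 th (W n)) + a*Tl p 1 th (W n)
  + b*Tl ps 1 0 (U n)*t n powr (- p)" for n
 proof -
  have "Jd (U n) (U n) = t n powr p*1 + lam*(t n powr q*Tl q 1 th (W n)) - a*(t n powr p*Tl p 1 th (W n)) - b*Tl ps 1 0 (U n)"
  proof -
   have "T LL p 1 1 (dq s p (U n)) = t n powr p" using Nn_powr[of "U n"] by (simp add: T_one_one t_def)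
   moreover have "Tl r 1 th (U n) = t n powr r*Tl r 1 th (W n)" for r unfolding UW by (rule pw_cmult_pos[OF tpos])
   ultimately show ?thesis unfolding Jd_def using p1 q1 exps by (simp add: DT_self)
  qed
  then have e: "Jd (U n) (U n) + b*Tl ps 1 0 (U n) = t n powr p + lam*(t n powr q*Tl q 1 th (W n)) - a*(t n powr p*Tl p 1 th (W n))" by linarith
  have "(Jd (U n) (U n) + b*Tl ps 1 0 (U n))*t n powr (- p)
   = (t n powr p*t n powr (- p))*(1 - a*Tl p 1 th (W n)) + lam*((t n powr q*t n powr (- p))*Tl q 1 th (W n))" unfolding e by (simp add: algebra_simps)
  also have "t n powr p*t n powr (- p) = 1" using tpos[of n] by (simp add: powr_add[symmetric])
  also have "t n powr q*t n powr (- p) = t n powr (q - p)" by (simp add: powr_add[symmetric])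
  finally show ?thesis by (simp add: algebra_simps)
 qed
 have sU: "abs (Jd (U n) (U n)) <= 1" for n by (rule small[OF UX]) (simp add: t_def)
 have Kabs: "abs (b*Tl ps 1 0 (U n)) <= K0" for n using K[of n] b0 T_nn(3)[of "U n"] by (simp add: K0_def)
 have "(%n. Jd (U n) (U n)*t n powr (- p) - lam*(t n powr (q - p)*Tl q 1 th (W n)) + a*Tl p 1 th (W n)
  + b*Tl ps 1 0 (U n)*t n powr (- p)) ---> 0 - lam*(0*Tl q 1 th z) + a*Tl p 1 th z + 0"
  by (intro tendsto_intros tsmall[OF _ always_eventually[OF allI[OF sU]]] tneg Tlim tsmall[OF _ always_eventually[OF allI[OF Kabs]]])
   (use p1 q1 qp ps_facts(1) in auto)
 then have "(%n::nat. 1::real) ---> 0" unfolding id1[symmetric] by (simp add: Tz)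
 then show False by (simp add: LIMSEQ_const_iff)
qed

text \<open>A lost mass l with energy b l must still obey the Sobolev inequality Sob l^(p/ps) <= b
  l, which bounds a positive l from below.\<close>

lemma concentration_bound:
 assumes b: "b > 0" and l: "l > 0" "l <= (b*l/Sob) powr (ps/p)"
 shows "(Sob/b) powr (ps/(ps - p)) <= l"
proof (rule ccontr)
 assume "\<not> ?thesis"
 then have lt: "l < (Sob/b) powr (ps/(ps - p))" by simp
 have psp: "ps - p > 0" using ps_facts(1) by simp
 have "l powr ((ps - p)/p) < ((Sob/b) powr (ps/(ps - p))) powr ((ps - p)/p)" using lt l psp p0 by (intro powr_less_mono2) auto
 also have "... = (Sob/b) powr (ps/p)" using psp p0 by (simp add: powr_powr)
 finally have 1: "l powr ((ps - p)/p) < (Sob/b) powr (ps/p)" .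
 have "l powr (ps/p) = l*l powr ((ps - p)/p)"
 proof -
  have "l*l powr ((ps - p)/p) = l powr (1 + (ps - p)/p)" using powr_mult_base[of l "(ps - p)/p"] l by simp
  also have "1 + (ps - p)/p = ps/p" using p0 by (simp add: field_simps)
  finally show ?thesis by simp
 qed
 then have "l powr (ps/p) < l*(Sob/b) powr (ps/p)" using 1 l by simp
 then have "(b/Sob) powr (ps/p)*l powr (ps/p) < (b/Sob) powr (ps/p)*(l*(Sob/b) powr (ps/p))" using b Sob_pos by simp
 also have "... = l*((b/Sob)*(Sob/b)) powr (ps/p)" by (subst powr_mult) (use b Sob_pos in auto)
 also have "... = l" using b Sob_pos l by simp
 also have "(b/Sob) powr (ps/p)*l powr (ps/p) = (b*l/Sob) powr (ps/p)" using powr_mult[of "b/Sob" l "ps/p"] b Sob_pos l by simp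
 finally show False using l by simp
qed

text \<open>The remainder u_n - z carries energy \<open>g n\<close> and critical mass
  \<open>m n\<close> with \<open>g n - b*m n\<close> -> 0 by Brezis-Lieb. If the mass had a positive
  limit along a subsequence, it would add at least \<open>cst b\<close> to J(z) >= 0, too much for
  the level. So the mass vanishes and levels pass to the limit.\<close>

lemma Cerami_critical:
 assumes u: "!!n. u n : XX" and J: "!!n. \<alpha> <= J (u n)" "!!n. J (u n) <= \<beta>"
  and hyp: "!!n v. v : XX ==> Nn v <= 2 + Nn (u n) ==> - (1/(real n + 1)) <= Jd (u n) v"
  and \<beta>: "b > 0 ==> \<beta> < cst b"
 shows "EX z:XX. (ALL v:XX. Jd z v = 0) \<and> \<alpha> <= J z \<and> J z <= \<beta>"
proof -
 obtain C where C: "!!n. Nn (u n) <= C" using Cerami_bounded[OF u J(2) hyp] by blast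
 obtain j z where j: "strict_mono j" "z : XX" "AE x in leb. (%n. u (j n) x) ---> z x"
  "!!r. 1 <= r ==> r < ps ==> (%n. Il r (%x. u (j n) x - z x)) ---> 0" "Nn z <= C" using XX_compact[of u C, OF u C] by blast
 define U where "U n = u (j n)" for n
 have UX: "U n : XX" for n unfolding U_def by (rule u)
 have UC: "Nn (U n) <= C" for n unfolding U_def by (rule C)
 have C0: "C >= 0" using UC[of 0] Nn_nonneg[of "U 0"] by linarith
 have jn: "n <= j n" for n using j(1) by (rule strict_mono_imp_increasing)
 have small: "abs (Jd (U n) v) <= 1/(real n + 1)" if "v : XX" "Nn v <= 2 + Nn (U n)" for n v
 proof (rule Jd_small[OF UX _ that])
  fix v assume "v : XX" "Nn v <= 2 + Nn (U n)"
  then have "- (1/(real (j n) + 1)) <= Jd (U n) v" unfolding U_def by (intro hyp) auto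
  moreover have "1/(real (j n) + 1) <= 1/(real n + 1)" using jn[of n] by (intro divide_left_mono) auto
  ultimately show "- (1/(real n + 1)) <= Jd (U n) v" by linarith
 qed
 have eps0: "(%n. 1/(real n + 1)) ---> 0" using lim_1_over_n[THEN LIMSEQ_Suc] by (simp add: add.commute)
 have zm: "z : Bl" using XX_DD[OF j(2)] by auto
 have lim: "AE x in leb. (%n. U n x) ---> z x" using j(3) by (simp add: U_def)
 have limdq: "AE w in LL. (%n. dq s p (U n) w) ---> dq s p z w" by (rule AE_dq_limit[OF lim])
 have UG: "G (U n) <= C powr p" for n unfolding Nn_powr[symmetric] using UC[of n] p0 by (intro powr_mono2) auto
 have Jdlim: "(%n. Jd (U n) v) ---> Jd z v" if v: "v : XX" for v
 proof -
  have l1: "(%n. EE (U n) v) ---> EE z v" by (rule DT_weak_convergence[OF XX_dq[OF UX] UG measurable_dq[OF zm] limdq p1 XX_dq[OF v]])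
  have l2: "(%n. DTl r 1 cm (U n) v) ---> DTl r 1 cm z v" if r: "1 < r" "r <= ps" for r cm
   by (rule DT_weak_convergence[OF XX_Lp[OF UX] embedding_le(2)[OF UX _ r(2) UC] zm lim r(1) XX_Lp[OF v]]) (use r in auto)
  show ?thesis unfolding Jd_def by (intro tendsto_intros l1 l2 p1 q1 exps order_refl)
 qed
 have crit: "Jd z v = 0" if v: "v : XX" for v
 proof -
  define c where "c = 1/(1 + Nn v)"
  have c1: "1 + Nn v > 0" by (simp add: add_pos_nonneg)
  have c: "c > 0" using c1 by (simp add: c_def)
  define w where "w = (%x. c * v x)"
  have w: "w : XX" unfolding w_def by (rule XX_cmult[OF v])
  have "Nn w <= 1" unfolding w_def Nn_cmult c_def using c1 by (simp add: divide_le_eq)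
  then have "abs (Jd (U n) w) <= 1/(real n + 1)" for n using Nn_nonneg[of "U n"] by (intro small w) linarith
  then have "(%n. Jd (U n) w) ---> 0" by (intro Lim_null_comparison[OF _ eps0]) auto
  then have "Jd z w = 0" using Jdlim[OF w] LIMSEQ_unique by blast
  moreover have "Jd z w = c*Jd z v" using Jd_lin[OF j(2) XX_zero v, of c] by (simp add: w_def Jd_def DT_def dq_def)
  ultimately show ?thesis using c by simp
 qed
 have Jd0: "(%n. Jd (U n) (U n)) ---> 0" by (rule Lim_null_comparison[OF _ eps0]) (use small[OF UX] in auto)
 have Tlim: "(%n. Tl r cp cm (U n)) ---> Tl r cp cm z" if "1 <= r" "r < ps" for r cp cm
  using that by (intro T_tendsto XX_Lp[OF UX] XX_Lp[OF j(2)]) (auto simp: U_def j(4))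
 have Jd_self: "Jd v v = G v + lam*Tl q 1 th v - a*Tl p 1 th v - b*Tl ps 1 0 v" for v
  unfolding Jd_def using p1 q1 exps by (simp add: DT_self T_one_one)
 define g where "g n = G (%x. U n x - z x)" for n
 \<comment> \<open>The critical term sees only positive parts, so the splitting is done for these.
   Taking positive parts does not increase distances, hence \<open>m n\<close> is still dominated by
   the full remainder.\<close>
 define m where "m n = Il ps (%x. max (U n x) 0 - max (z x) 0)" for n
 have dX: "(%x. U n x - z x) : XX" for n by (rule XX_diff[OF UX j(2)])
 have "(%n. Lpi LL p (dq s p (U n)) - Lpi LL p (%w. dq s p (U n) w - dq s p z w)) ---> Lpi LL p (dq s p z)"
  by (rule Brezis_Lieb[OF XX_dq[OF UX] UG measurable_dq[OF zm] limdq]) (use p1 in simp)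
 moreover have "Lpi LL p (%w. dq s p (U n) w - dq s p z w) = g n" for n
 proof -
  have "dq s p (%x. U n x - z x) = (%w. dq s p (U n) w - dq s p z w)" by (rule ext) (rule dq_diff)
  then show ?thesis by (simp add: g_def)
 qed
 ultimately have BL1: "(%n. G (U n) - g n) ---> G z" by simp
 have mz: "(%x. max (z x) 0) : XX" by (rule max_XX[OF j(2)])
 have "(%n. Il ps (%x. max (U n x) 0) - Il ps (%x. max (U n x) 0 - max (z x) 0)) ---> Il ps (%x. max (z x) 0)"
 proof (rule Brezis_Lieb)
  show "Il ps (%x. max (U n x) 0) <= (emb*C) powr ps" for n
  proof (rule order_trans[OF _ embedding_le(2)[OF UX ps1 order_refl UC]])
   show "Il ps (%x. max (U n x) 0) <= Il ps (U n)" by (rule Lpi_mono[OF Lps(3)[OF UX]]) (use exps XX_DD[OF max_XX[OF UX]] in auto)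
  qed
  show "AE x in leb. (%n. max (U n x) 0) ---> max (z x) 0" using lim by eventually_elim (intro tendsto_max tendsto_const)
 qed (use Lps(3)[OF max_XX[OF UX]] XX_DD[OF mz] ps1 in auto)
 then have BL2: "(%n. Tl ps 1 0 (U n) - m n) ---> Tl ps 1 0 z" using exps by (simp add: T_pos_part m_def)
 have gm: "(%n. g n - b*m n) ---> 0"
 proof -
  have "(%n. Jd (U n) (U n) - (G (U n) - g n) - lam*Tl q 1 th (U n) + a*Tl p 1 th (U n) + b*(Tl ps 1 0 (U n) - m n))
   ---> 0 - G z - lam*Tl q 1 th z + a*Tl p 1 th z + b*Tl ps 1 0 z" by (intro tendsto_intros Jd0 BL1 BL2 Tlim) (use q1 p1 qp ps_facts(1) in auto)
  moreover have "0 - G z - lam*Tl q 1 th z + a*Tl p 1 th z + b*Tl ps 1 0 z = 0" using crit[OF j(2)] unfolding Jd_self by simp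
  moreover have "Jd (U n) (U n) - (G (U n) - g n) - lam*Tl q 1 th (U n) + a*Tl p 1 th (U n) + b*(Tl ps 1 0 (U n) - m n) = g n - b*m n" for n
   unfolding Jd_self by (simp add: algebra_simps)
  ultimately show ?thesis by simp
 qed
 have Lpi_mono_max: "m n <= Il ps (%x. U n x - z x)" for n unfolding m_def by (rule Lpi_mono[OF Lps(3)[OF dX]])
   (use exps XX_DD[OF XX_diff[OF max_XX[OF UX] mz]] in \<open>auto simp: max_def\<close>)
 have mg: "m n <= (g n/Sob) powr (ps/p)" for n
 proof -
  have "m n <= Il ps (%x. U n x - z x)" by (rule Lpi_mono_max)
  also have "... = (Nl ps (%x. U n x - z x) powr p) powr (ps/p)" using Lpn_powr[of ps leb "%x. U n x - z x"] p0 ps_facts(3) by (simp add: powr_powr)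
  also have "... <= (g n/Sob) powr (ps/p)"
  proof (rule powr_mono2)
   show "Nl ps (%x. U n x - z x) powr p <= g n/Sob" using Sobolev[OF XX_DD[OF dX[of n]]] Sob_pos by (simp add: g_def field_simps)
  qed (use p0 ps_facts(3) in auto)
  finally show ?thesis .
 qed
 define \<kappa>1 where "\<kappa>1 = lam*(1/q - 1/p)"
 define \<kappa>2 where "\<kappa>2 = 1/p - 1/ps"
 have \<kappa>: "\<kappa>1 > 0" "\<kappa>2 > 0" using lam0 q1 qp p0 ps_facts(1) by (auto simp: \<kappa>1_def \<kappa>2_def field_simps)
 have Jval: "J (U n) = \<kappa>1*Tl q 1 th (U n) + \<kappa>2*b*(Tl ps 1 0 (U n) - m n) + \<kappa>2*(b*m n) + Jd (U n) (U n)/p" for n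
  using J_self[OF UX[of n]] by (simp add: \<kappa>1_def \<kappa>2_def algebra_simps)
 have Jz: "J z = \<kappa>1*Tl q 1 th z + \<kappa>2*b*Tl ps 1 0 z" using J_self[OF j(2)] crit[OF j(2)] by (simp add: \<kappa>1_def \<kappa>2_def)
 have Jlim: "(%n. J (U (r n))) ---> J z + \<kappa>2*l" if r: "strict_mono r" and l: "(%n. b*m (r n)) ---> l" for r l
 proof -
  have "(%n. \<kappa>1*Tl q 1 th (U (r n)) + \<kappa>2*b*(Tl ps 1 0 (U (r n)) - m (r n)) + \<kappa>2*(b*m (r n)) + Jd (U (r n)) (U (r n))/p)
   ---> \<kappa>1*Tl q 1 th z + \<kappa>2*b*Tl ps 1 0 z + \<kappa>2*l + 0/p"
   by (intro tendsto_intros l LIMSEQ_subseq_LIMSEQ[OF Jd0 r, unfolded comp_def] LIMSEQ_subseq_LIMSEQ[OF BL2 r, unfolded comp_def]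
     LIMSEQ_subseq_LIMSEQ[OF Tlim r, unfolded comp_def]) (use q1 p1 qp ps_facts(1) in auto)
  then show ?thesis unfolding Jval Jz by simp
 qed
 have m0: "m n >= 0" for n by (simp add: m_def)
 obtain r where r: "strict_mono r" "(%n. b*m (r n)) ---> 0"
 proof (cases "b = 0")
  case True
  then show ?thesis using that[of "%n. n"] by (simp add: strict_mono_def)
 next
  case False
  then have b: "b > 0" using b0 by simp
  have "m n <= (emb*(C + C)) powr ps" for n
  proof -
   have "Nn (%x. U n x - z x) <= Nn (U n) + Nn (%x. - z x)" using Nn_add[OF UX XX_cmult[OF j(2), of "- 1"], of n] by simp
   moreover have "Nn (%x. - z x) = Nn z" using Nn_cmult[of "- 1" z] by simp
   ultimately have "Nn (%x. U n x - z x) <= C + C" using UC[of n] j(5) by linarith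
   from embedding_le(2)[OF dX ps1 order_refl this] Lpi_mono_max[of n] show ?thesis by linarith
  qed
  then have "m n : {0..(emb*(C + C)) powr ps}" for n using m0 by simp
  then obtain l r where lr: "strict_mono r" "l : {0..(emb*(C + C)) powr ps}" "(%n. m (r n)) ---> l"
   using compact_Icc[of 0 "(emb*(C + C)) powr ps"] unfolding compact_eq_seq_compact_metric seq_compact_def comp_def by metis
  have gl: "(%n. g (r n)) ---> b*l"
  proof -
   have "(%n. (g (r n) - b*m (r n)) + b*m (r n)) ---> 0 + b*l" by (intro tendsto_intros lr LIMSEQ_subseq_LIMSEQ[OF gm lr(1), unfolded comp_def])
   then show ?thesis by simp
  qed
  have "l <= (b*l/Sob) powr (ps/p)"
  proof (rule LIMSEQ_le[OF lr(3)])
   show "(%n. (g (r n)/Sob) powr (ps/p)) ---> (b*l/Sob) powr (ps/p)" by (rule tendsto_powr'[OF tendsto_divide[OF gl tendsto_const] tendsto_const])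
     (use Sob_pos p0 ps_facts(3) in \<open>auto simp: g_def\<close>)
   show "EX N. ALL n>=N. m (r n) <= (g (r n)/Sob) powr (ps/p)" using mg by blast
  qed
  moreover have "\<not> l > 0" if "l <= (b*l/Sob) powr (ps/p)"
  proof
   assume "l > 0"
   then have L: "(Sob/b) powr (ps/(ps - p)) <= l" using concentration_bound[OF b _ that] by blast
   have "(%n. J (U (r n))) ---> J z + \<kappa>2*(b*l)" by (rule Jlim[OF lr(1) tendsto_mult[OF tendsto_const lr(3)]])
   then have "J z + \<kappa>2*(b*l) <= \<beta>" by (rule LIMSEQ_le_const2) (use J(2) in \<open>auto simp: U_def\<close>)
   moreover have "J z >= 0" unfolding Jz using \<kappa> b T_nn by (intro add_nonneg_nonneg mult_nonneg_nonneg) auto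
   moreover have "cst b <= \<kappa>2*(b*l)"
   proof -
    have "\<kappa>2*b*(Sob/b) powr (ps/(ps - p)) <= \<kappa>2*b*l" using L \<kappa> b by (intro mult_left_mono) auto
    then show ?thesis by (simp add: cst_def \<kappa>2_def mult.assoc)
   qed
   ultimately show False using \<beta>[OF b] by linarith
  qed
  ultimately have "l = 0" using lr(2) by force
  then have "(%n. b*m (r n)) ---> b*0" using lr(3) by (intro tendsto_intros) simp
  then show ?thesis using that[OF lr(1)] by simp
 qed
 have "(%n. J (U (r n))) ---> J z" using Jlim[OF r] by simp
 then have "\<alpha> <= J z" "J z <= \<beta>" using J by (auto intro: LIMSEQ_le_const LIMSEQ_le_const2 simp: U_def)
 then show ?thesis using crit j(2) by blast
qed

end

section \<open>Deformation and minimax\<close>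

context fracX
begin

lemma XX_sum: "finite I ==> (!!i. i : I ==> v i : XX) ==> (%x. \<Sum>i\<in>I. c i * v i x) : XX"
proof (induction I rule: finite_induct)
 case empty
 then show ?case by (simp add: XX_zero)
next
 case (insert i I)
 have "(%x. (\<Sum>i\<in>I. c i * v i x) + c i * v i x) : XX" using insert by (intro XX_lin) auto
 then show ?case using insert by (simp add: add.commute)
qed

lemma Nn_zero: "Nn (%x. 0) = 0"
 using Nn_cmult[of 0 "%x. 0"] by simp

lemma Nn_sum: "finite I ==> (!!i. i : I ==> v i : XX) ==> Nn (%x. \<Sum>i\<in>I. c i * v i x) <= (\<Sum>i\<in>I. abs (c i)*Nn (v i))"
proof (induction I rule: finite_induct)
 case empty
 then show ?case by (simp add: Nn_zero)
next
 case (insert i I)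
 have "Nn (%x. c i * v i x + (\<Sum>i\<in>I. c i * v i x)) <= Nn (%x. c i * v i x) + Nn (%x. \<Sum>i\<in>I. c i * v i x)"
  using insert by (intro Nn_add XX_cmult XX_sum) auto
 then show ?case using insert by (simp add: Nn_cmult)
qed

text \<open>\<open>XX\<close> is a set of functions with a seminorm and no metric type, so
  continuity into it is spelled out. Membership is required for all y, also outside
  \<open>Q\<close>, which keeps sums and limits free of side conditions.\<close>

definition Ncont :: "'a::metric_space set => ('a => real^'n => real) => bool" where
 "Ncont Q h \<longleftrightarrow> (ALL y. h y : XX) \<and> (ALL y:Q. ((%y'. Nn (%x. h y' x - h y x)) \<longlongrightarrow> 0) (at y within Q))"

lemma Ncont_XX: "Ncont Q h ==> h y : XX" by (simp add: Ncont_def)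

lemma Ncont_add:
 assumes h: "Ncont Q h" and c: "continuous_on Q c" and v: "v : XX"
 shows "Ncont Q (%y x. h y x + c y * v x)" unfolding Ncont_def
proof (intro conjI allI ballI)
 show "(%x. h y x + c y * v x) : XX" for y by (intro XX_lin Ncont_XX[OF h] v)
 fix y assume y: "y : Q"
 show "((%y'. Nn (%x. (h y' x + c y' * v x) - (h y x + c y * v x))) \<longlongrightarrow> 0) (at y within Q)"
 proof (rule tendsto_sandwich[OF _ _ tendsto_const])
  show "\<forall>\<^sub>F y' in at y within Q. Nn (%x. (h y' x + c y' * v x) - (h y x + c y * v x)) <= Nn (%x. h y' x - h y x) + abs (c y' - c y)*Nn v"
  proof (intro always_eventually allI)
   fix y'
   have "(%x. (h y' x + c y' * v x) - (h y x + c y * v x)) = (%x. (h y' x - h y x) + (c y' - c y) * v x)" by (auto simp: algebra_simps)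
   then show "Nn (%x. (h y' x + c y' * v x) - (h y x + c y * v x)) <= Nn (%x. h y' x - h y x) + abs (c y' - c y)*Nn v"
    using Nn_add[OF XX_diff[OF Ncont_XX[OF h, of y'] Ncont_XX[OF h, of y]] XX_cmult[OF v, of "c y' - c y"]] by (simp add: Nn_cmult)
  qed
  have "((%y'. Nn (%x. h y' x - h y x) + abs (c y' - c y)*Nn v) \<longlongrightarrow> 0 + abs (c y - c y)*Nn v) (at y within Q)"
   by (intro tendsto_intros) (use h c y in \<open>auto simp: Ncont_def continuous_on_def\<close>)
  then show "((%y'. Nn (%x. h y' x - h y x) + abs (c y' - c y)*Nn v) \<longlongrightarrow> 0) (at y within Q)" by simp
 qed auto
qed

lemma Ncont_sum:
 assumes h: "Ncont Q h"
 shows "finite I ==> (!!i. i : I ==> continuous_on Q (c i)) ==> (!!i. i : I ==> v i : XX) ==> Ncont Q (%y x. h y x + (\<Sum>i\<in>I. c i y * v i x))"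
proof (induction I rule: finite_induct)
 case empty
 then show ?case using h by simp
next
 case (insert i I)
 have "Ncont Q (%y x. (h y x + (\<Sum>i\<in>I. c i y * v i x)) + c i y * v i x)" using insert by (intro Ncont_add) auto
 then show ?case using insert by (simp add: add_ac)
qed

lemma Ncont_zero: "Ncont Q (%y x. 0)"
 by (simp add: Ncont_def XX_zero Nn_zero)

lemma Ncont_Nn: "Ncont Q h ==> continuous_on Q (%y. Nn (h y))"
 unfolding continuous_on_def
proof
 fix y assume h: "Ncont Q h" and y: "y : Q"
 have "((%y'. Nn (h y') - Nn (h y)) \<longlongrightarrow> 0) (at y within Q)"
 proof (rule Lim_null_comparison)
  show "\<forall>\<^sub>F y' in at y within Q. norm (Nn (h y') - Nn (h y)) <= Nn (%x. h y' x - h y x)"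
   by (intro always_eventually allI) (simp add: Nn_diff Ncont_XX[OF h])
  show "((%y'. Nn (%x. h y' x - h y x)) \<longlongrightarrow> 0) (at y within Q)" using h y by (simp add: Ncont_def)
 qed
 then show "((%y. Nn (h y)) \<longlongrightarrow> Nn (h y)) (at y within Q)" by (simp add: LIM_zero_iff)
qed

end

context func
begin

lemma Jd_sum: "finite I ==> u : XX ==> (!!i. i : I ==> v i : XX) ==> Jd u (%x. \<Sum>i\<in>I. c i * v i x) = (\<Sum>i\<in>I. c i*Jd u (v i))"
proof (induction I rule: finite_induct)
 case empty
 then show ?case by (simp add: Jd_def DT_def dq_def)
next
 case (insert i I)
 have "Jd u (%x. (\<Sum>i\<in>I. c i * v i x) + c i * v i x) = Jd u (%x. \<Sum>i\<in>I. c i * v i x) + c i*Jd u (v i)"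
  using insert by (intro Jd_lin XX_sum) auto
 then show ?case using insert by (simp add: add.commute)
qed

lemma Ncont_J: "Ncont Q h ==> continuous_on Q (%y. J (h y))"
 unfolding continuous_on_def Ncont_def by (auto intro!: J_tendsto)

lemma Ncont_Jd: "Ncont Q h ==> v : XX ==> continuous_on Q (%y. Jd (h y) v)"
 unfolding continuous_on_def Ncont_def by (auto intro!: Jd_tendsto)

text \<open>By contradiction: points at which no descent of size 1/(n+1) is available form a Cerami
  sequence, whose limit would be a critical point in the same range of levels.\<close>

lemma descent_directions:
 assumes none: "!!z. z : XX ==> \<alpha> <= J z ==> J z <= \<beta> ==> EX v:XX. Jd z v \<noteq> 0" and \<beta>: "b > 0 ==> \<beta> < cst b"
 shows "EX \<delta>>0. ALL u:XX. \<alpha> <= J u --> J u <= \<beta> --> (EX v:XX. Nn v <= 2 + Nn u \<and> Jd u v <= - \<delta>)"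
proof (rule ccontr)
 assume neg: "\<not> ?thesis"
 have "EX u. u : XX \<and> \<alpha> <= J u \<and> J u <= \<beta> \<and> (ALL v:XX. Nn v <= 2 + Nn u --> - (1/(real n + 1)) <= Jd u v)" for n
 proof -
  have "1/(real n + 1) > 0" by (simp add: add_nonneg_pos)
  then obtain u where "u : XX" "\<alpha> <= J u" "J u <= \<beta>" "\<not> (EX v:XX. Nn v <= 2 + Nn u \<and> Jd u v <= - (1/(real n + 1)))"
   using neg by blast
  then show ?thesis by (intro exI[of _ u]) (auto simp: not_le less_imp_le)
 qed
 then obtain u where u: "!!n. u n : XX" "!!n. \<alpha> <= J (u n)" "!!n. J (u n) <= \<beta>"
  "!!n v. v : XX ==> Nn v <= 2 + Nn (u n) ==> - (1/(real n + 1)) <= Jd (u n) v" by metis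
 from Cerami_critical[OF u \<beta>] none show False by blast
qed

text \<open>One explicit Euler step in place of a pseudo-gradient flow. A descent direction found at
  one parameter still works nearby, and a partition of unity on the compact set \<open>K\<close> of
  parameters glues finitely many of them. Directions may be as long as 3 + \<open>Nn (h y)\<close>,
  hence the growth factor 1 + \<open>\<tau>\<close>.\<close>

lemma deform_step:
 fixes Q :: "'c::metric_space set"
 assumes Q: "compact Q" and h: "Ncont Q h" and le: "!!y. y : Q ==> J (h y) <= \<beta>" and R: "!!y. y : Q ==> 3 + Nn (h y) <= R"
  and \<alpha>: "\<alpha> > 0" and \<delta>: "\<delta> > 0"
  and desc: "!!u. u : XX ==> \<alpha>/2 <= J u ==> J u <= \<beta> ==> EX v:XX. Nn v <= 2 + Nn u \<and> Jd u v <= - \<delta>"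
  and unif: "!!u v t. u : XX ==> v : XX ==> Nn u <= R ==> Nn v <= R ==> 0 <= t ==> t <= \<tau> ==> J (%x. u x + t * v x) <= J u + t*Jd u v + \<delta>/4*t"
  and \<tau>: "\<tau> > 0"
 shows "EX h'. Ncont Q h' \<and> (ALL y:Q. J (h' y) <= max (3*\<alpha>/4) (J (h y) - \<tau>*\<delta>/4)) \<and> (ALL y:Q. J (h y) <= \<alpha>/2 --> h' y = h y)
  \<and> (ALL y:Q. 3 + Nn (h' y) <= (1 + \<tau>)*(3 + Nn (h y)))"
proof -
 define K where "K = {y : Q. \<alpha>/2 <= J (h y)}"
 have cJ: "continuous_on Q (%y. J (h y))" by (rule Ncont_J[OF h])
 have hX: "h y : XX" for y by (rule Ncont_XX[OF h])
 show ?thesis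
 proof (cases "K = {}")
  case True
  then have "J (h y) <= \<alpha>/2" if "y : Q" for y using that by (force simp: K_def)
  then have "J (h y) <= max (3*\<alpha>/4) (J (h y) - \<tau>*\<delta>/4)" if "y : Q" for y using that \<alpha> by (fastforce simp: le_max_iff_disj)
  moreover have "3 + Nn (h y) <= (1 + \<tau>)*(3 + Nn (h y))" for y
  proof -
   have "0 <= \<tau>*(3 + Nn (h y))" using \<tau> by (intro mult_nonneg_nonneg) auto
   then show ?thesis unfolding distrib_right[of 1 \<tau>] by simp
  qed
  ultimately show ?thesis using h by blast
 next
  case False
  have "closed (Q \<inter> (%y. J (h y)) -` {\<alpha>/2..})" by (rule continuous_closed_preimage[OF cJ compact_imp_closed[OF Q]]) simp
  moreover have "K = Q \<inter> (Q \<inter> (%y. J (h y)) -` {\<alpha>/2..})" by (auto simp: K_def)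
  ultimately have Kc: "compact K" using compact_Int_closed[OF Q] by metis
  have "ALL y0:K. EX v r. v : XX \<and> r > 0 \<and> (ALL y:Q. dist y y0 < r --> Jd (h y) v <= - \<delta>/2 \<and> Nn v <= 3 + Nn (h y))"
  proof
   fix y0 assume "y0 : K"
   then have y0: "y0 : Q" "\<alpha>/2 <= J (h y0)" by (auto simp: K_def)
   obtain v where v: "v : XX" "Nn v <= 2 + Nn (h y0)" "Jd (h y0) v <= - \<delta>" using desc[OF hX y0(2) le[OF y0(1)]] by blast
   have "((%y. Jd (h y) v) \<longlongrightarrow> Jd (h y0) v) (at y0 within Q)" "((%y. Nn (h y)) \<longlongrightarrow> Nn (h y0)) (at y0 within Q)"
    using Ncont_Jd[OF h v(1)] Ncont_Nn[OF h] y0(1) by (auto simp: continuous_on_def)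
   then have "\<forall>\<^sub>F y in at y0 within Q. Jd (h y) v < - \<delta>/2" "\<forall>\<^sub>F y in at y0 within Q. Nn (h y0) - 1 < Nn (h y)"
    using v(3) \<delta> by (auto elim!: order_tendstoD)
   then have "\<forall>\<^sub>F y in at y0 within Q. Jd (h y) v < - \<delta>/2 \<and> Nn (h y0) - 1 < Nn (h y)" by eventually_elim simp
   then obtain r where r: "r > 0" "!!y. y : Q ==> y \<noteq> y0 ==> dist y y0 < r ==> Jd (h y) v < - \<delta>/2 \<and> Nn (h y0) - 1 < Nn (h y)"
    unfolding eventually_at by blast
   have "Jd (h y) v <= - \<delta>/2 \<and> Nn v <= 3 + Nn (h y)" if "y : Q" "dist y y0 < r" for y
    using r(2)[OF that(1) _ that(2)] v \<delta> by (cases "y = y0") auto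
   then show "EX v r. v : XX \<and> r > 0 \<and> (ALL y:Q. dist y y0 < r --> Jd (h y) v <= - \<delta>/2 \<and> Nn v <= 3 + Nn (h y))"
    using v(1) r(1) by blast
  qed
  then obtain v r where vr: "!!y0. y0 : K ==> v y0 : XX" "!!y0. y0 : K ==> r y0 > 0"
   "!!y0 y. y0 : K ==> y : Q ==> dist y y0 < r y0 ==> Jd (h y) (v y0) <= - \<delta>/2 \<and> Nn (v y0) <= 3 + Nn (h y)" by metis
  have "K \<subseteq> (\<Union>c\<in>K. ball c (r c))" using vr(2) by auto
  then obtain I where I: "I \<subseteq> K" "finite I" "K \<subseteq> (\<Union>c\<in>I. ball c (r c))"
   using compactE_image[OF Kc, of K "%c. ball c (r c)"] by (metis open_ball)
  define \<mu> where "\<mu> i y = max 0 (1 - dist y i/r i)" for i y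
  \<comment> \<open>The distance to \<open>K\<close> keeps the denominator positive everywhere and
    vanishes on \<open>K\<close>, where the weights must add up to 1.\<close>
  define S where "S y = (\<Sum>i\<in>I. \<mu> i y) + infdist y K" for y
  \<comment> \<open>Equal to 0 for levels up to \<open>\<alpha>/2\<close> and to 1 from
    \<open>3*\<alpha>/4\<close> on: low parameters stay fixed, high ones move at full speed.\<close>
  define \<eta> where "\<eta> y = min 1 (max 0 ((J (h y) - \<alpha>/2)/(\<alpha>/4)))" for y
  define l where "l i y = \<mu> i y/S y" for i y
  have \<mu>0: "\<mu> i y >= 0" for i y by (simp add: \<mu>_def)
  have \<mu>pos: "\<mu> i y > 0 ==> i : I ==> dist y i < r i" for i y using vr(2)[of i] I(1) by (auto simp: \<mu>_def max_def split: if_splits)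
  have sum0: "(\<Sum>i\<in>I. \<mu> i y) >= 0" for y by (intro sum_nonneg \<mu>0)
  have sumpos: "(\<Sum>i\<in>I. \<mu> i y) > 0" if yK: "y : K" for y
  proof -
   obtain i where i: "i : I" "y : ball i (r i)" using I(3) yK by blast
   have "\<mu> i y > 0" using i vr(2)[of i] I(1) by (auto simp: \<mu>_def dist_commute)
   also have "\<mu> i y <= (\<Sum>i\<in>I. \<mu> i y)" using i I(2) \<mu>0 by (intro member_le_sum) auto
   finally show ?thesis .
  qed
  have Spos: "S y > 0" for y
  proof (cases "y : K")
   case True
   then show ?thesis using sumpos[OF True] by (simp add: S_def add_pos_nonneg infdist_nonneg)
  next
   case F: False
   have "infdist y K > 0" using in_closed_iff_infdist_zero[OF compact_imp_closed[OF Kc] False, of y] F infdist_nonneg[of y K] by auto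
   then show ?thesis using sum0[of y] by (simp add: S_def)
  qed
  have l0: "l i y >= 0" for i y using \<mu>0 Spos[of y] by (simp add: l_def)
  have lsum_le: "(\<Sum>i\<in>I. l i y) <= 1" for y
   using Spos[of y] infdist_nonneg[of y K] by (simp add: l_def sum_divide_distrib[symmetric] divide_le_eq S_def)
  have lsum_1: "(\<Sum>i\<in>I. l i y) = 1" if "y : K" for y using Spos[of y] that by (simp add: l_def sum_divide_distrib[symmetric] S_def)
  have lc: "continuous_on Q (l i)" if "i : I" for i unfolding l_def \<mu>_def S_def using Spos[unfolded S_def \<mu>_def] vr(2) I(1) that
   by (intro continuous_intros) (auto simp: less_imp_neq[symmetric] dest: less_imp_neq)
  have \<eta>c: "continuous_on Q \<eta>" unfolding \<eta>_def using \<alpha> by (intro continuous_intros cJ) auto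
  have \<eta>: "0 <= \<eta> y" "\<eta> y <= 1" for y by (auto simp: \<eta>_def)
  define V where "V y = (%x. \<Sum>i\<in>I. l i y * v i x)" for y
  have VX: "V y : XX" for y unfolding V_def using I vr(1) by (intro XX_sum) auto
  have VN: "Nn (V y) <= 3 + Nn (h y)" if y: "y : Q" for y
  proof -
   have "Nn (V y) <= (\<Sum>i\<in>I. abs (l i y)*Nn (v i))" unfolding V_def using I vr(1) by (intro Nn_sum) auto
   also have "... <= (\<Sum>i\<in>I. l i y*(3 + Nn (h y)))"
   proof (rule sum_mono)
    fix i assume i: "i : I"
    show "abs (l i y)*Nn (v i) <= l i y*(3 + Nn (h y))"
    proof (cases "\<mu> i y > 0")
     case True
     then have "Nn (v i) <= 3 + Nn (h y)" using vr(3)[OF _ y \<mu>pos[OF True i]] i I(1) by blast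
     then show ?thesis using l0[of i y] by (simp add: mult_left_mono)
    next
     case False
     then have "l i y = 0" using \<mu>0[of i y] by (simp add: l_def)
     then show ?thesis by simp
    qed
   qed
   also have "... = (\<Sum>i\<in>I. l i y)*(3 + Nn (h y))" by (simp add: sum_distrib_right)
   also have "... <= 1*(3 + Nn (h y))" using lsum_le by (intro mult_right_mono) auto
   finally show ?thesis by simp
  qed
  have VJ: "Jd (h y) (V y) <= - \<delta>/2" if y: "y : K" for y
  proof -
   have yQ: "y : Q" using y by (simp add: K_def)
   have "Jd (h y) (V y) = (\<Sum>i\<in>I. l i y*Jd (h y) (v i))" unfolding V_def using I vr(1) by (intro Jd_sum hX) auto
   also have "... <= (\<Sum>i\<in>I. l i y*(- \<delta>/2))"
   proof (rule sum_mono)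
    fix i assume i: "i : I"
    show "l i y*Jd (h y) (v i) <= l i y*(- \<delta>/2)"
    proof (cases "\<mu> i y > 0")
     case True
     then have "Jd (h y) (v i) <= - \<delta>/2" using vr(3)[OF _ yQ \<mu>pos[OF True i]] i I(1) by blast
     then show ?thesis using l0[of i y] by (intro mult_left_mono)
    next
     case False
     then have "l i y = 0" using \<mu>0[of i y] by (simp add: l_def)
     then show ?thesis by simp
    qed
   qed
   also have "... = - \<delta>/2" using lsum_1[OF y] sum_distrib_right[of "%i. l i y" I "- \<delta>/2", symmetric] by (simp only: mult_1)
   finally show ?thesis .
  qed
  define h' where "h' y = (%x. h y x + (\<tau>*\<eta> y)*V y x)" for y
  have h'_alt: "h' = (%y x. h y x + (\<Sum>i\<in>I. (\<tau>*\<eta> y*l i y) * v i x))"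
   by (auto simp: h'_def V_def sum_distrib_left mult_ac fun_eq_iff)
  have "Ncont Q h'" unfolding h'_alt using I vr(1) by (intro Ncont_sum[OF h] continuous_intros \<eta>c lc) auto
  moreover have "J (h' y) <= max (3*\<alpha>/4) (J (h y) - \<tau>*\<delta>/4)" if y: "y : Q" for y
  proof (cases "y : K")
   case True
   have t: "0 <= \<tau>*\<eta> y" "\<tau>*\<eta> y <= \<tau>" using \<tau> \<eta>[of y] by (auto simp: mult_le_cancel_left1)
   have "J (h' y) <= J (h y) + (\<tau>*\<eta> y)*Jd (h y) (V y) + \<delta>/4*(\<tau>*\<eta> y)"
    unfolding h'_def using R[OF y] VN[OF y] by (intro unif hX VX t) auto
   also have "... <= J (h y) + (\<tau>*\<eta> y)*(- \<delta>/2) + \<delta>/4*(\<tau>*\<eta> y)"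
    using VJ[OF True] t \<delta> by (intro add_mono mult_left_mono) auto
   also have "... = J (h y) - \<eta> y*(\<tau>*\<delta>/4)" by (simp add: algebra_simps)
   finally have *: "J (h' y) <= J (h y) - \<eta> y*(\<tau>*\<delta>/4)" .
   show ?thesis
   proof (cases "J (h y) >= 3*\<alpha>/4")
    case True
    then have "(J (h y) - \<alpha>/2)/(\<alpha>/4) >= 1" using \<alpha> by (simp add: le_divide_eq)
    then have "\<eta> y = 1" by (simp add: \<eta>_def)
    then show ?thesis using*by (simp add: le_max_iff_disj)
   next
    case False
    have "0 <= \<eta> y*(\<tau>*\<delta>/4)" using \<eta>[of y] \<tau> \<delta> by simp
    then show ?thesis using*False by (simp add: le_max_iff_disj)
   qed
  next
   case False
   then have J: "J (h y) < \<alpha>/2" using y by (simp add: K_def)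
   then have "(J (h y) - \<alpha>/2)/(\<alpha>/4) <= 0" using \<alpha> by (intro divide_nonpos_pos) auto
   then have "\<eta> y = 0" by (simp add: \<eta>_def)
   then show ?thesis using J \<alpha> by (simp add: h'_def le_max_iff_disj)
  qed
  moreover have "h' y = h y" if "J (h y) <= \<alpha>/2" for y
  proof -
   have "(J (h y) - \<alpha>/2)/(\<alpha>/4) <= 0" using that \<alpha> by (intro divide_nonpos_pos) auto
   then have "\<eta> y = 0" by (simp add: \<eta>_def)
   then show ?thesis by (simp add: h'_def)
  qed
  moreover have "3 + Nn (h' y) <= (1 + \<tau>)*(3 + Nn (h y))" if y: "y : Q" for y
  proof -
   have "Nn (h' y) <= Nn (h y) + abs (\<tau>*\<eta> y)*Nn (V y)"
    unfolding h'_def using Nn_add[OF hX XX_cmult[OF VX, of "\<tau>*\<eta> y" y], of y] by (simp add: Nn_cmult)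
   also have "abs (\<tau>*\<eta> y)*Nn (V y) <= \<tau>*(3 + Nn (h y))"
    using \<tau> \<eta>[of y] VN[OF y] by (intro mult_mono) (auto simp: mult_le_cancel_left1)
   finally show ?thesis by (simp add: algebra_simps)
  qed
  ultimately show ?thesis by blast
 qed
qed

text \<open>Without a critical point, n steps of length \<open>\<tau>\<close> lower all levels by
  \<open>real n*(\<tau>*\<delta>/4)\<close>, or to \<open>3*\<alpha>/4\<close>, and leave low levels
  fixed, contradicting linking. The norm bound involves only the total time, so the radius of
  uniformity is fixed before the step length.\<close>

lemma minimax_critical:
 fixes Q :: "'c::metric_space set"
 assumes Q: "compact Q" and h0: "Ncont Q h0" and le: "!!y. y : Q ==> J (h0 y) <= \<beta>" and \<beta>: "b > 0 ==> \<beta> < cst b" and \<alpha>: "\<alpha> > 0"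
  and link: "!!h. Ncont Q h ==> (!!y. y : Q ==> J (h0 y) <= \<alpha>/2 ==> h y = h0 y) ==> EX y:Q. \<alpha> <= J (h y)"
 shows "EX z:XX. (ALL v:XX. Jd z v = 0) \<and> \<alpha>/2 <= J z \<and> J z <= \<beta>"
proof (rule ccontr)
 assume "\<not> ?thesis"
 then have "!!z. z : XX ==> \<alpha>/2 <= J z ==> J z <= \<beta> ==> EX v:XX. Jd z v \<noteq> 0" by blast
 then obtain \<delta> where \<delta>: "\<delta> > 0" and desc: "!!u. u : XX ==> \<alpha>/2 <= J u ==> J u <= \<beta> ==> EX v:XX. Nn v <= 2 + Nn u \<and> Jd u v <= - \<delta>"
  using descent_directions[of "\<alpha>/2" \<beta>] \<beta> by blast
 have "compact ((%y. Nn (h0 y)) ` Q)" by (rule compact_continuous_image[OF Ncont_Nn[OF h0] Q])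
 then obtain R0 where R0: "!!y. y : Q ==> abs (Nn (h0 y)) <= R0" using compact_imp_bounded by (force simp: bounded_iff)
 \<comment> \<open>The time in which descent at rate \<open>\<delta>/4\<close> uses up the whole
   level \<open>\<beta>\<close>.\<close>
 define B where "B = 4*abs \<beta>/\<delta>"
 have B: "B >= 0" using \<delta> by (simp add: B_def)
 \<comment> \<open>(1 + \<open>\<tau>\<close>)^n is at most exp(n \<open>\<tau>\<close>), and n
   \<open>\<tau>\<close> <= B + 1 for every \<open>\<tau>\<close> <= 1, the 1 paying for rounding up
   the number of steps.\<close>
 define R where "R = (3 + abs R0)*exp (B + 1)"
 have R: "R > 0" by (simp add: R_def add_pos_nonneg)
 obtain d where d: "d > 0" "!!u v t. u : XX ==> v : XX ==> Nn u <= R ==> Nn v <= R ==> 0 <= t ==> t <= d ==>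
  J (%x. u x + t * v x) <= J u + t*Jd u v + \<delta>/4*t" using J_uniform_diff[of "\<delta>/4" R] \<delta> R by auto
 define \<tau> where "\<tau> = min d 1"
 have \<tau>: "\<tau> > 0" "\<tau> <= d" "\<tau> <= 1" using d(1) by (auto simp: \<tau>_def)
 have iter: "(1 + \<tau>) ^ n <= exp (B + 1) ==> EX h. Ncont Q h \<and> (ALL y:Q. J (h y) <= max (3*\<alpha>/4) (\<beta> - real n*(\<tau>*\<delta>/4)) \<and> J (h y) <= max (3*\<alpha>/4) \<beta>)
   \<and> (ALL y:Q. J (h0 y) <= \<alpha>/2 --> h y = h0 y) \<and> (ALL y:Q. 3 + Nn (h y) <= (1 + \<tau>) ^ n*(3 + abs R0))" for n
 proof (induction n)
  case 0
  have "3 + Nn (h0 y) <= 3 + abs R0" if "y : Q" for y using R0[OF that] by linarith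
  then show ?case using h0 le by (intro exI[of _ h0]) (auto simp: le_max_iff_disj)
 next
  case (Suc n)
  have "(1 + \<tau>) ^ n <= (1 + \<tau>) ^ Suc n" using \<tau> by (intro power_increasing) auto
  then have en: "(1 + \<tau>) ^ n <= exp (B + 1)" using Suc.prems by linarith
  then obtain h where h: "Ncont Q h" "!!y. y : Q ==> J (h y) <= max (3*\<alpha>/4) (\<beta> - real n*(\<tau>*\<delta>/4))"
   "!!y. y : Q ==> J (h y) <= max (3*\<alpha>/4) \<beta>"
   "!!y. y : Q ==> J (h0 y) <= \<alpha>/2 ==> h y = h0 y" "!!y. y : Q ==> 3 + Nn (h y) <= (1 + \<tau>) ^ n*(3 + abs R0)" using Suc.IH by blast
  have \<beta>\<alpha>: "\<alpha> <= \<beta>" using link[OF h0] le by (meson order_trans)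
  have hle: "J (h y) <= \<beta>" if "y : Q" for y using h(3)[OF that] \<alpha> \<beta>\<alpha> by auto
  have hR: "3 + Nn (h y) <= R" if "y : Q" for y
  proof -
   have "(1 + \<tau>) ^ n*(3 + abs R0) <= exp (B + 1)*(3 + abs R0)" using en by (intro mult_right_mono) auto
   then show ?thesis using h(5)[OF that] by (simp add: R_def mult.commute)
  qed
  obtain h' where h': "Ncont Q h'" "!!y. y : Q ==> J (h' y) <= max (3*\<alpha>/4) (J (h y) - \<tau>*\<delta>/4)"
   "!!y. y : Q ==> J (h y) <= \<alpha>/2 ==> h' y = h y" "!!y. y : Q ==> 3 + Nn (h' y) <= (1 + \<tau>)*(3 + Nn (h y))"
   using deform_step[OF Q h(1) hle hR \<alpha> \<delta> desc d(2)[OF _ _ _ _ _ order_trans[OF _ \<tau>(2)]] \<tau>(1)] by blast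
  have pos: "0 <= \<tau>*\<delta>/4" using \<tau> \<delta> by simp
  show ?case
  proof (intro exI[of _ h'] conjI ballI impI h'(1))
   fix y assume y: "y : Q"
   show "J (h' y) <= max (3*\<alpha>/4) (\<beta> - real (Suc n)*(\<tau>*\<delta>/4))"
   proof -
    have "real (Suc n)*(\<tau>*\<delta>/4) = real n*(\<tau>*\<delta>/4) + \<tau>*\<delta>/4" by (simp add: algebra_simps)
    then show ?thesis using h'(2)[OF y] h(2)[OF y] pos by linarith
   qed
   show "J (h' y) <= max (3*\<alpha>/4) \<beta>" using h'(2)[OF y] h(3)[OF y] pos by linarith
   show "h' y = h0 y" if "J (h0 y) <= \<alpha>/2" using h(4)[OF y that] h'(3)[OF y] that by simp
   have "3 + Nn (h' y) <= (1 + \<tau>)*((1 + \<tau>) ^ n*(3 + abs R0))"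
    using h'(4)[OF y] mult_left_mono[OF h(5)[OF y], of "1 + \<tau>"] \<tau> by linarith
   then show "3 + Nn (h' y) <= (1 + \<tau>) ^ Suc n*(3 + abs R0)" by (simp add: mult.assoc)
  qed
 qed
 define n where "n = nat \<lceil>B/\<tau>\<rceil>"
 have n: "B/\<tau> <= real n" "real n <= B/\<tau> + 1"
 proof -
  have x: "B/\<tau> >= 0" using B \<tau> by simp
  show "B/\<tau> <= real n" unfolding n_def by (rule of_nat_ceiling)
  have "real n = real_of_int \<lceil>B/\<tau>\<rceil>" unfolding n_def using x by simp
  then show "real n <= B/\<tau> + 1" using of_int_ceiling_le_add_one[of "B/\<tau>"] by simp
 qed
 have "(1 + \<tau>) ^ n <= exp \<tau> ^ n" using \<tau> by (intro power_mono exp_ge_add_one_self) auto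
 also have "... = exp (real n*\<tau>)" by (simp add: exp_of_nat_mult)
 also have "... <= exp (B + 1)"
 proof -
  have "real n*\<tau> <= (B/\<tau> + 1)*\<tau>" using n \<tau> by (intro mult_right_mono) auto
  also have "... = B + \<tau>" using \<tau> by (simp add: field_simps)
  finally show ?thesis using \<tau> by simp
 qed
 finally obtain h where h: "Ncont Q h" "!!y. y : Q ==> J (h y) <= max (3*\<alpha>/4) (\<beta> - real n*(\<tau>*\<delta>/4))"
  "!!y. y : Q ==> J (h0 y) <= \<alpha>/2 ==> h y = h0 y" using iter[of n] by blast
 have "\<beta> - real n*(\<tau>*\<delta>/4) <= 0"
 proof -
  have "B <= real n*\<tau>" using n(1) \<tau> by (simp add: divide_le_eq)
  then have "B*(\<delta>/4) <= real n*\<tau>*(\<delta>/4)" using \<delta> by (intro mult_right_mono) auto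
  then show ?thesis using \<delta> by (simp add: B_def mult_ac)
 qed
 then have "J (h y) < \<alpha>" if "y : Q" for y using h(2)[OF that] \<alpha> by linarith
 moreover obtain y where "y : Q" "\<alpha> <= J (h y)" using link[OF h(1) h(3)] by blast
 ultimately show False by force
qed

end

section \<open>Mountain pass geometry\<close>

context func
begin

lemma phi_Nn_pos: "Nn phi > 0"
proof -
 have "Nn phi \<noteq> 0"
 proof
  assume "Nn phi = 0"
  then have "AE x in leb. phi x = 0" by (rule Nn_eq_0[OF phi(1)])
  then have "Il p phi = 0" using Lpi_eq_0[OF Lps(2)[OF phi(1)]] by simp
  then show False using phi(4) by simp
 qed
 then show ?thesis using Nn_nonneg[of phi] by linarith
qed

lemma a_pos: "a > 0"
 using a Lpi_nonneg[of LL p "dq s p phi"] by linarith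

lemma powr_interpolate_T:
 assumes e: "e > 0"
 shows "EX C>0. ALL w:XX. Tl p 1 th w <= e*Il ps w + C*Tl q 1 th w"
proof -
 obtain C where C: "C > 0" "!!t. t >= 0 ==> t powr (p - q) <= e*t powr (ps - q) + C"
  using powr_interpolate[of "p - q" "ps - q" e] qp ps_facts(1) e by auto
 have pos: "t powr p <= e*t powr ps + C*t powr q" if t: "t >= 0" for t
 proof -
  have "t powr q*t powr (p - q) <= t powr q*(e*t powr (ps - q) + C)" using C(2)[OF t] by (intro mult_left_mono) auto
  then show ?thesis by (simp add: distrib_left powr_add[symmetric] mult.left_commute mult.commute)
 qed
 have pt: "pw p 1 th t <= e*abs t powr ps + C*pw q 1 th t" for t
 proof (cases "t >= 0")
  case True
  then show ?thesis using pos[of t] by (simp add: pw_def)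
 next
  case False
  have th1: "0 <= th" "th <= 1" using th by auto
  have "th*(- t) powr p <= th*(e*(- t) powr ps + C*(- t) powr q)" using pos[of "- t"] False th1 by (intro mult_left_mono) auto
  moreover have "th*(e*(- t) powr ps) <= 1*(e*(- t) powr ps)" using th1 e by (intro mult_right_mono) auto
  ultimately show ?thesis using False by (simp add: pw_def algebra_simps)
 qed
 have "Tl p 1 th w <= e*Il ps w + C*Tl q 1 th w" if w: "w : XX" for w
 proof -
  note i = T_integrable[OF Lps(1)[OF w], of 1 th] T_integrable[OF Lps(2)[OF w], of 1 th] LpD(2)[OF Lps(3)[OF w]]
  have "Tl p 1 th w <= (LI x. e*abs (w x) powr ps + C*pw q 1 th (w x))" unfolding T_def using i pt by (intro integral_mono) auto
  also have "... = e*Il ps w + C*Tl q 1 th w" unfolding T_def Lpi_def using i by simp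
  finally show ?thesis .
 qed
 then show ?thesis using C(1) by blast
qed

text \<open>Near 0 the term of order q < p dominates: interpolated between the powers q and ps, the
  a-term is paid for by the lam-term up to half of the energy. The level found here depends on lam,
  unlike the one of \<open>sphere_level\<close>.\<close>

lemma local_geometry:
 assumes r0: "r0 > 0"
 shows "EX \<rho> \<alpha>. 0 < \<rho> \<and> \<rho> < r0 \<and> 0 < \<alpha> \<and> (ALL u:XX. Nn u = \<rho> --> \<alpha> <= J u)"
proof -
 define E where "E = emb powr ps"
 have E: "E > 0" using emb_pos by (simp add: E_def)
 obtain C where C: "C > 0" "!!w. w : XX ==> Tl p 1 th w <= 1/(2*a*E)*Il ps w + C*Tl q 1 th w" using powr_interpolate_T[of "1/(2*a*E)"] a_pos E by auto
 \<comment> \<open>Below \<open>r1\<close> the lam-term pays for its share of the interpolated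
   a-term; below \<open>r2\<close> the critical term takes at most a quarter of the energy.\<close>
 define r1 where "r1 = (lam*p/(q*a*C)) powr (1/(p - q))"
 define r2 where "r2 = (ps/(4*p*(b*E + 1))) powr (1/(ps - p))"
 define \<rho> where "\<rho> = min (r0/2) (min r1 r2)"
 have bE: "b*E + 1 > 0" using b0 E by (simp add: add_nonneg_pos)
 have r1: "r1 > 0" "r1 powr (p - q) = lam*p/(q*a*C)" using lam0 p0 q1 a_pos C qp by (auto simp: r1_def powr_powr)
 have r2: "r2 > 0" "r2 powr (ps - p) = ps/(4*p*(b*E + 1))" using p0 ps_facts(1,3) bE by (auto simp: r2_def powr_powr)
 have \<rho>: "\<rho> > 0" "\<rho> < r0" using r0 r1 r2 by (auto simp: \<rho>_def)
 have k1: "a/p*\<rho> powr p*C <= lam/q*\<rho> powr q"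
 proof -
  have "\<rho> powr (p - q) <= lam*p/(q*a*C)" unfolding r1(2)[symmetric] using \<rho> qp by (intro powr_mono2) (auto simp: \<rho>_def)
  then have "\<rho> powr (p - q)*(a/p*C) <= lam*p/(q*a*C)*(a/p*C)" using a_pos p0 C by (intro mult_right_mono) auto
  also have "... = lam/q" using a_pos p0 C q1 by simp
  finally have "\<rho> powr q*(\<rho> powr (p - q)*(a/p*C)) <= \<rho> powr q*(lam/q)" by (intro mult_left_mono) auto
  moreover have "\<rho> powr q*\<rho> powr (p - q) = \<rho> powr p" by (simp add: powr_add[symmetric])
  ultimately show ?thesis by (simp add: mult_ac)
 qed
 have k2: "b/ps*\<rho> powr ps*E <= \<rho> powr p/(4*p)"
 proof -
  have "\<rho> powr (ps - p) <= ps/(4*p*(b*E + 1))" unfolding r2(2)[symmetric] using \<rho> ps_facts(1) by (intro powr_mono2) (auto simp: \<rho>_def)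
  then have "\<rho> powr (ps - p) <= ps/(4*p)/(b*E + 1)" by simp
  then have "\<rho> powr (ps - p)*(b*E + 1) <= ps/(4*p)" unfolding pos_le_divide_eq[OF bE] .
  moreover have "\<rho> powr (ps - p)*(b*E) <= \<rho> powr (ps - p)*(b*E + 1)" by (intro mult_left_mono) auto
  ultimately have "\<rho> powr (ps - p)*(b*E) <= ps/(4*p)" by linarith
  then have "\<rho> powr (ps - p)*(b/ps*E) <= 1/(4*p)" using ps_facts(3) p0 by (simp add: field_simps)
  then have "\<rho> powr p*(\<rho> powr (ps - p)*(b/ps*E)) <= \<rho> powr p*(1/(4*p))" by (intro mult_left_mono) auto
  moreover have "\<rho> powr p*\<rho> powr (ps - p) = \<rho> powr ps" by (simp add: powr_add[symmetric])
  ultimately show ?thesis by (simp add: mult_ac)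
 qed
 have main: "\<rho> powr p/(4*p) <= J u" if u: "u : XX" "Nn u = \<rho>" for u
 proof -
  define w where "w = (%x. (1/\<rho>)*u x)"
  have w: "w : XX" unfolding w_def by (rule XX_cmult[OF u(1)])
  have wN: "Nn w = 1" unfolding w_def Nn_cmult using u(2) \<rho> by simp
  have uw: "u = (%x. \<rho>*w x)" using \<rho> by (auto simp: w_def)
  have wE: "Il ps w <= E" using embedding_le(2)[OF w ps1 order_refl, of 1] wN by (simp add: E_def)
  have Tp: "Tl p 1 th w <= 1/(2*a) + C*Tl q 1 th w"
  proof -
   have "1/(2*a*E)*Il ps w <= 1/(2*a*E)*E" using wE a_pos E by (intro mult_left_mono) auto
   then show ?thesis using C(2)[OF w] E by simp
  qed
  have Tps: "Tl ps 1 0 w <= E" using T_abs_le[OF Lps(3)[OF w], of 1 0] wE by simp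
  have Tu: "Tl r 1 cm u = \<rho> powr r*Tl r 1 cm w" for r cm unfolding uw by (rule pw_cmult_pos[OF \<rho>(1)])
  have Gu: "T LL p 1 1 (dq s p u) = \<rho> powr p" using Nn_powr[of u] u(2) by (simp add: T_one_one)
  have "a/p*(\<rho> powr p*Tl p 1 th w) <= a/p*(\<rho> powr p*(1/(2*a) + C*Tl q 1 th w))" using Tp a_pos p0 by (intro mult_left_mono) auto
  also have "... = \<rho> powr p/(2*p) + (a/p*\<rho> powr p*C)*Tl q 1 th w" using a_pos p0 by (simp add: distrib_left add_divide_distrib mult_ac)
  also have "... <= \<rho> powr p/(2*p) + (lam/q*\<rho> powr q)*Tl q 1 th w" using k1 T_nn by (intro add_left_mono mult_right_mono)
  finally have 1: "a/p*(\<rho> powr p*Tl p 1 th w) <= \<rho> powr p/(2*p) + (lam/q*\<rho> powr q)*Tl q 1 th w" .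
  have "b/ps*(\<rho> powr ps*Tl ps 1 0 w) <= b/ps*(\<rho> powr ps*E)" using Tps b0 ps_facts(3) by (intro mult_left_mono) auto
  then have 2: "b/ps*(\<rho> powr ps*Tl ps 1 0 w) <= \<rho> powr p/(4*p)" using k2 by (simp add: mult_ac)
  have "\<rho> powr p/(4*p) = 1/p*\<rho> powr p - \<rho> powr p/(2*p) - \<rho> powr p/(4*p)" using p0 by (simp add: field_simps)
  then show ?thesis unfolding J_def Tu Gu using 1 2 by (simp add: mult_ac)
 qed
 show ?thesis using \<rho> main p0 by (intro exI[of _ \<rho>] exI[of _ "\<rho> powr p/(4*p)"]) auto
qed

lemma T_nonneg_fun: "(!!x. f x >= 0) ==> T M r 1 cm f = Lpi M r f"
 by (simp add: T_def Lpi_def pw_def)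

text \<open>The path is t phi with t in [0, 1]. Along it the p-homogeneous terms have a nonpositive
  sum because G(phi) < a, so only the lam-term raises the level, and for small lam the endpoint phi
  does not lie above level 0.\<close>

lemma mountain_pass:
 assumes L: "lam/q*Il q phi <= (a - G phi)/p" and c: "b > 0 ==> lam/q*Il q phi < cst b"
 shows "EX z:XX. (ALL v:XX. Jd z v = 0) \<and> 0 < J z \<and> J z <= lam/q*Il q phi"
proof -
 define m where "m = Il q phi"
 have m: "m >= 0" by (simp add: m_def)
 define h0 where "h0 t = (%x. (0::real) + t*phi x)" for t :: real
 obtain \<rho> \<alpha> where \<rho>: "0 < \<rho>" "\<rho> < Nn phi" "0 < \<alpha>" "!!u. u : XX ==> Nn u = \<rho> ==> \<alpha> <= J u"
  using local_geometry[OF phi_Nn_pos] by blast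
 have h0c: "Ncont {0..1} h0" unfolding h0_def by (intro Ncont_add[OF Ncont_zero continuous_on_id phi(1)])
 have Jh: "J (h0 t) <= lam/q*(t powr q*m) - (a - G phi)/p*t powr p" if t: "t >= 0" for t
 proof -
  have h: "h0 t = (%x. t*phi x)" by (simp add: h0_def)
  have T: "Tl r 1 cm (h0 t) = t powr r*Il r phi" for r cm using t phi(2) by (subst T_nonneg_fun) (auto simp: h Lpi_cmult)
  have Gt: "T LL p 1 1 (dq s p (h0 t)) = t powr p*G phi"
  proof -
   have "dq s p (h0 t) = (%z. t*dq s p phi z)" unfolding h by (rule ext) (rule dq_cmult)
   then show ?thesis using t by (simp add: T_one_one Lpi_cmult)
  qed
  have "0 <= b/ps*(t powr ps*Il ps phi)" using b0 ps_facts(3) by simp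
  moreover have "(a - G phi)/p*t powr p = a/p*(t powr p*1) - 1/p*(t powr p*G phi)" by (simp add: diff_divide_distrib left_diff_distrib)
  ultimately show ?thesis unfolding J_def T Gt phi(4) m_def[symmetric] by linarith
 qed
 have le: "J (h0 t) <= lam/q*m" if t: "t : {0..1}" for t
 proof -
  have "t powr q <= 1" using t q1 by (intro powr_le1) auto
  then have "lam/q*(t powr q*m) <= lam/q*(1*m)" using lam0 q1 m by (intro mult_left_mono mult_right_mono) auto
  moreover have "0 <= (a - G phi)/p*t powr p" using a p0 by simp
  ultimately show ?thesis using Jh[of t] t by simp
 qed
 have J0: "J (h0 0) <= \<alpha>/2" and J1: "J (h0 1) <= \<alpha>/2" using Jh[of 0] Jh[of 1] L \<rho>(3) p0 q1 by (auto simp: m_def)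
 have "EX z:XX. (ALL v:XX. Jd z v = 0) \<and> \<alpha>/2 <= J z \<and> J z <= lam/q*m"
 proof (rule minimax_critical[of "{0..1}" h0])
  fix h assume h: "Ncont {0..1} h" and fixd: "!!y. y : {0..1} ==> J (h0 y) <= \<alpha>/2 ==> h y = h0 y"
  have e: "h 0 = h0 0" "h 1 = h0 1" using fixd[of 0] fixd[of 1] J0 J1 by auto
  have n: "Nn (h 0) = 0" "Nn (h 1) = Nn phi" unfolding e by (simp_all add: h0_def Nn_zero)
  obtain t where t: "0 <= t" "t <= 1" "Nn (h t) = \<rho>" using IVT'[of "%t. Nn (h t)" 0 \<rho> 1] Ncont_Nn[OF h] n \<rho> by auto
  show "EX y:{0..1}. \<alpha> <= J (h y)" by (rule bexI[of _ t]) (use \<rho>(4)[OF Ncont_XX[OF h] t(3)] t in auto)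
 qed (use h0c le c \<rho>(3) in \<open>auto simp: m_def\<close>)
 then show ?thesis using \<rho>(3) by (auto simp: m_def)
qed

text \<open>For \<open>th\<close> = 0 every nonlinear term vanishes against the negative part of z,
  so the energy of that part is 0.\<close>

lemma critical_nonneg:
 assumes t0: "th = 0" and z: "z : XX" and crit: "!!v. v : XX ==> Jd z v = 0"
 shows "AE x in leb. 0 <= z x"
proof -
 note mt = min_test[OF z]
 have "G (%x. min (z x) 0) <= 0" using mt(2) crit[OF mt(1)] mt(3)[OF p1] mt(3)[OF q1] mt(3)[OF exps(6)] by (simp add: t0 Jd_def)
 then have "Nn (%x. min (z x) 0) = 0" using Lpi_nonneg[of LL p "dq s p (%x. min (z x) 0)"] by (simp add: Nn_def Lpn_def)
 then have "AE x in leb. min (z x) 0 = 0" by (rule Nn_eq_0[OF mt(1)])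
 then show ?thesis by eventually_elim (auto simp: min_def split: if_splits)
qed

end

text \<open>Poincare-Miranda from Brouwer: clamp (x - f, y - g) to the rectangle. A fixed point
  where f or g is nonzero would sit on a face with the wrong sign.\<close>

lemma Miranda_rectangle:
 fixes f g :: "real \<times> real => real"
 assumes S: "a1 <= b1" "a2 <= b2" and cf: "continuous_on ({a1..b1} \<times> {a2..b2}) f" and cg: "continuous_on ({a1..b1} \<times> {a2..b2}) g"
  and f: "!!y. y : {a2..b2} ==> f (a1, y) <= 0" "!!y. y : {a2..b2} ==> 0 <= f (b1, y)"
  and g: "!!x. x : {a1..b1} ==> g (x, a2) <= 0" "!!x. x : {a1..b1} ==> 0 <= g (x, b2)"
 shows "EX z:{a1..b1} \<times> {a2..b2}. f z = 0 \<and> g z = 0"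
proof -
 define F where "F z = (max a1 (min b1 (fst z - f z)), max a2 (min b2 (snd z - g z)))" for z
 have "continuous_on ({a1..b1} \<times> {a2..b2}) F" unfolding F_def by (intro continuous_intros cf cg)
 moreover have "F ` ({a1..b1} \<times> {a2..b2}) \<subseteq> {a1..b1} \<times> {a2..b2}" using S by (auto simp: F_def)
 moreover have "compact ({a1..b1} \<times> {a2..b2})" "convex ({a1..b1} \<times> {a2..b2})" "{a1..b1} \<times> {a2..b2} \<noteq> {}"
  using S by (auto intro!: compact_Times convex_Times)
 ultimately obtain z where z: "z : {a1..b1} \<times> {a2..b2}" "F z = z" using brouwer by blast
 obtain x y where xy: "z = (x, y)" by force
 have x: "x : {a1..b1}" "max a1 (min b1 (x - f z)) = x" and y: "y : {a2..b2}" "max a2 (min b2 (y - g z)) = y" using z by (auto simp: F_def xy)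
 have "f z = 0"
 proof (rule ccontr)
  assume "f z \<noteq> 0"
  then have "(f z > 0 \<and> x = a1) \<or> (f z < 0 \<and> x = b1)" using x by (auto simp: max_def min_def split: if_splits)
  then show False using f[OF y(1)] xy by auto
 qed
 moreover have "g z = 0"
 proof (rule ccontr)
  assume "g z \<noteq> 0"
  then have "(g z > 0 \<and> y = a2) \<or> (g z < 0 \<and> y = b2)" using y by (auto simp: max_def min_def split: if_splits)
  then show False using g[OF x(1)] xy by auto
 qed
 ultimately show ?thesis using z(1) by blast
qed

section \<open>Linking geometry\<close>

context frac
begin

text \<open>The two functions are separated by at least \<open>\<rho>\<close>, so they interact only
  away from the singularity of the kernel. The error splits into a small multiple of the L^p mass of
  w and a term proportional to the volume of the small ball.\<close>

lemma cross_energy: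
 fixes x0 :: "real^'n"
 assumes psi: "psi : DD" "!!x. 0 <= psi x" "!!x. psi x <= k" "!!x. x : ball x0 (2*\<rho>) ==> psi x = 0" and k: "k > 0" and \<rho>: "\<rho> > 0" and e: "e > 0"
 shows "EX r. 0 < r \<and> r < \<rho> \<and> (ALL w:DD. (ALL x. 0 <= w x) --> (ALL x. x \<notin> ball x0 r --> w x = 0) --> Ll p w -->
  (ALL s t. 0 <= t --> G (%x. s*psi x + t*w x) <= abs s powr p*(G psi + e) + t powr p*(G w + e*Il p w)))"
proof -
 define A where "A = 2*\<kappa>*\<rho> powr (- (s*p))"
 have A: "A > 0" using \<kappa>(1) \<rho> by (simp add: A_def)
 define e1 where "e1 = e/A"
 have e1: "e1 > 0" "A*e1 = e" using A e by (auto simp: e1_def)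
 obtain C where C: "C > 0" "!!a b. abs (pw p 1 1 (a + b) - pw p 1 1 a) <= e1*abs a powr p + C*abs b powr p"
  using pw_add_bound[OF p0 e1(1), of 1 1] by blast
 have C3: "abs (a + b) powr p <= abs a powr p + (e1*abs a powr p + C*abs b powr p)" for a b using C(2)[of a b] unfolding pw_one_one by linarith
 define D where "D = A*C * k powr p*unit_ball_vol N"
 have D: "D > 0" using A C k ubv by (simp add: D_def)
 \<comment> \<open>The volume term is D r^N; this radius makes it at most e.\<close>
 define r where "r = min (\<rho>/2) ((e/D) powr (1/N))"
 have r: "0 < r" "r < \<rho>" using \<rho> e D by (auto simp: r_def)
 have Dr: "D*r powr N <= e"
 proof -
  have "r powr N <= ((e/D) powr (1/N)) powr N" using r N1 by (intro powr_mono2) (auto simp: r_def)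
  also have "... = e/D" using e D N1 by (simp add: powr_powr)
  finally show ?thesis using D by (simp add: field_simps)
 qed
 have main: "G (%x. \<sigma>*psi x + t*w x) <= abs \<sigma> powr p*(G psi + e) + t powr p*(G w + e*Il p w)"
  if w: "w : DD" "!!x. 0 <= w x" "!!x. x \<notin> ball x0 r ==> w x = 0" "Ll p w" and t: "0 <= t" for w \<sigma> t
 proof -
  define B where "B = ball x0 r"
  have Bs: "B : sets leb" by (simp add: B_def)
  have mB: "measure leb B = unit_ball_vol N*r powr N" using emeasure_ball_N[of r x0] r ubv by (simp add: B_def measure_def)
  have Bf: "emeasure leb B < \<infinity>" using emeasure_ball_N[of r x0] r by (simp add: B_def)
  define W where "W x = e1*(t powr p*abs (w x) powr p) + C*(abs \<sigma> powr p * k powr p)*ind B x" for x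
  have W0: "W x >= 0" for x using e1 C by (simp add: W_def)
  have iB: "integrable leb (%x. ind B x :: real)" using Bs Bf by (intro integrable_real_indicator)
  have Wi: "integrable leb W" unfolding W_def using iB LpD(2)[OF w(4)] by auto
  have Wint: "(LI x. W x) = e1*(t powr p*Il p w) + C*(abs \<sigma> powr p * k powr p)*(unit_ball_vol N*r powr N)"
  proof -
   have "(LI x. W x) = (LI x. e1*(t powr p*abs (w x) powr p)) + (LI x. C*(abs \<sigma> powr p * k powr p)*ind B x)"
    unfolding W_def using iB LpD(2)[OF w(4)] by (intro Bochner_Integration.integral_add) auto
   then show ?thesis using mB by (simp add: Lpi_def)
  qed
  define u where "u = (%x. \<sigma>*psi x + t*w x)"
  have one: "abs (t*w x - \<sigma>*psi y) powr p <= abs (t*w x) powr p + abs (\<sigma>*psi y) powr p + (W x + W y)*min 1 (norm (x - y)/\<rho>) powr p"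
   if x: "w x \<noteq> 0" and y: "psi y \<noteq> 0" for x y
  proof -
   have xB: "x : B" using x w(3) by (auto simp: B_def)
   have "dist x0 y >= 2*\<rho>" by (rule ccontr) (use y psi(4)[of y] in simp)
   moreover have "dist x0 x < \<rho>" using xB r by (simp add: B_def)
   ultimately have "norm (x - y) >= \<rho>" using dist_triangle[of x0 y x] by (simp add: dist_norm[of x y])
   then have m1: "min 1 (norm (x - y)/\<rho>) powr p = 1" using \<rho> by (simp add: min_def)
   have "abs (t*w x - \<sigma>*psi y) powr p <= abs (t*w x) powr p + (e1*abs (t*w x) powr p + C*abs (\<sigma>*psi y) powr p)"
    using C3[of "t*w x" "- (\<sigma>*psi y)"] by simp
   also have "e1*abs (t*w x) powr p + C*abs (\<sigma>*psi y) powr p <= W x"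
   proof -
    have "abs (\<sigma>*psi y) powr p <= abs \<sigma> powr p * k powr p"
     using psi(2,3)[of y] p0 by (simp add: abs_mult powr_mult mult_left_mono powr_mono2)
    then have "C*abs (\<sigma>*psi y) powr p <= C*(abs \<sigma> powr p * k powr p)" using C(1) by (intro mult_left_mono) auto
    then show ?thesis using t xB by (simp add: W_def abs_mult powr_mult)
   qed
   finally have "abs (t*w x - \<sigma>*psi y) powr p <= abs (t*w x) powr p + W x" by simp
   moreover have "A <= B + Z + (X + Y)*1" if "A <= B + X" "0 <= Y" "0 <= Z" for A B X Y Z :: real using that by simp
   ultimately show ?thesis unfolding m1 using W0[of y] powr_ge_zero[of "abs (\<sigma>*psi y)" p] by blast
  qed
  have pt: "abs (u x - u y) powr p <= abs \<sigma> powr p*abs (psi x - psi y) powr p + t powr p*abs (w x - w y) powr p + (W x + W y)*min 1 (norm (x - y)/\<rho>) powr p" for x y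
  proof -
   have sep: "psi x = 0 \<or> w x = 0" for x
   proof (cases "x : ball x0 r")
    case True
    then have "x : ball x0 (2*\<rho>)" using r \<rho> by simp
    then show ?thesis using psi(4) by blast
   qed (use w(3) in blast)
   have err: "0 <= (W x + W y)*min 1 (norm (x - y)/\<rho>) powr p" using W0[of x] W0[of y] by simp
   have tt: "abs t = t" using t by simp
   consider "w x = 0" "w y = 0" | "psi x = 0" "psi y = 0" | "w x \<noteq> 0" "psi y \<noteq> 0" | "w y \<noteq> 0" "psi x \<noteq> 0"
    using sep[of x] sep[of y] by blast
   then show ?thesis
   proof cases
    case 1
    have "u x - u y = \<sigma>*(psi x - psi y)" using 1 by (simp add: u_def right_diff_distrib)
    then show ?thesis using err 1 by (simp add: abs_mult powr_mult)
   next
    case 2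
    have "u x - u y = t*(w x - w y)" using 2 by (simp add: u_def right_diff_distrib)
    then show ?thesis using err 2 tt by (simp add: abs_mult powr_mult)
   next
    case 3
    then have z: "psi x = 0" "w y = 0" using sep[of x] sep[of y] by auto
    have "u x - u y = t*w x - \<sigma>*psi y" using z by (simp add: u_def)
    then show ?thesis using one[OF 3] z tt by (simp add: abs_mult powr_mult)
   next
    case 4
    then have z: "psi y = 0" "w x = 0" using sep[of x] sep[of y] by auto
    have "abs (u x - u y) = abs (t*w y - \<sigma>*psi x)" using z by (simp add: u_def abs_minus_commute)
    then show ?thesis using one[OF 4] z tt by (simp add: abs_mult powr_mult norm_minus_commute add_ac)
   qed
  qed
  have iw: "integrable LL (%z. (W (fst z) + W (snd z)) * kR \<rho> z)"
   and vw: "(\<integral>z. (W (fst z) + W (snd z)) * kR \<rho> z \<partial>LL) <= 2*\<kappa>*\<rho> powr (- (s*p))*(LI x. W x)"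
   using kR_weight[OF \<rho> Wi W0] by auto
  have uD: "u : DD" unfolding u_def using DD_lin[OF DD_lin[OF DD_zero psi(1), of \<sigma>] w(1), of t] by simp
  note ip = LpD(2)[OF DD_D(2)[OF psi(1)]] and iww = LpD(2)[OF DD_D(2)[OF w(1)]]
  have "G u <= (\<integral>z. abs \<sigma> powr p*abs (dq s p psi z) powr p + t powr p*abs (dq s p w z) powr p + (W (fst z) + W (snd z)) * kR \<rho> z \<partial>LL)"
   unfolding Lpi_def
  proof (rule integral_mono)
   fix z :: "(real^'n) \<times> (real^'n)"
   have "abs (u (fst z) - u (snd z)) powr p/norm (fst z - snd z) powr (N + s*p) <=
    (abs \<sigma> powr p*abs (psi (fst z) - psi (snd z)) powr p + t powr p*abs (w (fst z) - w (snd z)) powr p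
     + (W (fst z) + W (snd z))*min 1 (norm (fst z - snd z)/\<rho>) powr p)/norm (fst z - snd z) powr (N + s*p)"
    using pt[of "fst z" "snd z"] by (intro divide_right_mono) auto
   then show "abs (dq s p u z) powr p <= abs \<sigma> powr p*abs (dq s p psi z) powr p + t powr p*abs (dq s p w z) powr p + (W (fst z) + W (snd z)) * kR \<rho> z"
    unfolding dq_powr_N[OF p0] by (simp only: add_divide_distrib times_divide_eq_right)
  qed (use LpD(2)[OF DD_D(2)[OF uD]] ip iww iw in auto)
  also have "... = abs \<sigma> powr p*G psi + t powr p*G w + (\<integral>z. (W (fst z) + W (snd z)) * kR \<rho> z \<partial>LL)"
   unfolding Lpi_def using ip iww iw by simp
  also have "(\<integral>z. (W (fst z) + W (snd z)) * kR \<rho> z \<partial>LL) <= A*(e1*(t powr p*Il p w) + C*(abs \<sigma> powr p * k powr p)*(unit_ball_vol N*r powr N))"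
   using vw unfolding Wint A_def .
  also have "... = (A*e1)*(t powr p*Il p w) + abs \<sigma> powr p*(D*r powr N)" by (simp add: D_def algebra_simps)
  also have "... <= e*(t powr p*Il p w) + abs \<sigma> powr p*e" unfolding e1(2) using Dr by (intro add_left_mono mult_left_mono) auto
  finally show ?thesis by (simp add: u_def algebra_simps)
 qed
 then show ?thesis using r by blast
qed

text \<open>The bound is of order R^(N - s p) and tends to 0 with R: as N > s p, small balls can be
  cut out at arbitrarily small cost.\<close>

lemma cut_energy:
 fixes x0 :: "real^'n"
 assumes R: "R > 0"
 shows "(%x. 1 - cut R (x - x0)) : Bl" "Lp LL p (dq s p (%x. 1 - cut R (x - x0)))"
  "G (%x. 1 - cut R (x - x0)) <= 2*\<kappa>*R powr (- (s*p))*(unit_ball_vol N*(2*R) powr N)"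
proof -
 define c where "c = (%x. 1 - cut R (x - x0))"
 have cc: "continuous_on UNIV c" unfolding c_def cut_def using R by (intro continuous_intros) auto
 have cm: "c : Bl" by (intro measurable_borel_lebesgue borel_measurable_continuous_onI cc)
 then show "(%x. 1 - cut R (x - x0)) : Bl" by (simp add: c_def)
 define w :: "real^'n => real" where "w = ind (ball x0 (2*R))"
 have wi: "integrable leb w" unfolding w_def using emeasure_ball_N[of "2*R" x0] R by (intro integrable_real_indicator) auto
 have wv: "(LI x. w x) = unit_ball_vol N*(2*R) powr N" unfolding w_def using emeasure_ball_N[of "2*R" x0] R ubv by (simp add: measure_def)
 have w0: "w x >= 0" for x by (simp add: w_def)
 have bd: "abs (c x - c y) powr p <= (w x + w y)*min 1 (norm (x - y)/R) powr p" for x y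
 proof (cases "c x = 0 \<and> c y = 0")
  case True
  then show ?thesis using w0[of x] w0[of y] p0 by simp
 next
  case False
  then have "w x + w y >= 1" using cut_facts(4)[OF R, of "x - x0"] cut_facts(4)[OF R, of "y - x0"] w0[of x] w0[of y]
   by (auto simp: c_def w_def indicator_def dist_norm norm_minus_commute not_less)
  moreover have "abs (c x - c y) powr p <= min 1 (norm (x - y)/R) powr p"
   using cut_facts(5)[OF R, of "x - x0" "y - x0"] p0 by (intro powr_mono2) (auto simp: c_def abs_minus_commute)
  ultimately show ?thesis using mult_mono[of 1 "w x + w y" "abs (c x - c y) powr p" "min 1 (norm (x - y)/R) powr p"] by simp
 qed
 show "Lp LL p (dq s p (%x. 1 - cut R (x - x0)))" "G (%x. 1 - cut R (x - x0)) <= 2*\<kappa>*R powr (- (s*p))*(unit_ball_vol N*(2*R) powr N)"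
  using Lp_dq_weight[OF R wi w0 cm bd] unfolding wv c_def by auto
qed

end

context fracX
begin

text \<open>A competitor for \<open>phi\<close> that vanishes near \<open>x0\<close>, leaving room for a concentrated bump.\<close>
lemma truncated_competitor:
 fixes x0 :: "real^'n"
 assumes phi: "phi : XX" "!!x. 0 <= phi x" "Il p phi = 1" and a: "G phi < a" and R0: "R0 > 0"
 shows "EX psi:XX. EX k>0. EX R>0. (ALL x. 0 <= psi x \<and> psi x <= k \<and> psi x <= phi x) \<and> (ALL x:ball x0 (2*R). psi x = 0) \<and> R < R0 \<and> G psi < a*Il p psi"

proof -
 have a0: "a > 0" using a Lpi_nonneg[of LL p "dq s p phi"] by linarith
 have phim [measurable]: "phi : Bl" using XX_DD[OF phi(1)] by auto
 \<comment> \<open>Halfway between G(phi)/a and 1: truncation at a large height keeps the L^p mass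
   above it, and the remaining \<open>gap\<close> is shared out among the later errors.\<close>
 define \<theta> where "\<theta> = (G phi/a + 1)/2"
 have ga: "G phi/a < 1" using a a0 by simp
 have \<theta>: "G phi/a < \<theta>" "\<theta> < 1" using ga unfolding \<theta>_def by (auto simp: field_simps)
 have "EX n::nat. \<theta> < Il p (%x. min (phi x) (real n + 1))"
 proof (rule ccontr)
  assume "\<not> ?thesis"
  then have le: "Il p (%x. min (phi x) (real n + 1)) <= \<theta>" for n by (auto simp: not_less)
  have L: "Ll p (%x. min (phi x) (real n + 1))" for n
  proof (rule Lp_bound[OF XX_Lp[OF phi(1)], where C = 1])
   show "(%x. min (phi x) (real n + 1)) : Bl" by measurable
  qed (use phi(2) p0 ps_facts(1) in \<open>auto simp: abs_if\<close>)
  have "Il p phi <= \<theta>"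
  proof (rule Fatou_Lp(2)[OF L le phim _ p0], intro AE_I2 tendsto_eventually)
   fix x
   obtain n0 :: nat where "phi x <= real n0" using real_arch_simple by blast
   then show "EV n. min (phi x) (real n + 1) = phi x" unfolding eventually_sequentially by (intro exI[of _ n0]) (auto simp: min_def)
  qed
  then show False using phi(3) \<theta> by simp
 qed
 then obtain n :: nat where n: "\<theta> < Il p (%x. min (phi x) (real n + 1))" by blast
 define k where "k = real n + 1"
 have k: "k > 0" by (simp add: k_def add_nonneg_pos)
 define f where "f = (%x. min (phi x) k)"
 have fm [measurable]: "f : Bl" unfolding f_def by measurable
 have f: "0 <= f x" "f x <= k" "f x <= phi x" for x using phi(2)[of x] k by (auto simp: f_def)
 have fD: "f : DD" by (rule DD_bound[OF XX_DD[OF phi(1)] fm, where C = 1]) (use phi(2) k in \<open>auto simp: f_def min_def abs_if\<close>)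
 have fX: "f : XX" using fD XX_off[OF phi(1)] k by (auto simp: XX_def f_def)
 have fG: "G f <= G phi" by (rule G_mono[OF XX_DD[OF phi(1)] fm]) (auto simp: f_def min_def)
 have fL: "Ll p f" using XX_Lp[OF fX] p0 ps_facts(1) by simp
 have f\<theta>: "\<theta> < Il p f" using n by (simp add: f_def k_def)
 define gap where "gap = a*\<theta> - G phi"
 have gap: "gap > 0" using \<theta>(1) a0 by (simp add: gap_def field_simps)
 define e1 where "e1 = gap/(4*(G phi + 1))"
 have Gp: "G phi + 1 > 0" by (simp add: add_nonneg_pos)
 have e1: "e1 > 0" using gap Gp by (simp add: e1_def)
 have e1G: "e1*G phi <= gap/4"
 proof -
  have "e1*G phi <= e1*(G phi + 1)" using e1 by simp
  also have "... = gap/4" using Gp unfolding e1_def by (simp add: field_simps)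
  finally show ?thesis .
 qed
 obtain C where C: "C > 0" "!!a b. abs (pw p 1 1 (a + b) - pw p 1 1 a) <= e1*abs a powr p + C*abs b powr p"
  using pw_add_bound[OF p0 e1, of 1 1] by blast
 have C3: "abs (a + b) powr p <= (1 + e1)*abs a powr p + C*abs b powr p" for a b using C(2)[of a b] unfolding pw_one_one distrib_right by linarith
 define V where "V = unit_ball_vol N*2 powr N"
 have V: "V > 0" using ubv by (simp add: V_def)
 define c1 where "c1 = C * k powr p*(2*\<kappa>*V)"
 define c2 where "c2 = a * k powr p*V"
 have c: "c1 > 0" "c2 > 0" using C k \<kappa>(1) V a0 by (auto simp: c1_def c2_def)
 have Nsp: "N - s*p > 0" using sub by simp
 have N0: "N > 0" using N1 by simp
 \<comment> \<open>The energy of the hole, of order R^(N - s p), and the mass lost in it, of order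
   R^N, may each cost a quarter of the gap.\<close>
 define R where "R = min (R0/2) (min ((gap/(4*c1)) powr (1/(N - s*p))) ((gap/(4*c2)) powr (1/N)))"
 have R: "R > 0" "R < R0" using R0 gap c by (auto simp: R_def)
 have R1: "c1*R powr (N - s*p) <= gap/4"
 proof -
  have "R powr (N - s*p) <= ((gap/(4*c1)) powr (1/(N - s*p))) powr (N - s*p)" using R Nsp by (intro powr_mono2) (auto simp: R_def)
  also have "... = gap/(4*c1)" using gap c Nsp by (simp add: powr_powr)
  finally have "c1*R powr (N - s*p) <= c1*(gap/(4*c1))" using c by (intro mult_left_mono) auto
  then show ?thesis using c by simp
 qed
 have R2: "c2*R powr N <= gap/4"
 proof -
  have "R powr N <= ((gap/(4*c2)) powr (1/N)) powr N" using R N0 by (intro powr_mono2) (auto simp: R_def)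
  also have "... = gap/(4*c2)" using gap c N0 by (simp add: powr_powr)
  finally have "c2*R powr N <= c2*(gap/(4*c2))" using c by (intro mult_left_mono) auto
  then show ?thesis using c by simp
 qed
 define \<eta> where "\<eta> = (%x. cut R (x - x0))"
 have \<eta>: "0 <= \<eta> x" "\<eta> x <= 1" for x using cut_facts(1,2)[OF R(1)] by (auto simp: \<eta>_def)
 have \<eta>m [measurable]: "\<eta> \<in> Bl"
 proof -
  have "(%x. 1 - (1 - \<eta> x)) : Bl" using cut_energy(1)[OF R(1), of x0] unfolding \<eta>_def by measurable
  then show ?thesis by simp
 qed
 define psi where "psi = (%x. \<eta> x*f x)"
 have psim [measurable]: "psi : Bl" unfolding psi_def by measurable
 have psiD: "psi : DD" unfolding psi_def
 proof (rule mult_DD[OF fD fL \<eta>m \<eta> R(1), where L = 1])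
  show "abs (\<eta> x - \<eta> y) <= 1*min 1 (norm (x - y)/R)" for x y using cut_facts(5)[OF R(1), of "x - x0" "y - x0"] by (simp add: \<eta>_def)
 qed simp
 have psiX: "psi : XX" using psiD XX_off[OF fX] by (auto simp: XX_def psi_def)
 have psif: "0 <= psi x" "psi x <= f x" for x using \<eta>[of x] f[of x] by (auto simp: psi_def mult_le_cancel_right2 mult_left_le_one_le)
 have psi0: "psi x = 0" if "x : ball x0 R" for x
  using cut_facts(3)[OF R(1), of "x - x0"] that by (simp add: psi_def \<eta>_def dist_norm norm_minus_commute)
 have Gpsi: "G psi <= G f + e1*G f + C * k powr p*G (%x. 1 - \<eta> x)"
 proof -
  note i1 = LpD(2)[OF DD_D(2)[OF fD]]
  have i2: "integrable LL (%z. abs (dq s p (%x. 1 - \<eta> x) z) powr p)" using cut_energy(2)[OF R(1), of x0] by (auto simp: \<eta>_def)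
  have pt: "abs (psi x - psi y) powr p <= (1 + e1)*abs (f x - f y) powr p + C * k powr p*abs ((1 - \<eta> x) - (1 - \<eta> y)) powr p" for x y
  proof -
   have "psi x - psi y = \<eta> x*(f x - f y) + f y*(\<eta> x - \<eta> y)" by (simp add: psi_def algebra_simps)
   then have "abs (psi x - psi y) powr p <= (1 + e1)*abs (\<eta> x*(f x - f y)) powr p + C*abs (f y*(\<eta> x - \<eta> y)) powr p"
    using C3[of "\<eta> x*(f x - f y)" "f y*(\<eta> x - \<eta> y)"] by simp
   also have "... <= (1 + e1)*abs (f x - f y) powr p + C*(k powr p*abs (\<eta> x - \<eta> y) powr p)"
   proof (intro add_mono mult_left_mono)
    show "abs (\<eta> x*(f x - f y)) powr p <= abs (f x - f y) powr p"
     using \<eta>[of x] p0 by (intro powr_mono2) (auto simp: abs_mult mult_left_le_one_le)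
    show "abs (f y*(\<eta> x - \<eta> y)) powr p <= k powr p*abs (\<eta> x - \<eta> y) powr p"
     using f[of y] p0 by (simp add: abs_mult powr_mult mult_right_mono powr_mono2)
   qed (use e1 C in auto)
   also have "abs (\<eta> x - \<eta> y) = abs ((1 - \<eta> x) - (1 - \<eta> y))" by simp
   finally show ?thesis by (simp add: mult.assoc)
  qed
  have "G psi <= (\<integral>z. (1 + e1)*abs (dq s p f z) powr p + C * k powr p*abs (dq s p (%x. 1 - \<eta> x) z) powr p \<partial>LL)"
   unfolding Lpi_def
  proof (rule integral_mono)
   fix z :: "(real^'n) \<times> (real^'n)"
   have "abs (psi (fst z) - psi (snd z)) powr p/norm (fst z - snd z) powr (N + s*p) <=
    ((1 + e1)*abs (f (fst z) - f (snd z)) powr p + C * k powr p*abs ((1 - \<eta> (fst z)) - (1 - \<eta> (snd z))) powr p)/norm (fst z - snd z) powr (N + s*p)"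
    using pt[of "fst z" "snd z"] by (intro divide_right_mono) auto
   then show "abs (dq s p psi z) powr p <= (1 + e1)*abs (dq s p f z) powr p + C * k powr p*abs (dq s p (%x. 1 - \<eta> x) z) powr p"
    unfolding dq_powr_N[OF p0] by (simp only: add_divide_distrib times_divide_eq_right)
  qed (use LpD(2)[OF DD_D(2)[OF psiD]] i1 i2 in auto)
  also have "... = (1 + e1)*G f + C * k powr p*G (%x. 1 - \<eta> x)" unfolding Lpi_def using i1 i2 by simp
  finally show ?thesis by (simp add: distrib_right)
 qed
 have Gc: "C * k powr p*G (%x. 1 - \<eta> x) <= gap/4"
 proof -
  have "C * k powr p*G (%x. 1 - \<eta> x) <= C * k powr p*(2*\<kappa>*R powr (- (s*p))*(unit_ball_vol N*(2*R) powr N))"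
   unfolding \<eta>_def using cut_energy(3)[OF R(1), of x0] C k by (intro mult_left_mono) auto
  also have "... = c1*(R powr (- (s*p))*R powr N)" using R by (simp add: c1_def V_def powr_mult)
  also have "R powr (- (s*p))*R powr N = R powr (N - s*p)" by (simp add: powr_add[symmetric])
  finally show ?thesis using R1 by simp
 qed
 have Lpsi: "Il p f - k powr p*(V*R powr N) <= Il p psi"
 proof -
  define B where "B = ball x0 (2*R)"
  have mB: "measure leb B = V*R powr N" using emeasure_ball_N[of "2*R" x0] R ubv by (simp add: B_def measure_def V_def powr_mult)
  have iB: "integrable leb (%x. ind B x :: real)" using emeasure_ball_N[of "2*R" x0] R by (intro integrable_real_indicator) (auto simp: B_def)
  have iP: "integrable leb (%x. abs (psi x) powr p)" using XX_Lp[OF psiX, of p] p0 ps_facts(1) by auto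
  have "Il p f <= (LI x. abs (psi x) powr p + k powr p*ind B x)" unfolding Lpi_def
  proof (rule integral_mono)
   fix x
   show "abs (f x) powr p <= abs (psi x) powr p + k powr p*ind B x"
   proof (cases "x : B")
    case True
    have "abs (f x) powr p <= k powr p" using f[of x] p0 by (intro powr_mono2) auto
    then show ?thesis using True by (simp add: add_increasing)
   next
    case False
    then have "\<eta> x = 1" using cut_facts(4)[OF R(1), of "x - x0"] by (simp add: B_def \<eta>_def dist_norm norm_minus_commute not_less)
    then show ?thesis by (simp add: psi_def)
   qed
  qed (use LpD(2)[OF fL] iP iB in auto)
  also have "... = Il p psi + k powr p*(V*R powr N)" using iP iB mB by (simp add: Lpi_def)
  finally show ?thesis by simp
 qed
 have "G psi < a*Il p psi"
 proof -
  have "e1*G f <= e1*G phi" using fG e1 by (intro mult_left_mono) auto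
  then have 1: "G psi <= G phi + gap/2" using Gpsi Gc e1G fG by linarith
  have "a*(Il p f - k powr p*(V*R powr N)) <= a*Il p psi" using Lpsi a0 by (intro mult_left_mono) auto
  then have "a*Il p f - c2*R powr N <= a*Il p psi" by (simp add: c2_def algebra_simps)
  moreover have "a*\<theta> < a*Il p f" using f\<theta> a0 by simp
  moreover have "a*\<theta> = G phi + gap" by (simp add: gap_def)
  moreover have "x < y" if "f - r <= y" "t < f" "t = g + d" "x <= g + d/2" "r <= d/4" "0 < d" for x y f r t g d :: real using that by linarith
  ultimately show ?thesis using 1 R2 gap by blast
 qed
 moreover have "ALL x. 0 <= psi x \<and> psi x <= k \<and> psi x <= phi x" using psif f by (meson order_trans)
 moreover have "ALL x:ball x0 (2*(R/2)). psi x = 0" using psi0 by simp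
 moreover have "R/2 > 0" "R/2 < R0" using R by auto
 ultimately show ?thesis using psiX k by blast
qed

end

section \<open>Level estimates on rays and spheres\<close>

context fracX
begin

lemma Lpi_disjoint:
 assumes f: "Lp M r f" and g: "Lp M r g" and d: "!!x. f x = 0 \<or> g x = 0" and r: "r > 0"
 shows "Lpi M r (%x. f x + g x) = Lpi M r f + Lpi M r g"
proof -
 have "abs (f x + g x) powr r = abs (f x) powr r + abs (g x) powr r" for x using d[of x] r by auto
 then show ?thesis using f g by (simp add: Lpi_def LpD)
qed

lemma Ncont_DT:
 assumes phi: "phi : XX" and h: "Ncont Q h"
 shows "continuous_on Q (%y. EE phi (h y))" unfolding continuous_on_def
proof
 fix y assume y: "y : Q"
 note hX = Ncont_XX[OF h]
 have "((%y'. EE phi (h y') - EE phi (h y)) \<longlongrightarrow> 0) (at y within Q)"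
 proof (rule Lim_null_comparison)
  show "\<forall>\<^sub>F y' in at y within Q. norm (EE phi (h y') - EE phi (h y))
   <= 2*Nn phi powr (p - 1)*Nn (%x. h y' x - h y x)"
  proof (intro always_eventually allI)
   fix y'
   have "dq s p (%x. h y' x - h y x) = (%z. dq s p (h y') z + (-1)*dq s p (h y) z)" using dq_lin_fun[of "h y'" "-1" "h y"] by simp
   then have "EE phi (%x. h y' x - h y x) = EE phi (h y') - EE phi (h y)"
    using DT_lin[OF XX_dq[OF phi] XX_dq[OF hX[of y']] XX_dq[OF hX[of y]] p1, of 1 1 "-1"] by simp
   then show "norm (EE phi (h y') - EE phi (h y)) <= 2*Nn phi powr (p - 1)*Nn (%x. h y' x - h y x)"
    using DT_abs_le[OF XX_dq[OF phi] XX_dq[OF XX_diff[OF hX[of y'] hX[of y]]] p1, of 1 1] by (simp add: Nn_def)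
  qed
  have "((%y'. 2*Nn phi powr (p - 1)*Nn (%x. h y' x - h y x)) \<longlongrightarrow> 2*Nn phi powr (p - 1)*0) (at y within Q)"
   by (intro tendsto_intros) (use h y in \<open>simp add: Ncont_def\<close>)
  then show "((%y'. 2*Nn phi powr (p - 1)*Nn (%x. h y' x - h y x)) \<longlongrightarrow> 0) (at y within Q)" by simp
 qed
 then show "((%y'. EE phi (h y')) \<longlongrightarrow> EE phi (h y)) (at y within Q)" by (simp add: LIM_zero_iff)
qed

text \<open>Young with the exponents ps/p and ps/(ps - p) gives the maximum along the ray; inserting
  A < Sob E^(p/ps), the strict deficit of the concentrated bump, puts it below
  \<open>cst b\<close>.\<close>

lemma ray_bound:
 assumes b: "b > 0" and E: "E > 0" and A: "A < Sob*E powr (p/ps)"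
 shows "EX c>=0. c < cst b \<and> (ALL r>=0. A/p*r powr p - b/ps*E*r powr ps <= c)
  \<and> (EX M>0. ALL r>=M. A/p*r powr p - b/ps*E*r powr ps <= - 1)"
proof -
 \<comment> \<open>A itself may be negative or zero; half of the Sobolev bound is a positive
   substitute.\<close>
 define A' where "A' = max A (Sob*E powr (p/ps)/2)"
 have SE: "Sob*E powr (p/ps) > 0" using Sob_pos E by simp
 have A': "A' > 0" "A <= A'" "A' < Sob*E powr (p/ps)" using A SE by (auto simp: A'_def less_max_iff_disj)
 have pps: "ps - p > 0" "ps > 0" "p > 0" using ps_facts(1,3) p0 by auto
 define y where "y = A'*(b*E) powr (- (p/ps))"
 have y: "y > 0" using A' b E by (simp add: y_def)
 define c where "c = (1/p - 1/ps)*y powr (ps/(ps - p))"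
 have cc: "1/p - 1/ps > 0" using pps ps_facts(1) by (simp add: field_simps)
 have c0: "c >= 0" using cc by (simp add: c_def)
 have bd: "A/p*r powr p - b/ps*E*r powr ps <= c" if r: "r >= 0" for r
 proof -
  define x where "x = (b*E) powr (p/ps)*r powr p"
  have x: "x >= 0" by (simp add: x_def)
  have xy: "x*y = A'*r powr p"
  proof -
   have "(b*E) powr (p/ps)*(b*E) powr (- (p/ps)) = 1" using b E by (simp add: powr_add[symmetric])
   then show ?thesis by (simp add: x_def y_def mult_ac)
  qed
  have xp: "x powr (ps/p) = b*E*r powr ps" using b E pps r by (simp add: x_def powr_mult powr_powr)
  have "x*y <= x powr (ps/p)/(ps/p) + y powr (ps/(ps - p))/(ps/(ps - p))"
  proof (rule Youngs_inequality)
   show "1/(ps/p) + 1/(ps/(ps - p)) = 1" using pps by (simp add: field_simps)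
  qed (use pps ps_facts(1) x y in auto)
  then have "A'*r powr p <= p*(b/ps*E*r powr ps) + p*c"
  proof -
   have e1: "b*E*r powr ps/(ps/p) = p*(b/ps*E*r powr ps)" using pps by simp
   have e2: "y powr (ps/(ps - p))/(ps/(ps - p)) = p*c" using pps by (simp add: c_def field_simps)
   show ?thesis using \<open>x*y <= _\<close> unfolding xy xp e1 e2 .
  qed
  then have "A'/p*r powr p <= b/ps*E*r powr ps + c" using pps by (simp add: field_simps)
  moreover have "A/p*r powr p <= A'/p*r powr p" using A'(2) pps by (intro mult_right_mono divide_right_mono) auto
  ultimately show ?thesis by linarith
 qed
 have "c < cst b"
 proof -
  define Q where "Q = ps/(ps - p)"
  have Q: "Q > 0" using pps by (simp add: Q_def)
  have "y < Sob*E powr (p/ps)*(b*E) powr (- (p/ps))" unfolding y_def using A'(3) b E by (intro mult_strict_right_mono) auto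
  also have "... = Sob*b powr (- (p/ps))"
  proof -
   have "E powr (p/ps)*E powr (- (p/ps)) = 1" using E by (simp add: powr_add[symmetric])
   then show ?thesis using b E by (simp add: powr_mult mult_ac)
  qed
  finally have "y powr Q < (Sob*b powr (- (p/ps))) powr Q" using y Q by (intro powr_less_mono2) auto
  also have "... = Sob powr Q*b powr (- (p/ps)*Q)" using Sob_pos b by (simp add: powr_mult powr_powr)
  also have "- (p/ps)*Q = 1 - Q" using pps by (simp add: Q_def field_simps)
  also have "Sob powr Q*b powr (1 - Q) = b*(Sob/b) powr Q" using Sob_pos b by (simp add: powr_divide powr_diff)
  finally have "(1/p - 1/ps)*y powr Q < (1/p - 1/ps)*(b*(Sob/b) powr Q)" using cc by (intro mult_strict_left_mono)
  then show ?thesis by (simp add: c_def cst_def Q_def mult.assoc)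
 qed
 moreover have "EX M>0. ALL r>=M. A/p*r powr p - b/ps*E*r powr ps <= - 1"
 proof -
  define e where "e = b*E*p/(2*ps*A')"
  have e: "e > 0" using b E A' pps by (simp add: e_def)
  obtain C where C: "C > 0" "!!t. t >= 0 ==> t powr p <= e*t powr ps + C" using powr_interpolate[OF p0 ps_facts(1) e] by blast
  define k where "k = b*E/(2*ps)"
  have k: "k > 0" using b E pps by (simp add: k_def)
  define M where "M = ((A'/p*C + 1)/k) powr (1/ps)"
  have num: "A'/p*C + 1 > 0" using A' C pps by (simp add: add_pos_pos)
  have M: "M > 0" "M powr ps = (A'/p*C + 1)/k" using num k pps by (auto simp: M_def powr_powr)
  have "A/p*r powr p - b/ps*E*r powr ps <= - 1" if r: "r >= M" for r
  proof -
   have r0: "r >= 0" using r M by simp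
   have "A/p*r powr p <= A'/p*r powr p" using A'(2) pps by (intro mult_right_mono divide_right_mono) auto
   also have "... <= A'/p*(e*r powr ps + C)" using C(2)[OF r0] A' pps by (intro mult_left_mono) auto
   also have "... = k*r powr ps + A'/p*C" using A' pps by (simp add: e_def k_def field_simps)
   finally have 1: "A/p*r powr p <= k*r powr ps + A'/p*C" .
   have 2: "b/ps*E*r powr ps = k*r powr ps + k*r powr ps" using pps by (simp add: k_def field_simps)
   have "M powr ps <= r powr ps" using r M pps by (intro powr_mono2) auto
   then have "k*M powr ps <= k*r powr ps" using k by (intro mult_left_mono) auto
   then have "A'/p*C + 1 <= k*r powr ps" using M(2) k by simp
   then show ?thesis using 1 2 by linarith
  qed
  then show ?thesis using M(1) by blast
 qed
 ultimately show ?thesis using c0 bd by blast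
qed

text \<open>On the annihilator a < \<open>ls\<close> leaves the fraction 1 - a/ls of the energy, and
  on a small sphere the critical term takes only half of that. The lam-term is dropped as
  nonnegative, so neither radius nor level depends on lam.\<close>

lemma sphere_level:
 assumes b: "b > 0" and a: "0 < a" "a < ls"
 shows "EX \<rho> \<alpha>. 0 < \<rho> \<and> 0 < \<alpha> \<and> (ALL q lam h. 1 < q --> 0 < lam --> h : XX --> ls*Il p h <= G h --> Nn h = \<rho> --> \<alpha> <= JJ q lam a b 1 h)"
proof -
 define \<theta> where "\<theta> = 1 - a/ls"
 have \<theta>: "\<theta> > 0" using a by (simp add: \<theta>_def)
 define E where "E = emb powr ps"
 have E: "E > 0" using emb_pos by (simp add: E_def)
 have pps: "ps - p > 0" "ps > 0" "p > 0" using ps_facts(1,3) p0 by auto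
 define \<rho> where "\<rho> = (\<theta>*ps/(2*p*(b*E))) powr (1/(ps - p))"
 have \<rho>: "\<rho> > 0" "\<rho> powr (ps - p) = \<theta>*ps/(2*p*(b*E))" using \<theta> pps b E by (auto simp: \<rho>_def powr_powr)
 have k: "b/ps*E*\<rho> powr ps = \<rho> powr p*\<theta>/(2*p)"
 proof -
  have "\<rho> powr ps = \<rho> powr p*\<rho> powr (ps - p)" by (simp add: powr_add[symmetric])
  then show ?thesis unfolding \<rho>(2) using b E pps by (simp add: field_simps)
 qed
 have "\<rho> powr p*\<theta>/(2*p) <= JJ q lam a b 1 h"
  if q: "1 < q" "0 < lam" and h: "h : XX" "ls*Il p h <= G h" "Nn h = \<rho>" for q lam h
 proof -
  have G: "G h = \<rho> powr p" using Nn_powr[of h] h(3) by simp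
  have "Il p h <= \<rho> powr p/ls" using h(2) a unfolding G by (simp add: field_simps)
  then have "a/p*Il p h <= a/p*(\<rho> powr p/ls)" using a pps by (intro mult_left_mono) auto
  moreover have "1/p*\<rho> powr p - a/p*(\<rho> powr p/ls) = \<rho> powr p*\<theta>/p" by (simp add: \<theta>_def diff_divide_distrib right_diff_distrib mult_ac)
  moreover have "Tl ps 1 0 h <= E*\<rho> powr ps"
  proof -
   have "Tl ps 1 0 h <= Il ps h" using T_abs_le[OF XX_Lp[OF h(1)], of ps 1 0] pps by simp
   also have "... <= (emb*\<rho>) powr ps" by (rule embedding_le(2)[OF h(1) ps1 order_refl]) (simp add: h(3))
   finally show ?thesis using emb_pos \<rho> by (simp add: E_def powr_mult)
  qed
  then have "b/ps*Tl ps 1 0 h <= b/ps*(E*\<rho> powr ps)" using b pps by (intro mult_left_mono) auto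
  moreover have "0 <= lam/q*Il q h" using q by simp
  moreover have "\<rho> powr p*\<theta>/p = \<rho> powr p*\<theta>/(2*p) + \<rho> powr p*\<theta>/(2*p)" by simp
  moreover have "b/ps*(E*\<rho> powr ps) = \<rho> powr p*\<theta>/(2*p)" using k by (simp only: mult.assoc)
  moreover have "y <= u + v - x - z" if "x <= w" "u - w = t" "z <= y" "0 <= v" "t = y + y" for x w u t z y v :: real using that by linarith
  ultimately show ?thesis unfolding JJ_def T_one_one G by metis
 qed
 then show ?thesis using \<rho>(1) \<theta> pps by (intro exI[of _ \<rho>] exI[of _ "\<rho> powr p*\<theta>/(2*p)"]) auto
qed

end

section \<open>The linking solution\<close>

context fracX
begin

text \<open>The rectangle is spanned by psi and by e', the bump e corrected by a multiple of psi so
  as to lie in the annihilator of A(phi). psi and e are never both nonzero and interact weakly, so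
  up to the lam-term J is bounded by a nonpositive psi-part plus the ray of e. Miranda's theorem
  then finds a parameter where A(phi) vanishes and the norm is \<open>\<rho>\<close>.\<close>

lemma third_solution:
 fixes x0 :: "real^'n"
 assumes phi: "phi : XX" "!!x. 0 <= phi x" "AE x in leb. x : Om --> 0 < phi x" "Il p phi = 1" and a: "G phi < a"
  and q: "1 < q" "q < p" and b: "b > 0" and Nsp: "s*p^2 < N" and R0: "R0 > 0" "ball x0 R0 \<subseteq> Om"
  and eig: "!!v. v : XX ==> EE phi v = l1*DTl p 1 1 phi v" and l1: "l1 > 0"
  and W: "!!h. h : XX ==> EE phi h = 0 ==> ls*Il p h <= G h" and ls: "a < ls"
 shows "EX \<alpha>>0. EX l0>0. ALL lam. 0 < lam \<and> lam < l0 --> (EX z:XX. (ALL v:XX. JJd q lam a b 1 z v = 0) \<and> \<alpha> <= JJ q lam a b 1 z)"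
proof -
 have a0: "a > 0" using a Lpi_nonneg[of LL p "dq s p phi"] by linarith
 have pps: "ps - p > 0" "ps > 0" "p > 0" "p <= ps" "q > 0" "q <= ps" using ps_facts(1,3) p0 q by auto
 define l where "l v = EE phi v" for v
 obtain psi k R where psi: "psi : XX" "k > 0" "R > 0" "!!x. 0 <= psi x" "!!x. psi x <= k" "!!x. psi x <= phi x"
   "!!x. x : ball x0 (2*R) ==> psi x = 0" "R < R0" "G psi < a*Il p psi" using truncated_competitor[OF phi(1,2,4) a R0(1), of x0] by blast
 \<comment> \<open>The interaction error may use up half of the a-term of the bump and half of the
   gap of psi; what is left of the gap becomes \<open>\<kappa>p\<close>.\<close>
 define ep where "ep = min (a/2) ((a*Il p psi - G psi)/2)"
 have "ep > 0" unfolding ep_def using a0 psi(9) by simp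
 moreover have "ep <= a/2" "ep <= (a*Il p psi - G psi)/2" unfolding ep_def by (rule min.cobounded1 min.cobounded2)+
 ultimately have ep: "ep > 0" "ep <= a/2" "ep <= (a*Il p psi - G psi)/2" .
 obtain r where r: "0 < r" "r < R" and ce0: "ALL w:DD. (ALL x. 0 <= w x) --> (ALL x. x \<notin> ball x0 r --> w x = 0) --> Ll p w -->
  (ALL \<sigma> t. 0 <= t --> G (%x. \<sigma>*psi x + t*w x) <= abs \<sigma> powr p*(G psi + ep) + t powr p*(G w + ep*Il p w))"
  using cross_energy[of psi k x0 R ep, OF XX_DD[OF psi(1)] psi(4,5,7,2,3) ep(1)] by blast
 have a2: "a/2 > 0" using a0 by simp
 obtain e where e: "e : DD" "!!x. e x >= 0" "!!x. x \<notin> ball x0 r ==> e x = 0" "Ll p e"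
  "G e - a/2*Il p e < Sob*Nl ps e powr p" by (rule strict_Sobolev_deficit[OF Nsp r(1) a2, of x0]) (rule that; assumption)
 have eoff: "e x = 0" if "x \<notin> Om" for x
 proof (rule e(3))
  have "ball x0 r \<subseteq> ball x0 R0" using r psi(8) by (intro subset_ball) simp
  then show "x \<notin> ball x0 r" using that R0(2) by blast
 qed
 have eX: "e : XX" using e(1) eoff by (auto simp: XX_def)
 have sep: "psi x = 0 \<or> e x = 0" for x
 proof (cases "x : ball x0 r")
  case True
  then have "x : ball x0 (2*R)" using r by simp
  then show ?thesis using psi(7) by blast
 qed (use e(3) in blast)
 define E where "E = Il ps e"
 define A where "A = G e + ep*Il p e - a*Il p e"
 have e_nz: "\<not> (AE x in leb. e x = 0)"
 proof
  assume z: "AE x in leb. e x = 0"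
  then have "Nl ps e = 0" "Il p e = 0" using Lpn_eq_0[OF DD_D(3)[OF e(1)]] Lpi_eq_0[OF e(4)] by auto
  then show False using e(5) p0 Lpi_nonneg[of LL p "dq s p e"] by simp
 qed
 have E: "E > 0" using e_nz Lpi_eq_0[OF DD_D(3)[OF e(1)]] by (simp add: E_def less_le)
 have A: "A < Sob*E powr (p/ps)"
 proof -
  have "ep*Il p e <= a/2*Il p e" using ep(2) by (intro mult_right_mono) auto
  moreover have "Nl ps e powr p = E powr (p/ps)" by (simp add: Lpn_def E_def powr_powr)
  ultimately show ?thesis using e(5) by (simp add: A_def)
 qed
 obtain c1 M1 where c1: "c1 >= 0" "c1 < cst b" "!!t. t >= 0 ==> A/p*t powr p - b/ps*E*t powr ps <= c1"
  and M1: "M1 > 0" "!!t. t >= M1 ==> A/p*t powr p - b/ps*E*t powr ps <= - 1" using ray_bound[OF b E A] by blast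
 define \<kappa>p where "\<kappa>p = (a*Il p psi - G psi - ep)/p"
 have \<kappa>p: "\<kappa>p > 0" using ep(3) psi(9) pps by (simp add: \<kappa>p_def)
 define m1 where "m1 = Il q psi"
 define m2 where "m2 = Il q e"
 have m: "m1 >= 0" "m2 >= 0" by (auto simp: m1_def m2_def)
 have Jle: "JJ q lam a b 1 (%x. \<sigma>*psi x + t*e x) <= lam/q*(abs \<sigma> powr q*m1 + t powr q*m2) - \<kappa>p*abs \<sigma> powr p + (A/p*t powr p - b/ps*E*t powr ps)"
  if lam: "lam > 0" and t: "t >= 0" for lam \<sigma> t
 proof -
  define u where "u = (%x. \<sigma>*psi x + t*e x)"
  have uX: "u : XX" unfolding u_def by (intro XX_lin XX_cmult psi eX)
  have split: "Il \<nu> u = abs \<sigma> powr \<nu>*Il \<nu> psi + t powr \<nu>*Il \<nu> e" if \<nu>: "0 < \<nu>" "\<nu> <= ps" for \<nu>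
  proof -
   have "Il \<nu> u = Il \<nu> (%x. \<sigma>*psi x) + Il \<nu> (%x. t*e x)"
    unfolding u_def using sep \<nu> XX_Lp[OF psi(1) \<nu>] XX_Lp[OF eX \<nu>] by (intro Lpi_disjoint Lp_cmult) auto
   then show ?thesis using t by (simp add: Lpi_cmult)
  qed
  have Tps: "t powr ps*E <= Tl ps 1 0 u"
  proof -
   have "t powr ps*E = (LI x. abs (t*e x) powr ps)" using t Lpi_cmult[of leb ps t e] by (simp add: E_def Lpi_def)
   also have "... <= Tl ps 1 0 u" unfolding T_def
   proof (rule integral_mono)
    show "integrable leb (%x. abs (t*e x) powr ps)" using LpD(2)[OF Lp_cmult[OF DD_D(3)[OF e(1)], of t]] pps by simp
    show "integrable leb (%x. pw ps 1 0 (u x))" using T_integrable[OF XX_Lp[OF uX], of ps] pps by simp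
    show "abs (t*e x) powr ps <= pw ps 1 0 (u x)" for x using sep[of x] e(2)[of x] t by (auto simp: u_def pw_def)
   qed
   finally show ?thesis .
  qed
  have Gu: "T LL p 1 1 (dq s p u) <= abs \<sigma> powr p*(G psi + ep) + t powr p*(G e + ep*Il p e)"
   unfolding T_one_one u_def using ce0[rule_format, of e t \<sigma>] e t by blast
  have g1: "1/p*T LL p 1 1 (dq s p u) <= 1/p*(abs \<sigma> powr p*(G psi + ep) + t powr p*(G e + ep*Il p e))"
   using Gu pps by (intro mult_left_mono) auto
  have g2: "b/ps*(t powr ps*E) <= b/ps*Tl ps 1 0 u" using Tps b pps by (intro mult_left_mono) auto
  have "JJ q lam a b 1 u <= 1/p*(abs \<sigma> powr p*(G psi + ep) + t powr p*(G e + ep*Il p e))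
   + lam/q*(abs \<sigma> powr q*m1 + t powr q*m2) - a/p*(abs \<sigma> powr p*Il p psi + t powr p*Il p e) - b/ps*(t powr ps*E)"
   unfolding JJ_def using g1 g2 split[of q] split[of p] pps by (simp add: T_one_one m1_def m2_def)
  also have "... = lam/q*(abs \<sigma> powr q*m1 + t powr q*m2) - \<kappa>p*abs \<sigma> powr p + (A/p*t powr p - b/ps*E*t powr ps)"
   unfolding \<kappa>p_def A_def by (simp add: algebra_simps add_divide_distrib diff_divide_distrib)
  finally show ?thesis by (simp add: u_def)
 qed
 have phim: "phi : Bl" using XX_DD[OF phi(1)] by auto
 have Lphi: "Ll p phi" and Lpsi: "Ll p psi" using XX_Lp[OF phi(1)] XX_Lp[OF psi(1)] pps by auto
 have iphi: "integrable leb (%x. pw (p - 1) 1 (- 1) (phi x) * v x)" if "Ll p v" for v by (rule DT_integrable[OF Lphi that p1])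
 have lpsi: "l psi > 0"
 proof -
  have "Il p psi <= DTl p 1 1 phi psi" unfolding Lpi_def DT_def
  proof (rule integral_mono)
   fix x
   have "psi x powr p = psi x powr (p - 1)*psi x" using powr_mult_base[of "psi x" "p - 1"] psi(4)[of x] by (simp add: mult.commute)
   also have "... <= phi x powr (p - 1)*psi x" using psi(4,6)[of x] p1 by (intro mult_right_mono powr_mono2) auto
   finally show "abs (psi x) powr p <= pw (p - 1) 1 (- 1) (phi x)*psi x" using psi(4)[of x] phi(2)[of x] by (simp add: pw_def)
  qed (use LpD(2)[OF Lpsi] iphi[OF Lpsi] in auto)
  moreover have "Il p psi > 0"
  proof -
   have "0 < a*Il p psi" using psi(9) Lpi_nonneg[of LL p "dq s p psi"] by linarith
   then show ?thesis using a0 by (simp add: zero_less_mult_iff)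
  qed
  ultimately show ?thesis unfolding l_def eig[OF psi(1)] using l1 by simp
 qed
 have le: "l e > 0"
 proof -
  have nn: "0 <= pw (p - 1) 1 (- 1) (phi x)*e x" for x using phi(2)[of x] e(2)[of x] by (simp add: pw_def)
  have "DTl p 1 1 phi e >= 0" unfolding DT_def by (rule integral_nonneg_AE) (simp add: nn)
  moreover have "DTl p 1 1 phi e \<noteq> 0"
  proof
   assume "DTl p 1 1 phi e = 0"
   then have "AE x in leb. pw (p - 1) 1 (- 1) (phi x)*e x = 0" unfolding DT_def using integral_nonneg_eq_0_iff_AE[OF iphi[OF e(4)]] nn by simp
   then have "AE x in leb. e x = 0" using phi(3) by eventually_elim (use eoff in \<open>auto simp: pw_def split: if_splits\<close>)
   then show False using e_nz by simp
  qed
  ultimately show ?thesis unfolding l_def eig[OF eX] using l1 by simp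
 qed
 have l_lin: "l (%x. u x + \<sigma> * v x) = l u + \<sigma>*l v" if "u : XX" "v : XX" for u v \<sigma>
  unfolding l_def dq_lin_fun by (rule DT_lin[OF XX_dq[OF phi(1)] XX_dq[OF that(1)] XX_dq[OF that(2)] p1])
 have l0: "l (%x. 0) = 0" by (simp add: l_def DT_def dq_def)
 \<comment> \<open>Subtracting this multiple of psi puts e' into the kernel of \<open>l\<close>, so
   that \<open>l (h0 y)\<close> depends on the first coordinate only.\<close>
 define c where "c = l e/l psi"
 have c: "c > 0" using le lpsi by (simp add: c_def)
 define e' where "e' = (%x. e x + (- c)*psi x)"
 have e'X: "e' : XX" unfolding e'_def by (rule XX_lin[OF eX psi(1)])
 have le': "l e' = 0" unfolding e'_def l_lin[OF eX psi(1)] using lpsi by (simp add: c_def)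
 have Ne': "Nn e' > 0"
 proof -
  have "Nn e' \<noteq> 0"
  proof
   assume "Nn e' = 0"
   then have "AE x in leb. e' x = 0" by (rule Nn_eq_0[OF e'X])
   then have "AE x in leb. e x = 0" by eventually_elim (use sep c in \<open>force simp: e'_def\<close>)
   then show False using e_nz by simp
  qed
  then show ?thesis using Nn_nonneg[of e'] by linarith
 qed
 define h0 where "h0 y = (%x. (0 + fst y*psi x) + snd y*e' x)" for y :: "real \<times> real"
 have h0c: "Ncont Q h0" for Q unfolding h0_def by (intro Ncont_add Ncont_zero continuous_intros psi e'X)
 have h0_eq: "h0 y = (%x. (fst y - snd y*c)*psi x + snd y*e x)" for y by (auto simp: h0_def e'_def algebra_simps)
 have l_h0: "l (h0 y) = fst y*l psi" for y unfolding h0_def using l_lin[OF XX_lin[OF XX_zero psi(1)] e'X] l_lin[OF XX_zero psi(1)] l0 le' by simp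
 define M where "M = max M1 (((c1 + 1)/\<kappa>p) powr (1/p))"
 have M: "M > 0" "M >= M1" using M1(1) by (auto simp: M_def)
 have Msig: "- \<kappa>p*\<sigma> powr p <= - (c1 + 1)" if "\<sigma> >= M" for \<sigma>
 proof -
  have "(c1 + 1)/\<kappa>p = (((c1 + 1)/\<kappa>p) powr (1/p)) powr p" using c1(1) \<kappa>p pps by (simp add: powr_powr)
  also have "... <= \<sigma> powr p" using that pps by (intro powr_mono2) (auto simp: M_def)
  finally show ?thesis using \<kappa>p by (simp add: field_simps)
 qed
 have far: "- \<kappa>p*abs \<sigma> powr p + (A/p*t powr p - b/ps*E*t powr ps) <= - 1" if "t >= 0" "abs \<sigma> >= M \<or> t >= M" for \<sigma> t
  using that(2)
 proof
  assume "abs \<sigma> >= M"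
  then show ?thesis using Msig[of "abs \<sigma>"] c1(3)[OF that(1)] by linarith
 next
  assume "t >= M"
  moreover have "- \<kappa>p*abs \<sigma> powr p <= 0" using \<kappa>p by (intro mult_nonpos_nonneg) auto
  ultimately show ?thesis using M1(2)[of t] M(2) by linarith
 qed
 \<comment> \<open>In terms of psi and e the coefficients are fst y - c snd y and snd y. On the
   lateral sides either snd y >= M, or the first coefficient still has modulus at least S - M c =
   M.\<close>
 define S where "S = M*(1 + c)"
 have S: "S > 0" "S - M*c = M" using M(1) c by (auto simp: S_def algebra_simps intro!: add_pos_pos)
 obtain \<rho> \<alpha> where \<rho>: "\<rho> > 0" "\<alpha> > 0" and sph: "!!lam h. 0 < lam ==> h : XX ==> ls*Il p h <= G h ==> Nn h = \<rho> ==> \<alpha> <= JJ q lam a b 1 h"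
  using sphere_level[OF b a0 ls] q(1) by blast
 \<comment> \<open>Corrects the second Miranda function: on the bottom side h is a multiple of psi,
   and C |l| cancels its norm, leaving the negative value required there. At a common zero l = 0 and
   the correction disappears.\<close>
 define C where "C = Nn psi/l psi"
 \<comment> \<open>On the top side the norm, at least \<open>R2*Nn e' - S*Nn psi\<close>, must
   exceed \<open>\<rho>\<close> plus the correction.\<close>
 define R2 where "R2 = max M ((S*Nn psi + \<rho> + C*(S*l psi) + 1)/Nn e')"
 have R2: "R2 >= M" "R2*Nn e' >= S*Nn psi + \<rho> + C*(S*l psi) + 1"
 proof -
  have "(S*Nn psi + \<rho> + C*(S*l psi) + 1)/Nn e' <= R2" by (simp add: R2_def)
  then show "R2*Nn e' >= S*Nn psi + \<rho> + C*(S*l psi) + 1" unfolding pos_divide_le_eq[OF Ne'] .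
 qed (simp add: R2_def)
 have R20: "R2 > 0" using R2(1) M by linarith
 define Q where "Q = {- S..S} \<times> {0..R2}"
 define S2 where "S2 = S + c*R2"
 define L where "L = (S2 powr q*m1 + R2 powr q*m2)/q"
 have L0: "L >= 0" using m pps by (simp add: L_def)
 \<comment> \<open>What the lam-term may add: less than the room between \<open>c1\<close> and
   \<open>cst b\<close>, and so little that the boundary of the rectangle, bar its upper bound 0 or
   -1, stays at or below \<open>\<alpha>/2\<close>.\<close>
 define gap where "gap = min 1 (min (\<alpha>/2) ((cst b - c1)/2))"
 have "gap > 0" unfolding gap_def using \<rho>(2) c1(2) by simp
 moreover have "gap <= 1" "gap <= \<alpha>/2" "gap <= (cst b - c1)/2" unfolding gap_def by linarith+
 ultimately have gap: "gap > 0" "gap <= 1" "gap <= \<alpha>/2" "gap <= (cst b - c1)/2" .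
 define lm where "lm = gap/(L + 1)"
 have lm: "lm > 0" using gap L0 by (simp add: lm_def)
 have "EX z:XX. (ALL v:XX. JJd q lam a b 1 z v = 0) \<and> \<alpha>/2 <= JJ q lam a b 1 z" if lam: "0 < lam" "lam < lm" for lam
 proof -
  interpret F: func s p N ps TN Om phi q lam a b 1 by unfold_locales (use phi a q lam b in auto)
  have lL: "lam*L <= gap"
  proof -
   have "lam*L <= lm*(L + 1)" using lam L0 by (intro mult_mono) auto
   also have "... = gap" using L0 by (simp add: lm_def)
   finally show ?thesis .
  qed
  have low: "lam/q*(abs (fst y - snd y*c) powr q*m1 + snd y powr q*m2) <= gap" if y: "y : Q" for y
  proof -
   have y': "abs (fst y) <= S" "0 <= snd y" "snd y <= R2" using y by (auto simp: Q_def)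
   have "abs (fst y - snd y*c) <= abs (fst y) + snd y*c" using abs_triangle_ineq4[of "fst y" "snd y*c"] y' c by simp
   also have "... <= S2" using y'(1) mult_left_mono[OF y'(3) less_imp_le[OF c]] unfolding S2_def mult.commute[of "snd y" c] by linarith
   finally have "abs (fst y - snd y*c) powr q <= S2 powr q" using pps by (intro powr_mono2) auto
   moreover have "snd y powr q <= R2 powr q" using y' pps by (intro powr_mono2) auto
   ultimately have "lam/q*(abs (fst y - snd y*c) powr q*m1 + snd y powr q*m2) <= lam/q*(S2 powr q*m1 + R2 powr q*m2)"
    using lam pps m by (intro mult_left_mono add_mono mult_right_mono) auto
   also have "... = lam*L" by (simp add: L_def)
   finally show ?thesis using lL by linarith
  qed
  have Jh0: "JJ q lam a b 1 (h0 y) <= gap - \<kappa>p*abs (fst y - snd y*c) powr p + (A/p * snd y powr p - b/ps*E * snd y powr ps)" if y: "y : Q" for y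
   using Jle[OF lam(1), of "snd y" "fst y - snd y*c"] low[OF y] y unfolding h0_eq by (auto simp: Q_def)
  have bdry: "JJ q lam a b 1 (h0 y) <= \<alpha>/2" if y: "y : Q" and bd: "abs (fst y) = S \<or> snd y = 0 \<or> snd y = R2" for y
  proof (cases "snd y = 0")
   case True
   have "0 <= \<kappa>p*abs (fst y - snd y*c) powr p" using \<kappa>p by simp
   then show ?thesis using Jh0[OF y] gap(3) True p0 ps_facts(3) by simp
  next
   case False
   have y': "abs (fst y) <= S" "0 <= snd y" "snd y <= R2" using y by (auto simp: Q_def)
   have "abs (fst y - snd y*c) >= M \<or> snd y >= M"
   proof (cases "snd y >= M")
    case F: False
    then have "abs (fst y) = S" using bd False R2(1) by auto
    moreover have "snd y*c <= M*c" using F c by (intro mult_right_mono) auto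
    moreover have "0 <= snd y*c" using y' c by simp
    ultimately have "abs (fst y - snd y*c) >= S - M*c" using abs_triangle_ineq2[of "fst y" "snd y*c"] by simp
    then show ?thesis using S(2) by simp
   qed simp
   from far[OF y'(2) this] Jh0[OF y] gap(2) \<rho>(2) show ?thesis by linarith
  qed
  have "EX z:XX. (ALL v:XX. JJd q lam a b 1 z v = 0) \<and> \<alpha>/2 <= JJ q lam a b 1 z \<and> JJ q lam a b 1 z <= gap + c1"
  proof (rule F.minimax_critical[of Q h0])
   show "compact Q" unfolding Q_def by (intro compact_Times compact_Icc)
   show "Ncont Q h0" by (rule h0c)
   show "JJ q lam a b 1 (h0 y) <= gap + c1" if y: "y : Q" for y
   proof -
    have "snd y >= 0" using y by (auto simp: Q_def)
    moreover have "0 <= \<kappa>p*abs (fst y - snd y*c) powr p" using \<kappa>p by simp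
    ultimately show ?thesis using Jh0[OF y] c1(3)[of "snd y"] by linarith
   qed
   show "gap + c1 < cst b" using gap(4) c1(2) by (simp add: field_simps)
   show "\<alpha> > 0" by (rule \<rho>(2))
  next
   fix h assume h: "Ncont Q h" and fixd: "!!y. y : Q ==> JJ q lam a b 1 (h0 y) <= \<alpha>/2 ==> h y = h0 y"
   have eq: "h y = h0 y" if "y : Q" "abs (fst y) = S \<or> snd y = 0 \<or> snd y = R2" for y by (rule fixd[OF that(1) bdry[OF that]])
   have lc: "continuous_on Q (%y. l (h y))" unfolding l_def by (rule Ncont_DT[OF phi(1) h])
   have "EX y:{- S..S} \<times> {0..R2}. l (h y) = 0 \<and> Nn (h y) - \<rho> - C*abs (l (h y)) = 0"
   proof (rule Miranda_rectangle)
    show "continuous_on ({- S..S} \<times> {0..R2}) (%y. l (h y))"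
     "continuous_on ({- S..S} \<times> {0..R2}) (%y. Nn (h y) - \<rho> - C*abs (l (h y)))"
     unfolding Q_def[symmetric] by (intro continuous_intros lc Ncont_Nn[OF h])+
    show "l (h (- S, y)) <= 0" "0 <= l (h (S, y))" if "y : {0..R2}" for y using that S lpsi by (auto simp: eq Q_def l_h0)
    show "Nn (h (x, 0)) - \<rho> - C*abs (l (h (x, 0))) <= 0" if x: "x : {- S..S}" for x
    proof -
     have hx: "h (x, 0) = h0 (x, 0)" using x R20 by (intro eq) (auto simp: Q_def)
     have "Nn (h0 (x, 0)) = abs x*Nn psi" unfolding h0_def by (simp add: Nn_cmult)
     moreover have "C*abs (l (h0 (x, 0))) = abs x*Nn psi" using lpsi by (simp add: l_h0 C_def abs_mult)
     ultimately show ?thesis using \<rho>(1) by (simp add: hx)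
    qed
    show "0 <= Nn (h (x, R2)) - \<rho> - C*abs (l (h (x, R2)))" if x: "x : {- S..S}" for x
    proof -
     have hx: "h (x, R2) = h0 (x, R2)" using x R20 by (intro eq) (auto simp: Q_def)
     have xS: "abs x <= S" using x by auto
     have C0: "C >= 0" using lpsi by (simp add: C_def)
     have "C*abs (l (h0 (x, R2))) <= C*(S*l psi)" using xS lpsi C0 by (intro mult_left_mono) (auto simp: l_h0 abs_mult)
     moreover have "R2*Nn e' <= Nn (h0 (x, R2)) + S*Nn psi"
     proof -
      have p1: "(%x'. - x*psi x') : XX" by (rule XX_cmult[OF psi(1)])
      have "(%x'. R2*e' x') = (%x'. h0 (x, R2) x' + (- x*psi x'))" by (auto simp: h0_def)
      then have "R2*Nn e' = Nn (%x'. h0 (x, R2) x' + (- x*psi x'))" using Nn_cmult[of R2 e'] R20 by simp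
      also have "... <= Nn (h0 (x, R2)) + Nn (%x'. - x*psi x')" by (rule Nn_add[OF Ncont_XX[OF h0c] p1])
      also have "Nn (%x'. - x*psi x') = abs x*Nn psi" using Nn_cmult[of "- x" psi] by simp
      also have "... <= S*Nn psi" using xS by (intro mult_right_mono) auto
      finally show ?thesis by simp
     qed
     ultimately show ?thesis using R2(2) unfolding hx by linarith
    qed
   qed (use S R20 in auto)
   then obtain y where y: "y : Q" "l (h y) = 0" "Nn (h y) = \<rho>" by (auto simp: Q_def)
   have "\<alpha> <= JJ q lam a b 1 (h y)"
    by (rule sph[OF lam(1) Ncont_XX[OF h] W[OF Ncont_XX[OF h]] y(3)]) (use y(2) in \<open>simp add: l_def\<close>)
   then show "EX y:Q. \<alpha> <= JJ q lam a b 1 (h y)" using y(1) by blast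
  qed
  then show ?thesis by blast
 qed
 then show ?thesis using \<rho>(2) lm by (intro exI[of _ "\<alpha>/2"] conjI exI[of _ lm]) auto
qed

end

section \<open>The three solutions\<close>

lemma Lp_iff_nn_integral:
 "f : borel_measurable M ==> Lp M r f \<longleftrightarrow> (\<integral>\<^sup>+x. en (abs (f x) powr r) \<partial>M) < \<infinity>"
proof
 assume f: "f : borel_measurable M" and fin: "(\<integral>\<^sup>+x. en (abs (f x) powr r) \<partial>M) < \<infinity>"
 show "Lp M r f" by (rule Lp_nn_finite(1)[OF f, of r "enn2real (\<integral>\<^sup>+x. en (abs (f x) powr r) \<partial>M)"]) (use fin in auto)
qed (simp add: Lpi_nn)

context fracX
begin

text \<open>One inclusion is \<open>Sobolev_Lp\<close>; the other holds because over a bounded set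
  L^ps is contained in L^p.\<close>

lemma Xsp_XX: "Xsp Om s p = XX"
proof (intro set_eqI iffI)
 fix u assume "u : Xsp Om s p"
 then have u: "u : Bl" "(NI x. en (abs (u x) powr p)) < \<infinity>" "gagliardo s p u < \<infinity>"
  "AE x in leb. x \<notin> Om --> u x = 0" by (auto simp: Xsp_def Wsp_def)
 have "u : DD"
  by (rule Sobolev_Lp) (use u(2) u(3)[unfolded gagliardo_dq[OF p0]] Lp_iff_nn_integral[OF u(1)] Lp_iff_nn_integral[OF measurable_dq[OF u(1)]] in auto)
 then show "u : XX" using u(4) by (simp add: XX_def)
next
 fix u assume u: "u : XX"
 have um: "u : Bl" using XX_DD[OF u] by auto
 show "u : Xsp Om s p"
  using um XX_off[OF u] Lp_iff_nn_integral[OF um, of p] Lp_iff_nn_integral[OF measurable_dq[OF um]] XX_dq[OF u] XX_Lp[OF u, of p] p0 ps_facts(1)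
  by (simp add: Xsp_def Wsp_def gagliardo_dq[OF p0])
qed

lemma Xnorm_G: "u : XX ==> Xnorm_p s p u = G u"
 by (simp add: Xnorm_p_def gagliardo_dq[OF p0] Lpi_nn[OF XX_dq])

lemma set_integral_XX:
 assumes v: "v : XX" and f: "(%x. f x) : Bl"
 shows "(LINT x:Om|leb. f x * v x) = (LI x. f x * v x)" unfolding set_lebesgue_integral_def
proof (rule integral_cong_AE)
 have [measurable]: "v : Bl" using XX_DD[OF v] by auto
 note [measurable] = f Om_sets
 show "(%x. indicat_real Om x *\<^sub>R (f x * v x)) : Bl" "(%x. f x * v x) : Bl" by measurable
 show "AE x in leb. indicat_real Om x *\<^sub>R (f x * v x) = f x * v x" using XX_off[OF v] by eventually_elim (auto simp: indicator_def)
qed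

lemma set_integral_DT:
 assumes u: "u : XX" and v: "v : XX"
 shows "(LINT x:Om|leb. abs (u x) powr (r - 2)*u x * v x) = DTl r 1 1 u v"
proof -
 have um: "u : Bl" using XX_DD[OF u] by auto
 have "(LINT x:Om|leb. pw (r - 1) 1 (- 1) (u x) * v x) = DTl r 1 1 u v" unfolding DT_def by (rule set_integral_XX[OF v measurable_pw_comp[OF um]])
 then show ?thesis by (simp add: pw_odd)
qed

lemma Lp_pow_on_XX:
 assumes u: "u : XX"
 shows "Lp_pow_on Om p u = Il p u"
proof -
 have "DTl p 1 1 u u = Il p u" using DT_self[OF p1, of leb 1 1 u] by (simp add: T_one_one)
 moreover have "pw (p - 1) 1 (- 1) t*t = abs t powr p" for t by (rule dq_pair_nonneg_pw)
 ultimately show ?thesis using set_integral_DT[OF u u, of p] by (simp add: Lp_pow_on_def pw_odd)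
qed

lemma weak_solution_iff:
 "weak_solution Om s p q lam a b u \<longleftrightarrow> u : XX \<and> (ALL v:XX. JJd q lam a b 1 u v = 0)"
proof -
 have ce: "crit_exp TYPE('n) s p = ps" by (simp add: crit_exp_def ps_def N_def)
 have "A_op s p u v = - lam*(LINT x:Om|leb. abs (u x) powr (q - 2)*u x * v x)
    + a*(LINT x:Om|leb. abs (u x) powr (p - 2)*u x * v x)
    + b*(LINT x:Om|leb. max (u x) 0 powr (crit_exp TYPE('n) s p - 1) * v x) \<longleftrightarrow> JJd q lam a b 1 u v = 0"
  if u: "u : XX" and v: "v : XX" for v
 proof -
  have um: "u : Bl" using XX_DD[OF u] by auto
  have pm: "max t 0 powr (ps - 1) = pw (ps - 1) 1 (- 0) t" for t :: real by (simp add: pw_def max_def)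
  have "(LINT x:Om|leb. max (u x) 0 powr (crit_exp TYPE('n) s p - 1) * v x) = DTl ps 1 0 u v"
   unfolding DT_def ce pm by (rule set_integral_XX[OF v measurable_pw_comp[OF um]])
  then show ?thesis unfolding A_op_dq[OF p1] set_integral_DT[OF u v] JJd_def by auto
 qed
 then show ?thesis unfolding weak_solution_def Xsp_XX by auto
qed

text \<open>Different energy levels therefore certify solutions that differ on a set of positive
  measure.\<close>

lemma JJ_cong_AE:
 assumes u: "u : XX" and v: "v : XX" and uv: "AE x in leb. u x = v x"
 shows "JJ q lam a b th u = JJ q lam a b th v"
proof -
 have m: "u : Bl" "v : Bl" using XX_DD[OF u] XX_DD[OF v] by auto
 have "AE w in LL. dq s p u w = dq s p v w" using AE_LL[OF uv] by eventually_elim (simp add: dq_def)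
 then have "T LL p 1 1 (dq s p u) = T LL p 1 1 (dq s p v)" by (rule T_cong_AE[OF measurable_dq[OF m(1)] measurable_dq[OF m(2)]])
 then show ?thesis unfolding JJ_def by (simp add: T_cong_AE[OF m uv])
qed

lemma JJ_zero: "JJ q lam a b th (%x. 0) = 0"
 by (simp add: JJ_def T_def dq_def)

lemma T_DT_nonneg:
 assumes z: "z : XX" "AE x in leb. 0 <= z x"
 shows "Tl r 1 cm z = Tl r 1 1 z" "v : XX ==> DTl r 1 cm z v = DTl r 1 1 z v"
proof -
 define y where "y = (%x. max (z x) 0)"
 have m: "z : Bl" "y : Bl" using XX_DD[OF z(1)] XX_DD[OF max_XX[OF z(1)]] by (auto simp: y_def)
 have zy: "AE x in leb. z x = y x" using z(2) by eventually_elim (simp add: y_def)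
 have "Tl r 1 c y = Il r y" for c by (simp add: T_def Lpi_def pw_def y_def)
 then have "Tl r 1 c z = Il r y" for c using T_cong_AE[OF m zy, of r 1 c] by simp
 then show "Tl r 1 cm z = Tl r 1 1 z" by simp
 assume "v : XX"
 then have vm: "v : Bl" using XX_DD by auto
 have "DTl r 1 c y v = DTl r 1 1 y v" for c by (simp add: DT_def pw_def y_def)
 moreover have "DTl r 1 c z v = DTl r 1 c y v" for c by (rule DT_cong_AE[OF m vm vm zy]) simp
 ultimately show "DTl r 1 cm z v = DTl r 1 1 z v" by metis
qed

text \<open>The positive part of -z is 0, so the critical term disappears; the other terms of the
  energy are even. Nonnegative critical points of the functional without critical term are thus
  reflected into solutions.\<close>

lemma uminus_nonneg:
 assumes z: "z : XX" "AE x in leb. 0 <= z x"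
 shows "JJ q lam a b 1 (%x. - z x) = JJ q lam a 0 0 z"
  "v : XX ==> JJd q lam a b 1 (%x. - z x) v = - JJd q lam a 0 0 z v"
proof -
 have mz: "(%x. - z x) : XX" using XX_cmult[OF z(1), of "-1"] by simp
 have d: "dq s p (%x. - z x) = (%w. - dq s p z w)" using dq_cmult[of s p "-1" z] by (auto simp: fun_eq_iff)
 have m: "(%x. - z x) : Bl" using XX_DD[OF mz] by auto
 have pm: "AE x in leb. pw c 1 0 (- z x) = 0" if "c > 0" for c using z(2) by eventually_elim (use that in \<open>auto simp: pw_def\<close>)
 have "Tl ps 1 0 (%x. - z x) = (\<integral>x. 0 \<partial>(leb :: (real^'n) measure))"
  unfolding T_def by (rule integral_cong_AE) (use m pm[OF ps_facts(3)] in auto)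
 then have "Tl ps 1 0 (%x. - z x) = 0" by simp
 then show "JJ q lam a b 1 (%x. - z x) = JJ q lam a 0 0 z" unfolding JJ_def d T_DT_nonneg(1)[OF z, of _ 0] by (simp add: T_one_one Lpi_def)
 assume v: "v : XX"
 have vm: "v : Bl" using XX_DD[OF v] by auto
 have "DTl ps 1 0 (%x. - z x) v = (\<integral>x. 0 \<partial>(leb :: (real^'n) measure))" unfolding DT_def
 proof (rule integral_cong_AE)
  show "(%x. pw (ps - 1) 1 (- 0) (- z x) * v x) : Bl" using m vm by measurable
  show "AE x in leb. pw (ps - 1) 1 (- 0) (- z x) * v x = 0" using pm[of "ps - 1"] ps_facts(2) by auto
 qed simp
 then have "DTl ps 1 0 (%x. - z x) v = 0" by simp
 then show "JJd q lam a b 1 (%x. - z x) v = - JJd q lam a 0 0 z v" unfolding JJd_def d T_DT_nonneg(2)[OF z v, of _ 0] by (simp add: DT_uminus)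
qed

lemma cst_pos: "b > 0 ==> cst b > 0"
 using ps_facts(1) p0 Sob_pos by (simp add: cst_def field_simps)

text \<open>The two small solutions have opposite signs and positive energy, so they differ; the
  third has energy at least \<open>\<alpha>\<close>, above both. \<open>\<alpha>\<close> is fixed
  before lam, and \<open>lam0\<close> pushes the small levels below it.\<close>

lemma three_solutions:
 assumes Om: "open Om" "Om \<noteq> {}" and eigf: "first_eigenfunction Om s p \<phi>1" and a: "lambda1 Om s p < a" "a < lambda_star Om s p \<phi>1"
  and b: "b > 0" and q: "1 < q" "q < p" and Nsp: "s*p^2 < N"
 shows "EX lam0 > 0. ALL lam. 0 < lam \<and> lam < lam0 -->
  (EX u1 u2 u3. weak_solution Om s p q lam a b u1 \<and> weak_solution Om s p q lam a b u2
    \<and> weak_solution Om s p q lam a b u3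
    \<and> \<not> (AE x in leb. u1 x = 0) \<and> \<not> (AE x in leb. u2 x = 0)
    \<and> \<not> (AE x in leb. u3 x = 0)
    \<and> \<not> (AE x in leb. u1 x = u2 x) \<and> \<not> (AE x in leb. u1 x = u3 x)
    \<and> \<not> (AE x in leb. u2 x = u3 x))"
proof -
 define l1 where "l1 = lambda1 Om s p"
 define ls where "ls = lambda_star Om s p \<phi>1"
 have \<phi>: "\<phi>1 : XX" "Il p \<phi>1 = 1" "AE x in leb. x : Om --> \<phi>1 x > 0"
  using eigf Lp_pow_on_XX by (auto simp: first_eigenfunction_def Xsp_XX)
 have \<phi>eig: "EE \<phi>1 v = l1*DTl p 1 1 \<phi>1 v" if v: "v : XX" for v
  using eigf v set_integral_DT[OF \<phi>(1) v, of p] by (simp add: first_eigenfunction_def Xsp_XX A_op_dq[OF p1] l1_def)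
 \<comment> \<open>Altered on a null set so that nonnegativity holds everywhere, as the pointwise
   constructions require; norms and the form A(phi) do not change.\<close>
 define phi where "phi = (%x. max (\<phi>1 x) 0)"
 have phiX: "phi : XX" unfolding phi_def by (rule max_XX[OF \<phi>(1)])
 have eq: "AE x in leb. phi x = \<phi>1 x" using \<phi>(3) XX_off[OF \<phi>(1)] by eventually_elim (auto simp: phi_def)
 have m: "phi : Bl" "\<phi>1 : Bl" using XX_DD[OF phiX] XX_DD[OF \<phi>(1)] by auto
 have dqeq: "AE w in LL. dq s p phi w = dq s p \<phi>1 w" using AE_LL[OF eq] by eventually_elim (simp add: dq_def)
 have phi0: "0 <= phi x" for x by (simp add: phi_def)
 have phipos: "AE x in leb. x : Om --> 0 < phi x" using \<phi>(3) by eventually_elim (auto simp: phi_def)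
 have phi1: "Il p phi = 1" using Lpi_cong_AE[OF m eq] \<phi>(2) by simp
 have Aeq: "EE phi v = EE \<phi>1 v" if v: "v : XX" for v
 proof -
  have vm: "v : Bl" using XX_DD[OF v] by auto
  show ?thesis by (rule DT_cong_AE[OF measurable_dq[OF m(1)] measurable_dq[OF m(2)] measurable_dq[OF vm] measurable_dq[OF vm] dqeq]) simp
 qed
 have eig: "EE phi v = l1*DTl p 1 1 phi v" if v: "v : XX" for v
 proof -
  have vm: "v : Bl" using XX_DD[OF v] by auto
  have "DTl p 1 1 phi v = DTl p 1 1 \<phi>1 v" by (rule DT_cong_AE[OF m vm vm eq]) simp
  then show ?thesis using Aeq[OF v] \<phi>eig[OF v] by simp
 qed
 have Gphi: "G phi = l1" using eig[OF phiX] phi1 by (simp add: DT_self[OF p1] T_one_one)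
 have Ga: "G phi < a" using a(1) Gphi by (simp add: l1_def)
 have l1: "l1 > 0"
 proof -
  have "Nn phi \<noteq> 0"
  proof
   assume "Nn phi = 0"
   then have "AE x in leb. phi x = 0" by (rule Nn_eq_0[OF phiX])
   then show False using Lpi_eq_0[OF XX_Lp[OF phiX, of p]] phi1 p0 ps_facts(1) by simp
  qed
  then have "Nn phi > 0" using Nn_nonneg[of phi] by linarith
  then have "Nn phi powr p > 0" by simp
  then show ?thesis unfolding Nn_powr Gphi .
 qed
 \<comment> \<open>The infimum \<open>lambda_star\<close> concerns normalised elements;
   p-homogeneity carries the bound over to the whole annihilator.\<close>
 have W: "ls*Il p h <= G h" if h: "h : XX" "EE phi h = 0" for h
 proof (cases "Il p h = 0")
  case False
  then have L: "Il p h > 0" by (simp add: less_le)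
  define c where "c = (1/Il p h) powr (1/p)"
  have c: "c > 0" "c powr p = 1/Il p h" using L p0 by (auto simp: c_def powr_powr)
  define w where "w = (%x. c*h x)"
  have w: "w : XX" unfolding w_def by (rule XX_cmult[OF h(1)])
  have dqw: "dq s p w = (%z. c*dq s p h z)" unfolding w_def by (rule ext) (rule dq_cmult)
  have "Il p w = 1" unfolding w_def Lpi_cmult using c L by simp
  moreover have "EE \<phi>1 w = 0"
  proof -
   have "EE phi w = c*EE phi h" by (simp add: dqw DT_def mult.left_commute)
   then show ?thesis using h(2) Aeq[OF w] by simp
  qed
  ultimately have "ls <= G w" unfolding ls_def lambda_star_def using w Xnorm_G[OF w] by (intro cInf_lower bdd_belowI[of _ 0])
    (auto simp: Wspace_def Xsp_XX A_op_dq[OF p1] Lp_pow_on_XX Xnorm_p_def intro!: exI[of _ w])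
  also have "G w = 1/Il p h*G h" using c by (simp add: dqw Lpi_cmult)
  finally show ?thesis using L by (simp add: field_simps)
 qed simp
 obtain x0 R0 where R0: "R0 > 0" "ball x0 R0 \<subseteq> Om" using Om by (meson all_not_in_conv openE)
 have als: "a < ls" using a(2) by (simp add: ls_def)
 obtain \<alpha> l0 where \<alpha>: "\<alpha> > 0" and l0: "l0 > 0"
  and third: "ALL lam. 0 < lam \<and> lam < l0 --> (EX z:XX. (ALL v:XX. JJd q lam a b 1 z v = 0) \<and> \<alpha> <= JJ q lam a b 1 z)"
  using third_solution[OF phiX phi0 phipos phi1 Ga q b Nsp R0 eig l1 W als] by blast
 define mm where "mm = Il q phi/q"
 have mm: "mm >= 0" using q by (simp add: mm_def)
 \<comment> \<open>Three bounds on the mountain pass level: the endpoint of the path does not lie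
   above 0, compactness holds, and the level of the third solution is not reached.\<close>
 define g where "g = min ((a - G phi)/p) (min (cst b) \<alpha>)"
 have g: "g > 0" using Ga p0 cst_pos[OF b] \<alpha> by (simp add: g_def)
 have g': "g <= (a - G phi)/p" "g <= cst b" "g <= \<alpha>" unfolding g_def by linarith+
 define lam0 where "lam0 = min l0 (g/(mm + 1))"
 have "lam0 > 0" using l0 g mm by (simp add: lam0_def)
 moreover have "EX u1 u2 u3. weak_solution Om s p q lam a b u1 \<and> weak_solution Om s p q lam a b u2
    \<and> weak_solution Om s p q lam a b u3
    \<and> \<not> (AE x in leb. u1 x = 0) \<and> \<not> (AE x in leb. u2 x = 0)
    \<and> \<not> (AE x in leb. u3 x = 0)
    \<and> \<not> (AE x in leb. u1 x = u2 x) \<and> \<not> (AE x in leb. u1 x = u3 x)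
    \<and> \<not> (AE x in leb. u2 x = u3 x)" if lam: "0 < lam" "lam < lam0" for lam
 proof -
  have small: "lam/q*Il q phi < g"
  proof -
   have "lam < g/(mm + 1)" using lam by (simp add: lam0_def)
   then have "lam*(mm + 1) < g" using mm by (simp add: pos_less_divide_eq)
   moreover have "lam/q*Il q phi = lam*mm" by (simp add: mm_def)
   ultimately show ?thesis using lam by (simp add: distrib_left)
  qed
  interpret F0: func s p N ps TN Om phi q lam a 0 0 by unfold_locales (use phiX phi0 phipos phi1 Ga q lam in auto)
  interpret F1: func s p N ps TN Om phi q lam a b 0 by unfold_locales (use phiX phi0 phipos phi1 Ga q lam b in auto)
  obtain z where z: "z : XX" "!!v. v : XX ==> JJd q lam a 0 0 z v = 0" "0 < JJ q lam a 0 0 z" "JJ q lam a 0 0 z < \<alpha>"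
  proof -
   have "EX z:XX. (ALL v:XX. JJd q lam a 0 0 z v = 0) \<and> 0 < JJ q lam a 0 0 z \<and> JJ q lam a 0 0 z <= lam/q*Il q phi"
    by (rule F0.mountain_pass) (use small g' in auto)
   then show ?thesis using that small g'(3) by (meson order_le_less_trans order_less_le_trans)
  qed
  obtain y where y: "y : XX" "!!v. v : XX ==> JJd q lam a b 0 y v = 0" "0 < JJ q lam a b 0 y" "JJ q lam a b 0 y < \<alpha>"
  proof -
   have "EX z:XX. (ALL v:XX. JJd q lam a b 0 z v = 0) \<and> 0 < JJ q lam a b 0 z \<and> JJ q lam a b 0 z <= lam/q*Il q phi"
    by (rule F1.mountain_pass) (use small g' in auto)
   then show ?thesis using that small g'(3) by (meson order_le_less_trans order_less_le_trans)
  qed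
  have "lam < l0" using lam by (simp add: lam0_def)
  then obtain w where w: "w : XX" "!!v. v : XX ==> JJd q lam a b 1 w v = 0" "\<alpha> <= JJ q lam a b 1 w" using third lam(1) by blast
  have z0: "AE x in leb. 0 <= z x" by (rule F0.critical_nonneg[OF refl z(1,2)])
  have y0: "AE x in leb. 0 <= y x" by (rule F1.critical_nonneg[OF refl y(1,2)])
  define u where "u = (%x. - z x)"
  have u: "u : XX" unfolding u_def using XX_cmult[OF z(1), of "-1"] by simp
  have Ju: "JJ q lam a b 1 u = JJ q lam a 0 0 z" unfolding u_def by (rule uminus_nonneg(1)[OF z(1) z0])
  have Jy: "JJ q lam a b 1 y = JJ q lam a b 0 y" unfolding JJ_def using T_DT_nonneg(1)[OF y(1) y0, of _ 0] by simp
  have J0: "\<not> (AE x in leb. v x = 0)" if "v : XX" "JJ q lam a b 1 v > 0" for v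
   using JJ_cong_AE[OF that(1) XX_zero, of q lam a b 1] that(2) JJ_zero[of q lam a b 1] by auto
  have ne: "\<not> (AE x in leb. v x = w x)" if "v : XX" "JJ q lam a b 1 v < \<alpha>" for v
   using JJ_cong_AE[OF that(1) w(1), of q lam a b 1] that(2) w(3) by auto
  have uy: "\<not> (AE x in leb. u x = y x)"
  proof
   assume "AE x in leb. u x = y x"
   then have "AE x in leb. y x = 0" using z0 y0 by eventually_elim (simp add: u_def)
   then show False using J0[OF y(1)] Jy y(3) by simp
  qed
  have "weak_solution Om s p q lam a b u" unfolding weak_solution_iff using u uminus_nonneg(2)[OF z(1) z0] z(2) by (simp add: u_def)
  moreover have "weak_solution Om s p q lam a b y"
  proof -
   have "JJd q lam a b 1 y v = JJd q lam a b 0 y v" if "v : XX" for v unfolding JJd_def using T_DT_nonneg(2)[OF y(1) y0 that, of _ 0] by simp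
   then show ?thesis unfolding weak_solution_iff using y by simp
  qed
  moreover have "weak_solution Om s p q lam a b w" unfolding weak_solution_iff using w by simp
  moreover have "\<not> (AE x in leb. u x = 0)" using J0[OF u] Ju z(3) by simp
  moreover have "\<not> (AE x in leb. y x = 0)" using J0[OF y(1)] Jy y(3) by simp
  moreover have "\<not> (AE x in leb. w x = 0)" using J0[OF w(1)] \<alpha> w(3) by simp
  moreover have "\<not> (AE x in leb. u x = w x)" using ne[OF u] Ju z(4) by simp
  moreover have "\<not> (AE x in leb. y x = w x)" using ne[OF y(1)] Jy y(4) by simp
  ultimately show ?thesis using uy by blast
 qed
 ultimately show ?thesis by blast
qed

end

theorem theorem2p3:
  fixes \<Omega> :: "(real^'n::finite) set" and s p q a b :: real and \<phi>1 :: "real^'n \<Rightarrow> real"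
  assumes "smooth_bounded_domain \<Omega>"
    and "0 < s" "s < 1" "p > 1" "real CARD('n) > s * p"
    and "first_eigenfunction \<Omega> s p \<phi>1"
    and "lambda1 \<Omega> s p < a" "a < lambda_star \<Omega> s p \<phi>1"
    and "b > 0" "1 < q" "q < p"
    and "(real CARD('n) > s * p^2 \<and> p \<le> 2 * real CARD('n) / (real CARD('n) + s))
       \<or> (real CARD('n) > s * p * ((p - 1)^2 + p) \<and> p > 2 * real CARD('n) / (real CARD('n) + s))"
  shows "\<exists>lam0 > 0. \<forall>lam. 0 < lam \<and> lam < lam0 \<longrightarrow>
     (\<exists>u1 u2 u3. weak_solution \<Omega> s p q lam a b u1 \<and> weak_solution \<Omega> s p q lam a b u2
        \<and> weak_solution \<Omega> s p q lam a b u3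
        \<and> \<not> (AE x in lebesgue. u1 x = 0) \<and> \<not> (AE x in lebesgue. u2 x = 0)
        \<and> \<not> (AE x in lebesgue. u3 x = 0)
        \<and> \<not> (AE x in lebesgue. u1 x = u2 x) \<and> \<not> (AE x in lebesgue. u1 x = u3 x)
        \<and> \<not> (AE x in lebesgue. u2 x = u3 x))"
proof -
 have \<Omega>: "bounded \<Omega>" "open \<Omega>" "\<Omega> \<noteq> {}" using assms(1) by (auto simp: smooth_bounded_domain_def)
 interpret fracX s p "real CARD('n)" "real CARD('n)*p/(real CARD('n) - s*p)" "TYPE('n)" \<Omega> by unfold_locales (use assms \<Omega> in auto)
 \<comment> \<open>Both alternatives give N > s p^2, the second one because (p - 1)^2 + p >=
   p.\<close>
 have "s*p^2 < real CARD('n)" using assms(12)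
 proof
  assume *: "real CARD('n) > s*p*((p - 1)^2 + p) \<and> p > 2*real CARD('n)/(real CARD('n) + s)"
  have "s*p*p <= s*p*((p - 1)^2 + p)" using assms(2,4) by (intro mult_left_mono) auto
  then show ?thesis using*by (simp add: power2_eq_square mult.assoc)
 qed simp
 from three_solutions[OF \<Omega>(2,3) assms(6-11) this] show ?thesis .
qed

end
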